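(* Let $\mathcal M^g_k=\sup_{z\in\mathcal D} y^{k/2}|g_k(z)|$ (with $z=x+iy$), where $g_k$ is the random weight-$k$ cusp form described in the context. \begin{enumerate} \item[(i)] $k^{1/4}\ll \mathbb E[\mathcal M^g_k]\ll k^{1/4}\sqrt{\log k}$, with absolute implied constants. \item[(ii)] Let $\mu^g_k$ be a median of $\mathcal M^g_k$. Then $\mu^g_k=\mathbb E[\mathcal M^g_k]+O(k^{1/4})$, and there exists an absolute constant $c>0$ such that for every $r>0$, $$\Pr\big(|\mathcal M^g_k-\mu^g_k|>r\big)\le 2e^{-cr^2/k^{1/2}}.$$ \end{enumerate}
   Context: For even $k\ge 2$, let $\mathcal S_k$ be the space of weight-$k$ cusp forms for $\mathrm{SL}_2(\mathbb Z)$, viewed as holomorphic functions on $\mathbb H^2=\{z=x+iy:\ y>0\}$, and $N=N_k=\dim\mathcal S_k$ (so $N_k=k/12+O(1)$); only $k$ with $N_k\ge 1$ are considered. Let $\mathcal D=\{z\in\mathbb H^2:\ |\Re z|\le 1/2,\ |z|\ge 1\}$. The Petersson inner product is $\langle f,g\rangle=\int_{\mathcal D} f\bar g\,y^k\,\frac{dx\,dy}{y^2}$. With $f_1,\dots,f_N$ an orthonormal basis of $\mathcal S_k$, the random cusp form is $g_k=\sum_{j=1}^N a_jf_j$ with $(a_1,\dots,a_N)$ uniform on the unit sphere $\{\sum_j|a_j|^2=1\}\subset\mathbb C^N$. *)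

theory Defs
  imports "HOL-Analysis.Analysis" "HOL-Library.Function_Algebras"
begin

definition upper_half_plane :: "complex set" where
  "upper_half_plane = {z. Im z > 0}"

definition fundamental_domain :: "complex set" where
  "fundamental_domain = {z \<in> upper_half_plane. \<bar>Re z\<bar> \<le> 1 / 2 \<and> cmod z \<ge> 1}"

text \<open>
  Cusp forms are functions on the upper half plane; as HOL functions on all of \<open>complex\<close> they
  are made to vanish elsewhere, so that a cusp form is determined by its values on the upper half
  plane and the dimension below is the right one. The last condition is the Fourier expansion at
  the cusp, with vanishing constant coefficient.
\<close>

definition cusp_forms :: "nat \<Rightarrow> (complex \<Rightarrow> complex) set" where
  "cusp_forms k = {f.
     f holomorphic_on upper_half_plane \<and>
     (\<forall>z. z \<notin> upper_half_plane \<longrightarrow> f z = 0) \<and>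
     (\<forall>a b c d :: int. a * d - b * c = 1 \<longrightarrow>
        (\<forall>z\<in>upper_half_plane.
           f ((of_int a * z + of_int b) / (of_int c * z + of_int d)) =
             (of_int c * z + of_int d) ^ k * f z)) \<and>
     (\<exists>q :: nat \<Rightarrow> complex. q 0 = 0 \<and>
        (\<forall>z\<in>upper_half_plane. (\<lambda>n. q n * exp (2 * of_real pi * \<i> * of_nat n * z)) sums f z))}"

definition fun_scale :: "complex \<Rightarrow> (complex \<Rightarrow> complex) \<Rightarrow> complex \<Rightarrow> complex" where
  "fun_scale c f = (\<lambda>z. c * f z)"

interpretation cfun: vector_space fun_scale
  by unfold_locales (auto simp: fun_scale_def fun_eq_iff algebra_simps)

definition cusp_dim :: "nat \<Rightarrow> nat" where
  "cusp_dim k = cfun.dim (cusp_forms k)"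

definition petersson :: "nat \<Rightarrow> (complex \<Rightarrow> complex) \<Rightarrow> (complex \<Rightarrow> complex) \<Rightarrow> complex" where
  "petersson k f g =
     (LINT z:fundamental_domain|lborel. f z * cnj (g z) * of_real (Im z ^ k / Im z ^ 2))"

definition orthonormal_cusp_basis :: "nat \<Rightarrow> (nat \<Rightarrow> complex \<Rightarrow> complex) \<Rightarrow> bool" where
  "orthonormal_cusp_basis k f \<longleftrightarrow>
     cfun.span (f ` {..<cusp_dim k}) = cusp_forms k \<and>
     (\<forall>i<cusp_dim k. \<forall>j<cusp_dim k. petersson k (f i) (f j) = (if i = j then 1 else 0))"

text \<open>
  The uniform distribution on the unit sphere of \<open>\<complex>\<^sup>N\<close>, vectors being functions on \<open>{..<N}\<close>:
  the radial projection of the uniform distribution on the unit ball. This is normalised surface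
  measure, as the sector over a Borel subset of the sphere has volume proportional to the area
  of that subset.
\<close>

definition cvec_norm :: "nat \<Rightarrow> (nat \<Rightarrow> complex) \<Rightarrow> real" where
  "cvec_norm N a = sqrt (\<Sum>j<N. (cmod (a j))\<^sup>2)"

definition uniform_unit_sphere :: "nat \<Rightarrow> (nat \<Rightarrow> complex) measure" where
  "uniform_unit_sphere N =
     distr (uniform_measure (Pi\<^sub>M {..<N} (\<lambda>_. lborel))
             {a \<in> space (Pi\<^sub>M {..<N} (\<lambda>_. lborel)). cvec_norm N a \<le> 1})
           (Pi\<^sub>M {..<N} (\<lambda>_. borel))
           (\<lambda>a. \<lambda>j\<in>{..<N}. a j / of_real (cvec_norm N a))"

definition random_cusp_form ::
    "nat \<Rightarrow> (nat \<Rightarrow> complex \<Rightarrow> complex) \<Rightarrow> (nat \<Rightarrow> complex) \<Rightarrow> complex \<Rightarrow> complex" where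
  "random_cusp_form k f a = (\<lambda>z. \<Sum>j<cusp_dim k. a j * f j z)"

definition form_sup :: "nat \<Rightarrow> (complex \<Rightarrow> complex) \<Rightarrow> real" where
  "form_sup k g = (SUP z\<in>fundamental_domain. Im z powr (real k / 2) * cmod (g z))"

definition is_median :: "'a measure \<Rightarrow> ('a \<Rightarrow> real) \<Rightarrow> real \<Rightarrow> bool" where
  "is_median M X m \<longleftrightarrow>
     measure M {\<omega> \<in> space M. X \<omega> \<le> m} \<ge> 1 / 2 \<and> measure M {\<omega> \<in> space M. X \<omega> \<ge> m} \<ge> 1 / 2"

abbreviation coeff_law :: "nat \<Rightarrow> (nat \<Rightarrow> complex) measure" where
  "coeff_law k \<equiv> uniform_unit_sphere (cusp_dim k)"

definition sup_rv :: "nat \<Rightarrow> (nat \<Rightarrow> complex \<Rightarrow> complex) \<Rightarrow> (nat \<Rightarrow> complex) \<Rightarrow> real" where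
  "sup_rv k f a = form_sup k (random_cusp_form k f a)"

definition expected_sup :: "nat \<Rightarrow> (nat \<Rightarrow> complex \<Rightarrow> complex) \<Rightarrow> real" where
  "expected_sup k f = integral\<^sup>L (coeff_law k) (sup_rv k f)"

definition admissible :: "nat \<Rightarrow> (nat \<Rightarrow> complex \<Rightarrow> complex) \<Rightarrow> bool" where
  "admissible k f \<longleftrightarrow> even k \<and> k \<ge> 2 \<and> cusp_dim k \<ge> 1 \<and> orthonormal_cusp_basis k f"

end

theory Submission
  imports Defs "HOL-Probability.Probability" "HOL-Complex_Analysis.Complex_Analysis"
begin

text \<open>
  The sup-norm is a Lipschitz function of the coefficient vector, with constant the square root of
  the maximum of the Bergman kernel \<open>B z = y^k * (\<Sum>j. |f_j z|^2)\<close>. Evaluating the Fourier expansion on a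
  horizontal strip, which is covered by boundedly many translates of the fundamental domain, gives
  \<open>B \<lesssim> k powr (3/2)\<close>. Since the dimension is of order \<open>k\<close>, concentration of measure on the sphere
  (derived from the Prekopa-Leindler inequality on the ball) yields fluctuations of order
  \<open>k powr (1/4)\<close>. The lower bound for the mean comes from a single point \<open>z\<close> with
  \<open>B z \<greatersim> k powr (3/2)\<close>, found by testing the kernel against the product of a fixed cusp form and an
  Eisenstein series near \<open>y = k / (4 * pi * m)\<close>; products of this kind also give the lower bound for
  the dimension. For the upper bound, the sup-norm estimate is applied to the cusp form \<open>g ^ m\<close> of
  weight \<open>k * m\<close> with \<open>m\<close> of order \<open>ln k\<close>, whose Petersson norm has an explicit mean.
\<close>

section \<open>The Prekopa-Leindler inequality\<close>

text \<open>Two opposite comparisons of \<open>cusp_dim k\<close> with \<open>k\<close> are needed: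
  concentration and the upper bound for the mean require the dimension to be at least a multiple of
  k, the lower bound for the mean requires it to be at most one. The latter cannot be read off from
  the maximum k powr (3/2) of the kernel. The pointwise bound is therefore kept in the sharper form
  k * min (sqrt k) (sqrt y): sqrt y is integrable against dx dy / y^2, and the integral of the
  kernel is the dimension.

  Passing to g^m replaces a net on the non-compact domain. The sup-norm estimate bounds the 2m-th
  power of the supremum by a polynomial in k * m times an integral of |g|^(2m), whose mean reduces
  to moments at fixed points; the polynomial has a bounded 2m-th root once m is of order ln k.

  Neither a dimension formula nor the discriminant form enters. One cusp form that does not vanish
  at i, together with bounds for Eisenstein series that are uniform in the weight, supplies all test
  functions.\<close>

lemma emeasure_lborel_affine_image_vimage:
  fixes C :: "real set" assumes "C \<in> sets borel" "c \<noteq> 0"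
  shows "emeasure lborel C = ennreal \<bar>c\<bar> * emeasure lborel {x. t + c * x \<in> C}"
proof -
  have "emeasure lborel C = (\<integral>\<^sup>+x. indicator C x \<partial>lborel)"
    using assms by simp
  also have "\<dots> = \<bar>c\<bar> * (\<integral>\<^sup>+x. indicator C (t + c * x) \<partial>lborel)"
    using assms by (intro nn_integral_real_affine) auto
  also have "(\<integral>\<^sup>+x. indicator C (t + c * x) \<partial>lborel) = (\<integral>\<^sup>+x. indicator {x. t + c * x \<in> C} x \<partial>lborel)"
    by (intro nn_integral_cong) (auto split: split_indicator)
  also have "\<dots> = emeasure lborel {x. t + c * x \<in> C}"
    using assms by (intro nn_integral_indicator) (auto intro!: measurable_sets_borel[of _ borel] simp: pred_def)
  finally show ?thesis by simp
qed

text \<open>One-dimensional Brunn-Minkowski. If \<open>a\<close> nearly attains the supremum of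
  \<open>A\<close> and \<open>b\<close> nearly the infimum of \<open>B\<close>, then the half-size
  copies (A + b)/2 and (a + B)/2, after trimming, lie in \<open>C\<close> on opposite sides of (a +
  b)/2. Asking only that a measurable \<open>C\<close> contain the midpoints avoids the question
  whether a sumset is measurable.\<close>

lemma midpoint_emeasure_bounded:
  fixes A B C :: "real set"
  assumes [measurable]: "A \<in> sets borel" "B \<in> sets borel" "C \<in> sets borel"
    and ne: "A \<noteq> {}" "B \<noteq> {}" and bd: "A \<subseteq> {-n..n}" "B \<subseteq> {-n..n}"
    and mid: "\<And>x y. x \<in> A \<Longrightarrow> y \<in> B \<Longrightarrow> (x + y) / 2 \<in> C"
  shows "emeasure lborel A + emeasure lborel B \<le> 2 * emeasure lborel C"
proof (rule ennreal_le_epsilon)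
  fix e :: real assume e: "0 < e"
  have bA: "bdd_above A" and bB: "bdd_below B"
    using bd by (meson atLeastAtMost_iff bdd_aboveI bdd_belowI subsetD)+
  obtain a where a: "a \<in> A" "Sup A - e/2 < a"
    using less_cSup_iff[OF ne(1) bA, of "Sup A - e/2"] e by auto
  obtain b where b: "b \<in> B" "b < Inf B + e/2"
    using cInf_less_iff[OF ne(2) bB, of "Inf B + e/2"] e by auto
  define A' where "A' = A \<inter> {..a}"
  define B' where "B' = B \<inter> {b<..}"
  have [measurable]: "A' \<in> sets borel" "B' \<in> sets borel" by (auto simp: A'_def B'_def)
  have "A \<subseteq> A' \<union> {Sup A - e/2..Sup A}"
    using a bA by (auto simp: A'_def intro: cSup_upper)
  then have "emeasure lborel A \<le> emeasure lborel (A' \<union> {Sup A - e/2..Sup A})"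
    by (intro emeasure_mono) auto
  also have "\<dots> \<le> emeasure lborel A' + emeasure lborel {Sup A - e/2..Sup A}"
    by (intro emeasure_subadditive) auto
  finally have 1: "emeasure lborel A \<le> emeasure lborel A' + ennreal (e/2)" using e by simp
  have "B \<subseteq> B' \<union> {Inf B..Inf B + e/2}"
    using b bB by (auto simp: B'_def intro: cInf_lower)
  then have "emeasure lborel B \<le> emeasure lborel (B' \<union> {Inf B..Inf B + e/2})"
    by (intro emeasure_mono) auto
  also have "\<dots> \<le> emeasure lborel B' + emeasure lborel {Inf B..Inf B + e/2}"
    by (intro emeasure_subadditive) auto
  finally have 2: "emeasure lborel B \<le> emeasure lborel B' + ennreal (e/2)" using e by simp
  \<comment> \<open>\<open>A2\<close> is (A' + b)/2 and \<open>B2\<close> is (a + B')/2, written as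
    preimages so that measurability is immediate.\<close>
  define A2 where "A2 = {x. - b + 2 * x \<in> A'}"
  define B2 where "B2 = {x. - a + 2 * x \<in> B'}"
  have [measurable]: "A2 \<in> sets borel" "B2 \<in> sets borel"
    unfolding A2_def B2_def by measurable
  have "emeasure lborel A' = 2 * emeasure lborel A2"
    using emeasure_lborel_affine_image_vimage[of A' 2 "-b"] unfolding A2_def by simp
  moreover have "emeasure lborel B' = 2 * emeasure lborel B2"
    using emeasure_lborel_affine_image_vimage[of B' 2 "-a"] unfolding B2_def by simp
  moreover have "emeasure lborel A2 + emeasure lborel B2 = emeasure lborel (A2 \<union> B2)"
    by (rule plus_emeasure) (auto simp: A2_def B2_def A'_def B'_def)
  moreover have "emeasure lborel (A2 \<union> B2) \<le> emeasure lborel C"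
  proof (rule emeasure_mono)
    show "A2 \<union> B2 \<subseteq> C"
    proof safe
      fix x assume "x \<in> A2"
      then show "x \<in> C" using mid[of "-b+2*x" b] b by (simp add: A2_def A'_def)
    next
      fix x assume "x \<in> B2"
      then show "x \<in> C" using mid[of a "-a+2*x"] a by (simp add: B2_def B'_def)
    qed
  qed simp
  ultimately have "emeasure lborel A' + emeasure lborel B' \<le> 2 * emeasure lborel C"
    by (metis distrib_left mult_left_mono zero_le)
  moreover have "emeasure lborel A + emeasure lborel B \<le> (emeasure lborel A' + emeasure lborel B') + ennreal e"
  proof -
    have "emeasure lborel A + emeasure lborel B \<le> (emeasure lborel A' + ennreal (e/2)) + (emeasure lborel B' + ennreal (e/2))"
      using 1 2 by (rule add_mono)
    also have "\<dots> = (emeasure lborel A' + emeasure lborel B') + (ennreal (e/2) + ennreal (e/2))"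
      by (simp add: ac_simps)
    also have "ennreal (e/2) + ennreal (e/2) = ennreal e" using e by (subst ennreal_plus[symmetric]) auto
    finally show ?thesis .
  qed
  ultimately show "emeasure lborel A + emeasure lborel B \<le> 2 * emeasure lborel C + ennreal e"
    by (meson add_right_mono order_trans)
qed

lemma midpoint_emeasure:
  fixes A B C :: "real set"
  assumes [measurable]: "A \<in> sets borel" "B \<in> sets borel" "C \<in> sets borel"
    and ne: "A \<noteq> {}" "B \<noteq> {}"
    and mid: "\<And>x y. x \<in> A \<Longrightarrow> y \<in> B \<Longrightarrow> (x + y) / 2 \<in> C"
  shows "emeasure lborel A + emeasure lborel B \<le> 2 * emeasure lborel C"
proof -
  have lim: "(\<lambda>n. emeasure lborel (D \<inter> {- real n..real n})) \<longlonglongrightarrow> emeasure lborel D"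
    if [measurable]: "D \<in> sets borel" for D
  proof -
    have "(\<Union>n. D \<inter> {- real n..real n}) = D"
    proof safe
      fix x assume "x \<in> D"
      obtain n where "\<bar>x\<bar> \<le> real n" using real_arch_simple by blast
      then show "x \<in> (\<Union>n. D \<inter> {- real n..real n})" using \<open>x \<in> D\<close> by (intro UN_I[of n]) auto
    qed
    moreover have "(\<lambda>n. emeasure lborel (D \<inter> {- real n..real n})) \<longlonglongrightarrow> emeasure lborel (\<Union>n. D \<inter> {- real n..real n})"
      by (rule Lim_emeasure_incseq) (auto simp: incseq_def)
    ultimately show ?thesis by simp
  qed
  obtain a b where ab: "a \<in> A" "b \<in> B" using ne by auto
  \<comment> \<open>From \<open>n0\<close> on both truncated sets contain a point, as the bounded
    case demands.\<close>
  obtain n0 where n0: "\<bar>a\<bar> + \<bar>b\<bar> \<le> real n0" using real_arch_simple by blast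
  show ?thesis
  proof (rule LIMSEQ_le_const2)
    show "(\<lambda>n. emeasure lborel (A \<inter> {- real n..real n}) + emeasure lborel (B \<inter> {- real n..real n}))
            \<longlonglongrightarrow> emeasure lborel A + emeasure lborel B"
      by (intro tendsto_add lim) auto
    show "\<exists>N. \<forall>n\<ge>N. emeasure lborel (A \<inter> {- real n..real n}) + emeasure lborel (B \<inter> {- real n..real n}) \<le> 2 * emeasure lborel C"
    proof (intro exI allI impI)
      fix n assume "n0 \<le> n"
      then have "\<bar>a\<bar> + \<bar>b\<bar> \<le> real n" using n0 by linarith
      then have "a \<in> A \<inter> {- real n..real n}" "b \<in> B \<inter> {- real n..real n}" using ab by auto
      then show "emeasure lborel (A \<inter> {- real n..real n}) + emeasure lborel (B \<inter> {- real n..real n}) \<le> 2 * emeasure lborel C"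
        by (intro midpoint_emeasure_bounded[of _ _ _ "real n"]) (auto intro: mid)
    qed
  qed
qed

section \<open>The Prekopa-Leindler inequality on the real line\<close>

lemma pair_borel_CollectI:
  assumes "Measurable.pred (borel \<Otimes>\<^sub>M borel) P"
  shows "{p. P p} \<in> sets (lborel \<Otimes>\<^sub>M lborel)"
  using assms by (simp add: pred_def space_pair_measure cong: sets_pair_measure_cong)

lemma nn_integral_layer_cake:
  assumes "sigma_finite_measure M" and [measurable]: "f \<in> borel_measurable M"
  shows "integral\<^sup>N M f = (\<integral>\<^sup>+t. emeasure M {x\<in>space M. ennreal t < f x} * indicator {0..} t \<partial>lborel)"
proof -
  interpret sigma_finite_measure M by fact
  interpret pair_sigma_finite M "lborel :: real measure" ..
  have eq: "f x = (\<integral>\<^sup>+t. indicator {t. ennreal t < f x} t * indicator {0..} t \<partial>lborel)" for x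
  proof (cases "f x")
    case (real r)
    have "(\<integral>\<^sup>+t. indicator {t. ennreal t < f x} t * indicator {0..} t \<partial>lborel) = (\<integral>\<^sup>+t. indicator {0..<r} t \<partial>lborel)"
      using real by (intro nn_integral_cong) (auto split: split_indicator simp: ennreal_less_iff)
    then show ?thesis using real by simp
  next
    case top
    have "(\<integral>\<^sup>+t. indicator {t. ennreal t < f x} t * indicator {0..} t \<partial>lborel) = (\<integral>\<^sup>+t. indicator {0::real..} t \<partial>lborel)"
      using top by (intro nn_integral_cong) (auto split: split_indicator)
    also have "\<dots> = \<infinity>"
    proof -
      have "ennreal (real n) \<le> emeasure lborel {0::real..}" for n
      proof -
        have "emeasure lborel {0..real n} \<le> emeasure lborel {0::real..}" by (intro emeasure_mono) auto
        then show ?thesis by simp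
      qed
      then have "emeasure lborel {0::real..} = \<infinity>"
        by (metis ennreal_Ex_less_of_nat ennreal_of_nat_eq_real_of_nat infinity_ennreal_def linorder_not_less top.not_eq_extremum)
      then show ?thesis by simp
    qed
    finally show ?thesis using top by simp
  qed
  have "integral\<^sup>N M f = (\<integral>\<^sup>+x. (\<integral>\<^sup>+t. indicator {t. ennreal t < f x} t * indicator {0..} t \<partial>lborel) \<partial>M)"
    by (rule nn_integral_cong) (rule eq)
  also have "\<dots> = (\<integral>\<^sup>+t. (\<integral>\<^sup>+x. indicator {t. ennreal t < f x} t * indicator {0..} t \<partial>M) \<partial>lborel)"
  proof (rule Fubini'[symmetric])
    have "(\<lambda>(x, y). indicator {t. ennreal t < f x} y * indicator {0..} y :: ennreal) =
          (\<lambda>p. if ennreal (snd p) < f (fst p) \<and> 0 \<le> snd p then 1 else 0)"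
      by (auto split: split_indicator)
    also have "\<dots> \<in> borel_measurable (M \<Otimes>\<^sub>M lborel)" by measurable
    finally show "(\<lambda>(x, y). indicator {t. ennreal t < f x} y * indicator {0..} y :: ennreal)
      \<in> borel_measurable (M \<Otimes>\<^sub>M lborel)" .
  qed
  also have "\<dots> = (\<integral>\<^sup>+t. (\<integral>\<^sup>+x. indicator {x\<in>space M. ennreal t < f x} x * indicator {0..} t \<partial>M) \<partial>lborel)"
    by (auto intro!: nn_integral_cong split: split_indicator)
  also have "\<dots> = (\<integral>\<^sup>+t. emeasure M {x\<in>space M. ennreal t < f x} * indicator {0..} t \<partial>lborel)"
    by (intro nn_integral_cong, subst nn_integral_multc) auto
  finally show ?thesis .
qed

text \<open>AM-GM: it turns the additive comparison of normalised layer integrals into the product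
  form of the inequality.\<close>

lemma ennreal_mult_le_mean_square:
  fixes p q r :: ennreal
  assumes "p + q \<le> 2 * r" shows "p * q \<le> r\<^sup>2"
proof (cases r)
  case (real s)
  then have "p + q \<le> ennreal (2 * s)" using assms by (simp add: ennreal_mult)
  then have "p + q < \<top>" by (rule le_less_trans) simp
  then obtain u v where uv: "p = ennreal u" "q = ennreal v" "0 \<le> u" "0 \<le> v"
    by (metis ennreal_cases ennreal_add_eq_top less_irrefl)
  have "ennreal (u + v) \<le> ennreal (2 * s)"
    using \<open>p + q \<le> ennreal (2 * s)\<close> uv by simp
  then have "u + v \<le> 2 * s" using real by (subst (asm) ennreal_le_iff) auto
  then have "(u + v)\<^sup>2 \<le> (2 * s)\<^sup>2" using uv by (intro power_mono) auto
  moreover have "4 * (u * v) \<le> (u + v)\<^sup>2" using sum_squares_ge_zero[of "u - v" 0] by (simp add: power2_eq_square algebra_simps)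
  ultimately have "u * v \<le> s\<^sup>2" by (simp add: power2_eq_square)
  then show ?thesis using uv real by (simp add: ennreal_mult[symmetric] ennreal_power)
next
  case top
  then show ?thesis by simp
qed

text \<open>\<open>f\<close> and \<open>g\<close> are rescaled by their suprema a' and b', which
  boundedness makes finite. At level t the sets {f > a' t} and {g > b' t} have their midpoints in {h
  > c t} with c^2 = a' b', so the midpoint inequality for sets can be integrated over t.\<close>

lemma prekopa_leindler_real_bounded:
  fixes f g h :: "real \<Rightarrow> ennreal"
  assumes [measurable]: "f \<in> borel_measurable borel" "g \<in> borel_measurable borel" "h \<in> borel_measurable borel"
    and bd: "\<And>x. f x \<le> ennreal n" "\<And>x. g x \<le> ennreal n"
    and mid: "\<And>x y. f x * g y \<le> (h ((x + y) / 2))\<^sup>2"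
  shows "integral\<^sup>N lborel f * integral\<^sup>N lborel g \<le> (integral\<^sup>N lborel h)\<^sup>2"
proof -
  define a where "a = (SUP x. f x)"
  define b where "b = (SUP x. g x)"
  have abn: "a \<le> ennreal n" "b \<le> ennreal n" unfolding a_def b_def using bd by (auto intro: SUP_least)
  obtain a' where a': "a = ennreal a'" "0 \<le> a'" using abn by (metis ennreal_cases ennreal_less_top leD)
  obtain b' where b': "b = ennreal b'" "0 \<le> b'" using abn by (metis ennreal_cases ennreal_less_top leD)
  have fa: "f x \<le> ennreal a'" for x using a' unfolding a_def by (metis SUP_upper UNIV_I)
  have gb: "g x \<le> ennreal b'" for x using b' unfolding b_def by (metis SUP_upper UNIV_I)
  show ?thesis
  proof (cases "a' = 0 \<or> b' = 0")
    case True
    then have "f = (\<lambda>x. 0) \<or> g = (\<lambda>x. 0)" using fa gb by (auto simp: fun_eq_iff)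
    then show ?thesis by auto
  next
    case False
    then have pos: "a' > 0" "b' > 0" using a' b' by auto
    define c where "c = sqrt (a' * b')"
    have c: "c > 0" "c * c = a' * b'" using pos by (auto simp: c_def)
    have cake: "integral\<^sup>N lborel u = ennreal d * (\<integral>\<^sup>+t. emeasure lborel {x. ennreal (d * t) < u x} * indicator {0..} t \<partial>lborel)"
      if [measurable]: "u \<in> borel_measurable borel" and d: "d > 0" for u :: "real \<Rightarrow> ennreal" and d
    proof -
      have [measurable]: "(\<lambda>t. emeasure lborel {x. ennreal t < u x}) \<in> borel_measurable borel"
      proof -
        have "(\<lambda>t. emeasure lborel (Pair t -` {p. ennreal (fst p) < u (snd p)})) \<in> borel_measurable (lborel :: real measure)"
          by (rule lborel.measurable_emeasure_Pair) (rule pair_borel_CollectI, measurable)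
        then show ?thesis by (simp add: vimage_def)
      qed
      have "integral\<^sup>N lborel u = (\<integral>\<^sup>+t. emeasure lborel {x. ennreal t < u x} * indicator {0..} t \<partial>lborel)"
        by (subst nn_integral_layer_cake) (auto simp: sigma_finite_lborel)
      also have "\<dots> = \<bar>d\<bar> * (\<integral>\<^sup>+t. emeasure lborel {x. ennreal (0 + d * t) < u x} * indicator {0..} (0 + d * t) \<partial>lborel)"
        using d by (intro nn_integral_real_affine) auto
      also have "(\<integral>\<^sup>+t. emeasure lborel {x. ennreal (0 + d * t) < u x} * indicator {0..} (0 + d * t) \<partial>lborel)
          = (\<integral>\<^sup>+t. emeasure lborel {x. ennreal (d * t) < u x} * indicator {0..} t \<partial>lborel)"
        using d by (intro nn_integral_cong) (auto split: split_indicator simp: zero_le_mult_iff)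
      finally show ?thesis using d by simp
    qed
    define F where "F = (\<integral>\<^sup>+t. emeasure lborel {x. ennreal (a' * t) < f x} * indicator {0..} t \<partial>lborel)"
    define G where "G = (\<integral>\<^sup>+t. emeasure lborel {x. ennreal (b' * t) < g x} * indicator {0..} t \<partial>lborel)"
    define H where "H = (\<integral>\<^sup>+t. emeasure lborel {x. ennreal (c * t) < h x} * indicator {0..} t \<partial>lborel)"
    have meas: "(\<lambda>t. emeasure lborel {x. ennreal (d * t) < u x}) \<in> borel_measurable lborel"
      if [measurable]: "u \<in> borel_measurable borel" for u :: "real \<Rightarrow> ennreal" and d
    proof -
      have "(\<lambda>t. emeasure lborel (Pair t -` {p. ennreal (d * fst p) < u (snd p)})) \<in> borel_measurable (lborel :: real measure)"
        by (rule lborel.measurable_emeasure_Pair) (rule pair_borel_CollectI, measurable)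
      then show ?thesis by (simp add: vimage_def)
    qed
    have [measurable]: "(\<lambda>t. emeasure lborel {x. ennreal (a' * t) < f x}) \<in> borel_measurable lborel"
      "(\<lambda>t. emeasure lborel {x. ennreal (b' * t) < g x}) \<in> borel_measurable lborel"
      "(\<lambda>t. emeasure lborel {x. ennreal (c * t) < h x}) \<in> borel_measurable lborel"
      by (auto intro!: meas)
    have "F + G \<le> 2 * H"
    proof -
      have "F + G = (\<integral>\<^sup>+t. emeasure lborel {x. ennreal (a' * t) < f x} * indicator {0..} t
          + emeasure lborel {x. ennreal (b' * t) < g x} * indicator {0..} t \<partial>lborel)"
        unfolding F_def G_def by (rule nn_integral_add[symmetric]) auto
      also have "\<dots> \<le> (\<integral>\<^sup>+t. 2 * (emeasure lborel {x. ennreal (c * t) < h x} * indicator {0..} t) \<partial>lborel)"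
      proof (rule nn_integral_mono)
        fix t :: real
        show "emeasure lborel {x. ennreal (a' * t) < f x} * indicator {0..} t
          + emeasure lborel {x. ennreal (b' * t) < g x} * indicator {0..} t
          \<le> 2 * (emeasure lborel {x. ennreal (c * t) < h x} * indicator {0..} t)"
        proof (cases "0 \<le> t")
          case False then show ?thesis by simp
        next
          case t: True
          show ?thesis
          proof (cases "t < 1")
            case True
            \<comment> \<open>Below t = 1 both superlevel sets are inhabited, from t = 1 on both are
              empty. Without the normalisation one could be empty and the other not, and then the
              midpoint inequality for sets says nothing.\<close>
            have ne: "{x. ennreal (a' * t) < f x} \<noteq> {}" "{x. ennreal (b' * t) < g x} \<noteq> {}"
            proof -
              have "ennreal (a' * t) < (SUP x. f x)" using a' pos t True unfolding a_def[symmetric]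
                by (simp add: ennreal_less_iff)
              then show "{x. ennreal (a' * t) < f x} \<noteq> {}" by (auto simp: less_SUP_iff)
              have "ennreal (b' * t) < (SUP x. g x)" using b' pos t True unfolding b_def[symmetric]
                by (simp add: ennreal_less_iff)
              then show "{x. ennreal (b' * t) < g x} \<noteq> {}" by (auto simp: less_SUP_iff)
            qed
            have "emeasure lborel {x. ennreal (a' * t) < f x} + emeasure lborel {x. ennreal (b' * t) < g x}
               \<le> 2 * emeasure lborel {x. ennreal (c * t) < h x}"
            proof (rule midpoint_emeasure[OF _ _ _ ne])
              fix x y assume "x \<in> {x. ennreal (a' * t) < f x}" "y \<in> {x. ennreal (b' * t) < g x}"
              then have "ennreal (a' * t) * ennreal (b' * t) < f x * g y"
                using pos t fa[of x] gb[of y]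
                by (cases "f x"; cases "g y")
                  (auto simp: ennreal_less_iff ennreal_mult[symmetric] top_unique
                     intro!: mult_strict_mono intro: le_less_trans[of 0 "a' * t"])
              also have "\<dots> \<le> (h ((x + y) / 2))\<^sup>2" by (rule mid)
              moreover have e: "(ennreal (c * t))\<^sup>2 = ennreal (a' * t) * ennreal (b' * t)"
              proof -
                have "(c * t)\<^sup>2 = (a' * t) * (b' * t)" using c(2) by algebra
                moreover have "(ennreal (c * t))\<^sup>2 = ennreal ((c * t)\<^sup>2)"
                  using c t by (intro ennreal_power) auto
                ultimately show ?thesis using pos t by (simp add: ennreal_mult)
              qed
              ultimately have less: "(ennreal (c * t))\<^sup>2 < (h ((x + y) / 2))\<^sup>2"
                using e by simp
              then have "ennreal (c * t) < h ((x + y) / 2)"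
                by (meson power_mono linorder_not_le zero_le)
              then show "(x + y) / 2 \<in> {x. ennreal (c * t) < h x}" by simp
            qed auto
            then show ?thesis using t by simp
          next
            case False
            have "{x. ennreal (a' * t) < f x} = {}" "{x. ennreal (b' * t) < g x} = {}"
            proof -
              have "ennreal (a' * t) \<ge> f x" for x
                using fa[of x] False pos by (intro order_trans[OF fa]) (auto intro!: ennreal_leI)
              then show "{x. ennreal (a' * t) < f x} = {}" by (auto simp: not_less)
              have "ennreal (b' * t) \<ge> g x" for x
                using gb[of x] False pos by (intro order_trans[OF gb]) (auto intro!: ennreal_leI)
              then show "{x. ennreal (b' * t) < g x} = {}" by (auto simp: not_less)
            qed
            then show ?thesis by simp
          qed
        qed
      qed
      also have "\<dots> = 2 * H" unfolding H_def by (rule nn_integral_cmult) auto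
      finally show ?thesis .
    qed
    then have "F * G \<le> H\<^sup>2" by (rule ennreal_mult_le_mean_square)
    then have "ennreal (a' * b') * (F * G) \<le> ennreal (c * c) * H\<^sup>2" using c by (simp add: mult_left_mono)
    moreover have "integral\<^sup>N lborel f * integral\<^sup>N lborel g = ennreal (a' * b') * (F * G)"
      using cake[of f a'] cake[of g b'] pos by (simp add: F_def G_def ennreal_mult ac_simps)
    moreover have "(integral\<^sup>N lborel h)\<^sup>2 = ennreal (c * c) * H\<^sup>2"
      using cake[of h c] c(1) by (simp add: H_def ennreal_mult power2_eq_square ac_simps)
    ultimately show ?thesis by simp
  qed
qed

text \<open>The case of weight 1/2. Squaring \<open>h\<close> instead of taking a square root on the
  left stays within the arithmetic of \<open>ennreal\<close>. The midpoint map is a parameter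
  because the points of a product space are extensional functions, whose midpoint has to be
  restricted to the index set.\<close>

definition prekopa_leindler :: "'a measure \<Rightarrow> ('a \<Rightarrow> 'a \<Rightarrow> 'a) \<Rightarrow> bool" where
  "prekopa_leindler M mid \<longleftrightarrow>
     (\<forall>f\<in>borel_measurable M. \<forall>g\<in>borel_measurable M. \<forall>h\<in>borel_measurable M.
        (\<forall>x\<in>space M. \<forall>y\<in>space M. f x * g y \<le> (h (mid x y))\<^sup>2) \<longrightarrow>
        integral\<^sup>N M f * integral\<^sup>N M g \<le> ((integral\<^sup>N M h)\<^sup>2 :: ennreal))"

lemma prekopa_leindlerD:
  assumes "prekopa_leindler M mid" "f \<in> borel_measurable M" "g \<in> borel_measurable M" "h \<in> borel_measurable M"
    and "\<And>x y. x \<in> space M \<Longrightarrow> y \<in> space M \<Longrightarrow> f x * g y \<le> (h (mid x y))\<^sup>2"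
  shows "integral\<^sup>N M f * integral\<^sup>N M g \<le> ((integral\<^sup>N M h)\<^sup>2 :: ennreal)"
  using assms unfolding prekopa_leindler_def by blast

text \<open>Truncating \<open>f\<close> and \<open>g\<close> preserves the hypothesis with the same
  \<open>h\<close>, so monotone convergence can be applied to the two factors separately.\<close>

lemma prekopa_leindler_real: "prekopa_leindler lborel (\<lambda>x y. (x + y) / 2 :: real)"
  unfolding prekopa_leindler_def
proof (intro ballI impI)
  fix f g h :: "real \<Rightarrow> ennreal"
  assume [measurable]: "f \<in> borel_measurable lborel" "g \<in> borel_measurable lborel" "h \<in> borel_measurable lborel"
    and mid: "\<forall>x\<in>space lborel. \<forall>y\<in>space lborel. f x * g y \<le> (h ((x + y) / 2))\<^sup>2"
  have trunc: "integral\<^sup>N lborel u = (SUP n. \<integral>\<^sup>+x. min (u x) (of_nat n) \<partial>lborel)"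
    if [measurable]: "u \<in> borel_measurable lborel" for u :: "real \<Rightarrow> ennreal"
  proof -
    have "u x = (SUP n. min (u x) (of_nat n))" for x
    proof (rule antisym)
      show "u x \<le> (SUP n. min (u x) (of_nat n))"
      proof (cases "u x")
        case (real r)
        then obtain n where "u x \<le> of_nat n"
          by (metis ennreal_leI ennreal_of_nat_eq_real_of_nat real_arch_simple)
        then show ?thesis by (intro SUP_upper2[of n]) auto
      next
        case top
        then show ?thesis by (simp add: ennreal_SUP_of_nat_eq_top)
      qed
      show "(SUP n. min (u x) (of_nat n)) \<le> u x" by (auto intro: SUP_least)
    qed
    then have "integral\<^sup>N lborel u = (\<integral>\<^sup>+x. (SUP n. min (u x) (of_nat n)) \<partial>lborel)" by (metis (no_types, lifting) nn_integral_cong)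
    also have "\<dots> = (SUP n. \<integral>\<^sup>+x. min (u x) (of_nat n) \<partial>lborel)"
      by (rule nn_integral_monotone_convergence_SUP) (auto simp: incseq_def le_fun_def min.coboundedI2)
    finally show ?thesis .
  qed
  have "(\<integral>\<^sup>+x. min (f x) (of_nat n) \<partial>lborel) * (\<integral>\<^sup>+x. min (g x) (of_nat m) \<partial>lborel) \<le> (integral\<^sup>N lborel h)\<^sup>2" for n m
  proof (rule prekopa_leindler_real_bounded[of _ _ _ "real (n + m)"])
    show "min (f x) (of_nat n) \<le> ennreal (real (n + m))" "min (g x) (of_nat m) \<le> ennreal (real (n + m))" for x
      unfolding ennreal_of_nat_eq_real_of_nat[symmetric] by (auto intro!: min.coboundedI2)
    show "min (f x) (of_nat n) * min (g y) (of_nat m) \<le> (h ((x + y) / 2))\<^sup>2" for x y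
      by (rule order_trans[OF mult_mono[of _ "f x" _ "g y"]]) (use mid in auto)
  qed auto
  then show "integral\<^sup>N lborel f * integral\<^sup>N lborel g \<le> (integral\<^sup>N lborel h)\<^sup>2"
    apply (subst trunc[of f], simp, subst trunc[of g], simp)
    apply (subst SUP_mult_right_ennreal, rule SUP_least)
    apply (subst SUP_mult_left_ennreal, rule SUP_least)
    apply simp
    done
qed

section \<open>Tensorisation to the complex plane and to finite products\<close>

lemma lborel_complex_eq: "lborel = distr (lborel \<Otimes>\<^sub>M lborel) borel (\<lambda>(x, y). Complex x y)"
proof (rule lborel_eqI)
  have [measurable]: "(\<lambda>(x, y). Complex x y) \<in> borel \<Otimes>\<^sub>M borel \<rightarrow>\<^sub>M borel"
    unfolding Complex_eq by measurable
  fix l u :: complex assume lu: "\<And>b. b \<in> Basis \<Longrightarrow> l \<bullet> b \<le> u \<bullet> b"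
  have le: "Re l \<le> Re u" "Im l \<le> Im u" using lu[of 1] lu[of \<i>] by (auto simp: Basis_complex_def)
  have "(\<lambda>(x, y). Complex x y) -` box l u \<inter> space (lborel \<Otimes>\<^sub>M lborel) = {Re l<..<Re u} \<times> {Im l<..<Im u}"
    by (auto simp: box_def Basis_complex_def space_pair_measure)
  moreover have "emeasure (lborel \<Otimes>\<^sub>M lborel) ({Re l<..<Re u} \<times> {Im l<..<Im u}) = ennreal ((Re u - Re l) * (Im u - Im l))"
    using le by (subst lborel.emeasure_pair_measure_Times) (auto simp: ennreal_mult)
  ultimately show "emeasure (distr (lborel \<Otimes>\<^sub>M lborel) borel (\<lambda>(x, y). Complex x y)) (box l u) = (\<Prod>b\<in>Basis. (u - l) \<bullet> b)"
    by (subst emeasure_distr) (auto simp: Basis_complex_def)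
qed simp

lemma borel_measurable_Complex [measurable (raw)]:
  assumes [measurable]: "f \<in> borel_measurable M" "g \<in> borel_measurable M"
  shows "(\<lambda>x. Complex (f x) (g x)) \<in> borel_measurable M"
  unfolding Complex_eq by measurable

lemma nn_integral_lborel_complex:
  assumes [measurable]: "f \<in> borel_measurable borel"
  shows "integral\<^sup>N lborel f = (\<integral>\<^sup>+x. (\<integral>\<^sup>+y. f (Complex x y) \<partial>lborel) \<partial>lborel)"
proof -
  have "integral\<^sup>N lborel f = (\<integral>\<^sup>+p. f (case p of (x, y) \<Rightarrow> Complex x y) \<partial>(lborel \<Otimes>\<^sub>M lborel))"
    by (subst lborel_complex_eq, subst nn_integral_distr) (auto simp: case_prod_beta')
  also have "\<dots> = (\<integral>\<^sup>+x. (\<integral>\<^sup>+y. f (Complex x y) \<partial>lborel) \<partial>lborel)"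
    by (subst lborel.nn_integral_fst[symmetric]) (auto simp: case_prod_beta')
  finally show ?thesis .
qed

text \<open>The inequality in the inner variable, for fixed outer ones, is exactly the hypothesis of
  the inequality for the partial integrals in the outer variable.\<close>

lemma prekopa_leindler_complex: "prekopa_leindler lborel (\<lambda>x y. (x + y) / 2 :: complex)"
  unfolding prekopa_leindler_def
proof (intro ballI impI)
  fix f g h :: "complex \<Rightarrow> ennreal"
  assume [measurable]: "f \<in> borel_measurable lborel" "g \<in> borel_measurable lborel" "h \<in> borel_measurable lborel"
    and mid: "\<forall>x\<in>space lborel. \<forall>y\<in>space lborel. f x * g y \<le> (h ((x + y) / 2))\<^sup>2"
  have "(\<integral>\<^sup>+x. (\<integral>\<^sup>+y. f (Complex x y) \<partial>lborel) \<partial>lborel) * (\<integral>\<^sup>+x. (\<integral>\<^sup>+y. g (Complex x y) \<partial>lborel) \<partial>lborel)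
     \<le> (\<integral>\<^sup>+x. (\<integral>\<^sup>+y. h (Complex x y) \<partial>lborel) \<partial>lborel)\<^sup>2"
  proof (rule prekopa_leindlerD[OF prekopa_leindler_real])
    fix x x' :: real
    show "(\<integral>\<^sup>+y. f (Complex x y) \<partial>lborel) * (\<integral>\<^sup>+y. g (Complex x' y) \<partial>lborel)
       \<le> (\<integral>\<^sup>+y. h (Complex ((x + x') / 2) y) \<partial>lborel)\<^sup>2"
    proof (rule prekopa_leindlerD[OF prekopa_leindler_real])
      fix y y' :: real
      have "(Complex x y + Complex x' y') / 2 = Complex ((x + x') / 2) ((y + y') / 2)"
        by (simp add: complex_eq_iff)
      then show "f (Complex x y) * g (Complex x' y') \<le> (h (Complex ((x + x') / 2) ((y + y') / 2)))\<^sup>2"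
        using mid by (metis UNIV_I space_borel space_lborel)
    qed auto
  qed auto
  then show "integral\<^sup>N lborel f * integral\<^sup>N lborel g \<le> (integral\<^sup>N lborel h)\<^sup>2"
    by (simp add: nn_integral_lborel_complex)
qed

text \<open>The same tensorisation by induction, the new coordinate being the outer
  variable.\<close>

lemma prekopa_leindler_PiM:
  assumes "finite I"
  shows "prekopa_leindler (Pi\<^sub>M I (\<lambda>_. lborel)) (\<lambda>x y. \<lambda>i\<in>I. (x i + y i) / 2 :: complex)"
  using assms
proof (induction I)
  case empty
  interpret product_sigma_finite "\<lambda>_::'a. lborel :: complex measure" ..
  show ?case unfolding prekopa_leindler_def
    by (auto simp: PiM_empty nn_integral_count_space_finite restrict_def power2_eq_square)
next
  case (insert i I)
  interpret product_sigma_finite "\<lambda>_::'a. lborel :: complex measure" ..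
  interpret I: sigma_finite_measure "Pi\<^sub>M I (\<lambda>_. lborel :: complex measure)"
    by (rule sigma_finite) fact
  show ?case unfolding prekopa_leindler_def
  proof (intro ballI impI)
    fix f g h :: "('a \<Rightarrow> complex) \<Rightarrow> ennreal"
    let ?M = "Pi\<^sub>M (insert i I) (\<lambda>_. lborel)"
    let ?m = "\<lambda>x y. \<lambda>j\<in>I. (x j + y j) / 2 :: complex"
    assume [measurable]: "f \<in> borel_measurable ?M" "g \<in> borel_measurable ?M" "h \<in> borel_measurable ?M"
      and mid: "\<forall>x\<in>space ?M. \<forall>y\<in>space ?M. f x * g y \<le> (h (\<lambda>i\<in>insert i I. (x i + y i) / 2))\<^sup>2"
    have sec: "(\<lambda>x. u (x(i := s))) \<in> borel_measurable (Pi\<^sub>M I (\<lambda>_. lborel))"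
      if [measurable]: "u \<in> borel_measurable ?M" for u :: "('a \<Rightarrow> complex) \<Rightarrow> ennreal" and s by measurable
    have "(\<integral>\<^sup>+s. (\<integral>\<^sup>+x. f (x(i := s)) \<partial>Pi\<^sub>M I (\<lambda>_. lborel)) \<partial>lborel) * (\<integral>\<^sup>+s. (\<integral>\<^sup>+x. g (x(i := s)) \<partial>Pi\<^sub>M I (\<lambda>_. lborel)) \<partial>lborel)
       \<le> (\<integral>\<^sup>+s. (\<integral>\<^sup>+x. h (x(i := s)) \<partial>Pi\<^sub>M I (\<lambda>_. lborel)) \<partial>lborel)\<^sup>2"
    proof (rule prekopa_leindlerD[OF prekopa_leindler_complex])
      fix s t :: complex
      show "(\<integral>\<^sup>+x. f (x(i := s)) \<partial>Pi\<^sub>M I (\<lambda>_. lborel)) * (\<integral>\<^sup>+x. g (x(i := t)) \<partial>Pi\<^sub>M I (\<lambda>_. lborel))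
         \<le> (\<integral>\<^sup>+x. h (x(i := (s + t) / 2)) \<partial>Pi\<^sub>M I (\<lambda>_. lborel))\<^sup>2"
      proof (rule prekopa_leindlerD[OF insert.IH])
        fix x y :: "'a \<Rightarrow> complex" assume xy: "x \<in> space (Pi\<^sub>M I (\<lambda>_. lborel))" "y \<in> space (Pi\<^sub>M I (\<lambda>_. lborel))"
        have "x(i := s) \<in> space ?M" "y(i := t) \<in> space ?M" using xy by (auto simp: space_PiM PiE_def extensional_def)
        then have "f (x(i := s)) * g (y(i := t)) \<le> (h (\<lambda>j\<in>insert i I. ((x(i := s)) j + (y(i := t)) j) / 2))\<^sup>2"
          using mid by blast
        also have "(\<lambda>j\<in>insert i I. ((x(i := s)) j + (y(i := t)) j) / 2) = (?m x y)(i := (s + t) / 2)"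
          using insert.hyps by (auto simp: fun_eq_iff restrict_def)
        finally show "f (x(i := s)) * g (y(i := t)) \<le> (h ((?m x y)(i := (s + t) / 2)))\<^sup>2" .
      qed (auto intro: sec)
    qed (measurable; fail)+
    then show "integral\<^sup>N ?M f * integral\<^sup>N ?M g \<le> (integral\<^sup>N ?M h)\<^sup>2"
      by (simp add: product_nn_integral_insert_rev insert.hyps)
  qed
qed

section \<open>Concentration of measure on the complex sphere\<close>

abbreviation cvec_lborel :: "nat \<Rightarrow> (nat \<Rightarrow> complex) measure" where
  "cvec_lborel N \<equiv> Pi\<^sub>M {..<N} (\<lambda>_. lborel)"

abbreviation cvec_borel :: "nat \<Rightarrow> (nat \<Rightarrow> complex) measure" where
  "cvec_borel N \<equiv> Pi\<^sub>M {..<N} (\<lambda>_. borel)"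

definition cvec_unit_ball :: "nat \<Rightarrow> (nat \<Rightarrow> complex) set" where
  "cvec_unit_ball N = {a \<in> space (cvec_lborel N). cvec_norm N a \<le> 1}"

text \<open>Radial projection to the sphere; division by zero sends the origin to the zero
  vector.\<close>

definition cvec_dir :: "nat \<Rightarrow> (nat \<Rightarrow> complex) \<Rightarrow> nat \<Rightarrow> complex" where
  "cvec_dir N a = (\<lambda>j\<in>{..<N}. a j / of_real (cvec_norm N a))"

text \<open>The part of the ball on the rays through \<open>A\<close>. Its share of the volume is
  the spherical measure of \<open>A\<close>.\<close>

definition cvec_sector :: "nat \<Rightarrow> (nat \<Rightarrow> complex) set \<Rightarrow> (nat \<Rightarrow> complex) set" where
  "cvec_sector N A = {x \<in> cvec_unit_ball N. cvec_dir N x \<in> A}"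

lemma cvec_norm_L2: "cvec_norm N a = L2_set (\<lambda>j. cmod (a j)) {..<N}"
  by (simp add: cvec_norm_def L2_set_def)

lemma cvec_norm_nonneg [simp]: "0 \<le> cvec_norm N a"
  by (simp add: cvec_norm_L2 L2_set_nonneg)

lemma cvec_norm_square: "(cvec_norm N a)\<^sup>2 = (\<Sum>j<N. (cmod (a j))\<^sup>2)"
  by (simp add: cvec_norm_def sum_nonneg)

lemma cvec_norm_triangle: "cvec_norm N (\<lambda>j. a j + b j) \<le> cvec_norm N a + cvec_norm N b"
proof -
  have "cvec_norm N (\<lambda>j. a j + b j) \<le> L2_set (\<lambda>j. cmod (a j) + cmod (b j)) {..<N}"
    unfolding cvec_norm_L2 by (intro L2_set_mono norm_triangle_ineq) auto
  also have "\<dots> \<le> cvec_norm N a + cvec_norm N b"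
    unfolding cvec_norm_L2 by (rule L2_set_triangle_ineq)
  finally show ?thesis .
qed

lemma cvec_norm_scaleR: "cvec_norm N (\<lambda>j. c *\<^sub>R a j) = \<bar>c\<bar> * cvec_norm N a"
proof -
  have "cvec_norm N (\<lambda>j. c *\<^sub>R a j) = L2_set (\<lambda>j. \<bar>c\<bar> * cmod (a j)) {..<N}"
    by (simp add: cvec_norm_L2)
  also have "\<dots> = \<bar>c\<bar> * cvec_norm N a" by (simp add: L2_set_right_distrib cvec_norm_L2)
  finally show ?thesis .
qed

lemma cvec_norm_cong: "(\<And>j. j < N \<Longrightarrow> a j = b j) \<Longrightarrow> cvec_norm N a = cvec_norm N b"
  by (simp add: cvec_norm_def)

lemma cvec_norm_restrict [simp]: "cvec_norm N (restrict a {..<N}) = cvec_norm N a"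
  by (rule cvec_norm_cong) auto

lemma cvec_norm_eq_0_iff: "cvec_norm N a = 0 \<longleftrightarrow> (\<forall>j<N. a j = 0)"
  by (auto simp: cvec_norm_def sum_nonneg_eq_0_iff)

lemma cvec_norm_minus_commute: "cvec_norm N (\<lambda>j. a j - b j) = cvec_norm N (\<lambda>j. b j - a j)"
  unfolding cvec_norm_def by (subst norm_minus_commute) (rule refl)

text \<open>Uniform convexity of the ball: the midpoint of two points of the unit ball at distance d
  has squared norm at most 1 - d^2/4.\<close>

lemma cvec_norm_parallelogram:
  "(cvec_norm N (\<lambda>j. (a j + b j) / 2))\<^sup>2
     = ((cvec_norm N a)\<^sup>2 + (cvec_norm N b)\<^sup>2) / 2 - (cvec_norm N (\<lambda>j. a j - b j))\<^sup>2 / 4"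
proof -
  have "(cmod ((a j + b j) / 2))\<^sup>2 = ((cmod (a j))\<^sup>2 + (cmod (b j))\<^sup>2) / 2 - (cmod (a j - b j))\<^sup>2 / 4" for j
  proof -
    have gen: "p + d = 2 * s + 2 * t \<Longrightarrow> p / 4 = (s + t) / 2 - d / 4" for p d s t :: real
      by (simp add: field_simps)
    have e: "(cmod (a j + b j))\<^sup>2 + (cmod (a j - b j))\<^sup>2 = 2 * (cmod (a j))\<^sup>2 + 2 * (cmod (b j))\<^sup>2"
      by (simp add: cmod_power2) (simp add: power2_eq_square algebra_simps)
    have "(cmod ((a j + b j) / 2))\<^sup>2 = (cmod (a j + b j))\<^sup>2 / 4"
      by (simp add: norm_divide power_divide)
    then show ?thesis using gen[OF e] by (rule trans)
  qed
  then show ?thesis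
    unfolding cvec_norm_square by (simp add: sum_subtractf sum.distrib flip: sum_divide_distrib)
qed

lemma cvec_norm_diff_le: "cvec_norm N a - cvec_norm N b \<le> cvec_norm N (\<lambda>j. a j - b j)"
  using cvec_norm_triangle[of N b "\<lambda>j. a j - b j"] by simp

lemma cvec_dir_norm:
  assumes "cvec_norm N x \<noteq> 0" shows "cvec_norm N (cvec_dir N x) = 1"
proof -
  have "cvec_norm N (cvec_dir N x) = cvec_norm N (\<lambda>j. (1 / cvec_norm N x) *\<^sub>R x j)"
    unfolding cvec_dir_def by (rule cvec_norm_cong) (simp add: scaleR_conv_of_real)
  also have "\<dots> = 1" using assms by (simp add: cvec_norm_scaleR)
  finally show ?thesis .
qed

text \<open>With p and q the norms of \<open>x\<close> and \<open>y\<close>, the difference of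
  directions is (x - y)/p + (1/p - 1/q) y, and both summands have norm at most |x - y| / p. The
  bound 1/2 on the norms keeps the radial projection away from its singularity at the
  origin.\<close>

lemma cvec_dir_dist:
  assumes x: "cvec_norm N x \<ge> 1/2" and y: "cvec_norm N y \<ge> 1/2"
  shows "cvec_norm N (\<lambda>j. cvec_dir N x j - cvec_dir N y j) \<le> 4 * cvec_norm N (\<lambda>j. x j - y j)"
proof -
  define p q d where "p = cvec_norm N x" and "q = cvec_norm N y" and "d = cvec_norm N (\<lambda>j. x j - y j)"
  have pq: "p \<ge> 1/2" "q \<ge> 1/2" "p > 0" "q > 0" using x y by (auto simp: p_def q_def)
  have "cvec_norm N (\<lambda>j. cvec_dir N x j - cvec_dir N y j)
      = cvec_norm N (\<lambda>j. (1 / p) *\<^sub>R (x j - y j) + (1 / p - 1 / q) *\<^sub>R y j)"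
    by (rule cvec_norm_cong)
       (simp add: cvec_dir_def p_def[symmetric] q_def[symmetric] scaleR_conv_of_real algebra_simps)
  also have "\<dots> \<le> cvec_norm N (\<lambda>j. (1 / p) *\<^sub>R (x j - y j)) + cvec_norm N (\<lambda>j. (1 / p - 1 / q) *\<^sub>R y j)"
    by (rule cvec_norm_triangle)
  also have "\<dots> = d / p + \<bar>1 / p - 1 / q\<bar> * q"
    using pq by (simp add: cvec_norm_scaleR d_def q_def)
  also have "\<bar>1 / p - 1 / q\<bar> * q = \<bar>q - p\<bar> / p"
  proof -
    have "1 / p - 1 / q = (q - p) / (p * q)" using pq by (simp add: field_simps)
    then show ?thesis using pq by (simp add: abs_mult)
  qed
  also have "\<bar>q - p\<bar> \<le> d"
    using cvec_norm_diff_le[of N x y] cvec_norm_diff_le[of N y x]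
    by (auto simp: p_def q_def d_def cvec_norm_minus_commute[of N y x])
  finally have "cvec_norm N (\<lambda>j. cvec_dir N x j - cvec_dir N y j) \<le> d / p + d / p"
    using pq by (simp add: divide_right_mono)
  also have "\<dots> = d * (2 / p)" by simp
  also have "\<dots> \<le> d * 4" using pq by (intro mult_left_mono) (auto simp: d_def field_simps)
  finally show ?thesis by (simp add: d_def)
qed

text \<open>Volumes are taken in \<open>cvec_lborel\<close>, the spherical law lives on
  \<open>cvec_borel\<close>. The sigma-algebras agree, and measurability is carried across by this
  equation.\<close>

lemma sets_cvec: "sets (cvec_lborel N) = sets (cvec_borel N)"
  by (rule sets_PiM_cong) auto

lemma measurable_cvec_norm_borel [measurable]: "cvec_norm N \<in> borel_measurable (cvec_borel N)"
  unfolding cvec_norm_def[abs_def] by measurable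

lemma measurable_cvec_norm [measurable]: "cvec_norm N \<in> borel_measurable (cvec_lborel N)"
  using measurable_cvec_norm_borel by (simp add: measurable_cong_sets[OF sets_cvec refl])

lemma cvec_unit_ball_sets [measurable]: "cvec_unit_ball N \<in> sets (cvec_lborel N)"
  unfolding cvec_unit_ball_def by measurable

lemma measurable_cvec_dir [measurable]: "cvec_dir N \<in> cvec_lborel N \<rightarrow>\<^sub>M cvec_borel N"
proof -
  have [measurable]: "cvec_dir N \<in> cvec_borel N \<rightarrow>\<^sub>M cvec_borel N"
    unfolding cvec_dir_def[abs_def] by (rule measurable_restrict) measurable
  then show ?thesis by (simp add: measurable_cong_sets[OF sets_cvec refl])
qed

lemma cvec_sector_sets [measurable]:
  assumes "A \<in> sets (cvec_borel N)" shows "cvec_sector N A \<in> sets (cvec_lborel N)"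
proof -
  have "cvec_sector N A = cvec_unit_ball N \<inter> (cvec_dir N -` A \<inter> space (cvec_lborel N))"
    by (auto simp: cvec_sector_def cvec_unit_ball_def)
  then show ?thesis using assms by (auto intro: measurable_sets[OF measurable_cvec_dir])
qed

section \<open>Lebesgue measure under scalings and permutations\<close>

lemma emeasure_lborel_complex_scale:
  fixes A :: "complex set" assumes [measurable]: "A \<in> sets borel" and "c \<noteq> 0"
  shows "emeasure lborel A = ennreal (c\<^sup>2) * emeasure lborel {x. c *\<^sub>R x \<in> A}"
proof -
  have "emeasure lborel A = emeasure (density (distr lborel borel (\<lambda>x. 0 + c *\<^sub>R x)) (\<lambda>_. ennreal (\<bar>c\<bar> ^ DIM(complex)))) A"
    by (subst lborel_affine[OF assms(2), of 0]) simp
  also have "\<dots> = ennreal (c\<^sup>2) * emeasure (distr lborel borel (\<lambda>x. c *\<^sub>R x)) A"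
    by (subst emeasure_density_const) (auto simp: power2_abs)
  also have "emeasure (distr lborel borel (\<lambda>x. c *\<^sub>R x)) A = emeasure lborel {x. c *\<^sub>R x \<in> A}"
    by (subst emeasure_distr) (auto simp: vimage_def)
  finally show ?thesis .
qed

text \<open>The factors may differ between coordinates: equal ones give dilations of balls and
  cones, signs give the reflections used for the second moments.\<close>

lemma cvec_lborel_scale:
  assumes c: "\<And>i. i < N \<Longrightarrow> c i \<noteq> 0" and A[measurable]: "A \<in> sets (cvec_lborel N)"
  shows "emeasure (cvec_lborel N) A
    = ennreal (\<Prod>i<N. (c i)\<^sup>2) * emeasure (cvec_lborel N) {x \<in> space (cvec_lborel N). (\<lambda>i\<in>{..<N}. c i *\<^sub>R x i) \<in> A}"
proof -
  interpret product_sigma_finite "\<lambda>_::nat. lborel :: complex measure" ..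
  let ?P = "cvec_lborel N"
  let ?T = "\<lambda>x. \<lambda>i\<in>{..<N}. c i *\<^sub>R x i :: complex"
  have T[measurable]: "?T \<in> ?P \<rightarrow>\<^sub>M ?P" by (rule measurable_restrict) measurable
  have eq: "scale_measure (ennreal (\<Prod>i<N. (c i)\<^sup>2)) (distr ?P ?P ?T) = ?P"
  proof (rule PiM_eqI)
    fix S :: "nat \<Rightarrow> complex set" assume S: "\<And>i. i \<in> {..<N} \<Longrightarrow> S i \<in> sets lborel"
    have [measurable]: "Pi\<^sub>E {..<N} S \<in> sets ?P" using S by (intro sets_PiM_I_finite) auto
    have "?T -` Pi\<^sub>E {..<N} S \<inter> space ?P = Pi\<^sub>E {..<N} (\<lambda>i. {x. c i *\<^sub>R x \<in> S i})"
      by (intro set_eqI) (simp add: space_PiM restrict_PiE_iff, blast intro: PiE_I PiE_E)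
    moreover have "{x. c i *\<^sub>R x \<in> S i} \<in> sets borel" if "i < N" for i
    proof -
      have "(\<lambda>x. c i *\<^sub>R x) -` S i \<inter> space borel \<in> sets borel"
        by (rule measurable_sets[of _ _ borel]) (use S[of i] that in auto)
      then show ?thesis by (simp add: vimage_def)
    qed
    ultimately have "emeasure (distr ?P ?P ?T) (Pi\<^sub>E {..<N} S) = (\<Prod>i<N. emeasure lborel {x. c i *\<^sub>R x \<in> S i})"
      by (subst emeasure_distr) (auto intro!: emeasure_PiM)
    moreover have "ennreal (\<Prod>i<N. (c i)\<^sup>2) = (\<Prod>i<N. ennreal ((c i)\<^sup>2))"
      by (subst prod_ennreal) auto
    ultimately show "emeasure (scale_measure (ennreal (\<Prod>i<N. (c i)\<^sup>2)) (distr ?P ?P ?T)) (Pi\<^sub>E {..<N} S) = (\<Prod>i<N. emeasure lborel (S i))"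
      by (simp add: prod.distrib[symmetric])
         (rule prod.cong, use S c in \<open>auto intro!: emeasure_lborel_complex_scale[symmetric]\<close>)
  qed simp_all
  have "emeasure ?P A = emeasure (scale_measure (ennreal (\<Prod>i<N. (c i)\<^sup>2)) (distr ?P ?P ?T)) A"
    by (subst eq) (rule refl)
  also have "\<dots> = ennreal (\<Prod>i<N. (c i)\<^sup>2) * emeasure ?P {x \<in> space ?P. ?T x \<in> A}"
    by (simp add: emeasure_distr vimage_def Int_def conj_commute)
  finally show ?thesis .
qed

lemma cvec_lborel_permute:
  assumes p: "p permutes {..<N}"
  shows "distr (cvec_lborel N) (cvec_lborel N) (\<lambda>x. \<lambda>i\<in>{..<N}. x (p i)) = cvec_lborel N"
proof -
  interpret product_sigma_finite "\<lambda>_::nat. lborel :: complex measure" ..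
  let ?P = "cvec_lborel N"
  let ?T = "\<lambda>x. \<lambda>i\<in>{..<N}. x (p i) :: complex"
  have pN: "p i < N \<longleftrightarrow> i < N" for i using permutes_in_image[OF p, of i] by simp
  have T[measurable]: "?T \<in> ?P \<rightarrow>\<^sub>M ?P"
    by (rule measurable_restrict) (simp add: pN)
  show ?thesis
  proof (rule PiM_eqI)
    fix S :: "nat \<Rightarrow> complex set" assume S: "\<And>i. i \<in> {..<N} \<Longrightarrow> S i \<in> sets lborel"
    have [measurable]: "Pi\<^sub>E {..<N} S \<in> sets ?P" using S by (intro sets_PiM_I_finite) auto
    have inv: "inv p i < N \<longleftrightarrow> i < N" for i using permutes_in_image[OF permutes_inv[OF p], of i] by simp
    have pi: "p (inv p i) = i" "inv p (p i) = i" for i using permutes_inverses[OF p] by auto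
    have "?T -` Pi\<^sub>E {..<N} S \<inter> space ?P = Pi\<^sub>E {..<N} (\<lambda>i. S (inv p i))"
    proof (intro set_eqI iffI)
      fix x assume x: "x \<in> ?T -` Pi\<^sub>E {..<N} S \<inter> space ?P"
      have "x i \<in> S (inv p i)" if "i < N" for i
      proof -
        have "?T x (inv p i) \<in> S (inv p i)" using x that inv by (auto simp: PiE_iff)
        then show ?thesis using that inv pi by auto
      qed
      then show "x \<in> Pi\<^sub>E {..<N} (\<lambda>i. S (inv p i))" using x by (auto simp: space_PiM PiE_iff)
    next
      fix x assume x: "x \<in> Pi\<^sub>E {..<N} (\<lambda>i. S (inv p i))"
      have "x (p i) \<in> S i" if "i < N" for i using x that pN[of i] pi(2)[of i] by (auto simp: PiE_iff dest!: bspec[of _ _ "p i"])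
      then show "x \<in> ?T -` Pi\<^sub>E {..<N} S \<inter> space ?P" using x by (auto simp: space_PiM PiE_iff)
    qed
    then have "emeasure (distr ?P ?P ?T) (Pi\<^sub>E {..<N} S) = (\<Prod>i<N. emeasure lborel (S (inv p i)))"
      using S inv by (subst emeasure_distr) (auto intro!: emeasure_PiM)
    also have "\<dots> = (\<Prod>i<N. emeasure lborel (S i))"
      using prod.permute[OF permutes_inv[OF p], of "\<lambda>i. emeasure lborel (S i)"] by (simp add: comp_def)
    finally show "emeasure (distr ?P ?P ?T) (Pi\<^sub>E {..<N} S) = (\<Prod>i\<in>{..<N}. emeasure lborel (S i))" .
  qed simp_all
qed

lemma cvec_unit_ball_finite: "emeasure (cvec_lborel N) (cvec_unit_ball N) < \<infinity>"
proof -
  interpret product_sigma_finite "\<lambda>_::nat. lborel :: complex measure" ..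
  have "cmod (x i) \<le> 1" if "x \<in> cvec_unit_ball N" "i < N" for x i
  proof -
    have "cmod (x i) \<le> cvec_norm N x" unfolding cvec_norm_L2 using that by (intro member_le_L2_set) auto
    then show ?thesis using that by (simp add: cvec_unit_ball_def)
  qed
  then have "emeasure (cvec_lborel N) (cvec_unit_ball N) \<le> emeasure (cvec_lborel N) (Pi\<^sub>E {..<N} (\<lambda>_. cball 0 1))"
    by (intro emeasure_mono sets_PiM_I_finite) (auto simp: PiE_iff cvec_unit_ball_def space_PiM dest: extensional_arb)
  also have "\<dots> = (\<Prod>i<N. emeasure lborel (cball (0::complex) 1))" by (rule emeasure_PiM) auto
  also have "\<dots> < \<infinity>" 
    using emeasure_bounded_finite[OF bounded_cball[of "0::complex" 1]] by (simp add: power_less_top_ennreal)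
  finally show ?thesis .
qed

lemma cvec_unit_ball_pos:
  assumes "N \<ge> 1" shows "emeasure (cvec_lborel N) (cvec_unit_ball N) > 0"
proof -
  interpret product_sigma_finite "\<lambda>_::nat. lborel :: complex measure" ..
  \<comment> \<open>A polydisc of this radius lies in the unit ball, as the Euclidean norm is at
    most the sum of the moduli.\<close>
  let ?B = "ball (0::complex) (1 / real N)"
  have "x \<in> cvec_unit_ball N" if "x \<in> Pi\<^sub>E {..<N} (\<lambda>_. ?B)" for x
  proof -
    have "cvec_norm N x \<le> (\<Sum>j<N. cmod (x j))" unfolding cvec_norm_L2 by (rule L2_set_le_sum) auto
    also have "\<dots> \<le> (\<Sum>j<N. 1 / real N)" using that by (intro sum_mono) (auto simp: PiE_iff less_imp_le)
    also have "\<dots> \<le> 1" by simp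
    finally show ?thesis using that by (auto simp: cvec_unit_ball_def space_PiM PiE_iff)
  qed
  then have "emeasure (cvec_lborel N) (Pi\<^sub>E {..<N} (\<lambda>_. ?B)) \<le> emeasure (cvec_lborel N) (cvec_unit_ball N)"
    by (intro emeasure_mono) auto
  moreover have "emeasure (cvec_lborel N) (Pi\<^sub>E {..<N} (\<lambda>_. ?B)) = (\<Prod>i<N. emeasure lborel ?B)"
    by (rule emeasure_PiM) auto
  moreover have "emeasure lborel ?B \<noteq> 0"
  proof
    assume "emeasure lborel ?B = 0"
    then have "negligible ?B" by (simp add: negligible_iff_null_sets null_sets_completionI null_setsI)
    then show False using open_not_negligible[of ?B] assms by simp
  qed
  then have "0 < (\<Prod>i<N. emeasure lborel ?B)"
    by (simp only: zero_less_iff_neq_zero prod_constant) (rule power_not_zero)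
  ultimately show ?thesis by (simp only:)
qed

section \<open>The uniform law as a ratio of volumes\<close>

lemma uniform_unit_sphere_eq:
  "uniform_unit_sphere N = distr (uniform_measure (cvec_lborel N) (cvec_unit_ball N)) (cvec_borel N) (cvec_dir N)"
  unfolding uniform_unit_sphere_def cvec_unit_ball_def cvec_dir_def[abs_def] ..

lemma sets_uniform_unit_sphere [simp, measurable_cong]: "sets (uniform_unit_sphere N) = sets (cvec_borel N)"
  by (simp add: uniform_unit_sphere_eq)

lemma space_uniform_unit_sphere [simp]: "space (uniform_unit_sphere N) = space (cvec_borel N)"
  by (simp add: uniform_unit_sphere_eq)

lemma emeasure_uniform_unit_sphere:
  assumes A: "A \<in> sets (cvec_borel N)"
  shows "emeasure (uniform_unit_sphere N) A
    = emeasure (cvec_lborel N) (cvec_sector N A) / emeasure (cvec_lborel N) (cvec_unit_ball N)"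
proof -
  have m: "cvec_dir N \<in> uniform_measure (cvec_lborel N) (cvec_unit_ball N) \<rightarrow>\<^sub>M cvec_borel N"
    using measurable_cvec_dir by (simp add: measurable_cong_sets[OF sets_uniform_measure refl])
  have "emeasure (uniform_unit_sphere N) A
      = emeasure (uniform_measure (cvec_lborel N) (cvec_unit_ball N)) (cvec_dir N -` A \<inter> space (cvec_lborel N))"
    unfolding uniform_unit_sphere_eq using emeasure_distr[OF m A] by simp
  also have "\<dots> = emeasure (cvec_lborel N) (cvec_unit_ball N \<inter> (cvec_dir N -` A \<inter> space (cvec_lborel N)))
      / emeasure (cvec_lborel N) (cvec_unit_ball N)"
    by (rule emeasure_uniform_measure) (auto intro: measurable_sets[OF measurable_cvec_dir A])
  also have "cvec_unit_ball N \<inter> (cvec_dir N -` A \<inter> space (cvec_lborel N)) = cvec_sector N A"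
    by (auto simp: cvec_sector_def cvec_unit_ball_def)
  finally show ?thesis .
qed

lemma prob_space_uniform_unit_sphere:
  assumes "N \<ge> 1" shows "prob_space (uniform_unit_sphere N)"
  unfolding uniform_unit_sphere_eq
proof (rule prob_space.prob_space_distr)
  show "prob_space (uniform_measure (cvec_lborel N) (cvec_unit_ball N))"
    using cvec_unit_ball_finite[of N] cvec_unit_ball_pos[OF assms]
    by (intro prob_space_uniform_measure) auto
  show "cvec_dir N \<in> uniform_measure (cvec_lborel N) (cvec_unit_ball N) \<rightarrow>\<^sub>M cvec_borel N"
    using measurable_cvec_dir by (simp add: measurable_cong_sets[OF sets_uniform_measure refl])
qed

lemma cvec_sector_finite: "A \<in> sets (cvec_borel N) \<Longrightarrow> emeasure (cvec_lborel N) (cvec_sector N A) < \<infinity>"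
  by (rule le_less_trans[OF emeasure_mono cvec_unit_ball_finite]) (auto simp: cvec_sector_def)

lemma measure_uniform_unit_sphere:
  assumes "N \<ge> 1" "A \<in> sets (cvec_borel N)"
  shows "measure (uniform_unit_sphere N) A * measure (cvec_lborel N) (cvec_unit_ball N)
    = measure (cvec_lborel N) (cvec_sector N A)"
proof -
  have V: "emeasure (cvec_lborel N) (cvec_unit_ball N) = ennreal (measure (cvec_lborel N) (cvec_unit_ball N))"
    using cvec_unit_ball_finite[of N] by (intro emeasure_eq_ennreal_measure) auto
  moreover have "emeasure (cvec_lborel N) (cvec_sector N A) = ennreal (measure (cvec_lborel N) (cvec_sector N A))"
    using cvec_sector_finite[OF assms(2)] by (intro emeasure_eq_ennreal_measure) auto
  moreover have pos: "measure (cvec_lborel N) (cvec_unit_ball N) > 0"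
    using V cvec_unit_ball_pos[OF assms(1)] by (metis ennreal_0 less_irrefl measure_nonneg order_le_less)
  ultimately have "measure (uniform_unit_sphere N) A
      = measure (cvec_lborel N) (cvec_sector N A) / measure (cvec_lborel N) (cvec_unit_ball N)"
    unfolding measure_def[of "uniform_unit_sphere N"] emeasure_uniform_unit_sphere[OF assms(2)]
    by (simp add: divide_ennreal)
  then show ?thesis using pos by simp
qed

text \<open>Only the origin has a direction that is not a unit vector, and for \<open>N\<close> at
  least 1 a single point has volume zero.\<close>

lemma AE_uniform_unit_sphere_norm:
  assumes "N \<ge> 1" shows "AE a in uniform_unit_sphere N. cvec_norm N a = 1"
proof (rule AE_I)
  let ?A = "{a \<in> space (cvec_borel N). cvec_norm N a \<noteq> 1}"
  show "{a \<in> space (uniform_unit_sphere N). cvec_norm N a \<noteq> 1} \<subseteq> ?A" by simp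
  show "?A \<in> sets (uniform_unit_sphere N)" by simp
  interpret product_sigma_finite "\<lambda>_::nat. lborel :: complex measure" ..
  have "cvec_sector N ?A \<subseteq> Pi\<^sub>E {..<N} (\<lambda>_. {0})"
  proof
    fix x assume x: "x \<in> cvec_sector N ?A"
    then have "cvec_norm N x = 0" using cvec_dir_norm[of N x] by (auto simp: cvec_sector_def)
    then show "x \<in> Pi\<^sub>E {..<N} (\<lambda>_. {0})" using x
      by (intro PiE_I) (auto simp: cvec_norm_eq_0_iff cvec_sector_def cvec_unit_ball_def space_PiM PiE_iff extensional_def)
  qed
  then have "emeasure (cvec_lborel N) (cvec_sector N ?A) \<le> emeasure (cvec_lborel N) (Pi\<^sub>E {..<N} (\<lambda>_. {0}))"
    by (intro emeasure_mono sets_PiM_I_finite) auto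
  also have "\<dots> = (\<Prod>i<N. emeasure lborel {0::complex})" by (rule emeasure_PiM) auto
  also have "\<dots> = 0" using assms by (simp add: power_0_left)
  finally show "emeasure (uniform_unit_sphere N) ?A = 0"
    by (subst emeasure_uniform_unit_sphere) auto
qed

section \<open>Separated sets and concentration\<close>

lemma cvec_dir_scale:
  assumes "c > 0" shows "cvec_dir N (\<lambda>i\<in>{..<N}. c *\<^sub>R x i) = cvec_dir N x"
proof -
  have "cvec_norm N (\<lambda>i\<in>{..<N}. c *\<^sub>R x i) = c * cvec_norm N x"
    using assms by (simp add: cvec_norm_scaleR)
  then show ?thesis using assms by (auto simp: cvec_dir_def fun_eq_iff restrict_def scaleR_conv_of_real)
qed

text \<open>A sector is a truncated cone, so halving maps it onto its inner part; the real dimension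
  is 2N.\<close>

lemma cvec_inner_sector:
  assumes "A \<in> sets (cvec_borel N)"
  shows "emeasure (cvec_lborel N) {x \<in> cvec_sector N A. cvec_norm N x \<le> 1/2}
    = ennreal ((1/4) ^ N) * emeasure (cvec_lborel N) (cvec_sector N A)"
proof -
  let ?S = "{x \<in> cvec_sector N A. cvec_norm N x \<le> 1/2}"
  have S: "?S \<in> sets (cvec_lborel N)"
  proof -
    have "?S = cvec_sector N A \<inter> {x \<in> space (cvec_lborel N). cvec_norm N x \<le> 1/2}"
      by (auto simp: cvec_sector_def cvec_unit_ball_def)
    then show ?thesis using assms by auto
  qed
  have "emeasure (cvec_lborel N) ?S = ennreal (\<Prod>i<N. (1/2)\<^sup>2) *
      emeasure (cvec_lborel N) {x \<in> space (cvec_lborel N). (\<lambda>i\<in>{..<N}. (1/2) *\<^sub>R x i) \<in> ?S}"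
    by (rule cvec_lborel_scale) (use S in auto)
  also have "(\<Prod>i<N. (1/2)\<^sup>2) = ((1/4) ^ N :: real)" by (simp add: power2_eq_square)
  also have "{x \<in> space (cvec_lborel N). (\<lambda>i\<in>{..<N}. (1/2) *\<^sub>R x i) \<in> ?S} = cvec_sector N A"
  proof -
    have "(\<lambda>i\<in>{..<N}. (1/2) *\<^sub>R x i) \<in> ?S \<longleftrightarrow> x \<in> cvec_sector N A" if "x \<in> space (cvec_lborel N)" for x
    proof -
      let ?y = "\<lambda>i\<in>{..<N}. (1/2) *\<^sub>R x i"
      have n: "cvec_norm N ?y = cvec_norm N x / 2" using cvec_norm_scaleR[of N "1/2" x] by simp
      have d: "cvec_dir N ?y = cvec_dir N x" by (rule cvec_dir_scale) simp
      have "?y \<in> space (cvec_lborel N)" by (simp add: space_PiM)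
      then show ?thesis unfolding mem_Collect_eq cvec_sector_def cvec_unit_ball_def n d using that by auto
    qed
    moreover have "cvec_sector N A \<subseteq> space (cvec_lborel N)" by (auto simp: cvec_sector_def cvec_unit_ball_def)
    ultimately show ?thesis by blast
  qed
  finally show ?thesis .
qed

lemma cvec_ball_scale:
  assumes "l > 0"
  shows "emeasure (cvec_lborel N) {x \<in> space (cvec_lborel N). cvec_norm N x \<le> l}
    = ennreal (l ^ (2 * N)) * emeasure (cvec_lborel N) (cvec_unit_ball N)"
proof -
  let ?S = "{x \<in> space (cvec_lborel N). cvec_norm N x \<le> l}"
  have "emeasure (cvec_lborel N) ?S = ennreal (\<Prod>i<N. l\<^sup>2) *
      emeasure (cvec_lborel N) {x \<in> space (cvec_lborel N). (\<lambda>i\<in>{..<N}. l *\<^sub>R x i) \<in> ?S}"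
    by (rule cvec_lborel_scale) (use assms in auto)
  also have "(\<Prod>i<N. l\<^sup>2) = l ^ (2 * N)" by (simp add: power_mult)
  also have "{x \<in> space (cvec_lborel N). (\<lambda>i\<in>{..<N}. l *\<^sub>R x i) \<in> ?S} = cvec_unit_ball N"
    using assms by (auto simp: cvec_unit_ball_def cvec_norm_scaleR space_PiM)
  finally show ?thesis .
qed

text \<open>The outer shells of the sectors over \<open>A\<close> and \<open>B\<close> are still at
  distance \<rho>/4, so by uniform convexity their midpoints lie in the ball of radius
  \<open>l\<close>. Prekopa-Leindler for the three indicator functions bounds the product of the
  volumes of the shells by the square of the volume of that ball, which is exponentially small in N
  \<rho>^2.\<close>

lemma sphere_separation:
  assumes N: "N \<ge> 1" and A: "A \<in> sets (cvec_borel N)" and B: "B \<in> sets (cvec_borel N)" and "\<rho> \<ge> 0"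
    and sep: "\<And>a b. a \<in> A \<Longrightarrow> b \<in> B \<Longrightarrow> cvec_norm N a = 1 \<Longrightarrow> cvec_norm N b = 1 \<Longrightarrow>
                \<rho> \<le> cvec_norm N (\<lambda>j. a j - b j)"
  shows "measure (uniform_unit_sphere N) A * measure (uniform_unit_sphere N) B \<le> 2 * exp (- (real N * \<rho>\<^sup>2 / 32))"
proof -
  let ?P = "cvec_lborel N"
  define V where "V = measure ?P (cvec_unit_ball N)"
  have Ve: "emeasure ?P (cvec_unit_ball N) = ennreal V"
    using cvec_unit_ball_finite[of N] unfolding V_def by (intro emeasure_eq_ennreal_measure) auto
  have V0: "V > 0"
    using Ve cvec_unit_ball_pos[OF N] by (metis V_def ennreal_0 less_irrefl measure_nonneg order_le_less)
  \<comment> \<open>The inner half of each sector is discarded because the direction map is not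
    Lipschitz near the origin. This costs at most a quarter of the volume.\<close>
  define ann where "ann D = {x \<in> cvec_sector N D. cvec_norm N x > 1/2}" for D
  have ann_sets: "ann D \<in> sets ?P" if "D \<in> sets (cvec_borel N)" for D
  proof -
    have "ann D = cvec_sector N D \<inter> {x \<in> space ?P. cvec_norm N x > 1/2}"
      by (auto simp: ann_def cvec_sector_def cvec_unit_ball_def)
    then show ?thesis using that by auto
  qed
  have ann: "emeasure ?P (ann D) \<ge> ennreal (3/4 * (measure (uniform_unit_sphere N) D * V))"
    if D: "D \<in> sets (cvec_borel N)" for D
  proof -
    let ?I = "{x \<in> cvec_sector N D. cvec_norm N x \<le> 1/2}"
    define s where "s = measure ?P (cvec_sector N D)"
    have s: "emeasure ?P (cvec_sector N D) = ennreal s"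
      using cvec_sector_finite[OF D] unfolding s_def by (intro emeasure_eq_ennreal_measure) auto
    have s0: "s \<ge> 0" by (simp add: s_def)
    have I: "?I = cvec_sector N D - ann D" by (auto simp: ann_def)
    have "emeasure ?P (cvec_sector N D) = emeasure ?P (ann D) + emeasure ?P ?I"
      unfolding I using ann_sets[OF D] cvec_sector_sets[OF D]
      by (subst plus_emeasure) (auto intro!: arg_cong[where f = "emeasure ?P"] simp: ann_def)
    then have e: "ennreal s = emeasure ?P (ann D) + ennreal ((1/4)^N * s)"
      using cvec_inner_sector[OF D] s s0 by (simp add: ennreal_mult)
    have "(1/4::real)^N \<le> (1/4)^1" using N by (intro power_decreasing) auto
    then have "(1/4)^N * s \<le> 1/4 * s" using s0 by (intro mult_right_mono) auto
    moreover have "emeasure ?P (ann D) \<noteq> \<top>" using e by auto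
    then obtain t where t: "emeasure ?P (ann D) = ennreal t" "t \<ge> 0" by (metis ennreal_cases)
    then have "ennreal s = ennreal (t + (1/4)^N * s)" using e s0 by (simp add: ennreal_plus)
    then have "s = t + (1/4)^N * s" using s0 t by (subst (asm) ennreal_inj) auto
    ultimately have "3/4 * s \<le> t" by linarith
    then have "ennreal (3/4 * s) \<le> emeasure ?P (ann D)" unfolding t(1) by (rule ennreal_leI)
    moreover have "measure (uniform_unit_sphere N) D * V = s"
      using measure_uniform_unit_sphere[OF N D] by (simp add: V_def s_def)
    ultimately show ?thesis by simp
  qed
  \<comment> \<open>From 1 - (\<rho>/4)^2/4 <= exp (- \<rho>^2/64) = l^2. The ball of radius
    \<open>l\<close> has relative volume l^(2N), and its square gives the exponent N
    \<rho>^2/32.\<close>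
  define l where "l = exp (- \<rho>\<^sup>2 / 128)"
  have l: "l > 0" by (simp add: l_def)
  let ?H = "{x \<in> space ?P. cvec_norm N x \<le> l}"
  have "(\<integral>\<^sup>+x. indicator (ann A) x \<partial>?P) * (\<integral>\<^sup>+x. indicator (ann B) x \<partial>?P) \<le> (\<integral>\<^sup>+x. indicator ?H x \<partial>?P)\<^sup>2"
  proof (rule prekopa_leindlerD[OF prekopa_leindler_PiM])
    fix x y assume "x \<in> space ?P" "y \<in> space ?P"
    show "indicator (ann A) x * indicator (ann B) y \<le> (indicator ?H (\<lambda>i\<in>{..<N}. (x i + y i) / 2) :: ennreal)\<^sup>2"
    proof (cases "x \<in> ann A \<and> y \<in> ann B")
      case False then show ?thesis by auto
    next
      case True
      then have x: "cvec_norm N x > 1/2" "cvec_norm N x \<le> 1" "cvec_dir N x \<in> A"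
        and y: "cvec_norm N y > 1/2" "cvec_norm N y \<le> 1" "cvec_dir N y \<in> B"
        by (auto simp: ann_def cvec_sector_def cvec_unit_ball_def)
      define d where "d = cvec_norm N (\<lambda>j. x j - y j)"
      have "\<rho> \<le> cvec_norm N (\<lambda>j. cvec_dir N x j - cvec_dir N y j)"
        using x y by (intro sep cvec_dir_norm) auto
      also have "\<dots> \<le> 4 * d" unfolding d_def using x y by (intro cvec_dir_dist) auto
      finally have "\<rho>\<^sup>2 \<le> (4 * d)\<^sup>2" using \<open>\<rho> \<ge> 0\<close> by (intro power_mono) auto
      then have d: "\<rho>\<^sup>2 / 64 \<le> d\<^sup>2 / 4" by (simp add: power2_eq_square)
      have "(cvec_norm N x)\<^sup>2 \<le> 1\<^sup>2" "(cvec_norm N y)\<^sup>2 \<le> 1\<^sup>2" using x y by (intro power_mono; simp)+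
      then have "(cvec_norm N (\<lambda>j. (x j + y j) / 2))\<^sup>2 \<le> 1 - d\<^sup>2 / 4"
        unfolding cvec_norm_parallelogram d_def by simp
      also have "\<dots> \<le> 1 - \<rho>\<^sup>2 / 64" using d by simp
      also have "\<dots> \<le> exp (- \<rho>\<^sup>2 / 64)" using exp_ge_add_one_self[of "- \<rho>\<^sup>2 / 64"] by simp
      also have "\<dots> = l\<^sup>2" by (simp add: l_def power2_eq_square flip: exp_add)
      finally have "cvec_norm N (\<lambda>j. (x j + y j) / 2) \<le> l" by (rule power2_le_imp_le) (use l in simp)
      then have "(\<lambda>i\<in>{..<N}. (x i + y i) / 2) \<in> ?H" by (simp add: space_PiM)
      then show ?thesis using True by simp
    qed
  qed (use ann_sets[OF A] ann_sets[OF B] in auto)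
  then have PL: "emeasure ?P (ann A) * emeasure ?P (ann B) \<le> (emeasure ?P ?H)\<^sup>2"
    using ann_sets[OF A] ann_sets[OF B] by simp
  define sA sB where "sA = measure (uniform_unit_sphere N) A" and "sB = measure (uniform_unit_sphere N) B"
  have s0: "sA \<ge> 0" "sB \<ge> 0" by (auto simp: sA_def sB_def)
  have "ennreal (3/4 * (sA * V)) * ennreal (3/4 * (sB * V)) \<le> (ennreal (l ^ (2*N)) * ennreal V)\<^sup>2"
    unfolding Ve[symmetric] cvec_ball_scale[OF l, symmetric]
    by (rule order_trans[OF mult_mono[OF ann[OF A, folded sA_def] ann[OF B, folded sB_def]] PL]) auto
  then have "ennreal ((3/4 * (sA * V)) * (3/4 * (sB * V))) \<le> ennreal ((l ^ (2*N) * V)\<^sup>2)"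
    using s0 V0 l by (simp add: ennreal_mult[symmetric] ennreal_power)
  then have "(3/4 * (sA * V)) * (3/4 * (sB * V)) \<le> (l ^ (2*N) * V)\<^sup>2"
    by (subst (asm) ennreal_le_iff) auto
  then have "(9/16 * (sA * sB)) * V\<^sup>2 \<le> (l ^ (2*N))\<^sup>2 * V\<^sup>2"
    by (simp add: power2_eq_square algebra_simps)
  then have "9/16 * (sA * sB) \<le> (l ^ (2*N))\<^sup>2" using V0 by simp
  also have "(l ^ (2*N))\<^sup>2 = exp (- (real N * \<rho>\<^sup>2 / 32))"
    by (simp add: l_def flip: exp_of_nat_mult power_mult)
  finally have "sA * sB \<le> 16/9 * exp (- (real N * \<rho>\<^sup>2 / 32))" by simp
  also have "\<dots> \<le> 2 * exp (- (real N * \<rho>\<^sup>2 / 32))" by (intro mult_right_mono) auto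
  finally show ?thesis by (simp add: sA_def sB_def)
qed

text \<open>Only half of the mass must lie below \<open>m\<close>. The statement therefore serves
  \<open>X\<close> and \<open>- X\<close> at a median, and later a level that comes from Markov's
  inequality. The two level sets are separated by r/L because \<open>X\<close> is Lipschitz.\<close>

lemma sphere_upper_tail:
  assumes N: "N \<ge> 1" and X[measurable]: "X \<in> borel_measurable (cvec_borel N)" and L: "L > 0" and r: "r \<ge> 0"
    and lip: "\<And>a b. a \<in> space (cvec_borel N) \<Longrightarrow> b \<in> space (cvec_borel N) \<Longrightarrow>
                X b - X a \<le> L * cvec_norm N (\<lambda>j. a j - b j)"
    and med: "measure (uniform_unit_sphere N) {a \<in> space (cvec_borel N). X a \<le> m} \<ge> 1/2"
  shows "measure (uniform_unit_sphere N) {a \<in> space (cvec_borel N). X a > m + r}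
           \<le> 4 * exp (- (real N * (r / L)\<^sup>2 / 32))"
proof -
  let ?A = "{a \<in> space (cvec_borel N). X a \<le> m}" and ?B = "{a \<in> space (cvec_borel N). X a > m + r}"
  let ?\<sigma> = "measure (uniform_unit_sphere N)"
  have "?\<sigma> ?A * ?\<sigma> ?B \<le> 2 * exp (- (real N * (r / L)\<^sup>2 / 32))"
  proof (rule sphere_separation[OF N])
    fix a b assume ab: "a \<in> ?A" "b \<in> ?B"
    then have "r \<le> X b - X a" by auto
    also have "\<dots> \<le> L * cvec_norm N (\<lambda>j. a j - b j)" using ab by (intro lip) auto
    finally show "r / L \<le> cvec_norm N (\<lambda>j. a j - b j)" using L by (simp add: field_simps)
  qed (use L r in auto)
  moreover have "1/2 * ?\<sigma> ?B \<le> ?\<sigma> ?A * ?\<sigma> ?B" using med by (intro mult_right_mono) auto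
  ultimately show ?thesis by simp
qed

lemma sphere_concentration:
  assumes N: "N \<ge> 1" and X[measurable]: "X \<in> borel_measurable (cvec_borel N)" and L: "L > 0" and r: "r > 0"
    and lip: "\<And>a b. a \<in> space (cvec_borel N) \<Longrightarrow> b \<in> space (cvec_borel N) \<Longrightarrow>
                X b - X a \<le> L * cvec_norm N (\<lambda>j. a j - b j)"
    and med: "is_median (uniform_unit_sphere N) X m"
  shows "measure (uniform_unit_sphere N) {a \<in> space (cvec_borel N). \<bar>X a - m\<bar> > r}
           \<le> 2 * exp (- (real N * (r / L)\<^sup>2 / 96))"
proof -
  let ?\<sigma> = "measure (uniform_unit_sphere N)" and ?S = "space (cvec_borel N)"
  interpret prob_space "uniform_unit_sphere N" by (rule prob_space_uniform_unit_sphere[OF N])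
  define t where "t = real N * (r / L)\<^sup>2 / 32"
  have 1: "?\<sigma> {a \<in> ?S. X a > m + r} \<le> 4 * exp (- t)" unfolding t_def
    by (rule sphere_upper_tail) (use assms in \<open>auto simp: is_median_def\<close>)
  have 2: "?\<sigma> {a \<in> ?S. - X a > - m + r} \<le> 4 * exp (- t)" unfolding t_def
  proof (rule sphere_upper_tail)
    show "- X b - - X a \<le> L * cvec_norm N (\<lambda>j. a j - b j)" if "a \<in> ?S" "b \<in> ?S" for a b
      using lip[OF that(2,1)] cvec_norm_minus_commute[of N a b] by simp
  qed (use assms in \<open>auto simp: is_median_def\<close>)
  have "?\<sigma> {a \<in> ?S. \<bar>X a - m\<bar> > r} \<le> ?\<sigma> ({a \<in> ?S. X a > m + r} \<union> {a \<in> ?S. - X a > - m + r})"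
    by (rule finite_measure_mono) auto
  also have "\<dots> \<le> ?\<sigma> {a \<in> ?S. X a > m + r} + ?\<sigma> {a \<in> ?S. - X a > - m + r}"
    by (rule measure_Un_le) auto
  finally have 3: "?\<sigma> {a \<in> ?S. \<bar>X a - m\<bar> > r} \<le> 8 * exp (- t)" using 1 2 by simp
  \<comment> \<open>The two tails add up to 8 exp (-t). A probability satisfies p^3 <= p, and the
    cube root of 8 is 2, so the prefactor 2 costs a factor 3 in the exponent.\<close>
  have "p \<le> 2 * exp (- (t / 3))" if p: "0 \<le> p" "p \<le> 1" "p \<le> 8 * exp (- t)" for p :: real
  proof (rule power_le_imp_le_base[of _ 2])
    have "p ^ Suc 2 = p * p\<^sup>2" by (simp add: power2_eq_square power3_eq_cube numeral_2_eq_2)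
    also have "\<dots> \<le> p * 1" using p by (intro mult_left_mono power_le_one) auto
    also have "\<dots> \<le> 8 * exp (- t)" using p by simp
    also have "\<dots> = (2 * exp (- (t / 3))) ^ Suc 2" by (simp add: power_mult_distrib flip: exp_of_nat_mult exp_add)
    finally show "p ^ Suc 2 \<le> (2 * exp (- (t / 3))) ^ Suc 2" .
  qed simp
  from this[OF measure_nonneg prob_le_1 3] show ?thesis by (simp add: t_def)
qed

section \<open>Moments on the sphere\<close>

lemma power_div_fact_le_exp:
  fixes x :: real assumes "x \<ge> 0" shows "x ^ m / fact m \<le> exp x"
proof -
  have s: "(\<lambda>n. x ^ n / fact n) sums exp x"
    using exp_converges[of x] by (simp add: scaleR_conv_of_real divide_inverse mult.commute)
  have "(\<Sum>n\<in>{m}. x ^ n / fact n) \<le> (\<Sum>n. x ^ n / fact n)"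
    using assms s by (intro sum_le_suminf) (auto simp: sums_iff)
  then show ?thesis using s by (simp add: sums_iff)
qed

text \<open>With half of the tail exponent, the variable exp (b Z^2 / 2) exceeds t with probability
  at most A / t^2, which is integrable over t >= 1. Levels below 1 contribute at most 1.\<close>

lemma (in prob_space) subgaussian_exp_moment:
  assumes [measurable]: "Z \<in> borel_measurable M" and b: "b > 0" and A: "A \<ge> 0"
    and tail: "\<And>r. r > 0 \<Longrightarrow> prob {x \<in> space M. \<bar>Z x\<bar> > r} \<le> A * exp (- (b * r\<^sup>2))"
  shows "(\<integral>\<^sup>+x. ennreal (exp (b * (Z x)\<^sup>2 / 2)) \<partial>M) \<le> ennreal (1 + A)"
proof -
  let ?W = "\<lambda>x. exp (b * (Z x)\<^sup>2 / 2)"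
  have "(\<integral>\<^sup>+x. ennreal (?W x) \<partial>M)
      = (\<integral>\<^sup>+t. emeasure M {x\<in>space M. ennreal t < ennreal (?W x)} * indicator {0..} t \<partial>lborel)"
    by (rule nn_integral_layer_cake) (auto intro: sigma_finite_measure_axioms)
  also have "\<dots> \<le> (\<integral>\<^sup>+t. indicator {0..1} t + ennreal (A / t\<^sup>2) * indicator {1..} t \<partial>lborel)"
  proof (rule nn_integral_mono)
    fix t :: real
    consider "t < 0" | "0 \<le> t" "t \<le> 1" | "t > 1" by linarith
    then show "emeasure M {x\<in>space M. ennreal t < ennreal (?W x)} * indicator {0..} t
       \<le> indicator {0..1} t + ennreal (A / t\<^sup>2) * indicator {1..} t"
    proof cases
      case 2
      then show ?thesis using emeasure_le_1 by (auto intro: add_increasing2)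
    next
      case 3
      define r where "r = sqrt (2 * ln t / b)"
      have r: "r > 0" "r\<^sup>2 = 2 * ln t / b" using 3 b by (auto simp: r_def)
      have "{x\<in>space M. ennreal t < ennreal (?W x)} \<subseteq> {x \<in> space M. \<bar>Z x\<bar> > r}"
      proof safe
        fix x assume "ennreal t < ennreal (?W x)"
        then have "t < ?W x" using 3 by (simp add: ennreal_less_iff)
        then have "ln t < b * (Z x)\<^sup>2 / 2" using 3 by (metis exp_less_cancel_iff exp_ln less_trans zero_less_one)
        moreover have "b * r\<^sup>2 = 2 * ln t" using b r by simp
        ultimately have "b * r\<^sup>2 < b * \<bar>Z x\<bar>\<^sup>2" by simp
        then have "r\<^sup>2 < \<bar>Z x\<bar>\<^sup>2" using b by (simp only: mult_less_cancel_left_pos)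
        then show "r < \<bar>Z x\<bar>" by (rule power_less_imp_less_base) simp
      qed
      then have "prob {x\<in>space M. ennreal t < ennreal (?W x)} \<le> prob {x \<in> space M. \<bar>Z x\<bar> > r}"
        by (intro finite_measure_mono) auto
      also have "\<dots> \<le> A * exp (- (b * r\<^sup>2))" by (rule tail[OF r(1)])
      also have "b * r\<^sup>2 = 2 * ln t" using b r by simp
      also have "exp (- (2 * ln t)) = 1 / t\<^sup>2"
        using 3 by (simp add: exp_minus exp_double inverse_eq_divide)
      finally have "emeasure M {x\<in>space M. ennreal t < ennreal (?W x)} \<le> ennreal (A / t\<^sup>2)"
        by (simp add: emeasure_eq_measure ennreal_leI)
      then show ?thesis using 3 by simp
    qed simp
  qed
  also have "\<dots> = (\<integral>\<^sup>+t. indicator {0..1::real} t \<partial>lborel) + (\<integral>\<^sup>+t. ennreal (A / t\<^sup>2) * indicator {1..} t \<partial>lborel)"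
    by (rule nn_integral_add) auto
  also have "(\<integral>\<^sup>+t. ennreal (A / t\<^sup>2) * indicator {1..} t \<partial>lborel) = ennreal (0 - (- A / 1))"
  proof (rule nn_integral_FTC_atLeast)
    show "((\<lambda>t. - A / t) has_real_derivative A / t\<^sup>2) (at t)" if "1 \<le> t" for t
      using that by (auto intro!: derivative_eq_intros simp: power2_eq_square)
    show "((\<lambda>t. - A / t) \<longlongrightarrow> 0) at_top"
      by (rule tendsto_divide_0[OF tendsto_const]) (simp add: filterlim_at_top_imp_at_infinity filterlim_ident)
  qed (use A in auto)
  also have "(\<integral>\<^sup>+t. indicator {0..1::real} t \<partial>lborel) = 1" by simp
  finally show ?thesis using A by simp
qed

lemma (in prob_space) subgaussian_abs_moment:
  assumes [measurable]: "Z \<in> borel_measurable M" and b: "b > 0" and A: "A \<ge> 0"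
    and tail: "\<And>r. r > 0 \<Longrightarrow> prob {x \<in> space M. \<bar>Z x\<bar> > r} \<le> A * exp (- (b * r\<^sup>2))"
  shows "(\<integral>\<^sup>+x. ennreal \<bar>Z x\<bar> \<partial>M) \<le> ennreal (sqrt (2 / b) * (1 + A))"
proof -
  have "\<bar>z\<bar> \<le> sqrt (2 / b) * exp (b * z\<^sup>2 / 2)" for z
  proof -
    define u where "u = \<bar>z\<bar> * sqrt (b / 2)"
    have u: "u\<^sup>2 = b * z\<^sup>2 / 2" using b by (simp add: u_def power_mult_distrib)
    have "u \<le> 1 + u\<^sup>2" using zero_le_power2[of "u - 1/2"] by (simp add: power2_eq_square algebra_simps)
    also have "\<dots> \<le> exp (u\<^sup>2)" by (rule exp_ge_add_one_self)
    finally have "sqrt (2 / b) * u \<le> sqrt (2 / b) * exp (b * z\<^sup>2 / 2)" unfolding u using b by (intro mult_left_mono) auto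
    moreover have "sqrt (2 / b) * u = \<bar>z\<bar>"
      using b by (simp add: u_def mult.left_commute flip: real_sqrt_mult)
    ultimately show ?thesis by simp
  qed
  then have "(\<integral>\<^sup>+x. ennreal \<bar>Z x\<bar> \<partial>M) \<le> (\<integral>\<^sup>+x. ennreal (sqrt (2 / b)) * ennreal (exp (b * (Z x)\<^sup>2 / 2)) \<partial>M)"
    using b by (intro nn_integral_mono) (simp add: ennreal_mult[symmetric] ennreal_leI)
  also have "\<dots> = ennreal (sqrt (2 / b)) * (\<integral>\<^sup>+x. ennreal (exp (b * (Z x)\<^sup>2 / 2)) \<partial>M)"
    by (rule nn_integral_cmult) auto
  also have "\<dots> \<le> ennreal (sqrt (2 / b)) * ennreal (1 + A)"
    by (intro mult_left_mono subgaussian_exp_moment[OF assms]) auto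
  finally show ?thesis using b A by (simp add: ennreal_mult)
qed

text \<open>A single term of the exponential series. The growth like m! is what produces the factor
  sqrt (ln k) in the end.\<close>

lemma (in prob_space) subgaussian_even_moment:
  assumes [measurable]: "Z \<in> borel_measurable M" and b: "b > 0" and A: "A \<ge> 0"
    and tail: "\<And>r. r > 0 \<Longrightarrow> prob {x \<in> space M. \<bar>Z x\<bar> > r} \<le> A * exp (- (b * r\<^sup>2))"
  shows "(\<integral>\<^sup>+x. ennreal ((Z x) ^ (2 * m)) \<partial>M) \<le> ennreal (fact m * (2 / b) ^ m * (1 + A))"
proof -
  have "z ^ (2 * m) \<le> (fact m * (2 / b) ^ m) * exp (b * z\<^sup>2 / 2)" for z
  proof -
    have "(b * z\<^sup>2 / 2) ^ m / fact m \<le> exp (b * z\<^sup>2 / 2)" using b by (intro power_div_fact_le_exp) auto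
    then have "(fact m * (2 / b) ^ m) * ((b * z\<^sup>2 / 2) ^ m / fact m) \<le> (fact m * (2 / b) ^ m) * exp (b * z\<^sup>2 / 2)"
      using b by (intro mult_left_mono) auto
    moreover have "(fact m * p ^ m) * (q ^ m / fact m) = (p * q) ^ m" for p q :: real
      by (simp add: power_mult_distrib)
    moreover have "(2 / b) * (b * z\<^sup>2 / 2) = z\<^sup>2" using b by simp
    ultimately show ?thesis by (simp only: power_mult)
  qed
  then have "(\<integral>\<^sup>+x. ennreal ((Z x) ^ (2 * m)) \<partial>M) \<le> (\<integral>\<^sup>+x. ennreal (fact m * (2 / b) ^ m) * ennreal (exp (b * (Z x)\<^sup>2 / 2)) \<partial>M)"
    using b by (intro nn_integral_mono) (simp add: ennreal_mult[symmetric] ennreal_leI)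
  also have "\<dots> = ennreal (fact m * (2 / b) ^ m) * (\<integral>\<^sup>+x. ennreal (exp (b * (Z x)\<^sup>2 / 2)) \<partial>M)"
    by (rule nn_integral_cmult) auto
  also have "\<dots> \<le> ennreal (fact m * (2 / b) ^ m) * ennreal (1 + A)"
    by (intro mult_left_mono subgaussian_exp_moment[OF assms]) auto
  finally show ?thesis using b A by (simp add: ennreal_mult)
qed

section \<open>Symmetries of the sphere and second moments\<close>

text \<open>Such a map carries sectors to sectors, so its invariance on the sphere is inherited from
  Lebesgue measure. Sign changes and permutations are the only symmetries required.\<close>

lemma uniform_unit_sphere_invariant:
  assumes T: "T \<in> cvec_lborel N \<rightarrow>\<^sub>M cvec_lborel N" and inv: "distr (cvec_lborel N) (cvec_lborel N) T = cvec_lborel N"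
    and norm: "\<And>x. x \<in> space (cvec_lborel N) \<Longrightarrow> cvec_norm N (T x) = cvec_norm N x"
    and dir: "\<And>x. x \<in> space (cvec_lborel N) \<Longrightarrow> cvec_dir N (T x) = T (cvec_dir N x)"
  shows "distr (uniform_unit_sphere N) (cvec_borel N) T = uniform_unit_sphere N"
proof (rule measure_eqI)
  have Tb: "T \<in> cvec_borel N \<rightarrow>\<^sub>M cvec_borel N"
    using T by (simp add: measurable_cong_sets[OF sets_cvec sets_cvec])
  then have Tu: "T \<in> uniform_unit_sphere N \<rightarrow>\<^sub>M cvec_borel N"
    by (simp add: measurable_cong_sets[OF sets_uniform_unit_sphere refl])
  fix A assume "A \<in> sets (distr (uniform_unit_sphere N) (cvec_borel N) T)"
  then have A: "A \<in> sets (cvec_borel N)" by simp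
  let ?A' = "T -` A \<inter> space (cvec_borel N)"
  have A': "?A' \<in> sets (cvec_borel N)" by (rule measurable_sets[OF Tb A])
  have "cvec_sector N ?A' = T -` cvec_sector N A \<inter> space (cvec_lborel N)"
  proof (intro set_eqI iffI)
    fix x assume "x \<in> cvec_sector N ?A'"
    then show "x \<in> T -` cvec_sector N A \<inter> space (cvec_lborel N)"
      using measurable_space[OF T, of x] by (auto simp: cvec_sector_def cvec_unit_ball_def norm dir)
  next
    fix x assume "x \<in> T -` cvec_sector N A \<inter> space (cvec_lborel N)"
    then show "x \<in> cvec_sector N ?A'"
      using measurable_space[OF measurable_cvec_dir, of x N] by (auto simp: cvec_sector_def cvec_unit_ball_def norm dir)
  qed
  then have "emeasure (cvec_lborel N) (cvec_sector N ?A') = emeasure (distr (cvec_lborel N) (cvec_lborel N) T) (cvec_sector N A)"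
    using cvec_sector_sets[OF A] by (subst emeasure_distr[OF T]) auto
  then have "emeasure (uniform_unit_sphere N) ?A' = emeasure (uniform_unit_sphere N) A"
    unfolding inv by (simp add: emeasure_uniform_unit_sphere[OF A] emeasure_uniform_unit_sphere[OF A'])
  then show "emeasure (distr (uniform_unit_sphere N) (cvec_borel N) T) A = emeasure (uniform_unit_sphere N) A"
    by (simp add: emeasure_distr[OF Tu A])
qed simp

lemma uniform_unit_sphere_sign_flip:
  assumes c: "\<And>i. i < N \<Longrightarrow> \<bar>c i\<bar> = 1"
  shows "distr (uniform_unit_sphere N) (cvec_borel N) (\<lambda>x. \<lambda>i\<in>{..<N}. c i *\<^sub>R x i) = uniform_unit_sphere N"
proof (rule uniform_unit_sphere_invariant)
  let ?T = "\<lambda>x. \<lambda>i\<in>{..<N}. c i *\<^sub>R x i :: complex"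
  show T: "?T \<in> cvec_lborel N \<rightarrow>\<^sub>M cvec_lborel N" by (rule measurable_restrict) measurable
  have c0: "c i \<noteq> 0" if "i < N" for i using c[OF that] by auto
  have c1: "(c i)\<^sup>2 = 1" if "i < N" for i using c[OF that] power2_abs[of "c i"] by simp
  show "distr (cvec_lborel N) (cvec_lborel N) ?T = cvec_lborel N"
  proof (rule measure_eqI)
    fix A assume "A \<in> sets (distr (cvec_lborel N) (cvec_lborel N) ?T)"
    then have A: "A \<in> sets (cvec_lborel N)" by simp
    have "?T -` A \<inter> space (cvec_lborel N) = {x \<in> space (cvec_lborel N). ?T x \<in> A}" by auto
    then show "emeasure (distr (cvec_lborel N) (cvec_lborel N) ?T) A = emeasure (cvec_lborel N) A"
      using cvec_lborel_scale[of N c A] c0 c1 A by (simp add: emeasure_distr[OF T A])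
  qed simp
  show n: "cvec_norm N (?T x) = cvec_norm N x" for x
    by (simp add: cvec_norm_def c power_mult_distrib)
  show "cvec_dir N (?T x) = ?T (cvec_dir N x)" for x
    unfolding cvec_dir_def n by (auto simp: fun_eq_iff scaleR_conv_of_real)
qed

lemma uniform_unit_sphere_permute:
  assumes p: "p permutes {..<N}"
  shows "distr (uniform_unit_sphere N) (cvec_borel N) (\<lambda>x. \<lambda>i\<in>{..<N}. x (p i)) = uniform_unit_sphere N"
proof (rule uniform_unit_sphere_invariant)
  let ?T = "\<lambda>x. \<lambda>i\<in>{..<N}. x (p i) :: complex"
  have pN: "p i < N \<longleftrightarrow> i < N" for i using permutes_in_image[OF p, of i] by simp
  show T: "?T \<in> cvec_lborel N \<rightarrow>\<^sub>M cvec_lborel N"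
    by (rule measurable_restrict) (simp add: pN)
  show "distr (cvec_lborel N) (cvec_lborel N) ?T = cvec_lborel N" by (rule cvec_lborel_permute[OF p])
  show n: "cvec_norm N (?T x) = cvec_norm N x" for x
    using sum.permute[OF p, of "\<lambda>i. (cmod (x i))\<^sup>2"] by (simp add: cvec_norm_def comp_def)
  show "cvec_dir N (?T x) = ?T (cvec_dir N x)" for x
    unfolding cvec_dir_def n by (auto simp: fun_eq_iff pN)
qed

lemma sphere_integrable_bounded:
  fixes h :: "(nat \<Rightarrow> complex) \<Rightarrow> 'b :: {banach, second_countable_topology}"
  assumes N: "N \<ge> 1" and h: "h \<in> borel_measurable (cvec_borel N)"
    and B: "\<And>a. a \<in> space (cvec_borel N) \<Longrightarrow> cvec_norm N a = 1 \<Longrightarrow> norm (h a) \<le> B"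
  shows "integrable (uniform_unit_sphere N) h"
proof -
  interpret prob_space "uniform_unit_sphere N" by (rule prob_space_uniform_unit_sphere[OF N])
  show ?thesis
  proof (rule integrable_const_bound[where B = B])
    show "AE x in uniform_unit_sphere N. norm (h x) \<le> B"
      using AE_uniform_unit_sphere_norm[OF N] AE_space by eventually_elim (simp add: B)
    show "h \<in> borel_measurable (uniform_unit_sphere N)"
      using h by (simp add: measurable_cong_sets[OF sets_uniform_unit_sphere refl])
  qed
qed

lemma cmod_le_cvec_norm: "i < N \<Longrightarrow> cmod (a i) \<le> cvec_norm N a"
  unfolding cvec_norm_L2 by (intro member_le_L2_set) auto

lemma cvec_coord_product_measurable:
  assumes "i < N" "j < N"
  shows "(\<lambda>a. a i * cnj (a j)) \<in> borel_measurable (cvec_borel N)"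
proof -
  have "cnj \<in> borel_measurable borel"
    by (intro borel_measurable_continuous_onI continuous_on_cnj continuous_on_id)
  moreover have "(\<lambda>a. a l) \<in> borel_measurable (cvec_borel N)" if "l < N" for l
    using that by (intro measurable_component_singleton) auto
  ultimately show ?thesis
    using assms by (intro borel_measurable_times measurable_compose[of "\<lambda>a. a j" _ borel cnj]) auto
qed

lemma complex_eq_neg_self: "x = - x \<Longrightarrow> x = (0::complex)"
  by (simp add: complex_eq_iff)

text \<open>Changing the sign of coordinate \<open>i\<close> negates an off-diagonal moment.
  Transpositions make the diagonal moments equal, and these sum to 1 because the norm is 1 almost
  everywhere.\<close>

lemma sphere_second_moments:
  assumes N: "N \<ge> 1" and i: "i < N" and j: "j < N"
  shows "(LINT a|uniform_unit_sphere N. a i * cnj (a j)) = (if i = j then 1 / of_nat N else 0)"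
proof -
  let ?\<sigma> = "uniform_unit_sphere N"
  interpret prob_space ?\<sigma> by (rule prob_space_uniform_unit_sphere[OF N])
  have [measurable]: "(\<lambda>a. a i) \<in> borel_measurable (cvec_borel N)" if "i < N" for i
    using that by (intro measurable_component_singleton) auto
  have m: "(\<lambda>a. a i * cnj (a j)) \<in> borel_measurable (cvec_borel N)" if "i < N" "j < N" for i j
    by (rule cvec_coord_product_measurable[OF that])
  show ?thesis
  proof (cases "i = j")
    case False
    define c where "c l = (if l = i then -1 else 1 :: real)" for l
    let ?T = "\<lambda>x. \<lambda>l\<in>{..<N}. c l *\<^sub>R x l :: complex"
    have Tm: "?T \<in> ?\<sigma> \<rightarrow>\<^sub>M cvec_borel N"
      unfolding measurable_cong_sets[OF sets_uniform_unit_sphere refl] by (rule measurable_restrict) simp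
    have "(LINT a|?\<sigma>. a i * cnj (a j)) = (LINT a|distr ?\<sigma> (cvec_borel N) ?T. a i * cnj (a j))"
      by (subst uniform_unit_sphere_sign_flip) (auto simp: c_def)
    also have "\<dots> = (LINT a|?\<sigma>. ?T a i * cnj (?T a j))"
      by (rule integral_distr[OF Tm m[OF i j]])
    also have "\<dots> = (LINT a|?\<sigma>. - (a i * cnj (a j)))"
      using i j False by (simp add: c_def)
    also have "\<dots> = - (LINT a|?\<sigma>. a i * cnj (a j))" by simp
    finally have "(LINT a|?\<sigma>. a i * cnj (a j)) = 0" by (rule complex_eq_neg_self)
    then show ?thesis using False by simp
  next
    case True
    let ?q = "\<lambda>i. LINT a|?\<sigma>. a i * cnj (a i)"
    have int: "integrable ?\<sigma> (\<lambda>a. a i * cnj (a i))" if "i < N" for i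
    proof (rule sphere_integrable_bounded[OF N m[OF that that], of 1])
      fix a assume "cvec_norm N a = 1"
      then have "cmod (a i) \<le> 1" using cmod_le_cvec_norm[OF that, of a] by simp
      then show "norm (a i * cnj (a i)) \<le> 1" by (simp add: norm_mult mult_le_one)
    qed
    have eq: "?q l = ?q i" if l: "l < N" for l
    proof -
      let ?T = "\<lambda>x. \<lambda>m\<in>{..<N}. x (Transposition.transpose i l m) :: complex"
      have p: "Transposition.transpose i l permutes {..<N}" using i l by (intro permutes_swap_id) auto
      have Tm: "?T \<in> ?\<sigma> \<rightarrow>\<^sub>M cvec_borel N"
      proof (unfold measurable_cong_sets[OF sets_uniform_unit_sphere refl], rule measurable_restrict)
        fix m assume "m \<in> {..<N}"
        then have "Transposition.transpose i l m \<in> {..<N}" using permutes_in_image[OF p] by blast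
        then show "(\<lambda>x. x (Transposition.transpose i l m)) \<in> cvec_borel N \<rightarrow>\<^sub>M borel" by (intro measurable_component_singleton)
      qed
      have "?q i = (LINT a|distr ?\<sigma> (cvec_borel N) ?T. a i * cnj (a i))"
        by (subst uniform_unit_sphere_permute[OF p]) simp
      also have "\<dots> = (LINT a|?\<sigma>. ?T a i * cnj (?T a i))"
        by (rule integral_distr[OF Tm m[OF i i]])
      also have "\<dots> = ?q l" using i by simp
      finally show ?thesis by simp
    qed
    have "of_nat N * ?q i = (\<Sum>l<N. ?q l)" using eq by simp
    also have "\<dots> = (LINT a|?\<sigma>. (\<Sum>l<N. a l * cnj (a l)))"
      by (rule Bochner_Integration.integral_sum[symmetric]) (use int in auto)
    also have "\<dots> = (LINT a|?\<sigma>. 1)"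
    proof (rule integral_cong_AE)
      show "AE x in ?\<sigma>. (\<Sum>l<N. x l * cnj (x l)) = 1"
        using AE_uniform_unit_sphere_norm[OF N]
      proof eventually_elim
        case (elim a)
        have "(\<Sum>l<N. a l * cnj (a l)) = of_real ((cvec_norm N a)\<^sup>2)"
          unfolding cvec_norm_square by (simp only: of_real_sum complex_norm_square)
        then show ?case using elim by simp
      qed
      show "(\<lambda>a. \<Sum>l<N. a l * cnj (a l)) \<in> borel_measurable ?\<sigma>"
        unfolding measurable_cong_sets[OF sets_uniform_unit_sphere refl]
        by (intro borel_measurable_sum m) auto
    qed auto
    also have "\<dots> = 1"
      using prob_space.prob_space[OF prob_space_uniform_unit_sphere[OF N]] by (simp del: prob_space)
    finally show ?thesis using True N by (simp add: field_simps)
  qed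
qed

section \<open>Linear functionals of a uniform vector\<close>

text \<open>Bilinear, without conjugation: the value at z of the form with coefficients a is the
  pairing of a with the vector of the f_j z.\<close>

definition cvec_pair :: "nat \<Rightarrow> (nat \<Rightarrow> complex) \<Rightarrow> (nat \<Rightarrow> complex) \<Rightarrow> complex" where
  "cvec_pair N a v = (\<Sum>j<N. a j * v j)"

lemma cvec_pair_le: "cmod (cvec_pair N a v) \<le> cvec_norm N a * cvec_norm N v"
proof -
  have "cmod (cvec_pair N a v) \<le> (\<Sum>j<N. cmod (a j) * cmod (v j))"
    unfolding cvec_pair_def by (rule order_trans[OF norm_sum]) (simp add: norm_mult)
  also have "\<dots> \<le> cvec_norm N a * cvec_norm N v"
    unfolding cvec_norm_L2 using L2_set_mult_ineq[of "\<lambda>j. cmod (a j)" "\<lambda>j. cmod (v j)" "{..<N}"] by simp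
  finally show ?thesis .
qed

lemma cvec_pair_diff: "cvec_pair N (\<lambda>j. a j - b j) v = cvec_pair N a v - cvec_pair N b v"
  by (simp add: cvec_pair_def sum_subtractf left_diff_distrib)

lemma cvec_pair_measurable [measurable]: "(\<lambda>a. cvec_pair N a v) \<in> borel_measurable (cvec_borel N)"
  unfolding cvec_pair_def by measurable

lemma sphere_pair_second_moment:
  assumes N: "N \<ge> 1"
  shows "(LINT a|uniform_unit_sphere N. (cmod (cvec_pair N a v))\<^sup>2) = (cvec_norm N v)\<^sup>2 / real N"
proof -
  let ?\<sigma> = "uniform_unit_sphere N"
  have [measurable]: "(\<lambda>a. a i) \<in> borel_measurable (cvec_borel N)" if "i < N" for i
    using that by (intro measurable_component_singleton) auto
  have int: "integrable ?\<sigma> (\<lambda>a. v i * cnj (v j) * (a i * cnj (a j)))" if "i < N" "j < N" for i j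
  proof (rule integrable_mult_right, rule sphere_integrable_bounded[OF N, of _ 1])
    show "(\<lambda>a. a i * cnj (a j)) \<in> borel_measurable (cvec_borel N)"
      by (rule cvec_coord_product_measurable[OF that])
    fix a assume "cvec_norm N a = 1"
    then have "cmod (a i) \<le> 1" "cmod (a j) \<le> 1"
      using cmod_le_cvec_norm[OF that(1), of a] cmod_le_cvec_norm[OF that(2), of a] by auto
    then show "norm (a i * cnj (a j)) \<le> 1" by (simp add: norm_mult mult_le_one)
  qed
  have "complex_of_real (LINT a|?\<sigma>. (cmod (cvec_pair N a v))\<^sup>2) = (LINT a|?\<sigma>. complex_of_real ((cmod (cvec_pair N a v))\<^sup>2))"
    by (rule integral_complex_of_real[symmetric])
  also have "\<dots> = (LINT a|?\<sigma>. (\<Sum>i<N. \<Sum>j<N. v i * cnj (v j) * (a i * cnj (a j))))"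
    unfolding complex_norm_square cvec_pair_def
    by (rule Bochner_Integration.integral_cong) (auto simp: sum_product ac_simps)
  also have "\<dots> = (\<Sum>i<N. \<Sum>j<N. (LINT a|?\<sigma>. v i * cnj (v j) * (a i * cnj (a j))))"
    using int by (subst Bochner_Integration.integral_sum, force, intro sum.cong refl Bochner_Integration.integral_sum) auto
  also have "\<dots> = (\<Sum>i<N. \<Sum>j<N. v i * cnj (v j) * (if i = j then 1 / of_nat N else 0))"
    using sphere_second_moments[OF N] by simp
  also have "\<dots> = (\<Sum>i<N. v i * cnj (v i) / of_nat N)"
    by (intro sum.cong refl) (simp add: if_distrib[where f = "\<lambda>x. _ * x"] cong: if_cong)
  also have "\<dots> = complex_of_real ((cvec_norm N v)\<^sup>2 / real N)"
    unfolding cvec_norm_square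
    by (simp only: of_real_divide of_real_sum complex_norm_square sum_divide_distrib of_real_of_nat_eq)
  finally show ?thesis using of_real_eq_iff by blast
qed

text \<open>Concentration about the level \<open>m\<close> of order 1/sqrt N becomes a tail about 0:
  for s >= 2m the deviation s - m is at least s/2, which turns the constant 32 into 128.\<close>

lemma sphere_pair_tail:
  assumes N: "N \<ge> 1" and v: "cvec_norm N v = 1" and s: "s > 0"
  shows "measure (uniform_unit_sphere N) {a \<in> space (cvec_borel N). cmod (cvec_pair N a v) > s}
    \<le> 4 * exp (- (real N / 128 * s\<^sup>2))"
proof -
  let ?\<sigma> = "uniform_unit_sphere N" and ?S = "space (cvec_borel N)"
  let ?Y = "\<lambda>a. cmod (cvec_pair N a v)"
  interpret prob_space ?\<sigma> by (rule prob_space_uniform_unit_sphere[OF N])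
  \<comment> \<open>The second moment is 1/N, so Markov's inequality leaves at most mass 1/4 above
    \<open>m\<close>; no exact median is required.\<close>
  define m where "m = 2 / sqrt (real N)"
  have m: "m > 0" "m\<^sup>2 = 4 / real N" using N by (auto simp: m_def power_divide)
  have int: "integrable ?\<sigma> (\<lambda>a. (?Y a)\<^sup>2)"
  proof (rule sphere_integrable_bounded[OF N, of _ 1])
    fix a assume "cvec_norm N a = 1"
    then have "?Y a \<le> 1" using cvec_pair_le[of N a v] v by simp
    then show "norm ((?Y a)\<^sup>2) \<le> 1" by (simp add: power_le_one)
  qed measurable
  have "prob {a \<in> space ?\<sigma>. (?Y a)\<^sup>2 \<ge> m\<^sup>2} \<le> (LINT a|?\<sigma>. (?Y a)\<^sup>2) / m\<^sup>2"
    using m N integral_Markov_inequality_measure[OF int, of "space ?\<sigma>" "m\<^sup>2"] by simp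
  also have "\<dots> = 1 / 4" using sphere_pair_second_moment[OF N, of v] v m N by simp
  finally have big: "prob {a \<in> ?S. (?Y a)\<^sup>2 \<ge> m\<^sup>2} \<le> 1/4" by simp
  have "prob (space ?\<sigma> - {a \<in> ?S. (?Y a)\<^sup>2 \<ge> m\<^sup>2}) = 1 - prob {a \<in> ?S. (?Y a)\<^sup>2 \<ge> m\<^sup>2}"
    by (rule prob_compl) simp
  moreover have "prob (space ?\<sigma> - {a \<in> ?S. (?Y a)\<^sup>2 \<ge> m\<^sup>2}) \<le> prob {a \<in> ?S. ?Y a \<le> m}"
    using m by (intro finite_measure_mono) (auto intro: power2_le_imp_le less_imp_le)
  ultimately have med: "prob {a \<in> ?S. ?Y a \<le> m} \<ge> 1/2" using big by linarith
  show ?thesis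
  proof (cases "s \<ge> 2 * m")
    case True
    have "prob {a \<in> ?S. ?Y a > s} = prob {a \<in> ?S. ?Y a > m + (s - m)}" by simp
    also have "\<dots> \<le> 4 * exp (- (real N * ((s - m) / 1)\<^sup>2 / 32))"
    proof (rule sphere_upper_tail[OF N])
      fix a b
      have "?Y b - ?Y a \<le> cmod (cvec_pair N a v - cvec_pair N b v)"
        by (metis norm_minus_commute norm_triangle_ineq2)
      also have "\<dots> \<le> cvec_norm N (\<lambda>j. a j - b j)"
        using cvec_pair_le[of N "\<lambda>j. a j - b j" v] v by (simp add: cvec_pair_diff)
      finally show "?Y b - ?Y a \<le> 1 * cvec_norm N (\<lambda>j. a j - b j)" by simp
    qed (use True m med in auto)
    also have "\<dots> \<le> 4 * exp (- (real N / 128 * s\<^sup>2))"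
    proof -
      have "(s / 2)\<^sup>2 \<le> (s - m)\<^sup>2" using True s by (intro power_mono) auto
      then have "real N * (s / 2)\<^sup>2 \<le> real N * (s - m)\<^sup>2" by (intro mult_left_mono) auto
      then show ?thesis by (simp add: power_divide)
    qed
    finally show ?thesis .
  next
    \<comment> \<open>For s < 2m the exponent is at most 1/8, so the right-hand side exceeds
      1.\<close>
    case False
    then have "s\<^sup>2 \<le> (2 * m)\<^sup>2" using s by (intro power_mono) auto
    then have "s\<^sup>2 \<le> 16 / real N" using m by (simp add: power_mult_distrib)
    then have "real N / 128 * s\<^sup>2 \<le> 1/8" using N by (simp add: field_simps)
    then have "exp (- (real N / 128 * s\<^sup>2)) \<ge> 1 - 1/8"
      using exp_ge_add_one_self[of "- (real N / 128 * s\<^sup>2)"] by linarith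
    then have "1 \<le> 4 * exp (- (real N / 128 * s\<^sup>2))" by linarith
    then show ?thesis using prob_le_1 order_trans by blast
  qed
qed

lemma sphere_pair_even_moment_unit:
  assumes N: "N \<ge> 1" and v: "cvec_norm N v = 1"
  shows "(\<integral>\<^sup>+a. ennreal (cmod (cvec_pair N a v) ^ (2 * m)) \<partial>uniform_unit_sphere N)
    \<le> ennreal (5 * fact m * (256 / real N) ^ m)"
proof -
  interpret prob_space "uniform_unit_sphere N" by (rule prob_space_uniform_unit_sphere[OF N])
  have "(\<integral>\<^sup>+a. ennreal (cmod (cvec_pair N a v) ^ (2 * m)) \<partial>uniform_unit_sphere N)
     \<le> ennreal (fact m * (2 / (real N / 128)) ^ m * (1 + 4))"
    by (rule subgaussian_even_moment) (use N sphere_pair_tail[OF N v] in auto)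
  then show ?thesis by (simp add: ac_simps)
qed

lemma cvec_pair_scaleR: "cvec_pair N a (\<lambda>j. c *\<^sub>R v j) = c *\<^sub>R cvec_pair N a v"
  by (simp add: cvec_pair_def scaleR_sum_right)

lemma sphere_pair_even_moment:
  assumes N: "N \<ge> 1"
  shows "(\<integral>\<^sup>+a. ennreal (cmod (cvec_pair N a v) ^ (2 * m)) \<partial>uniform_unit_sphere N)
    \<le> ennreal (5 * fact m * (256 * (cvec_norm N v)\<^sup>2 / real N) ^ m)"
proof (cases "cvec_norm N v = 0")
  case True
  then have "cvec_pair N a v = 0" for a using cvec_pair_le[of N a v] by simp
  moreover have "(0::real) ^ (2 * m) \<le> 5 * fact m * 0 ^ m" by (cases m) auto
  ultimately show ?thesis
    using True prob_space.emeasure_space_1[OF prob_space_uniform_unit_sphere[OF N]]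
    by (simp add: ennreal_leI)
next
  case False
  define n where "n = cvec_norm N v"
  have n: "n > 0" using False by (simp add: n_def less_le)
  define u where "u = (\<lambda>j. (1 / n) *\<^sub>R v j)"
  have u: "cvec_norm N u = 1" using n by (simp add: u_def cvec_norm_scaleR n_def)
  have "cmod (cvec_pair N a v) ^ (2 * m) = (n\<^sup>2) ^ m * cmod (cvec_pair N a u) ^ (2 * m)" for a
    using n by (simp add: u_def cvec_pair_scaleR power_mult power_divide)
  then have "(\<integral>\<^sup>+a. ennreal (cmod (cvec_pair N a v) ^ (2 * m)) \<partial>uniform_unit_sphere N)
      = (\<integral>\<^sup>+a. ennreal ((n\<^sup>2) ^ m) * ennreal (cmod (cvec_pair N a u) ^ (2 * m)) \<partial>uniform_unit_sphere N)"
    by (simp add: ennreal_mult)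
  also have "\<dots> = ennreal ((n\<^sup>2) ^ m) * (\<integral>\<^sup>+a. ennreal (cmod (cvec_pair N a u) ^ (2 * m)) \<partial>uniform_unit_sphere N)"
    by (rule nn_integral_cmult) measurable
  also have "\<dots> \<le> ennreal ((n\<^sup>2) ^ m) * ennreal (5 * fact m * (256 / real N) ^ m)"
    by (intro mult_left_mono sphere_pair_even_moment_unit[OF N u]) auto
  also have "\<dots> = ennreal (5 * fact m * (256 * n\<^sup>2 / real N) ^ m)"
    by (simp add: ennreal_mult[symmetric] power_mult_distrib power_divide)
  finally show ?thesis by (simp add: n_def)
qed

text \<open>A first moment is bounded from below by the second and fourth ones, through t^2 - t^4 <=
  t for t >= 0.\<close>

lemma sphere_pair_abs_lower:
  assumes N: "N \<ge> 1"
  shows "cvec_norm N v / (3000 * sqrt (real N)) \<le> (LINT a|uniform_unit_sphere N. cmod (cvec_pair N a v))"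
proof -
  let ?\<sigma> = "uniform_unit_sphere N"
  let ?Y = "\<lambda>a. cmod (cvec_pair N a v)"
  define n where "n = cvec_norm N v"
  have n0: "n \<ge> 0" by (simp add: n_def)
  have bd: "?Y a \<le> n" if "cvec_norm N a = 1" for a using cvec_pair_le[of N a v] that by (simp add: n_def)
  have int: "integrable ?\<sigma> (\<lambda>a. ?Y a ^ p)" for p
  proof (rule sphere_integrable_bounded[OF N, of _ "n ^ p"])
    fix a assume "cvec_norm N a = 1"
    then show "norm (?Y a ^ p) \<le> n ^ p" using bd[of a] by (simp add: norm_power power_mono)
  qed measurable
  show ?thesis
  proof (cases "n = 0")
    case True
    then show ?thesis by (simp add: n_def)
  next
    case False
    then have n: "n > 0" using n0 by simp
    \<comment> \<open>The scale makes the second-moment term dominate: the fourth moment has the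
      constant 655360 = 5 * 2 * 256^2, and 1/1000 - 655360/10^9 exceeds 1/3000.\<close>
    define s where "s = 1000 * n / sqrt (real N)"
    have s: "s > 0" using n N by (simp add: s_def)
    have 2: "(LINT a|?\<sigma>. ?Y a ^ 2) = n\<^sup>2 / real N" using sphere_pair_second_moment[OF N, of v] by (simp add: n_def)
    have "ennreal (LINT a|?\<sigma>. ?Y a ^ 4) = (\<integral>\<^sup>+a. ennreal (?Y a ^ 4) \<partial>?\<sigma>)"
      by (rule nn_integral_eq_integral[symmetric]) (use int in auto)
    also have "\<dots> \<le> ennreal (5 * fact 2 * (256 * n\<^sup>2 / real N)\<^sup>2)"
      using sphere_pair_even_moment[OF N, of v 2] by (simp add: n_def)
    finally have 4: "(LINT a|?\<sigma>. ?Y a ^ 4) \<le> 655360 * n ^ 4 / (real N)\<^sup>2"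
      by (simp add: power_divide power_mult_distrib flip: power_mult)
    have pw: "u\<^sup>2 / s - u ^ 4 / s ^ 3 \<le> u" if "u \<ge> 0" for u :: real
    proof -
      define t where "t = u / s"
      have t: "t \<ge> 0" "u = s * t" using that s by (auto simp: t_def)
      have "t\<^sup>2 - t ^ 4 \<le> t"
      proof (cases "t \<le> 1")
        case True
        then have "t * t \<le> t * 1" using t by (intro mult_left_mono) auto
        moreover have "t ^ 4 \<ge> 0" by simp
        ultimately show ?thesis unfolding power2_eq_square by linarith
      next
        case False
        then have "t\<^sup>2 \<le> t ^ 4" by (intro power_increasing) auto
        then show ?thesis using t by linarith
      qed
      then have "s * (t\<^sup>2 - t ^ 4) \<le> s * t" using s by (intro mult_left_mono) auto
      moreover have "u\<^sup>2 / s - u ^ 4 / s ^ 3 = s * (t\<^sup>2 - t ^ 4)"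
        using s by (simp add: t(2) power_mult_distrib field_simps power2_eq_square power3_eq_cube numeral_eq_Suc)
      ultimately show ?thesis using t by simp
    qed
    have "(LINT a|?\<sigma>. ?Y a ^ 2 / s - ?Y a ^ 4 / s ^ 3) \<le> (LINT a|?\<sigma>. ?Y a)"
      using int[of 1] int[of 2] int[of 4] by (intro integral_mono) (auto simp: pw)
    moreover have "(LINT a|?\<sigma>. ?Y a ^ 2 / s - ?Y a ^ 4 / s ^ 3) = (LINT a|?\<sigma>. ?Y a ^ 2) / s - (LINT a|?\<sigma>. ?Y a ^ 4) / s ^ 3"
      using int[of 2] int[of 4] by simp
    moreover have "(n\<^sup>2 / real N) / s - (655360 * n ^ 4 / (real N)\<^sup>2) / s ^ 3 \<le> (LINT a|?\<sigma>. ?Y a ^ 2) / s - (LINT a|?\<sigma>. ?Y a ^ 4) / s ^ 3"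
      unfolding 2 using 4 s by (intro diff_left_mono divide_right_mono) auto
    moreover have "(n\<^sup>2 / real N) / s - (655360 * n ^ 4 / (real N)\<^sup>2) / s ^ 3 \<ge> n / (3000 * sqrt (real N))"
    proof -
      define q where "q = sqrt (real N)"
      have q: "q > 0" "real N = q * q" using N by (auto simp: q_def)
      have "(n\<^sup>2 / real N) / s - (655360 * n ^ 4 / (real N)\<^sup>2) / s ^ 3 = (1/1000 - 655360/10^9) * (n / q)"
        using q n unfolding s_def q_def[symmetric] q(2)
        by (simp add: field_simps power2_eq_square power3_eq_cube numeral_eq_Suc)
      also have "\<dots> \<ge> (1/3000) * (n / q)" using q n by (intro mult_right_mono) auto
      finally show ?thesis by (simp add: q_def)
    qed
    ultimately show ?thesis unfolding n_def[symmetric] by linarith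
  qed
qed

section \<open>Hyperbolic area\<close>

text \<open>Substitution is available on compact intervals only; the measures are compared on the
  intervals [-n, n] and their images, and monotone convergence passes to the limit.\<close>

lemma emeasure_distr_exp:
  "distr lborel borel exp = density lborel (\<lambda>y. ennreal (1 / y) * indicator {0<..} y)" (is "?M = ?D")
proof (rule measure_eqI)
  fix A assume "A \<in> sets (distr lborel borel (exp :: real \<Rightarrow> real))"
  then have A[measurable]: "A \<in> sets borel" by simp
  let ?L = "\<lambda>n::nat. \<integral>\<^sup>+y. ennreal (indicator A y / y) * indicator {exp (- real n)..exp (real n)} y \<partial>lborel"
  let ?R = "\<lambda>n::nat. \<integral>\<^sup>+t. ennreal (indicator A (exp t)) * indicator {- real n..real n} t \<partial>lborel"
  have eq: "?L n = ?R n" for n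
  proof -
    have "continuous_on {- real n..real n} (exp :: real \<Rightarrow> real)"
      by (intro continuous_at_imp_continuous_on) auto
    moreover have "set_borel_measurable borel {exp (- real n)..exp (real n)} (\<lambda>y. indicator A y / y :: real)"
      by (simp add: set_borel_measurable_def)
    ultimately have "?L n = (\<integral>\<^sup>+t. ennreal (indicator A (exp t) / exp t * exp t) * indicator {- real n..real n} t \<partial>lborel)"
      unfolding nn_integral_set_ennreal
      by (intro nn_integral_substitution DERIV_exp) auto
    then show ?thesis by simp
  qed
  have "?R \<longlonglongrightarrow> (\<integral>\<^sup>+t. ennreal (indicator A (exp t)) \<partial>lborel)"
  proof (rule nn_integral_LIMSEQ)
    show "(\<lambda>n. ennreal (indicator A (exp t)) * indicator {- real n..real n} t) \<longlonglongrightarrow> ennreal (indicator A (exp t))" for t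
    proof (rule tendsto_eventually)
      obtain m where "\<bar>t\<bar> \<le> real m" using real_arch_simple by blast
      then show "\<forall>\<^sub>F n in sequentially. ennreal (indicator A (exp t)) * indicator {- real n..real n} t = ennreal (indicator A (exp t))"
        unfolding eventually_sequentially by (intro exI[of _ m]) (auto split: split_indicator)
    qed
  qed (auto simp: incseq_def le_fun_def split: split_indicator)
  moreover have "?L \<longlonglongrightarrow> (\<integral>\<^sup>+y. ennreal (indicator A y / y) * indicator {0<..} y \<partial>lborel)"
  proof (rule nn_integral_LIMSEQ)
    show "(\<lambda>n. ennreal (indicator A y / y) * indicator {exp (- real n)..exp (real n)} y)
       \<longlonglongrightarrow> ennreal (indicator A y / y) * indicator {0<..} y" for y
    proof (rule tendsto_eventually)
      obtain m where m: "\<bar>ln y\<bar> \<le> real m" using real_arch_simple by blast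
      have "(y \<in> {exp (- real n)..exp (real n)}) = (y \<in> {0<..})" if "n \<ge> m" for n
      proof
        assume "y \<in> {0<..}"
        then have y: "y = exp (ln y)" by simp
        have "- real n \<le> ln y" "ln y \<le> real n" using m that by linarith+
        then show "y \<in> {exp (- real n)..exp (real n)}" by (subst y, subst y) simp
      next
        assume "y \<in> {exp (- real n)..exp (real n)}"
        then have "exp (- real n) \<le> y" by simp
        then show "y \<in> {0<..}" using less_le_trans[OF exp_gt_zero] by blast
      qed
      then show "\<forall>\<^sub>F n in sequentially. ennreal (indicator A y / y) * indicator {exp (- real n)..exp (real n)} y
        = ennreal (indicator A y / y) * indicator {0<..} y"
        unfolding eventually_sequentially by (intro exI[of _ m]) (auto simp: indicator_def)
    qed
    show "incseq (\<lambda>n y. ennreal (indicator A y / y) * indicator {exp (- real n)..exp (real n)} y)"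
    proof (intro incseq_SucI le_funI mult_left_mono)
      fix n and y :: real
      have "exp (- real (Suc n)) \<le> exp (- real n)" "exp (real n) \<le> exp (real (Suc n))"
        by (simp_all only: exp_le_cancel_iff)
      then have "{exp (- real n)..exp (real n)} \<subseteq> {exp (- real (Suc n))..exp (real (Suc n))}"
        by (simp only: atLeastatMost_subset_iff simp_thms)
      then show "indicator {exp (- real n)..exp (real n)} y \<le> (indicator {exp (- real (Suc n))..exp (real (Suc n))} y :: ennreal)"
        unfolding indicator_def by (auto simp del: of_nat_Suc atLeastatMost_subset_iff)
    qed auto
  qed auto
  ultimately have "(\<integral>\<^sup>+t. ennreal (indicator A (exp t)) \<partial>lborel) = (\<integral>\<^sup>+y. ennreal (indicator A y / y) * indicator {0<..} y \<partial>lborel)"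
    unfolding eq by (rule LIMSEQ_unique)
  moreover have "emeasure ?M A = (\<integral>\<^sup>+t. ennreal (indicator A (exp t)) \<partial>lborel)"
    by (subst nn_integral_indicator[symmetric], simp, subst nn_integral_distr)
       (auto simp: ennreal_indicator)
  moreover have "emeasure ?D A = (\<integral>\<^sup>+y. ennreal (indicator A y / y) * indicator {0<..} y \<partial>lborel)"
    by (subst emeasure_density) (auto intro!: nn_integral_cong split: split_indicator)
  ultimately show "emeasure ?M A = emeasure ?D A" by simp
qed simp

lemma nn_integral_exp_substitution:
  assumes [measurable]: "\<phi> \<in> borel_measurable borel"
  shows "(\<integral>\<^sup>+y. ennreal (1 / y) * indicator {0<..} y * \<phi> y \<partial>lborel) = (\<integral>\<^sup>+t. \<phi> (exp t) \<partial>lborel)"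
proof -
  have "(\<integral>\<^sup>+t. \<phi> (exp t) \<partial>lborel) = integral\<^sup>N (distr lborel borel exp) \<phi>"
    by (subst nn_integral_distr) auto
  also have "\<dots> = (\<integral>\<^sup>+y. ennreal (1 / y) * indicator {0<..} y * \<phi> y \<partial>lborel)"
    unfolding emeasure_distr_exp by (subst nn_integral_density) auto
  finally show ?thesis by simp
qed

definition hyp_weight :: "complex \<Rightarrow> ennreal" where
  "hyp_weight z = ennreal (1 / (Im z)\<^sup>2) * indicator upper_half_plane z"

lemma upper_half_plane_sets [measurable]: "upper_half_plane \<in> sets borel"
  unfolding upper_half_plane_def by measurable

lemma fundamental_domain_sets [measurable]: "fundamental_domain \<in> sets borel"
  unfolding fundamental_domain_def by measurable

lemma hyp_weight_measurable [measurable]: "hyp_weight \<in> borel_measurable borel"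
  unfolding hyp_weight_def[abs_def] by measurable

text \<open>In the coordinates \<open>z = e\<^sup>t (s + \<i>)\<close> the hyperbolic area element is \<open>ds dt\<close>.\<close>

lemma nn_integral_hyp_coordinates:
  assumes [measurable]: "h \<in> borel_measurable borel"
  shows "(\<integral>\<^sup>+z. h z * hyp_weight z \<partial>lborel)
    = (\<integral>\<^sup>+s. (\<integral>\<^sup>+t. h (Complex (exp t * s) (exp t)) \<partial>lborel) \<partial>lborel)"
proof -
  let ?g = "\<lambda>x y. h (Complex x y) * (ennreal (1 / y\<^sup>2) * indicator {0<..} y)"
  have "(\<integral>\<^sup>+z. h z * hyp_weight z \<partial>lborel) = (\<integral>\<^sup>+x. (\<integral>\<^sup>+y. ?g x y \<partial>lborel) \<partial>lborel)"
    by (subst nn_integral_lborel_complex)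
       (auto simp: hyp_weight_def upper_half_plane_def indicator_def intro!: nn_integral_cong)
  also have "\<dots> = (\<integral>\<^sup>+y. (\<integral>\<^sup>+x. ?g x y \<partial>lborel) \<partial>lborel)"
    by (rule lborel_pair.Fubini'[symmetric]) simp
  also have "\<dots> = (\<integral>\<^sup>+y. ennreal (1 / y) * indicator {0<..} y * (\<integral>\<^sup>+s. h (Complex (y * s) y) \<partial>lborel) \<partial>lborel)"
  proof (rule nn_integral_cong)
    fix y :: real
    show "(\<integral>\<^sup>+x. ?g x y \<partial>lborel) = ennreal (1 / y) * indicator {0<..} y * (\<integral>\<^sup>+s. h (Complex (y * s) y) \<partial>lborel)"
    proof (cases "y > 0")
      case True
      have "(\<integral>\<^sup>+x. ?g x y \<partial>lborel) = (\<integral>\<^sup>+x. h (Complex x y) \<partial>lborel) * ennreal (1 / y\<^sup>2)"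
        using True by (subst nn_integral_multc[symmetric]) (auto intro!: nn_integral_cong)
      also have "(\<integral>\<^sup>+x. h (Complex x y) \<partial>lborel) = ennreal y * (\<integral>\<^sup>+s. h (Complex (y * s) y) \<partial>lborel)"
        using True nn_integral_real_affine[of "\<lambda>x. h (Complex x y)" y 0] by simp
      also have "ennreal y * (\<integral>\<^sup>+s. h (Complex (y * s) y) \<partial>lborel) * ennreal (1 / y\<^sup>2)
          = (ennreal y * ennreal (1 / y\<^sup>2)) * (\<integral>\<^sup>+s. h (Complex (y * s) y) \<partial>lborel)" by (simp add: ac_simps)
      also have "ennreal y * ennreal (1 / y\<^sup>2) = ennreal (1 / y)"
        using True by (subst ennreal_mult[symmetric]) (auto simp: power2_eq_square)
      finally show ?thesis using True by simp
    qed simp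
  qed
  also have "\<dots> = (\<integral>\<^sup>+t. (\<integral>\<^sup>+s. h (Complex (exp t * s) (exp t)) \<partial>lborel) \<partial>lborel)"
    by (subst nn_integral_exp_substitution) auto
  also have "\<dots> = (\<integral>\<^sup>+s. (\<integral>\<^sup>+t. h (Complex (exp t * s) (exp t)) \<partial>lborel) \<partial>lborel)"
    by (rule lborel_pair.Fubini') simp
  finally show ?thesis .
qed

text \<open>In the coordinates (s, t) the map z to -1/z sends s to -s and t to - ln (1 + s^2) - t.
  For each fixed s this is a reflection in t, so ds dt is preserved and no Jacobian in the plane has
  to be computed.\<close>

lemma hyp_inversion:
  assumes [measurable]: "h \<in> borel_measurable borel"
  shows "(\<integral>\<^sup>+z. h (- 1 / z) * hyp_weight z \<partial>lborel) = (\<integral>\<^sup>+z. h z * hyp_weight z \<partial>lborel)"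
proof -
  let ?H = "\<lambda>s. \<integral>\<^sup>+t. h (Complex (exp t * s) (exp t)) \<partial>lborel"
  have inv: "- 1 / Complex (exp t * s) (exp t)
      = Complex (exp (- ln (1 + s\<^sup>2) - t) * - s) (exp (- ln (1 + s\<^sup>2) - t))" for s t :: real
  proof -
    have p: "1 + s\<^sup>2 > 0" by (simp add: add_pos_nonneg)
    then have e: "exp (- ln (1 + s\<^sup>2) - t) = 1 / ((1 + s\<^sup>2) * exp t)"
      by (simp add: exp_diff exp_minus inverse_eq_divide)
    have n: "(exp t)\<^sup>2 * s\<^sup>2 + (exp t)\<^sup>2 = exp t * exp t * (1 + s\<^sup>2)" by (simp add: power2_eq_square algebra_simps)
    show ?thesis unfolding e using p
      by (auto simp: complex_eq_iff Re_divide Im_divide n divide_simps)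
  qed
  have "(\<integral>\<^sup>+z. h (- 1 / z) * hyp_weight z \<partial>lborel) = (\<integral>\<^sup>+s. ?H (- s) \<partial>lborel)"
  proof (subst nn_integral_hyp_coordinates, simp, rule nn_integral_cong)
    fix s :: real
    show "(\<integral>\<^sup>+t. h (- 1 / Complex (exp t * s) (exp t)) \<partial>lborel) = ?H (- s)"
      unfolding inv using nn_integral_real_affine[of "\<lambda>t. h (Complex (exp t * - s) (exp t))" "-1" "- ln (1 + s\<^sup>2)"]
      by simp
  qed
  also have "\<dots> = (\<integral>\<^sup>+s. ?H s \<partial>lborel)"
    using nn_integral_real_affine[of ?H "-1" 0] by simp
  also have "\<dots> = (\<integral>\<^sup>+z. h z * hyp_weight z \<partial>lborel)" by (subst nn_integral_hyp_coordinates) auto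
  finally show ?thesis .
qed

lemma hyp_translation:
  assumes [measurable]: "h \<in> borel_measurable borel"
  shows "(\<integral>\<^sup>+z. h (z + of_real c) * hyp_weight z \<partial>lborel) = (\<integral>\<^sup>+z. h z * hyp_weight z \<partial>lborel)"
proof -
  let ?G = "\<lambda>x. \<integral>\<^sup>+y. h (Complex x y) * hyp_weight (Complex x y) \<partial>lborel"
  have "(\<integral>\<^sup>+z. h (z + of_real c) * hyp_weight z \<partial>lborel) = (\<integral>\<^sup>+x. ?G (c + x) \<partial>lborel)"
    by (subst nn_integral_lborel_complex)
       (auto simp: hyp_weight_def upper_half_plane_def indicator_def complex_eq_iff algebra_simps
         intro!: nn_integral_cong arg_cong2[where f = times] arg_cong[where f = h])
  also have "\<dots> = (\<integral>\<^sup>+x. ?G x \<partial>lborel)"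
    using nn_integral_real_affine[of ?G 1 c] by simp
  also have "\<dots> = (\<integral>\<^sup>+z. h z * hyp_weight z \<partial>lborel)" by (subst nn_integral_lborel_complex) auto
  finally show ?thesis .
qed

section \<open>Comparison of a strip with the fundamental domain\<close>

text \<open>Its horizontal sections are full periods at every height, which makes the Fourier modes
  orthogonal on it; the curved lower boundary of the fundamental domain would destroy this. The
  height 1/2 leaves room below the points of the fundamental domain.\<close>

definition half_strip :: "complex set" where
  "half_strip = {z. \<bar>Re z\<bar> \<le> 1 / 2 \<and> Im z \<ge> 1 / 2}"

text \<open>Inside the unit circle, inversion leaves the real part in [-1, 1], and a shift by at
  most 1 brings it into [-1/2, 1/2]. The shifted point stays outside the unit circle because |Re z|
  <= 1/2.\<close>

lemma half_strip_cover:
  assumes "z \<in> half_strip"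
  shows "z \<in> fundamental_domain \<or> - 1 / z \<in> fundamental_domain
    \<or> - 1 / z + 1 \<in> fundamental_domain \<or> - 1 / z - 1 \<in> fundamental_domain"
proof (cases "cmod z \<ge> 1")
  case True
  then show ?thesis using assms by (auto simp: half_strip_def fundamental_domain_def upper_half_plane_def)
next
  case False
  define x y r where "x = Re z" and "y = Im z" and "r = x\<^sup>2 + y\<^sup>2"
  have xy: "\<bar>x\<bar> \<le> 1/2" "y \<ge> 1/2" using assms by (auto simp: x_def y_def half_strip_def)
  have "(1/2)\<^sup>2 \<le> y\<^sup>2" using xy by (intro power_mono) auto
  then have rx: "r \<ge> x\<^sup>2 + 1/4" by (simp add: r_def power2_eq_square)
  then have r0: "r > 0" using zero_le_power2[of x] by linarith
  have "(cmod z)\<^sup>2 < 1\<^sup>2" using False by (intro power_strict_mono) auto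
  then have r1: "r < 1" by (simp add: cmod_power2 r_def x_def y_def)
  define w where "w = - 1 / z"
  have inv: "Re w = - x / r" "Im w = y / r"
    by (auto simp: w_def Re_divide Im_divide x_def y_def r_def)
  have im: "y / r > 0" using xy r0 by simp
  \<comment> \<open>|x| <= x^2 + 1/4 <= r; the second inequality is where the height 1/2
    enters.\<close>
  have rx2: "\<bar>x\<bar> \<le> r"
  proof -
    have "\<bar>x\<bar> \<le> \<bar>x\<bar>\<^sup>2 + 1/4" using zero_le_power2[of "\<bar>x\<bar> - 1/2"] by (simp add: power2_eq_square algebra_simps)
    then show ?thesis using rx by simp
  qed
  have norm: "cmod u \<ge> 1" if "(Re u)\<^sup>2 + (Im u)\<^sup>2 \<ge> 1" for u
    using that by (simp add: cmod_def)
  have xr: "x\<^sup>2 + y\<^sup>2 = r" by (simp add: r_def)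
  have main: "(- x / r)\<^sup>2 + (y / r)\<^sup>2 = 1 / r"
  proof -
    have "(- x / r)\<^sup>2 + (y / r)\<^sup>2 = (x\<^sup>2 + y\<^sup>2) / r\<^sup>2" by (simp add: power_divide add_divide_distrib)
    also have "\<dots> = 1 / r" using r0 by (simp only: xr) (simp add: power2_eq_square)
    finally show ?thesis .
  qed
  have r1': "1 / r \<ge> 1" using r0 r1 by simp
  consider "\<bar>x / r\<bar> \<le> 1/2" | "x / r > 1/2" | "x / r < - 1/2" by linarith
  then show ?thesis
  proof cases
    case 1
    have "w \<in> fundamental_domain" unfolding fundamental_domain_def upper_half_plane_def
      using 1 im norm[of w] main r1' by (auto simp: inv)
    then show ?thesis by (auto simp: w_def)
  next
    case 2
    have "x / r \<le> 1" using rx2 r0 by (simp add: field_simps)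
    \<comment> \<open>For w = -1/z this is |w + 1|^2; it is at least 1 since 1 - 2x >= 0.\<close>
    have e: "(- x / r + 1)\<^sup>2 + (y / r)\<^sup>2 = 1 / r - 2 * (x / r) + 1"
      using main by (simp add: power2_eq_square algebra_simps)
    have "1 / r - 2 * (x / r) \<ge> 0" using xy r0 by (simp add: field_simps)
    then have "(Re (w + 1))\<^sup>2 + (Im (w + 1))\<^sup>2 \<ge> 1" using e by (simp add: inv del: minus_divide_left)
    moreover have "\<bar>Re (w + 1)\<bar> \<le> 1/2" using 2 \<open>x / r \<le> 1\<close> inv by simp
    ultimately have "w + 1 \<in> fundamental_domain"
      unfolding fundamental_domain_def upper_half_plane_def using im norm[of "w + 1"] inv by simp
    then show ?thesis by (auto simp: w_def)
  next
    case 3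
    have "- x / r \<le> 1" using rx2 r0 by (simp add: field_simps)
    have e: "(- x / r - 1)\<^sup>2 + (y / r)\<^sup>2 = 1 / r + 2 * (x / r) + 1"
      using main by (simp add: power2_eq_square algebra_simps)
    have "1 / r + 2 * (x / r) \<ge> 0" using xy r0 by (simp add: field_simps)
    then have "(Re (w - 1))\<^sup>2 + (Im (w - 1))\<^sup>2 \<ge> 1" using e by (simp add: inv del: minus_divide_left)
    moreover have "Re (w - 1) = - (x / r) - 1" by (simp add: inv)
    then have "\<bar>Re (w - 1)\<bar> \<le> 1/2" using 3 \<open>- x / r \<le> 1\<close> unfolding abs_le_iff by linarith
    ultimately have "w - 1 \<in> fundamental_domain"
      unfolding fundamental_domain_def upper_half_plane_def using im norm[of "w - 1"] inv by simp
    then show ?thesis by (auto simp: w_def)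
  qed
qed

text \<open>Each of the four pieces of the cover is carried onto the fundamental domain by a
  measure-preserving map under which \<open>h\<close> is invariant, whence the factor 4.\<close>

lemma half_strip_integral_le:
  assumes [measurable]: "h \<in> borel_measurable borel"
    and inv: "\<And>z. z \<in> upper_half_plane \<Longrightarrow> h (- 1 / z) = h z"
    and per: "\<And>z. z \<in> upper_half_plane \<Longrightarrow> h (z + 1) = h z" "\<And>z. z \<in> upper_half_plane \<Longrightarrow> h (z - 1) = h z"
  shows "(\<integral>\<^sup>+z. h z * indicator half_strip z * hyp_weight z \<partial>lborel)
    \<le> 4 * (\<integral>\<^sup>+z. h z * indicator fundamental_domain z * hyp_weight z \<partial>lborel)"
proof -
  let ?D = "fundamental_domain"
  let ?I = "\<integral>\<^sup>+z. h z * indicator ?D z * hyp_weight z \<partial>lborel"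
  have shift: "(\<integral>\<^sup>+z. h z * indicator ?D (- 1 / z + of_real c) * hyp_weight z \<partial>lborel) = ?I"
    if c: "c \<in> {0, 1, -1}" for c
  proof -
    let ?g = "\<lambda>z. h z * indicator ?D (z + of_real c)"
    have "(\<integral>\<^sup>+z. h z * indicator ?D (- 1 / z + of_real c) * hyp_weight z \<partial>lborel) = (\<integral>\<^sup>+z. ?g (- 1 / z) * hyp_weight z \<partial>lborel)"
      by (rule nn_integral_cong) (auto simp: hyp_weight_def inv[simplified] split: split_indicator)
    also have "\<dots> = (\<integral>\<^sup>+z. ?g z * hyp_weight z \<partial>lborel)" by (rule hyp_inversion) simp
    also have "\<dots> = (\<integral>\<^sup>+z. (\<lambda>z. h z * indicator ?D z) (z + of_real c) * hyp_weight z \<partial>lborel)"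
      using c per by (intro nn_integral_cong) (auto simp: hyp_weight_def split: split_indicator)
    also have "\<dots> = ?I" by (rule hyp_translation) simp
    finally show ?thesis .
  qed
  have "(\<integral>\<^sup>+z. h z * indicator half_strip z * hyp_weight z \<partial>lborel)
    \<le> (\<integral>\<^sup>+z. h z * indicator ?D z * hyp_weight z + h z * indicator ?D (- 1 / z + of_real 0) * hyp_weight z
        + h z * indicator ?D (- 1 / z + of_real 1) * hyp_weight z + h z * indicator ?D (- 1 / z + of_real (-1)) * hyp_weight z \<partial>lborel)"
  proof (rule nn_integral_mono)
    fix z
    have "indicator half_strip z \<le> (indicator ?D z + indicator ?D (- 1 / z + of_real 0)
        + indicator ?D (- 1 / z + of_real 1) + indicator ?D (- 1 / z + of_real (-1)) :: ennreal)"
    proof (cases "z \<in> half_strip")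
      case True
      from half_strip_cover[OF True] True show ?thesis
        by (elim disjE) (auto simp: add_increasing add_increasing2)
    qed simp
    then have "h z * hyp_weight z * indicator half_strip z \<le> h z * hyp_weight z * (indicator ?D z + indicator ?D (- 1 / z + of_real 0)
        + indicator ?D (- 1 / z + of_real 1) + indicator ?D (- 1 / z + of_real (-1)))"
      by (rule mult_left_mono) simp
    then show "h z * indicator half_strip z * hyp_weight z \<le> h z * indicator ?D z * hyp_weight z + h z * indicator ?D (- 1 / z + of_real 0) * hyp_weight z
        + h z * indicator ?D (- 1 / z + of_real 1) * hyp_weight z + h z * indicator ?D (- 1 / z + of_real (-1)) * hyp_weight z"
      by (simp only: distrib_left ac_simps)
  qed
  also have "\<dots> = ?I + ?I + ?I + ?I"
    by (subst nn_integral_add, measurable)+ (simp only: shift insert_iff simp_thms)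
  also have "\<dots> = 4 * ?I" by (simp only: numeral_Bit0 numeral_One distrib_right mult_1_left add.assoc)
  finally show ?thesis .
qed

section \<open>Fourier expansions and the sup-norm of cusp forms\<close>

lemma norm_exp_2pi_i: "cmod (exp (2 * of_real pi * \<i> * of_nat n * z)) = exp (- 2 * pi * real n * Im z)"
  by (simp add: norm_exp_eq_Re)

lemma exp_2pi_i_power: "exp (2 * of_real pi * \<i> * of_nat n * z) = exp (2 * of_real pi * \<i> * z) ^ n"
  by (simp add: exp_of_nat_mult[symmetric] ac_simps)

lemma periodic_add_int:
  assumes per: "\<And>z. z \<in> upper_half_plane \<Longrightarrow> f (z + 1) = f z" and z: "z \<in> upper_half_plane"
  shows "f (z + of_int n) = f z"
proof -
  have nat: "f (z + of_nat m) = f z" if "z \<in> upper_half_plane" for z m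
    using that
  proof (induction m)
    case (Suc m)
    have "z + of_nat m \<in> upper_half_plane" using Suc.prems by (simp add: upper_half_plane_def)
    from per[OF this] show ?case using Suc by (simp add: ac_simps)
  qed simp
  show ?thesis
  proof (cases "n \<ge> 0")
    case True
    then show ?thesis using nat[OF z, of "nat n"] by simp
  next
    case False
    then have "z + of_int n \<in> upper_half_plane" using z by (simp add: upper_half_plane_def)
    from nat[OF this, of "nat (- n)"] show ?thesis using False by simp
  qed
qed

text \<open>A function of period 1 descends to the punctured unit disc in the variable exp (2 pi i
  z). Decay at the cusp makes 0 a removable singularity with value 0, and the Taylor coefficients
  there are the Fourier coefficients.\<close>

lemma fourier_expansion:
  assumes holo: "f holomorphic_on upper_half_plane"
    and per: "\<And>z. z \<in> upper_half_plane \<Longrightarrow> f (z + 1) = f z"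
    and dec: "\<And>e. e > 0 \<Longrightarrow> \<exists>Y>0. \<forall>z. Im z \<ge> Y \<longrightarrow> cmod (f z) \<le> e"
  shows "\<exists>q :: nat \<Rightarrow> complex. q 0 = 0 \<and>
    (\<forall>z\<in>upper_half_plane. (\<lambda>n. q n * exp (2 * of_real pi * \<i> * of_nat n * z)) sums f z)"
proof -
  define c where "c = 2 * of_real pi * \<i>"
  have c0: "c \<noteq> 0" by (simp add: c_def)
  define h where "h w = f (Ln w / c)" for w
  have ImL: "Im (w / c) = - Re w / (2 * pi)" for w by (simp add: c_def Im_divide power2_eq_square)
  \<comment> \<open>Independence of the choice of logarithm; this is the only use of
    periodicity.\<close>
  have well: "f z = f z'" if zz: "z \<in> upper_half_plane" "z' \<in> upper_half_plane" "exp (c * z) = exp (c * z')" for z z'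
  proof -
    obtain n :: int where "c * z = c * z' + (of_int (2 * n) * pi) * \<i>" using zz(3) by (auto simp: exp_eq)
    then have "c * z = c * (z' + of_int n)" by (simp add: c_def algebra_simps)
    then have "z = z' + of_int n" using c0 by simp
    then show ?thesis using periodic_add_int[where f = f, OF per zz(2)] by simp
  qed
  have inH: "w / c \<in> upper_half_plane" if "cmod (exp w) < 1" for w
    using that by (simp add: upper_half_plane_def ImL field_simps)
  have Lninv: "Ln w / c \<in> upper_half_plane" if "w \<noteq> 0" "cmod w < 1" for w
    using that by (intro inH) simp
  have hz: "h (exp (c * z)) = f z" if z: "z \<in> upper_half_plane" for z
    unfolding h_def
  proof (rule well[OF Lninv z])
    show "cmod (exp (c * z)) < 1" using z by (simp add: c_def upper_half_plane_def)
  qed (use c0 in auto)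
  \<comment> \<open>\<open>h\<close> is defined by the principal logarithm, which jumps along the
    negative axis. On the disc slit along the positive axis instead, Ln (-w) + pi i is another
    logarithm of w, which gives the same values. The two slit discs cover the punctured
    disc.\<close>
  let ?S1 = "ball (0::complex) 1 - \<real>\<^sub>\<le>\<^sub>0" and ?S2 = "ball (0::complex) 1 \<inter> {w. - w \<notin> \<real>\<^sub>\<le>\<^sub>0}"
  have h1: "h holomorphic_on ?S1"
  proof -
    have "(f \<circ> (\<lambda>w. Ln w / c)) holomorphic_on ?S1"
    proof (rule holomorphic_on_compose_gen[OF _ holo])
      show "(\<lambda>w. Ln w / c) ` ?S1 \<subseteq> upper_half_plane" by (auto intro!: Lninv)
    qed (use c0 in \<open>auto intro!: holomorphic_intros\<close>)
    then show ?thesis by (simp add: h_def[abs_def] comp_def)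
  qed
  have h2: "h holomorphic_on ?S2"
  proof -
    have "(f \<circ> (\<lambda>w. (Ln (- w) + of_real pi * \<i>) / c)) holomorphic_on ?S2"
    proof (rule holomorphic_on_compose_gen[OF _ holo])
      show "(\<lambda>w. (Ln (- w) + of_real pi * \<i>) / c) ` ?S2 \<subseteq> upper_half_plane"
      proof safe
        fix w :: complex assume w: "w \<in> ball 0 1" "- w \<notin> \<real>\<^sub>\<le>\<^sub>0"
        then have "w \<noteq> 0" by auto
        then have "exp (Ln (- w) + of_real pi * \<i>) = w" by (simp add: exp_add)
        then show "(Ln (- w) + of_real pi * \<i>) / c \<in> upper_half_plane" using w by (intro inH) simp
      qed
    qed (use c0 in \<open>auto intro!: holomorphic_intros\<close>)
    moreover have "(f \<circ> (\<lambda>w. (Ln (- w) + of_real pi * \<i>) / c)) w = h w" if "w \<in> ?S2" for w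
    proof -
      have w: "w \<noteq> 0" "cmod w < 1" using that by auto
      show ?thesis unfolding h_def comp_def
        by (rule well[OF inH Lninv]) (use w c0 in \<open>auto simp: exp_add exp_pi_i'\<close>)
    qed
    ultimately show ?thesis by (rule holomorphic_transform)
  qed
  have "open {w::complex. - w \<notin> \<real>\<^sub>\<le>\<^sub>0}"
  proof -
    have "{w::complex. - w \<notin> \<real>\<^sub>\<le>\<^sub>0} = uminus -` (- \<real>\<^sub>\<le>\<^sub>0)" by auto
    then show ?thesis using closed_nonpos_Reals_complex by (auto intro!: open_vimage continuous_intros)
  qed
  then have "h holomorphic_on ?S1 \<union> ?S2"
    using closed_nonpos_Reals_complex by (intro holomorphic_on_Un h1 h2) auto
  moreover have "?S1 \<union> ?S2 = ball 0 1 - {0}"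
  proof -
    have real0: "w = 0" if "w \<in> \<real>\<^sub>\<le>\<^sub>0" "w \<in> \<real>\<^sub>\<ge>\<^sub>0" for w :: complex
      using that by (auto simp: complex_nonpos_Reals_iff complex_nonneg_Reals_iff complex_eq_iff)
    show ?thesis
    proof (intro equalityI subsetI)
      fix x assume x: "x \<in> ball (0::complex) 1 - {0}"
      then have "x \<notin> \<real>\<^sub>\<le>\<^sub>0 \<or> x \<notin> \<real>\<^sub>\<ge>\<^sub>0" using real0 by blast
      then show "x \<in> ?S1 \<union> ?S2" using x by auto
    qed auto
  qed
  ultimately have hol: "h holomorphic_on ball 0 1 - {0}" by simp
  have small: "cmod (h w) \<le> e" if w: "w \<noteq> 0" "cmod w < exp (- 2 * pi * Y)" and Y: "Y > 0" "\<forall>z. Im z \<ge> Y \<longrightarrow> cmod (f z) \<le> e" for w Y e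
  proof -
    have "ln (cmod w) \<le> - 2 * pi * Y" using w by (metis exp_ln less_imp_le exp_le_cancel_iff zero_less_norm_iff)
    then have "Im (Ln w / c) \<ge> Y" using w by (simp add: ImL field_simps)
    then show ?thesis using Y by (simp add: h_def)
  qed
  have ev: "eventually (\<lambda>w. cmod (h w) \<le> e) (at 0)" if "e > 0" for e
  proof -
    from dec[OF that] obtain Y where Y: "Y > 0" "\<forall>z. Im z \<ge> Y \<longrightarrow> cmod (f z) \<le> e" by blast
    show ?thesis unfolding eventually_at
      by (intro exI[of _ "exp (- 2 * pi * Y)"]) (auto intro: small[OF _ _ Y])
  qed
  have "\<exists>g. g holomorphic_on ball 0 1 \<and> (\<forall>w\<in>ball 0 1 - {0}. g w = h w)"
    using holomorphic_on_extend_bounded[OF hol] ev[of 1] by auto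
  then obtain g where g: "g holomorphic_on ball 0 1" "\<And>w. w \<in> ball 0 1 - {0} \<Longrightarrow> g w = h w" by blast
  have g0: "g 0 = 0"
  proof -
    have "isCont g 0" using holomorphic_on_imp_continuous_on[OF g(1)] continuous_on_interior[of "ball 0 1" g 0] by simp
    then have l1: "(g \<longlongrightarrow> g 0) (at 0)" by (simp add: isCont_def)
    have "eventually (\<lambda>w. w \<in> ball 0 1 - {0}) (at (0::complex))"
      by (intro eventually_at_in_open) auto
    moreover have "(h \<longlongrightarrow> 0) (at 0)"
    proof (rule tendstoI)
      fix e :: real assume "e > 0"
      then have "eventually (\<lambda>w. cmod (h w) \<le> e / 2) (at 0)" by (intro ev) auto
      then show "eventually (\<lambda>w. dist (h w) 0 < e) (at 0)"
        by eventually_elim (use \<open>e > 0\<close> in auto)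
    qed
    ultimately have "(g \<longlongrightarrow> 0) (at 0)"
      by (subst tendsto_cong[of g h]) (auto elim!: eventually_mono simp: g(2))
    then show ?thesis using l1 by (metis tendsto_unique trivial_limit_at)
  qed
  define q where "q n = (deriv ^^ n) g 0 / fact n" for n
  have "(\<lambda>n. q n * exp (2 * of_real pi * \<i> * of_nat n * z)) sums f z" if z: "z \<in> upper_half_plane" for z
  proof -
    have w: "exp (c * z) \<in> ball 0 1 - {0}" using z by (simp add: c_def upper_half_plane_def)
    then have "(\<lambda>n. (deriv ^^ n) g 0 / fact n * (exp (c * z) - 0) ^ n) sums g (exp (c * z))"
      by (intro holomorphic_power_series[OF g(1)]) auto
    then show ?thesis using g(2)[OF w] hz[OF z] by (simp add: q_def exp_2pi_i_power c_def)
  qed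
  moreover have "q 0 = 0" using g0 by (simp add: q_def)
  ultimately show ?thesis by blast
qed

text \<open>Convergence to 0 as Im z grows, uniformly in Re z, replaces the Fourier expansion. This
  condition passes directly to products and powers.\<close>

lemma cusp_formsI:
  assumes "f holomorphic_on upper_half_plane" "\<And>z. z \<notin> upper_half_plane \<Longrightarrow> f z = 0"
    and mod: "\<And>a b c d :: int. \<And>z. a * d - b * c = 1 \<Longrightarrow> z \<in> upper_half_plane \<Longrightarrow>
      f ((of_int a * z + of_int b) / (of_int c * z + of_int d)) = (of_int c * z + of_int d) ^ k * f z"
    and lim: "(f \<longlongrightarrow> 0) (filtercomap Im at_top)"
  shows "f \<in> cusp_forms k"
proof -
  have dec: "\<exists>Y>0. \<forall>z. Im z \<ge> Y \<longrightarrow> cmod (f z) \<le> e" if "e > 0" for e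
  proof -
    have "eventually (\<lambda>z. dist (f z) 0 < e) (filtercomap Im at_top)" using lim that by (rule tendstoD)
    then obtain Y where "\<And>z. Im z \<ge> Y \<Longrightarrow> dist (f z) 0 < e"
      unfolding eventually_filtercomap_at_top_linorder by blast
    then show ?thesis by (intro exI[of _ "max Y 1"]) (auto intro: less_imp_le)
  qed
  have "f (z + 1) = f z" if "z \<in> upper_half_plane" for z using mod[of 1 1 1 0 z] that by simp
  then show ?thesis using fourier_expansion[OF assms(1) _ dec] assms(1-3) unfolding cusp_forms_def by blast
qed

lemma cusp_form_holomorphic: "f \<in> cusp_forms k \<Longrightarrow> f holomorphic_on upper_half_plane"
  by (simp add: cusp_forms_def)

lemma cusp_form_outside: "f \<in> cusp_forms k \<Longrightarrow> z \<notin> upper_half_plane \<Longrightarrow> f z = 0"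
  by (simp add: cusp_forms_def)

lemma cusp_form_modular:
  "f \<in> cusp_forms k \<Longrightarrow> a * d - b * c = 1 \<Longrightarrow> z \<in> upper_half_plane \<Longrightarrow>
   f ((of_int a * z + of_int b) / (of_int c * z + of_int d)) = (of_int c * z + of_int d) ^ k * f z"
  for a b c d :: int by (simp add: cusp_forms_def)

lemma cusp_form_inversion: "f \<in> cusp_forms k \<Longrightarrow> z \<in> upper_half_plane \<Longrightarrow> f (- 1 / z) = z ^ k * f z"
  using cusp_form_modular[of f k 0 0 "-1" 1 z] by simp

lemma cusp_form_translation:
  "f \<in> cusp_forms k \<Longrightarrow> z \<in> upper_half_plane \<Longrightarrow> f (z + 1) = f z"
  "f \<in> cusp_forms k \<Longrightarrow> z \<in> upper_half_plane \<Longrightarrow> f (z - 1) = f z"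
  using cusp_form_modular[of f k 1 1 1 0 z] cusp_form_modular[of f k 1 1 "-1" 0 z] by auto

lemma cusp_form_expansion:
  assumes "f \<in> cusp_forms k"
  obtains q where "q 0 = 0"
    "\<And>z. z \<in> upper_half_plane \<Longrightarrow> (\<lambda>n. q n * exp (2 * of_real pi * \<i> * of_nat n * z)) sums f z"
    "\<And>t. t > 0 \<Longrightarrow> summable (\<lambda>n. cmod (q n) * exp (- 2 * pi * real n * t))"
proof -
  from assms obtain q where q: "q 0 = 0"
    "\<And>z. z \<in> upper_half_plane \<Longrightarrow> (\<lambda>n. q n * exp (2 * of_real pi * \<i> * of_nat n * z)) sums f z"
    unfolding cusp_forms_def by blast
  have "summable (\<lambda>n. cmod (q n) * exp (- 2 * pi * real n * t))" if t: "t > 0" for t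
  proof -
    \<comment> \<open>Convergence at height t/2 gives absolute convergence at the greater height t,
      where the modulus of the variable is smaller.\<close>
    have "\<i> * of_real (t / 2) \<in> upper_half_plane" using t by (simp add: upper_half_plane_def)
    from q(2)[OF this, unfolded exp_2pi_i_power]
    have "summable (\<lambda>n. q n * exp (2 * of_real pi * \<i> * (\<i> * of_real (t / 2))) ^ n)"
      by (rule sums_summable)
    then have "summable (\<lambda>n. norm (q n * of_real (exp (- 2 * pi * t)) ^ n))"
      by (rule powser_insidea) (use t in auto)
    then show ?thesis by (simp add: norm_mult norm_power exp_of_nat_mult[symmetric] ac_simps)
  qed
  then show ?thesis using q that by blast
qed

text \<open>Every term with n >= 1 is compared with its value at height 1/2: between the heights 1/2
  and y it decays at least as fast as the first harmonic. The added 1 in the constant keeps it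
  positive for the zero form.\<close>

lemma cusp_form_decay:
  assumes "f \<in> cusp_forms k"
  obtains C where "C > 0" "\<And>z. Im z \<ge> 1/2 \<Longrightarrow> cmod (f z) \<le> C * exp (- 2 * pi * Im z)"
proof -
  obtain q where q: "q 0 = 0"
    "\<And>z. z \<in> upper_half_plane \<Longrightarrow> (\<lambda>n. q n * exp (2 * of_real pi * \<i> * of_nat n * z)) sums f z"
    "\<And>t. t > 0 \<Longrightarrow> summable (\<lambda>n. cmod (q n) * exp (- 2 * pi * real n * t))"
    by (rule cusp_form_expansion[OF assms], rule that)
  define S where "S = (\<Sum>n. cmod (q n) * exp (- 2 * pi * real n * (1/2)))"
  have S0: "S \<ge> 0" unfolding S_def using q(3)[of "1/2"] by (intro suminf_nonneg) auto
  have "cmod (f z) \<le> (S * exp pi + 1) * exp (- 2 * pi * Im z)" if z: "Im z \<ge> 1/2" for z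
  proof -
    have zH: "z \<in> upper_half_plane" using z by (simp add: upper_half_plane_def)
    have le: "cmod (q n * exp (2 * of_real pi * \<i> * of_nat n * z))
        \<le> (cmod (q n) * exp (- 2 * pi * real n * (1/2))) * (exp pi * exp (- 2 * pi * Im z))" for n
    proof (cases "n = 0")
      case False
      have "real n * Im z \<ge> real n * (1/2) - 1/2 + Im z"
      proof -
        have "(real n - 1) * Im z \<ge> (real n - 1) * (1/2)" using False z by (intro mult_left_mono) auto
        then show ?thesis by (simp add: algebra_simps diff_divide_distrib)
      qed
      then have "2 * pi * (real n * Im z) \<ge> 2 * pi * (real n * (1/2) - 1/2 + Im z)" by (intro mult_left_mono) auto
      then have "exp (- 2 * pi * real n * Im z) \<le> exp (- 2 * pi * real n * (1/2) + (pi + - 2 * pi * Im z))"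
        by (simp add: algebra_simps)
      then have "cmod (q n) * exp (- 2 * pi * real n * Im z)
          \<le> cmod (q n) * (exp (- 2 * pi * real n * (1/2)) * (exp pi * exp (- 2 * pi * Im z)))"
        unfolding exp_add by (intro mult_left_mono) auto
      then show ?thesis by (simp add: norm_mult norm_exp_2pi_i mult.assoc)
    qed (simp add: q)
    have "cmod (f z) \<le> (\<Sum>n. (cmod (q n) * exp (- 2 * pi * real n * (1/2))) * (exp pi * exp (- 2 * pi * Im z)))"
      unfolding sums_unique[OF q(2)[OF zH]]
      by (rule norm_suminf_le[OF le]) (intro summable_mult2 q(3), simp)
    also have "\<dots> = S * (exp pi * exp (- 2 * pi * Im z))"
      unfolding S_def by (rule suminf_mult2[symmetric]) (intro q(3), simp)
    also have "\<dots> \<le> (S * exp pi + 1) * exp (- 2 * pi * Im z)" by (simp add: algebra_simps)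
    finally show ?thesis .
  qed
  then show ?thesis using S0 that[of "S * exp pi + 1"] by (simp add: add_nonneg_pos)
qed

lemma cusp_form_measurable:
  assumes "f \<in> cusp_forms k" shows "f \<in> borel_measurable borel"
proof -
  have "continuous_on upper_half_plane f"
    by (rule holomorphic_on_imp_continuous_on[OF cusp_form_holomorphic[OF assms]])
  then have "(\<lambda>z. indicator upper_half_plane z *\<^sub>R f z) \<in> borel_measurable borel"
    by (intro borel_measurable_continuous_on_indicator) auto
  also have "(\<lambda>z. indicator upper_half_plane z *\<^sub>R f z) = f"
    using cusp_form_outside[OF assms] by (auto simp: fun_eq_iff indicator_def)
  finally show ?thesis .
qed

lemma cusp_form_tendsto:
  assumes "f \<in> cusp_forms k" shows "(f \<longlongrightarrow> 0) (filtercomap Im at_top)"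
proof -
  obtain C where C: "C > 0" "\<And>z. Im z \<ge> 1/2 \<Longrightarrow> cmod (f z) \<le> C * exp (- 2 * pi * Im z)"
    using cusp_form_decay[OF assms] by blast
  have "((\<lambda>y. C * exp (- 2 * pi * y)) \<longlongrightarrow> C * 0) at_top"
    by (intro tendsto_mult tendsto_const filterlim_compose[OF exp_at_bot] filterlim_tendsto_neg_mult_at_bot[OF tendsto_const])
       (auto simp: filterlim_ident)
  then have "((\<lambda>z. C * exp (- 2 * pi * Im z)) \<longlongrightarrow> 0) (filtercomap Im at_top)"
    using filterlim_compose[OF _ filterlim_filtercomap] by fastforce
  moreover have "eventually (\<lambda>z. norm (f z) \<le> C * exp (- 2 * pi * Im z)) (filtercomap Im at_top)"
    unfolding eventually_filtercomap_at_top_linorder using C(2) by blast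
  ultimately show ?thesis by (rule Lim_null_comparison[rotated])
qed

lemma cusp_form_power:
  assumes f: "f \<in> cusp_forms k" and m: "m \<ge> 1"
  shows "(\<lambda>z. f z ^ m) \<in> cusp_forms (k * m)"
proof (rule cusp_formsI)
  show "(\<lambda>z. f z ^ m) holomorphic_on upper_half_plane"
    by (intro holomorphic_intros cusp_form_holomorphic[OF f])
  show "f z ^ m = 0" if "z \<notin> upper_half_plane" for z using cusp_form_outside[OF f that] m by simp
  show "f ((of_int a * z + of_int b) / (of_int c * z + of_int d)) ^ m = (of_int c * z + of_int d) ^ (k * m) * f z ^ m"
    if "a * d - b * c = 1" "z \<in> upper_half_plane" for a b c d :: int and z
    using cusp_form_modular[OF f that] by (simp add: power_mult_distrib power_mult)
  show "((\<lambda>z. f z ^ m) \<longlongrightarrow> 0) (filtercomap Im at_top)"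
    using tendsto_power[OF cusp_form_tendsto[OF f], of m] m by (simp add: power_0_left)
qed

section \<open>Parseval's identity on horizontal lines\<close>

lemma integral_exp_2pi_i:
  fixes l :: int
  shows "(LINT x|lborel. indicator {-1/2..1/2} x *\<^sub>R exp (2 * of_real pi * \<i> * of_int l * of_real x)) = (if l = 0 then 1 else 0 :: complex)"
proof (cases "l = 0")
  case True
  then show ?thesis by simp
next
  case False
  define c where "c = 2 * of_real pi * \<i> * (of_int l :: complex)"
  have c: "c \<noteq> 0" using False by (simp add: c_def)
  have "(LINT x|lborel. indicator {-1/2..1/2} x *\<^sub>R exp (c * of_real x)) = exp (c * of_real (1/2)) / c - exp (c * of_real (-1/2)) / c"
  proof (rule integral_FTC_Icc)
    show "((\<lambda>x. exp (c * of_real x) / c) has_vector_derivative exp (c * of_real x)) (at x within {-1/2..1/2})" for x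
    proof -
      have "((\<lambda>w. exp (c * w) / c) has_field_derivative exp (c * of_real x)) (at (of_real x))"
        using c by (auto intro!: derivative_eq_intros)
      from has_vector_derivative_real_field[OF this] show ?thesis .
    qed
    show "continuous_on {-1/2..1/2} (\<lambda>x. exp (c * complex_of_real x))" by (intro continuous_intros)
  qed simp
  also have "exp (c * of_real (1/2)) = exp (c * of_real (-1/2))"
    unfolding exp_eq by (rule exI[of _ l]) (simp add: c_def)
  finally show ?thesis using False by (simp add: c_def mult.assoc)
qed

lemma fourier_partial_parseval:
  fixes c :: "nat \<Rightarrow> complex"
  shows "(LINT x|lborel. indicator {-1/2..1/2} x *\<^sub>R (cmod (\<Sum>n<M. c n * exp (2 * of_real pi * \<i> * of_nat n * of_real x)))\<^sup>2)
    = (\<Sum>n<M. (cmod (c n))\<^sup>2)"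
proof -
  let ?e = "\<lambda>(l::int) (x::real). exp (2 * of_real pi * \<i> * of_int l * of_real x)"
  have int: "integrable lborel (\<lambda>x. indicator {-1/2..1/2} x *\<^sub>R ?e l x)" for l
    by (rule borel_integrable_compact) (auto intro!: continuous_intros)
  have expand: "complex_of_real (indicator {-1/2..1/2} x *\<^sub>R (cmod (\<Sum>n<M. c n * exp (2 * of_real pi * \<i> * of_nat n * of_real x)))\<^sup>2)
    = (\<Sum>n<M. \<Sum>m<M. (c n * cnj (c m)) * (indicator {-1/2..1/2} x *\<^sub>R ?e (int n - int m) x))" for x
  proof -
    have "?e (int n - int m) x = exp (2 * of_real pi * \<i> * of_nat n * of_real x) * cnj (exp (2 * of_real pi * \<i> * of_nat m * of_real x))" for n m
      by (simp add: exp_cnj exp_add[symmetric] algebra_simps)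
    moreover have "complex_of_real ((cmod (\<Sum>n<M. c n * exp (2 * of_real pi * \<i> * of_nat n * of_real x)))\<^sup>2)
      = (\<Sum>n<M. \<Sum>m<M. (c n * exp (2 * of_real pi * \<i> * of_nat n * of_real x)) * cnj (c m * exp (2 * of_real pi * \<i> * of_nat m * of_real x)))"
      unfolding complex_norm_square cnj_sum sum_product ..
    ultimately show ?thesis
      by (cases "x \<in> {-1/2..1/2}") (auto simp: ac_simps)
  qed
  have "complex_of_real (LINT x|lborel. indicator {-1/2..1/2} x *\<^sub>R (cmod (\<Sum>n<M. c n * exp (2 * of_real pi * \<i> * of_nat n * of_real x)))\<^sup>2)
    = (LINT x|lborel. (\<Sum>n<M. \<Sum>m<M. (c n * cnj (c m)) * (indicator {-1/2..1/2} x *\<^sub>R ?e (int n - int m) x)))"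
    unfolding integral_complex_of_real[symmetric] expand ..
  also have "\<dots> = (\<Sum>n<M. \<Sum>m<M. (LINT x|lborel. (c n * cnj (c m)) * (indicator {-1/2..1/2} x *\<^sub>R ?e (int n - int m) x)))"
  proof -
    have int2: "integrable lborel (\<lambda>x. (c n * cnj (c m)) * (indicator {-1/2..1/2} x *\<^sub>R ?e (int n - int m) x))" for n m
      by (rule integrable_mult_right[OF int])
    have "(LINT x|lborel. (\<Sum>n<M. \<Sum>m<M. (c n * cnj (c m)) * (indicator {-1/2..1/2} x *\<^sub>R ?e (int n - int m) x)))
      = (\<Sum>n<M. (LINT x|lborel. (\<Sum>m<M. (c n * cnj (c m)) * (indicator {-1/2..1/2} x *\<^sub>R ?e (int n - int m) x))))"
      by (rule Bochner_Integration.integral_sum) (intro Bochner_Integration.integrable_sum int2)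
    also have "\<dots> = (\<Sum>n<M. \<Sum>m<M. (LINT x|lborel. (c n * cnj (c m)) * (indicator {-1/2..1/2} x *\<^sub>R ?e (int n - int m) x)))"
      by (intro sum.cong refl Bochner_Integration.integral_sum int2)
    finally show ?thesis .
  qed
  also have "\<dots> = (\<Sum>n<M. \<Sum>m<M. (c n * cnj (c m)) * (if int n - int m = 0 then 1 else 0))"
    unfolding integral_mult_right_zero integral_exp_2pi_i ..
  also have "\<dots> = (\<Sum>n<M. c n * cnj (c n))"
    by (intro sum.cong refl) (simp add: if_distrib[where f = "\<lambda>x. _ * x"] cong: if_cong)
  also have "\<dots> = complex_of_real (\<Sum>n<M. (cmod (c n))\<^sup>2)"
    by (simp only: of_real_sum complex_norm_square)
  finally show ?thesis using of_real_eq_iff by blast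
qed

lemma fourier_parseval:
  fixes c :: "nat \<Rightarrow> complex" and F :: "real \<Rightarrow> complex"
  assumes sum: "summable (\<lambda>n. cmod (c n))"
    and F: "\<And>x. (\<lambda>n. c n * exp (2 * of_real pi * \<i> * of_nat n * of_real x)) sums F x"
    and [measurable]: "F \<in> borel_measurable borel"
  shows "(\<integral>\<^sup>+x. ennreal ((cmod (F x))\<^sup>2) * indicator {-1/2..1/2} x \<partial>lborel) = (\<Sum>n. ennreal ((cmod (c n))\<^sup>2))"
proof -
  let ?P = "\<lambda>M (x::real). \<Sum>n<M. c n * exp (2 * of_real pi * \<i> * of_nat n * of_real x)"
  define S where "S = (\<Sum>n. cmod (c n))"
  have Pb: "cmod (?P M x) \<le> S" for M x
  proof -
    have "cmod (?P M x) \<le> (\<Sum>n<M. cmod (c n))"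
      by (rule order_trans[OF norm_sum]) (simp add: norm_mult)
    also have "\<dots> \<le> S" unfolding S_def by (rule sum_le_suminf[OF sum]) auto
    finally show ?thesis .
  qed
  have PF: "(\<lambda>M. ?P M x) \<longlonglongrightarrow> F x" for x using F[of x] by (simp add: sums_def)
  have [measurable]: "?P M \<in> borel_measurable borel" for M
    by (intro borel_measurable_continuous_onI continuous_intros)
  let ?s = "\<lambda>M x. indicator {-1/2..1/2} x *\<^sub>R (cmod (?P M x))\<^sup>2 :: real"
  let ?f = "\<lambda>x. indicator {-1/2..1/2} x *\<^sub>R (cmod (F x))\<^sup>2 :: real"
  let ?w = "\<lambda>x. indicator {-1/2..1/2::real} x *\<^sub>R S\<^sup>2 :: real"
  have w: "integrable lborel ?w" by simp
  have lim: "AE x in lborel. (\<lambda>M. ?s M x) \<longlonglongrightarrow> ?f x"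
    by (intro AE_I2 tendsto_intros PF)
  have bd: "AE x in lborel. norm (?s M x) \<le> ?w x" for M
    using Pb by (intro AE_I2) (auto simp: indicator_def intro: power_mono)
  have int: "integrable lborel ?f"
    by (rule integrable_dominated_convergence[OF _ _ w lim bd]) auto
  have "(\<lambda>M. integral\<^sup>L lborel (?s M)) \<longlonglongrightarrow> integral\<^sup>L lborel ?f"
    by (rule integral_dominated_convergence[OF _ _ w lim bd]) auto
  then have sums: "(\<lambda>n. (cmod (c n))\<^sup>2) sums (integral\<^sup>L lborel ?f)"
    unfolding fourier_partial_parseval sums_def .
  have "(\<integral>\<^sup>+x. ennreal ((cmod (F x))\<^sup>2) * indicator {-1/2..1/2} x \<partial>lborel) = (\<integral>\<^sup>+x. ennreal (?f x) \<partial>lborel)"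
    by (rule nn_integral_cong) (auto simp: indicator_def)
  also have "\<dots> = ennreal (integral\<^sup>L lborel ?f)"
    by (rule nn_integral_eq_integral[OF int]) auto
  also have "\<dots> = (\<Sum>n. ennreal ((cmod (c n))\<^sup>2))"
    using sums by (subst suminf_ennreal2) (auto simp: sums_iff)
  finally show ?thesis .
qed

section \<open>The norm of a cusp form in terms of its Fourier coefficients\<close>

text \<open>The squared norm as an element of \<open>ennreal\<close>, so that estimates need no
  prior integrability; the Bochner integral in \<open>petersson\<close> would return 0 for a
  divergent norm.\<close>

definition petersson_nn :: "nat \<Rightarrow> (complex \<Rightarrow> complex) \<Rightarrow> ennreal" where
  "petersson_nn k f = (\<integral>\<^sup>+z. ennreal ((cmod (f z))\<^sup>2 * Im z ^ k) * indicator fundamental_domain z * hyp_weight z \<partial>lborel)"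

definition strip_nn :: "nat \<Rightarrow> (complex \<Rightarrow> complex) \<Rightarrow> ennreal" where
  "strip_nn k f = (\<integral>\<^sup>+z. ennreal ((cmod (f z))\<^sup>2 * Im z ^ k) * indicator half_strip z * hyp_weight z \<partial>lborel)"

text \<open>|f z|^2 (Im z)^k is invariant under the generators z + 1 and -1/z, because Im (-1/z) =
  Im z / |z|^2 compensates the factor of automorphy.\<close>

lemma strip_nn_le_petersson_nn:
  assumes f: "f \<in> cusp_forms k" shows "strip_nn k f \<le> 4 * petersson_nn k f"
  unfolding strip_nn_def petersson_nn_def
proof (rule half_strip_integral_le)
  note [measurable] = cusp_form_measurable[OF f]
  show "(\<lambda>z. ennreal ((cmod (f z))\<^sup>2 * Im z ^ k)) \<in> borel_measurable borel" by measurable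
  fix z assume z: "z \<in> upper_half_plane"
  have "z \<noteq> 0" using z by (auto simp: upper_half_plane_def)
  have "Im (- 1 / z) = Im z / (cmod z)\<^sup>2" by (simp add: Im_divide cmod_power2)
  then have "(cmod (f (- 1 / z)))\<^sup>2 * Im (- 1 / z) ^ k = ((cmod z)\<^sup>2) ^ k * (cmod (f z))\<^sup>2 * (Im z ^ k / ((cmod z)\<^sup>2) ^ k)"
    unfolding cusp_form_inversion[OF f z]
    by (simp add: norm_mult norm_power power_mult_distrib power_divide flip: power_mult) (simp add: mult.commute)
  also have "\<dots> = (cmod (f z))\<^sup>2 * Im z ^ k" using \<open>z \<noteq> 0\<close> by simp
  finally show "ennreal ((cmod (f (- 1 / z)))\<^sup>2 * Im (- 1 / z) ^ k) = ennreal ((cmod (f z))\<^sup>2 * Im z ^ k)" by simp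
  show "ennreal ((cmod (f (z + 1)))\<^sup>2 * Im (z + 1) ^ k) = ennreal ((cmod (f z))\<^sup>2 * Im z ^ k)"
    "ennreal ((cmod (f (z - 1)))\<^sup>2 * Im (z - 1) ^ k) = ennreal ((cmod (f z))\<^sup>2 * Im z ^ k)"
    using cusp_form_translation[OF f z] by simp_all
qed

text \<open>An incomplete gamma integral: the squared norm of the n-th harmonic on the strip.
  Writing y ^ k / y^2 avoids the truncated exponent k - 2 when k = 1.\<close>

definition fourier_weight :: "nat \<Rightarrow> nat \<Rightarrow> ennreal" where
  "fourier_weight k n = (\<integral>\<^sup>+y. ennreal (y ^ k / y\<^sup>2 * exp (- 4 * pi * real n * y)) * indicator {1/2..} y \<partial>lborel)"

lemma strip_nn_fourier:
  assumes f: "f \<in> cusp_forms k"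
    and q: "\<And>z. z \<in> upper_half_plane \<Longrightarrow> (\<lambda>n. q n * exp (2 * of_real pi * \<i> * of_nat n * z)) sums f z"
    and s: "\<And>t. t > 0 \<Longrightarrow> summable (\<lambda>n. cmod (q n) * exp (- 2 * pi * real n * t))"
  shows "strip_nn k f = (\<Sum>n. ennreal ((cmod (q n))\<^sup>2) * fourier_weight k n)"
proof -
  note [measurable] = cusp_form_measurable[OF f]
  have [measurable]: "half_strip \<in> sets borel" unfolding half_strip_def by measurable
  let ?w = "\<lambda>y::real. ennreal (y ^ k / y\<^sup>2) * indicator {1/2..} y"
  have line: "(\<integral>\<^sup>+x. ennreal ((cmod (f (Complex x y)))\<^sup>2) * indicator {-1/2..1/2} x \<partial>lborel)
      = (\<Sum>n. ennreal ((cmod (q n))\<^sup>2 * exp (- 4 * pi * real n * y)))" if y: "y > 0" for y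
  proof -
    define c where "c n = q n * of_real (exp (- 2 * pi * real n * y))" for n
    have "(\<integral>\<^sup>+x. ennreal ((cmod (f (Complex x y)))\<^sup>2) * indicator {-1/2..1/2} x \<partial>lborel) = (\<Sum>n. ennreal ((cmod (c n))\<^sup>2))"
    proof (rule fourier_parseval)
      show "summable (\<lambda>n. cmod (c n))" using s[OF y] by (simp add: c_def norm_mult)
      fix x
      have "q n * exp (2 * of_real pi * \<i> * of_nat n * Complex x y) = c n * exp (2 * of_real pi * \<i> * of_nat n * of_real x)" for n
      proof -
        have "2 * of_real pi * \<i> * of_nat n * Complex x y
            = of_real (- 2 * pi * real n * y) + 2 * of_real pi * \<i> * of_nat n * of_real x"
          by (simp add: complex_eq_iff)
        then show ?thesis by (simp only: exp_add c_def exp_of_real mult.assoc)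
      qed
      then show "(\<lambda>n. c n * exp (2 * of_real pi * \<i> * of_nat n * of_real x)) sums f (Complex x y)"
        using q[of "Complex x y"] y by (simp add: upper_half_plane_def)
    qed measurable
    moreover have "(cmod (c n))\<^sup>2 = (cmod (q n))\<^sup>2 * exp (- 4 * pi * real n * y)" for n
      by (simp add: c_def norm_mult power_mult_distrib flip: exp_double)
    ultimately show ?thesis by simp
  qed
  have "strip_nn k f = (\<integral>\<^sup>+x. (\<integral>\<^sup>+y. ennreal ((cmod (f (Complex x y)))\<^sup>2) * indicator {-1/2..1/2} x * ?w y \<partial>lborel) \<partial>lborel)"
    unfolding strip_nn_def
    by (subst nn_integral_lborel_complex)
       (auto simp: half_strip_def hyp_weight_def upper_half_plane_def indicator_def ennreal_mult[symmetric] intro!: nn_integral_cong)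
  also have "\<dots> = (\<integral>\<^sup>+y. (\<integral>\<^sup>+x. ennreal ((cmod (f (Complex x y)))\<^sup>2) * indicator {-1/2..1/2} x * ?w y \<partial>lborel) \<partial>lborel)"
    by (rule lborel_pair.Fubini'[symmetric]) measurable
  also have "\<dots> = (\<integral>\<^sup>+y. (\<Sum>n. ennreal ((cmod (q n))\<^sup>2) * (ennreal (y ^ k / y\<^sup>2 * exp (- 4 * pi * real n * y)) * indicator {1/2..} y)) \<partial>lborel)"
  proof (rule nn_integral_cong)
    fix y :: real
    have "(\<integral>\<^sup>+x. ennreal ((cmod (f (Complex x y)))\<^sup>2) * indicator {-1/2..1/2} x * ?w y \<partial>lborel)
      = (\<integral>\<^sup>+x. ennreal ((cmod (f (Complex x y)))\<^sup>2) * indicator {-1/2..1/2} x \<partial>lborel) * ?w y"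
      by (rule nn_integral_multc) measurable
    also have "\<dots> = (\<Sum>n. ennreal ((cmod (q n))\<^sup>2) * (ennreal (y ^ k / y\<^sup>2 * exp (- 4 * pi * real n * y)) * indicator {1/2..} y))"
    proof (cases "y \<ge> 1/2")
      case True
      then have "y > 0" by simp
      then show ?thesis unfolding line[OF \<open>y > 0\<close>] ennreal_suminf_multc[symmetric]
        using True by (intro suminf_cong) (simp add: ennreal_mult'[symmetric] ac_simps)
    qed simp
    finally show "(\<integral>\<^sup>+x. ennreal ((cmod (f (Complex x y)))\<^sup>2) * indicator {-1/2..1/2} x * ?w y \<partial>lborel)
      = (\<Sum>n. ennreal ((cmod (q n))\<^sup>2) * (ennreal (y ^ k / y\<^sup>2 * exp (- 4 * pi * real n * y)) * indicator {1/2..} y))" .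
  qed
  also have "\<dots> = (\<Sum>n. ennreal ((cmod (q n))\<^sup>2) * fourier_weight k n)"
    unfolding fourier_weight_def
    by (subst nn_integral_suminf) (auto intro!: suminf_cong nn_integral_cmult)
  finally show ?thesis .
qed

section \<open>The pointwise bound for cusp forms\<close>

lemma ln_add_one_ge_quadratic:
  fixes s :: real assumes "\<bar>s\<bar> \<le> 1/2" shows "s - 2 * s\<^sup>2 \<le> ln (1 + s)"
  using abs_ln_one_plus_x_minus_x_bound[OF assms] by linarith

text \<open>Only a window around y is kept. For t = y (1 + u) the logarithm of t^k exp (-4 pi n t)
  changes by about D u - O(k u^2) with D = k - 4 pi n y. On a window of width of order 1/sqrt k,
  placed on the side where D u is positive, the quadratic loss is bounded and the gain is |D| / (8
  sqrt k). This gain makes the dual sum over n converge.\<close>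

lemma fourier_weight_lower:
  assumes k: "k \<ge> 1" and y: "y \<ge> 4/5"
  shows "ennreal (y ^ k / y * exp (- 4 * pi * real n * y) * exp (\<bar>real k - 4 * pi * real n * y\<bar> / (8 * sqrt (real k))) / (16 * sqrt (real k)))
    \<le> fourier_weight k n"
proof -
  define K where "K = sqrt (real k)"
  have K: "K \<ge> 1" "K\<^sup>2 = real k" using k by (auto simp: K_def)
  define s where "s = 1 / (4 * K)"
  have s: "s > 0" "s \<le> 1/4" using K by (auto simp: s_def field_simps)
  have ks: "real k * s\<^sup>2 = 1/16" using K by (simp add: s_def power_divide power_mult_distrib flip: K(2))
  define D where "D = real k - 4 * pi * real n * y"
  \<comment> \<open>The window is u in [s/2, s] or [-s, -s/2], according to the sign of D; thus D u
    >= |D| s/2 throughout.\<close>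
  define a where "a = (if D \<ge> 0 then s / 2 else - s)"
  have sgn: "D * u \<ge> \<bar>D\<bar> * (s / 2)" "\<bar>u\<bar> \<le> s" if "a \<le> u" "u \<le> a + s / 2" for u
  proof -
    show "\<bar>u\<bar> \<le> s" using that s by (auto simp: a_def split: if_splits)
    show "D * u \<ge> \<bar>D\<bar> * (s / 2)"
    proof (cases "D \<ge> 0")
      case True then show ?thesis using that mult_left_mono[of "s / 2" u D] by (simp add: a_def)
    next
      case False
      then have "(- D) * (s / 2) \<le> (- D) * (- u)" using that by (intro mult_left_mono) (auto simp: a_def)
      then show ?thesis using False by simp
    qed
  qed
  let ?B = "y ^ k / y\<^sup>2 * exp (- 4 * pi * real n * y) * (exp (\<bar>D\<bar> * (s / 2)) * (1/2))"
  let ?I = "{y * (1 + a)..y * (1 + a) + y * (s / 2)}"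
  have low: "?B \<le> t ^ k / t\<^sup>2 * exp (- 4 * pi * real n * t)" if t: "t \<in> ?I" for t
  proof -
    define u where "u = t / y - 1"
    have tu: "t = y * (1 + u)" using y by (simp add: u_def)
    have "y * (1 + a) \<le> y * (1 + u)" "y * (1 + u) \<le> y * (1 + a + s / 2)"
      using t unfolding tu by (auto simp: algebra_simps)
    then have u: "a \<le> u" "u \<le> a + s / 2" using y by auto
    have u1: "\<bar>u\<bar> \<le> 1/4" using sgn(2)[OF u] s by simp
    then have p: "1 + u > 0" by auto
    have "u\<^sup>2 \<le> s\<^sup>2" using sgn(2)[OF u] s by (simp add: abs_le_square_iff[symmetric])
    then have ku: "real k * u\<^sup>2 \<le> 1/16" unfolding ks[symmetric] by (intro mult_left_mono) auto
    have "(1 + u) ^ k = exp (real k * ln (1 + u))" using p by (simp add: exp_of_nat_mult)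
    also have "\<dots> \<ge> exp (real k * (u - 2 * u\<^sup>2))"
      using u1 by (auto intro!: mult_left_mono ln_add_one_ge_quadratic)
    finally have 1: "(1 + u) ^ k \<ge> exp (real k * (u - 2 * u\<^sup>2))" .
    have "exp (\<bar>D\<bar> * (s / 2)) * exp (- 1/8) = exp (\<bar>D\<bar> * (s / 2) - 1/8)" by (simp add: exp_add[symmetric])
    also have "\<dots> \<le> exp (real k * (u - 2 * u\<^sup>2) - 4 * pi * real n * y * u)"
    proof -
      have "real k * (u - 2 * u\<^sup>2) - 4 * pi * real n * y * u = D * u - 2 * (real k * u\<^sup>2)"
        by (simp add: D_def algebra_simps)
      then show ?thesis using sgn(1)[OF u] ku by simp
    qed
    also have "\<dots> \<le> (1 + u) ^ k * exp (- (4 * pi * real n * y * u))"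
      unfolding exp_diff divide_inverse exp_minus using 1 by (intro mult_right_mono) auto
    finally have 2: "exp (\<bar>D\<bar> * (s / 2)) * exp (- 1/8) \<le> (1 + u) ^ k * exp (- (4 * pi * real n * y * u))" .
    have "(1 + u)\<^sup>2 \<le> (5/4)\<^sup>2" using u1 p by (intro power_mono) auto
    then have "1 / (5/4)\<^sup>2 \<le> 1 / (1 + u)\<^sup>2" using p by (intro divide_left_mono) auto
    then have 3: "1 / (1 + u)\<^sup>2 \<ge> 16/25" by (simp add: power_divide)
    have 4: "exp (- 1/8) \<ge> (7/8::real)" using exp_ge_add_one_self[of "- 1/8 :: real"] by simp
    have "exp (\<bar>D\<bar> * (s / 2)) * (1/2) \<le> (exp (\<bar>D\<bar> * (s / 2)) * (7/8)) * (16/25)" by simp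
    also have "\<dots> \<le> ((1 + u) ^ k * exp (- (4 * pi * real n * y * u))) * (1 / (1 + u)\<^sup>2)"
    proof (rule mult_mono)
      have "exp (\<bar>D\<bar> * (s / 2)) * (7/8) \<le> exp (\<bar>D\<bar> * (s / 2)) * exp (- 1/8)" using 4 by (intro mult_left_mono) auto
      then show "exp (\<bar>D\<bar> * (s / 2)) * (7/8) \<le> (1 + u) ^ k * exp (- (4 * pi * real n * y * u))" using 2 by linarith
    qed (use 3 p in auto)
    finally have 5: "exp (\<bar>D\<bar> * (s / 2)) * (1/2) \<le> ((1 + u) ^ k * exp (- (4 * pi * real n * y * u))) * (1 / (1 + u)\<^sup>2)" .
    have "?B \<le> y ^ k / y\<^sup>2 * exp (- 4 * pi * real n * y) * (((1 + u) ^ k * exp (- (4 * pi * real n * y * u))) * (1 / (1 + u)\<^sup>2))"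
      using y by (intro mult_left_mono[OF 5]) auto
    also have "\<dots> = (y * (1 + u)) ^ k / (y * (1 + u))\<^sup>2 * (exp (- 4 * pi * real n * y) * exp (- (4 * pi * real n * y * u)))"
      by (simp add: power_mult_distrib)
    also have "exp (- 4 * pi * real n * y) * exp (- (4 * pi * real n * y * u)) = exp (- 4 * pi * real n * t)"
      unfolding exp_add[symmetric] tu by (simp add: algebra_simps)
    finally show ?thesis by (simp add: tu)
  qed
  \<comment> \<open>The window must stay inside the strip: 4/5 * 3/4 = 3/5 is above 1/2.\<close>
  have half: "y * (1 + a) \<ge> 1/2"
  proof -
    have "1 + a \<ge> 3/4" using s by (simp add: a_def)
    then have "y * (1 + a) \<ge> 4/5 * (3/4)" using y by (intro mult_mono) auto
    then show ?thesis by simp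
  qed
  have B0: "?B \<ge> 0" using y by simp
  have "ennreal (?B * (y * (s / 2))) = (\<integral>\<^sup>+t. ennreal ?B * indicator ?I t \<partial>lborel)"
  proof -
    have "emeasure lborel ?I = ennreal (y * (s / 2))" using y s by simp
    then have "(\<integral>\<^sup>+t. ennreal ?B * indicator ?I t \<partial>lborel) = ennreal ?B * ennreal (y * (s / 2))"
      by (subst nn_integral_cmult_indicator) auto
    then show ?thesis using B0 y s by (subst ennreal_mult) auto
  qed
  also have "\<dots> \<le> fourier_weight k n"
    unfolding fourier_weight_def
  proof (rule nn_integral_mono)
    fix t
    show "ennreal ?B * indicator ?I t \<le> ennreal (t ^ k / t\<^sup>2 * exp (- 4 * pi * real n * t)) * indicator {1/2..} t"
    proof (cases "t \<in> ?I")
      case True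
      then have "t \<ge> 1/2" using half by simp
      then show ?thesis using True low[OF True] by (simp add: ennreal_leI)
    qed simp
  qed
  finally have "ennreal (?B * (y * (s / 2))) \<le> fourier_weight k n" .
  moreover have "?B * (y * (s / 2)) = y ^ k / y * exp (- 4 * pi * real n * y) * exp (\<bar>D\<bar> / (8 * K)) / (16 * K)"
    using y K by (simp add: s_def power2_eq_square)
  ultimately show ?thesis by (simp add: D_def K_def)
qed

lemma geometric_sum_inj_le:
  fixes x :: real assumes "finite A" "inj_on g A" "0 < x" "x < 1"
  shows "(\<Sum>n\<in>A. x ^ g n) \<le> 1 / (1 - x)"
proof -
  have "(\<Sum>n\<in>A. x ^ g n) = (\<Sum>j\<in>g ` A. x ^ j)" using assms by (simp add: sum.reindex)
  also have "\<dots> \<le> (\<Sum>j. x ^ j)" using assms by (intro sum_le_suminf summable_geometric) auto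
  also have "\<dots> = 1 / (1 - x)" using assms by (intro suminf_geometric) auto
  finally show ?thesis .
qed

lemma one_div_one_minus_exp_le:
  fixes \<alpha> :: real assumes "\<alpha> > 0" shows "1 / (1 - exp (- \<alpha>)) \<le> 1 + 1 / \<alpha>"
proof -
  have "1 + \<alpha> \<le> exp \<alpha>" by (rule exp_ge_add_one_self)
  then have "exp (- \<alpha>) \<le> 1 / (1 + \<alpha>)" using assms by (simp add: exp_minus field_simps)
  then have "\<alpha> / (1 + \<alpha>) \<le> 1 - exp (- \<alpha>)" using assms by (simp add: field_simps)
  then have "1 / (1 - exp (- \<alpha>)) \<le> 1 / (\<alpha> / (1 + \<alpha>))" using assms by (intro divide_left_mono) auto
  also have "\<dots> = 1 + 1 / \<alpha>" using assms by (simp add: field_simps)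
  finally show ?thesis .
qed

text \<open>Two geometric series, one on each side of \<beta>/\<alpha>, started at the nearest index
  on that side.\<close>

lemma exp_abs_sum_le:
  fixes \<alpha> \<beta> :: real assumes \<alpha>: "\<alpha> > 0" and A: "finite A"
  shows "(\<Sum>n\<in>A. exp (- \<bar>\<beta> - \<alpha> * real n\<bar>)) \<le> 2 * (1 + 1 / \<alpha>)"
proof -
  define x where "x = exp (- \<alpha>)"
  have x: "0 < x" "x < 1" using \<alpha> by (auto simp: x_def)
  have xp: "exp (- (\<alpha> * real j)) = x ^ j" for j by (simp add: x_def exp_of_nat_mult[symmetric] mult.commute)
  let ?U = "{n\<in>A. \<alpha> * real n \<ge> \<beta>}" and ?L = "{n\<in>A. \<alpha> * real n < \<beta>}"
  have up: "(\<Sum>n\<in>?U. exp (- \<bar>\<beta> - \<alpha> * real n\<bar>)) \<le> 1 / (1 - x)"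
  proof (cases "?U = {}")
    case True then show ?thesis using x by (simp only: sum.empty) simp
  next
    case False
    define n0 where "n0 = Min ?U"
    have n0: "n0 \<in> ?U" unfolding n0_def by (rule Min_in) (use A in simp, fact False)
    have "(\<Sum>n\<in>?U. exp (- \<bar>\<beta> - \<alpha> * real n\<bar>)) \<le> (\<Sum>n\<in>?U. x ^ (n - n0))"
    proof (rule sum_mono)
      fix n assume n: "n \<in> ?U"
      have "n0 \<le> n" using n A by (auto simp: n0_def)
      then have "\<alpha> * real (n - n0) = \<alpha> * real n - \<alpha> * real n0" by (simp add: of_nat_diff algebra_simps)
      then have "\<alpha> * real (n - n0) \<le> \<bar>\<beta> - \<alpha> * real n\<bar>" using n n0 by simp
      then show "exp (- \<bar>\<beta> - \<alpha> * real n\<bar>) \<le> x ^ (n - n0)" unfolding xp[symmetric] by simp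
    qed
    also have "\<dots> \<le> 1 / (1 - x)"
    proof (rule geometric_sum_inj_le)
      have "n0 \<le> n" if "n \<in> ?U" for n using that A by (auto simp: n0_def)
      then show "inj_on (\<lambda>n. n - n0) ?U" by (intro inj_onI) (metis (no_types, lifting) le_add_diff_inverse)
    qed (use A x in auto)
    finally show ?thesis .
  qed
  have lo: "(\<Sum>n\<in>?L. exp (- \<bar>\<beta> - \<alpha> * real n\<bar>)) \<le> 1 / (1 - x)"
  proof (cases "?L = {}")
    case True then show ?thesis using x by (simp only: sum.empty) simp
  next
    case False
    define n1 where "n1 = Max ?L"
    have n1: "n1 \<in> ?L" unfolding n1_def by (rule Max_in) (use A in simp, fact False)
    have "(\<Sum>n\<in>?L. exp (- \<bar>\<beta> - \<alpha> * real n\<bar>)) \<le> (\<Sum>n\<in>?L. x ^ (n1 - n))"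
    proof (rule sum_mono)
      fix n assume n: "n \<in> ?L"
      have "n \<le> n1" using n A by (auto simp: n1_def)
      then have "\<alpha> * real (n1 - n) = \<alpha> * real n1 - \<alpha> * real n" by (simp add: of_nat_diff algebra_simps)
      then have "\<alpha> * real (n1 - n) \<le> \<bar>\<beta> - \<alpha> * real n\<bar>" using n n1 by simp
      then show "exp (- \<bar>\<beta> - \<alpha> * real n\<bar>) \<le> x ^ (n1 - n)" unfolding xp[symmetric] by simp
    qed
    also have "\<dots> \<le> 1 / (1 - x)"
    proof (rule geometric_sum_inj_le)
      have "n \<le> n1" if "n \<in> ?L" for n using that A by (auto simp: n1_def)
      then show "inj_on (\<lambda>n. n1 - n) ?L" by (intro inj_onI) (metis (no_types, lifting) diff_diff_cancel)
    qed (use A x in auto)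
    finally show ?thesis .
  qed
  have "(\<Sum>n\<in>A. exp (- \<bar>\<beta> - \<alpha> * real n\<bar>)) = (\<Sum>n\<in>?U \<union> ?L. exp (- \<bar>\<beta> - \<alpha> * real n\<bar>))"
    by (rule sum.cong) auto
  also have "\<dots> = (\<Sum>n\<in>?U. exp (- \<bar>\<beta> - \<alpha> * real n\<bar>)) + (\<Sum>n\<in>?L. exp (- \<bar>\<beta> - \<alpha> * real n\<bar>))"
    using A by (intro sum.union_disjoint) auto
  also have "\<dots> \<le> 2 * (1 / (1 - x))" using up lo by simp
  also have "\<dots> \<le> 2 * (1 + 1 / \<alpha>)" using one_div_one_minus_exp_le[OF \<alpha>] by (simp add: x_def)
  finally show ?thesis .
qed

text \<open>Without the index 0 the geometric series is 1/(exp u - 1), which is at most 2/u^2;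
  including it would leave a constant that does not decay.\<close>

lemma exp_sum_le_square:
  fixes u :: real assumes u: "u > 0" and A: "finite A" "0 \<notin> A"
  shows "(\<Sum>n\<in>A. exp (- (u * real n))) \<le> 2 / u\<^sup>2"
proof -
  define x where "x = exp (- u)"
  have x: "0 < x" "x < 1" using u by (auto simp: x_def)
  have "(\<Sum>n\<in>A. exp (- (u * real n))) = x * (\<Sum>n\<in>A. x ^ (n - 1))"
  proof -
    have "exp (- (u * real n)) = x * x ^ (n - 1)" if "n \<in> A" for n
    proof -
      have "n \<noteq> 0" using that A by metis
      then have "x * x ^ (n - 1) = x ^ n" by (cases n) auto
      then show ?thesis by (simp add: x_def exp_of_nat_mult[symmetric] mult.commute)
    qed
    then show ?thesis by (simp add: sum_distrib_left)
  qed
  also have "\<dots> \<le> x * (1 / (1 - x))"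
  proof (intro mult_left_mono geometric_sum_inj_le)
    show "inj_on (\<lambda>n. n - 1) A"
    proof (rule inj_onI)
      fix a b assume "a \<in> A" "b \<in> A" "a - 1 = b - 1"
      moreover have "a \<noteq> 0" "b \<noteq> 0" using \<open>a \<in> A\<close> \<open>b \<in> A\<close> A by metis+
      ultimately show "a = b" by linarith
    qed
  qed (use A x in auto)
  also have "\<dots> = 1 / (exp u - 1)" using u by (simp add: x_def exp_minus field_simps)
  also have "\<dots> \<le> 1 / (u\<^sup>2 / 2)"
    using u exp_lower_Taylor_quadratic[of u] by (intro divide_left_mono) auto
  finally show ?thesis by simp
qed

text \<open>For y <= k the effective n lie in a window of width about sqrt k / y around k / (4 pi
  y); the sum is of order 1 + sqrt k / y, so the left side is of order y sqrt k + k, hence at most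
  of order k sqrt y. For y > k every n >= 1 lies beyond the peak, and the exponent is at least a
  multiple of n sqrt y, so the sum is O(1/y).\<close>

lemma sup_bound_numeric:
  assumes k: "k \<ge> 1" and y: "y \<ge> 4/5" and A: "finite A" "0 \<notin> A"
  shows "16 * sqrt (real k) * y * (\<Sum>n\<in>A. exp (- (\<bar>real k - 4 * pi * real n * y\<bar> / (8 * sqrt (real k)))))
    \<le> 60 * real k * min (sqrt (real k)) (sqrt y)"
proof -
  define K Y where "K = sqrt (real k)" and "Y = sqrt y"
  have K: "K \<ge> 1" "real k = K * K" using k by (auto simp: K_def)
  have Y: "Y > 0" "y = Y * Y" using y by (auto simp: Y_def)
  have Y8: "Y \<ge> 8/10"
  proof (rule ccontr)
    assume "\<not> Y \<ge> 8/10"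
    then have "Y * Y < 8/10 * (8/10)" using Y by (intro mult_strict_mono) auto
    then show False using Y y by simp
  qed
  let ?S = "\<Sum>n\<in>A. exp (- (\<bar>real k - 4 * pi * real n * y\<bar> / (8 * K)))"
  show ?thesis
  proof (cases "y \<le> real k")
    case True
    then have YK: "Y \<le> K" by (simp add: K_def Y_def)
    define \<alpha> where "\<alpha> = pi * y / (2 * K)"
    have \<alpha>: "\<alpha> > 0" using y K by (simp add: \<alpha>_def)
    have "\<bar>real k - 4 * pi * real n * y\<bar> / (8 * K) = \<bar>K / 8 - \<alpha> * real n\<bar>" for n
    proof -
      have "(real k - 4 * pi * real n * y) / (8 * K) = K / 8 - \<alpha> * real n"
        using K by (simp add: \<alpha>_def field_simps)
      then show ?thesis using K by (metis abs_divide abs_of_nonneg mult_nonneg_nonneg zero_le_numeral order_trans zero_le_one)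
    qed
    then have "?S \<le> 2 * (1 + 1 / \<alpha>)" using exp_abs_sum_le[OF \<alpha> A(1), of "K / 8"] by simp
    then have "16 * K * y * ?S \<le> 16 * K * y * (2 * (1 + 1 / \<alpha>))" using K y by (intro mult_left_mono) auto
    also have "\<dots> = 32 * (K * y) + 64 * (K * K) / pi" using K y by (simp add: \<alpha>_def field_simps)
    also have "64 * (K * K) / pi \<le> 64 * (K * K) / 3" using pi_gt3 K by (intro divide_left_mono) auto
    also have "32 * (K * y) + 64 * (K * K) / 3 \<le> 60 * (K * K) * min K Y"
    proof -
      have a: "K * y \<le> (K * K) * Y"
        using YK Y K by (simp add: mult_mono mult.assoc)
      have c: "(K * K) * (8/10) \<le> (K * K) * Y" using Y8 K by (intro mult_left_mono) auto
      have P0: "0 \<le> (K * K) * Y" using Y K by simp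
      have "8 * (K * K) \<le> 10 * ((K * K) * Y)" using c by (simp add: field_simps)
      then have "96 * (K * y) + 64 * (K * K) \<le> 180 * ((K * K) * Y)" using a P0 by linarith
      then have "32 * (K * y) + 64 * (K * K) / 3 \<le> 60 * ((K * K) * Y)" by (simp add: field_simps)
      moreover have "min K Y = Y" using YK by simp
      ultimately show ?thesis by simp
    qed
    finally show ?thesis by (simp add: K_def[symmetric] Y_def[symmetric]) (simp add: K(2))
  next
    case False
    then have yk: "real k < y" by simp
    then have KY: "K \<le> Y" by (simp add: K_def Y_def)
    define u where "u = 11/8 * Y"
    have u: "u > 0" using Y by (simp add: u_def)
    have "?S \<le> (\<Sum>n\<in>A. exp (- (u * real n)))"
    proof (rule sum_mono)
      fix n assume "n \<in> A"
      then have n: "real n \<ge> 1" using A(2) by (cases n) auto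
      have "y \<le> real n * y" using n y by (simp add: mult_right_mono[of 1 "real n" y, simplified])
      then have "11 * (real n * y) \<le> 12 * (real n * y) - real k" using yk by linarith
      also have "12 * (real n * y) \<le> 4 * pi * (real n * y)" using pi_gt3 n y by (intro mult_right_mono) auto
      finally have "11 * (real n * y) \<le> \<bar>real k - 4 * pi * real n * y\<bar>" by (simp add: mult.assoc)
      then have q1: "11 * (real n * y) / (8 * K) \<le> \<bar>real k - 4 * pi * real n * y\<bar> / (8 * K)"
        using K by (intro divide_right_mono) auto
      have q2: "u * real n \<le> 11 * (real n * y) / (8 * K)"
      proof -
        have "Y * K \<le> Y * Y" using KY Y by simp
        then have "real n * (Y * K) \<le> real n * (Y * Y)" by (rule mult_left_mono) simp
        then have "u * real n * (8 * K) \<le> 11 * (real n * y)" unfolding u_def Y(2) by (simp add: algebra_simps)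
        then show ?thesis using K by (simp add: pos_le_divide_eq)
      qed
      show "exp (- (\<bar>real k - 4 * pi * real n * y\<bar> / (8 * K))) \<le> exp (- (u * real n))"
        unfolding exp_le_cancel_iff neg_le_iff_le by (rule order_trans[OF q2 q1])
    qed
    also have "\<dots> \<le> 2 / u\<^sup>2" by (rule exp_sum_le_square[OF u A])
    also have "\<dots> \<le> 2 / y"
    proof -
      have "u\<^sup>2 = 121/64 * y" unfolding Y(2) by (simp add: u_def power2_eq_square)
      then show ?thesis using y u by (intro divide_left_mono) auto
    qed
    finally have S: "?S \<le> 2 / y" .
    have "16 * K * y * ?S \<le> 16 * K * y * (2 / y)"
      by (rule mult_left_mono[OF S]) (use K y in simp)
    also have "\<dots> = 32 * K" using y by simp
    also have "\<dots> \<le> 60 * ((K * K) * K)"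
    proof -
      have "1 * 1 \<le> K * K" using K by (intro mult_mono) auto
      then have "1 * K \<le> (K * K) * K" using K by (intro mult_right_mono) auto
      then show ?thesis using K by simp
    qed
    also have "\<dots> = 60 * (K * K) * min K Y" using KY by simp
    finally show ?thesis by (simp add: K_def[symmetric] Y_def[symmetric]) (simp add: K(2))
  qed
qed

text \<open>Weighted Cauchy-Schwarz on the Fourier coefficients, with the lower bound
  \<open>J\<close> for the strip norms of the harmonics as weight. One factor is then at most the
  norm on the strip, the other is the sum estimated in \<open>sup_bound_numeric\<close>. The
  constant 240 is 4 * 60, with the 4 from the comparison with the fundamental domain.\<close>

theorem cusp_form_pointwise_bound:
  assumes f: "f \<in> cusp_forms k" and k: "k \<ge> 1" and y: "Im z \<ge> 4/5"
  shows "ennreal (Im z ^ k * (cmod (f z))\<^sup>2)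
    \<le> ennreal (240 * real k * min (sqrt (real k)) (sqrt (Im z))) * petersson_nn k f"
proof -
  obtain q where q: "q 0 = 0"
    "\<And>z. z \<in> upper_half_plane \<Longrightarrow> (\<lambda>n. q n * exp (2 * of_real pi * \<i> * of_nat n * z)) sums f z"
    "\<And>t. t > 0 \<Longrightarrow> summable (\<lambda>n. cmod (q n) * exp (- 2 * pi * real n * t))"
    by (rule cusp_form_expansion[OF f], rule that)
  define y where "y = Im z"
  have y0: "y > 0" "y \<ge> 4/5" using assms(3) by (auto simp: y_def)
  define T where "T = 60 * real k * min (sqrt (real k)) (sqrt y)"
  have T: "T > 0" using k y0 by (simp add: T_def)
  define J where "J n = y ^ k / y * exp (- 4 * pi * real n * y) * exp (\<bar>real k - 4 * pi * real n * y\<bar> / (8 * sqrt (real k))) / (16 * sqrt (real k))" for n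
  have J: "J n > 0" for n using y0 k by (simp add: J_def)
  have main: "ennreal (y ^ k * (cmod (f z))\<^sup>2) \<le> ennreal T * strip_nn k f"
  proof (cases "strip_nn k f = \<infinity>")
    case True then show ?thesis using T by (simp add: ennreal_mult_top)
  next
    case False
    then obtain m where m: "strip_nn k f = ennreal m" "m \<ge> 0" by (metis ennreal_cases infinity_ennreal_def)
    have partial: "y ^ k * (cmod (\<Sum>n<M. q n * exp (2 * of_real pi * \<i> * of_nat n * z)))\<^sup>2 \<le> T * m" for M
    proof -
      \<comment> \<open>The coefficient at 0 vanishes, and for large y the dual sum is small enough
        only without the index 0.\<close>
      let ?A = "{..<M} - {0}"
      have A: "finite ?A" "0 \<notin> ?A" by auto
      have "ennreal (\<Sum>n\<in>?A. (cmod (q n))\<^sup>2 * J n) = (\<Sum>n\<in>?A. ennreal ((cmod (q n))\<^sup>2) * ennreal (J n))"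
        using J by (subst sum_ennreal[symmetric]) (auto simp: ennreal_mult less_imp_le)
      also have "\<dots> \<le> (\<Sum>n\<in>?A. ennreal ((cmod (q n))\<^sup>2) * fourier_weight k n)"
        unfolding J_def using k y0 by (intro sum_mono mult_left_mono fourier_weight_lower) auto
      also have "\<dots> \<le> (\<Sum>n. ennreal ((cmod (q n))\<^sup>2) * fourier_weight k n)"
        by (rule sum_le_suminf) auto
      also have "\<dots> = ennreal m" by (rule trans[OF strip_nn_fourier[OF f q(2,3), symmetric] m(1)])
      finally have 1: "(\<Sum>n\<in>?A. (cmod (q n))\<^sup>2 * J n) \<le> m" using m by simp
      have "cmod (\<Sum>n<M. q n * exp (2 * of_real pi * \<i> * of_nat n * z)) \<le> (\<Sum>n\<in>?A. cmod (q n) * exp (- 2 * pi * real n * y))"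
      proof -
        have "(\<Sum>n<M. q n * exp (2 * of_real pi * \<i> * of_nat n * z)) = (\<Sum>n\<in>?A. q n * exp (2 * of_real pi * \<i> * of_nat n * z))"
          by (rule sum.mono_neutral_right) (auto simp: q(1))
        also have "cmod \<dots> \<le> (\<Sum>n\<in>?A. cmod (q n * exp (2 * of_real pi * \<i> * of_nat n * z)))" by (rule norm_sum)
        finally show ?thesis by (simp only: norm_mult norm_exp_2pi_i y_def)
      qed
      then have "(cmod (\<Sum>n<M. q n * exp (2 * of_real pi * \<i> * of_nat n * z)))\<^sup>2 \<le> (\<Sum>n\<in>?A. cmod (q n) * exp (- 2 * pi * real n * y))\<^sup>2"
        by (intro power_mono) auto
      also have "(\<Sum>n\<in>?A. cmod (q n) * exp (- 2 * pi * real n * y))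
          = (\<Sum>n\<in>?A. (cmod (q n) * sqrt (J n)) * (exp (- 2 * pi * real n * y) / sqrt (J n)))"
        using J by (intro sum.cong) (auto simp: less_imp_neq[symmetric])
      also have "\<dots>\<^sup>2 \<le> (\<Sum>n\<in>?A. (cmod (q n) * sqrt (J n))\<^sup>2) * (\<Sum>n\<in>?A. (exp (- 2 * pi * real n * y) / sqrt (J n))\<^sup>2)"
        by (rule Cauchy_Schwarz_ineq_sum)
      also have "(\<Sum>n\<in>?A. (cmod (q n) * sqrt (J n))\<^sup>2) = (\<Sum>n\<in>?A. (cmod (q n))\<^sup>2 * J n)"
        using J by (intro sum.cong) (auto simp: power_mult_distrib less_imp_le)
      also have "(\<Sum>n\<in>?A. (exp (- 2 * pi * real n * y) / sqrt (J n))\<^sup>2)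
          = (\<Sum>n\<in>?A. 16 * sqrt (real k) * y / y ^ k * exp (- (\<bar>real k - 4 * pi * real n * y\<bar> / (8 * sqrt (real k)))))"
      proof (rule sum.cong[OF refl])
        fix n
        have "(exp (- 2 * pi * real n * y) / sqrt (J n))\<^sup>2 = exp (- 4 * pi * real n * y) / J n"
          using J[of n] by (simp add: power_divide less_imp_le flip: exp_double)
        also have "\<dots> = 16 * sqrt (real k) * y / y ^ k * exp (- (\<bar>real k - 4 * pi * real n * y\<bar> / (8 * sqrt (real k))))"
          unfolding J_def using y0 by (simp add: exp_minus field_simps)
        finally show "(exp (- 2 * pi * real n * y) / sqrt (J n))\<^sup>2 = 16 * sqrt (real k) * y / y ^ k * exp (- (\<bar>real k - 4 * pi * real n * y\<bar> / (8 * sqrt (real k))))" .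
      qed
      also have "\<dots> = (16 * sqrt (real k) * y * (\<Sum>n\<in>?A. exp (- (\<bar>real k - 4 * pi * real n * y\<bar> / (8 * sqrt (real k)))))) / y ^ k"
        by (simp add: sum_distrib_left sum_divide_distrib)
      finally have "y ^ k * (cmod (\<Sum>n<M. q n * exp (2 * of_real pi * \<i> * of_nat n * z)))\<^sup>2
         \<le> y ^ k * ((\<Sum>n\<in>?A. (cmod (q n))\<^sup>2 * J n) * ((16 * sqrt (real k) * y * (\<Sum>n\<in>?A. exp (- (\<bar>real k - 4 * pi * real n * y\<bar> / (8 * sqrt (real k)))))) / y ^ k))"
        using y0 by (intro mult_left_mono) auto
      also have "\<dots> = (\<Sum>n\<in>?A. (cmod (q n))\<^sup>2 * J n) * (16 * sqrt (real k) * y * (\<Sum>n\<in>?A. exp (- (\<bar>real k - 4 * pi * real n * y\<bar> / (8 * sqrt (real k))))))"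
        using y0 by simp
      also have "\<dots> \<le> m * T"
      proof (rule mult_mono[OF 1])
        show "16 * sqrt (real k) * y * (\<Sum>n\<in>?A. exp (- (\<bar>real k - 4 * pi * real n * y\<bar> / (8 * sqrt (real k))))) \<le> T"
          unfolding T_def by (rule sup_bound_numeric[OF k y0(2) A])
      qed (use m y0 in \<open>auto intro!: mult_nonneg_nonneg sum_nonneg\<close>)
      finally show ?thesis by (simp add: mult.commute)
    qed
    have "z \<in> upper_half_plane" using y0 by (simp add: upper_half_plane_def y_def)
    from q(2)[OF this] have "(\<lambda>M. \<Sum>n<M. q n * exp (2 * of_real pi * \<i> * of_nat n * z)) \<longlonglongrightarrow> f z" by (simp add: sums_def)
    then have "(\<lambda>M. y ^ k * (cmod (\<Sum>n<M. q n * exp (2 * of_real pi * \<i> * of_nat n * z)))\<^sup>2) \<longlonglongrightarrow> y ^ k * (cmod (f z))\<^sup>2"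
      by (intro tendsto_intros)
    then have "y ^ k * (cmod (f z))\<^sup>2 \<le> T * m" using partial by (intro LIMSEQ_le_const2) auto
    then show ?thesis using T m by (simp add: ennreal_mult[symmetric] ennreal_leI)
  qed
  also have "\<dots> \<le> ennreal T * (4 * petersson_nn k f)"
    by (intro mult_left_mono strip_nn_le_petersson_nn[OF f]) auto
  also have "\<dots> = ennreal (4 * T) * petersson_nn k f"
    using T by (simp add: ennreal_mult mult.assoc mult.left_commute)
  also have "4 * T = 240 * real k * min (sqrt (real k)) (sqrt (Im z))" by (simp add: T_def y_def)
  finally show ?thesis by (simp add: y_def)
qed

section \<open>Eisenstein series\<close>

definition lattice_pairs :: "(int \<times> int) set" where
  "lattice_pairs = UNIV - {(0, 0)}"

text \<open>The unnormalised series over all nonzero pairs, coprime or not, so that a unimodular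
  matrix simply permutes the terms. \<open>infsum\<close> is an unordered sum and calls for absolute
  convergence, hence the weights k >= 4.\<close>

definition eisenstein :: "nat \<Rightarrow> complex \<Rightarrow> complex" where
  "eisenstein k z = (\<Sum>\<^sub>\<infinity>(c, d)\<in>lattice_pairs. 1 / (of_int c * z + of_int d) ^ k)"

text \<open>A majorant of product form, whose summability reduces to one variable. Up to a factor 4
  it dominates (c^2 + d^2)^(-2), which is what weight 4 provides.\<close>

definition lattice_bound :: "int \<times> int \<Rightarrow> real" where
  "lattice_bound p = 1 / (1 + (real_of_int (fst p))\<^sup>2) * (1 / (1 + (real_of_int (snd p))\<^sup>2))"

lemma summable_on_inverse_one_plus_square_int:
  "(\<lambda>c::int. 1 / (1 + (real_of_int c)\<^sup>2)) summable_on UNIV"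
proof -
  have nat: "(\<lambda>n::nat. 1 / (1 + (real n)\<^sup>2)) summable_on UNIV"
  proof (rule norm_summable_imp_summable_on, rule summable_comparison_test)
    show "summable (\<lambda>n::nat. 1 / (real n)\<^sup>2 + (if n = 0 then 1 else 0))"
      using inverse_power_summable[of 2, where ?'a = real]
      by (intro summable_add) (auto simp: inverse_eq_divide)
    show "\<exists>N. \<forall>n\<ge>N. norm (norm (1 / (1 + (real n)\<^sup>2))) \<le> 1 / (real n)\<^sup>2 + (if n = 0 then 1 else 0)"
      by (intro exI[of _ 0] allI impI) (auto simp: frac_le add_pos_nonneg abs_of_pos)
  qed
  have 1: "(\<lambda>c::int. 1 / (1 + (real_of_int c)\<^sup>2)) summable_on range int"
    by (subst summable_on_reindex) (use nat in \<open>auto simp: comp_def\<close>)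
  have 2: "(\<lambda>c::int. 1 / (1 + (real_of_int c)\<^sup>2)) summable_on range (\<lambda>n. - int n)"
    by (subst summable_on_reindex) (use nat in \<open>auto simp: comp_def inj_on_def\<close>)
  have "(UNIV :: int set) = range int \<union> range (\<lambda>n. - int n)"
  proof safe
    fix x :: int assume "x \<notin> range (\<lambda>n. - int n)"
    moreover have "x = int (nat x) \<or> x = - int (nat (- x))" by auto
    ultimately show "x \<in> range int" by blast
  qed auto
  then show ?thesis using summable_on_union[OF 1 2] by simp
qed

lemma lattice_bound_nonneg [simp]: "lattice_bound p \<ge> 0"
  by (simp add: lattice_bound_def add_nonneg_nonneg)

lemma lattice_bound_summable: "lattice_bound summable_on A"
proof -
  let ?g = "\<lambda>c::int. 1 / (1 + (real_of_int c)\<^sup>2)"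
  have "(\<lambda>(c, d). ?g c * ?g d) summable_on UNIV \<times> UNIV"
  proof (rule summable_on_SigmaI[where g = "\<lambda>c. ?g c * (\<Sum>\<^sub>\<infinity>d. ?g d)"])
    show "((\<lambda>d. case (c, d) of (c, d) \<Rightarrow> ?g c * ?g d) has_sum ?g c * (\<Sum>\<^sub>\<infinity>d. ?g d)) UNIV" for c
      unfolding prod.case
      by (intro has_sum_cmult_right has_sum_infsum summable_on_inverse_one_plus_square_int)
    show "(\<lambda>c. ?g c * (\<Sum>\<^sub>\<infinity>d. ?g d)) summable_on UNIV"
      by (intro summable_on_cmult_left summable_on_inverse_one_plus_square_int)
  qed (auto intro!: mult_nonneg_nonneg add_nonneg_nonneg)
  then have "lattice_bound summable_on UNIV" by (simp add: lattice_bound_def[abs_def] case_prod_beta')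
  then show ?thesis by (rule summable_on_subset_banach) simp
qed

lemma lattice_pair_square_ge:
  assumes "p \<in> lattice_pairs"
  shows "(real_of_int (fst p))\<^sup>2 + (real_of_int (snd p))\<^sup>2 \<ge> 1"
proof -
  obtain c d where p: "p = (c, d)" by (cases p)
  have "c \<noteq> 0 \<or> d \<noteq> 0" using assms by (auto simp: lattice_pairs_def p)
  then have "c\<^sup>2 + d\<^sup>2 \<ge> 1"
    by (metis int_one_le_iff_zero_less sum_power2_gt_zero_iff)
  then have "real_of_int (c\<^sup>2 + d\<^sup>2) \<ge> 1" by linarith
  then show ?thesis by (simp add: p)
qed

lemma lattice_bound_ge:
  assumes "p \<in> lattice_pairs"
  shows "1 / ((real_of_int (fst p))\<^sup>2 + (real_of_int (snd p))\<^sup>2)\<^sup>2 \<le> 4 * lattice_bound p"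
proof -
  define x y where "x = (real_of_int (fst p))\<^sup>2" and "y = (real_of_int (snd p))\<^sup>2"
  have xy: "x \<ge> 0" "y \<ge> 0" "x + y \<ge> 1" using lattice_pair_square_ge[OF assms] by (auto simp: x_def y_def)
  have "(1 + x) * (1 + y) \<le> 4 * (x + y)\<^sup>2"
  proof -
    have "(1 + x) * (1 + y) \<le> (2 * (x + y)) * (2 * (x + y))" using xy by (intro mult_mono) auto
    then show ?thesis by (simp add: power2_eq_square algebra_simps)
  qed
  moreover have "(1 + x) * (1 + y) > 0" "(x + y)\<^sup>2 > 0" using xy by (auto intro!: mult_pos_pos)
  ultimately have "1 / (x + y)\<^sup>2 \<le> 4 * (1 / ((1 + x) * (1 + y)))" by (simp add: field_simps)
  then show ?thesis by (simp add: lattice_bound_def x_def y_def)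
qed

text \<open>The forms \<open>\<bar>cz + d\<bar>\<^sup>2\<close> are comparable to \<open>c\<^sup>2 + d\<^sup>2\<close>, locally uniformly in \<open>z\<close>.\<close>

lemma lattice_norm_lower:
  assumes "e > 0" "Im z \<ge> e" "\<bar>Re z\<bar> \<le> R"
  shows "(real_of_int c)\<^sup>2 + (real_of_int d)\<^sup>2 \<le> (2 + (2 * R\<^sup>2 + 1) / e\<^sup>2) * (cmod (of_int c * z + of_int d))\<^sup>2"
proof -
  define x y where "x = Re z" and "y = Im z"
  define C D where "C = real_of_int c" and "D = real_of_int d"
  define Q where "Q = (C * x + D)\<^sup>2 + (C * y)\<^sup>2"
  have Q: "(cmod (of_int c * z + of_int d))\<^sup>2 = Q"
    by (simp add: Q_def C_def D_def x_def y_def cmod_power2)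
  have "e\<^sup>2 \<le> y\<^sup>2" using assms by (intro power_mono) (auto simp: y_def)
  then have "C\<^sup>2 * e\<^sup>2 \<le> C\<^sup>2 * y\<^sup>2" by (intro mult_left_mono) auto
  also have "\<dots> \<le> Q" by (simp add: Q_def power_mult_distrib)
  finally have 1: "C\<^sup>2 \<le> Q / e\<^sup>2" using assms by (simp add: field_simps)
  have "D\<^sup>2 \<le> 2 * (C * x + D)\<^sup>2 + 2 * (C * x)\<^sup>2"
  proof -
    have "0 \<le> ((C * x + D) + C * x)\<^sup>2" by simp
    then show ?thesis by (simp add: power2_eq_square algebra_simps)
  qed
  moreover have "(C * x)\<^sup>2 \<le> C\<^sup>2 * R\<^sup>2"
  proof -
    have "\<bar>x\<bar>\<^sup>2 \<le> R\<^sup>2" using assms by (intro power_mono) (auto simp: x_def)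
    then show ?thesis by (simp add: power_mult_distrib mult_left_mono)
  qed
  moreover have "(C * x + D)\<^sup>2 \<le> Q" by (simp add: Q_def)
  ultimately have "C\<^sup>2 + D\<^sup>2 \<le> 2 * Q + (2 * R\<^sup>2 + 1) * C\<^sup>2" by (simp add: algebra_simps)
  also have "\<dots> \<le> 2 * Q + (2 * R\<^sup>2 + 1) * (Q / e\<^sup>2)" by (intro add_left_mono mult_left_mono 1) auto
  finally show ?thesis unfolding Q C_def[symmetric] D_def[symmetric] by (simp add: algebra_simps add_divide_distrib)
qed

text \<open>The factor A ^ k is wasteful, but only local uniformity in z for a fixed weight is at
  stake here; it feeds the Weierstrass test.\<close>

lemma eisenstein_term_bound:
  assumes "e > 0" "Im z \<ge> e" "\<bar>Re z\<bar> \<le> R" and p: "p \<in> lattice_pairs" and k: "k \<ge> 4"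
  defines "A \<equiv> 2 + (2 * R\<^sup>2 + 1) / e\<^sup>2"
  shows "cmod (1 / (of_int (fst p) * z + of_int (snd p)) ^ k) \<le> A ^ k * (4 * lattice_bound p)"
proof -
  define s where "s = (real_of_int (fst p))\<^sup>2 + (real_of_int (snd p))\<^sup>2"
  define w where "w = cmod (of_int (fst p) * z + of_int (snd p))"
  have A: "A \<ge> 2" by (simp add: A_def)
  have s1: "s \<ge> 1" using lattice_pair_square_ge[OF p] by (simp add: s_def)
  have sw: "s \<le> A * w\<^sup>2" using lattice_norm_lower[OF assms(1-3), of "fst p" "snd p"] by (simp add: s_def w_def A_def)
  have w0: "w > 0"
  proof (rule ccontr)
    assume "\<not> w > 0"
    then have "w = 0" by (simp add: w_def)
    then show False using sw s1 by simp
  qed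
  have "s \<le> A\<^sup>2 * w\<^sup>2"
  proof -
    have "A * 1 \<le> A * A" using A by (intro mult_left_mono) auto
    then have "A * w\<^sup>2 \<le> A\<^sup>2 * w\<^sup>2" by (intro mult_right_mono) (auto simp: power2_eq_square)
    then show ?thesis using sw by linarith
  qed
  then have "s \<le> (A * w)\<^sup>2" by (simp add: power_mult_distrib)
  then have s2: "sqrt s \<le> A * w" using A w0 by (simp add: real_le_lsqrt)
  have "sqrt s ^ 4 = (sqrt s ^ 2)\<^sup>2" by (simp flip: power_mult)
  then have "s\<^sup>2 = sqrt s ^ 4" using s1 by simp
  also have "\<dots> \<le> sqrt s ^ k" using s1 k by (intro power_increasing) auto
  also have "\<dots> \<le> (A * w) ^ k" using s2 s1 by (intro power_mono) auto
  finally have "s\<^sup>2 \<le> A ^ k * w ^ k" by (simp add: power_mult_distrib)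
  then have "1 / w ^ k \<le> A ^ k * (1 / s\<^sup>2)" using s1 w0 by (simp add: field_simps)
  also have "\<dots> \<le> A ^ k * (4 * lattice_bound p)"
    using A lattice_bound_ge[OF p] by (intro mult_left_mono) (auto simp: s_def)
  finally show ?thesis by (simp add: w_def norm_divide norm_power)
qed

lemma eisenstein_eq: "eisenstein k z = (\<Sum>\<^sub>\<infinity>p\<in>lattice_pairs. 1 / (of_int (fst p) * z + of_int (snd p)) ^ k)"
  by (simp add: eisenstein_def case_prod_beta')

lemma lattice_form_nonzero:
  assumes "z \<in> upper_half_plane" "p \<in> lattice_pairs" shows "of_int (fst p) * z + of_int (snd p) \<noteq> 0"
proof
  assume 0: "of_int (fst p) * z + of_int (snd p) = 0"
  then have "Im (of_int (fst p) * z + of_int (snd p)) = 0" by simp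
  then have "fst p = 0" using assms by (simp add: upper_half_plane_def)
  then show False using 0 assms by (auto simp: lattice_pairs_def prod_eq_iff)
qed

lemma eisenstein_holomorphic:
  assumes k: "k \<ge> 4" shows "eisenstein k holomorphic_on upper_half_plane"
proof -
  have "eisenstein k holomorphic_on ball z (Im z / 2)" if z: "z \<in> upper_half_plane" for z
  proof -
    define e where "e = Im z / 2"
    have e: "e > 0" using z by (simp add: e_def upper_half_plane_def)
    define R where "R = \<bar>Re z\<bar> + e"
    have near: "Im w \<ge> e" "\<bar>Re w\<bar> \<le> R" if "w \<in> cball z e" for w
      using that abs_Re_le_cmod[of "z - w"] abs_Im_le_cmod[of "z - w"] by (auto simp: dist_norm e_def R_def)
    have wH: "w \<in> upper_half_plane" if "w \<in> cball z e" for w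
      using near(1)[OF that] e by (simp add: upper_half_plane_def)
    let ?t = "\<lambda>p w. 1 / (of_int (fst p) * w + of_int (snd p)) ^ k :: complex"
    have ul: "uniform_limit (cball z e) (\<lambda>X w. \<Sum>p\<in>X. ?t p w) (\<lambda>w. \<Sum>\<^sub>\<infinity>p\<in>lattice_pairs. ?t p w) (finite_subsets_at_top lattice_pairs)"
      by (rule Weierstrass_m_test_general[OF eisenstein_term_bound[OF e near _ k]])
         (auto intro!: summable_on_cmult_right lattice_bound_summable)
    have ev: "eventually (\<lambda>X. continuous_on (cball z e) (\<lambda>w. \<Sum>p\<in>X. ?t p w) \<and> (\<lambda>w. \<Sum>p\<in>X. ?t p w) holomorphic_on ball z e) (finite_subsets_at_top lattice_pairs)"
    proof (rule eventually_finite_subsets_at_top_weakI)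
      fix X assume X: "finite X" "X \<subseteq> lattice_pairs"
      have "(\<lambda>w. \<Sum>p\<in>X. ?t p w) holomorphic_on cball z e"
        using X wH lattice_form_nonzero by (intro holomorphic_intros) (auto simp: subset_iff)
      then show "continuous_on (cball z e) (\<lambda>w. \<Sum>p\<in>X. ?t p w) \<and> (\<lambda>w. \<Sum>p\<in>X. ?t p w) holomorphic_on ball z e"
        using holomorphic_on_imp_continuous_on holomorphic_on_subset ball_subset_cball by blast
    qed
    obtain "(\<lambda>w. \<Sum>\<^sub>\<infinity>p\<in>lattice_pairs. ?t p w) holomorphic_on ball z e"
      using holomorphic_uniform_limit[OF ev ul] by auto
    then show ?thesis by (simp add: eisenstein_eq[abs_def] e_def)
  qed
  then have "eisenstein k holomorphic_on (\<Union>z\<in>upper_half_plane. ball z (Im z / 2))"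
    by (subst holomorphic_on_UN_open) auto
  moreover have "upper_half_plane \<subseteq> (\<Union>z\<in>upper_half_plane. ball z (Im z / 2))"
    by (auto simp: upper_half_plane_def)
  ultimately show ?thesis by (rule holomorphic_on_subset)
qed

text \<open>Multiplying the pair (c, d) from the right by the matrix permutes the nonzero pairs,
  with the inverse matrix giving \<open>\<psi>\<close>.\<close>

lemma eisenstein_modular:
  fixes a b c d :: int
  assumes det: "a * d - b * c = 1" and z: "z \<in> upper_half_plane"
  shows "eisenstein k ((of_int a * z + of_int b) / (of_int c * z + of_int d)) = (of_int c * z + of_int d) ^ k * eisenstein k z"
proof -
  define j where "j = of_int c * z + of_int d"
  have "(c, d) \<in> lattice_pairs" using det by (auto simp: lattice_pairs_def)
  from lattice_form_nonzero[OF z this] have j: "j \<noteq> 0" by (simp add: j_def)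
  define \<phi> where "\<phi> p = (fst p * a + snd p * c, fst p * b + snd p * d)" for p :: "int \<times> int"
  define \<psi> where "\<psi> p = (fst p * d - snd p * c, snd p * a - fst p * b)" for p :: "int \<times> int"
  have inv1: "\<psi> (\<phi> p) = p" for p
  proof -
    have "(fst p * a + snd p * c) * d - (fst p * b + snd p * d) * c = fst p * (a * d - b * c)"
      "(fst p * b + snd p * d) * a - (fst p * a + snd p * c) * b = snd p * (a * d - b * c)" by (simp_all add: algebra_simps)
    then show ?thesis unfolding det by (simp add: \<phi>_def \<psi>_def)
  qed
  have inv2: "\<phi> (\<psi> p) = p" for p
  proof -
    have "(fst p * d - snd p * c) * a + (snd p * a - fst p * b) * c = fst p * (a * d - b * c)"
      "(fst p * d - snd p * c) * b + (snd p * a - fst p * b) * d = snd p * (a * d - b * c)" by (simp_all add: algebra_simps)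
    then show ?thesis unfolding det by (simp add: \<phi>_def \<psi>_def)
  qed
  have 0: "\<phi> (0, 0) = (0, 0)" "\<psi> (0, 0) = (0, 0)" by (auto simp: \<phi>_def \<psi>_def)
  have bij: "bij_betw \<phi> lattice_pairs lattice_pairs"
  proof (rule bij_betwI[where g = \<psi>])
    show "\<phi> \<in> lattice_pairs \<rightarrow> lattice_pairs" using inv1 0 by (metis (no_types, lifting) DiffD2 DiffI Pi_I UNIV_I lattice_pairs_def singletonD singletonI)
    show "\<psi> \<in> lattice_pairs \<rightarrow> lattice_pairs" using inv2 0 by (metis (no_types, lifting) DiffD2 DiffI Pi_I UNIV_I lattice_pairs_def singletonD singletonI)
  qed (auto simp: inv1 inv2)
  have "eisenstein k ((of_int a * z + of_int b) / j)
      = (\<Sum>\<^sub>\<infinity>p\<in>lattice_pairs. j ^ k * (1 / (of_int (fst (\<phi> p)) * z + of_int (snd (\<phi> p))) ^ k))"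
    unfolding eisenstein_eq
  proof (rule infsum_cong)
    fix p
    have "of_int (fst p) * ((of_int a * z + of_int b) / j) + of_int (snd p) = (of_int (fst (\<phi> p)) * z + of_int (snd (\<phi> p))) / j"
      using j by (simp add: \<phi>_def j_def field_simps)
    then show "1 / (of_int (fst p) * ((of_int a * z + of_int b) / j) + of_int (snd p)) ^ k
        = j ^ k * (1 / (of_int (fst (\<phi> p)) * z + of_int (snd (\<phi> p))) ^ k)"
      by (simp add: power_divide)
  qed
  also have "\<dots> = j ^ k * (\<Sum>\<^sub>\<infinity>p\<in>lattice_pairs. 1 / (of_int (fst (\<phi> p)) * z + of_int (snd (\<phi> p))) ^ k)"
    by (rule infsum_cmult_right')
  also have "(\<Sum>\<^sub>\<infinity>p\<in>lattice_pairs. 1 / (of_int (fst (\<phi> p)) * z + of_int (snd (\<phi> p))) ^ k) = eisenstein k z"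
    unfolding eisenstein_eq by (rule infsum_reindex_bij_betw[OF bij, of "\<lambda>p. 1 / (of_int (fst p) * z + of_int (snd p)) ^ k"])
  finally show ?thesis by (simp add: j_def)
qed

definition lattice_total :: real where
  "lattice_total = (\<Sum>\<^sub>\<infinity>p. lattice_bound p)"

lemma lattice_sum_bound:
  fixes t :: "int \<times> int \<Rightarrow> complex"
  assumes b: "\<And>p. p \<in> A \<Longrightarrow> cmod (t p) \<le> c * lattice_bound p" and c: "c \<ge> 0"
  shows "t summable_on A" "cmod (infsum t A) \<le> c * lattice_total"
proof -
  have s: "(\<lambda>p. c * lattice_bound p) summable_on A"
    by (intro summable_on_cmult_right lattice_bound_summable)
  have "(\<lambda>p. norm (t p)) summable_on A"
    by (rule Infinite_Sum.abs_summable_on_comparison_test'[OF s b])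
  then show sum: "t summable_on A" by (rule abs_summable_summable)
  have "cmod (infsum t A) \<le> (\<Sum>\<^sub>\<infinity>p\<in>A. c * lattice_bound p)"
    by (rule norm_infsum_le[OF has_sum_infsum[OF sum] has_sum_infsum[OF s] b])
  also have "\<dots> \<le> (\<Sum>\<^sub>\<infinity>p. c * lattice_bound p)"
    using c by (intro infsum_mono2 summable_on_cmult_right lattice_bound_summable) auto
  also have "\<dots> = c * lattice_total" unfolding lattice_total_def by (rule infsum_cmult_right')
  finally show "cmod (infsum t A) \<le> c * lattice_total" .
qed

lemma lattice_total_nonneg: "lattice_total \<ge> 0"
  unfolding lattice_total_def by (rule infsum_nonneg) simp

section \<open>Bounds on the fundamental domain, uniform in the weight\<close>

lemma fundamental_domain_Im:
  assumes "z \<in> fundamental_domain" shows "(Im z)\<^sup>2 \<ge> 3/4" "Im z > 0" "Im z \<ge> 4/5"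
proof -
  have z: "Im z > 0" "\<bar>Re z\<bar> \<le> 1/2" "cmod z \<ge> 1"
    using assms by (auto simp: fundamental_domain_def upper_half_plane_def)
  have "1\<^sup>2 \<le> (cmod z)\<^sup>2" using z by (intro power_mono) auto
  moreover have "\<bar>Re z\<bar>\<^sup>2 \<le> (1/2)\<^sup>2" using z by (intro power_mono) auto
  ultimately show *: "(Im z)\<^sup>2 \<ge> 3/4" by (simp add: cmod_power2 power_divide)
  show "Im z > 0" by fact
  \<comment> \<open>4/5 is a rational number just below sqrt 3 / 2.\<close>
  show "Im z \<ge> 4/5"
  proof (rule power2_le_imp_le)
    show "(4/5)\<^sup>2 \<le> (Im z)\<^sup>2" using * by (simp add: power_divide)
  qed (use z in simp)
qed

text \<open>|cz + d|^2 >= c^2 - |cd| + d^2, a positive integer. With all forms at least 1 in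
  modulus, raising the weight only shrinks the terms, and this is the source of uniformity in
  \<open>k\<close>.\<close>

lemma fundamental_domain_form_ge_1:
  assumes z: "z \<in> fundamental_domain" and p: "p \<in> lattice_pairs"
  shows "cmod (of_int (fst p) * z + of_int (snd p)) \<ge> 1"
proof -
  define c d where "c = fst p" and "d = snd p"
  define C D where "C = real_of_int c" and "D = real_of_int d"
  have zz: "\<bar>Re z\<bar> \<le> 1/2" "(Re z)\<^sup>2 + (Im z)\<^sup>2 \<ge> 1"
  proof -
    have "1\<^sup>2 \<le> (cmod z)\<^sup>2" using z by (intro power_mono) (auto simp: fundamental_domain_def)
    then show "(Re z)\<^sup>2 + (Im z)\<^sup>2 \<ge> 1" by (simp add: cmod_power2)
  qed (use z in \<open>simp add: fundamental_domain_def\<close>)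
  have "2 * (c\<^sup>2 - \<bar>c * d\<bar> + d\<^sup>2) \<ge> c\<^sup>2 + d\<^sup>2"
  proof -
    have "0 \<le> (\<bar>c\<bar> - \<bar>d\<bar>)\<^sup>2" by simp
    then show ?thesis by (simp add: power2_eq_square abs_mult algebra_simps)
  qed
  moreover have "c\<^sup>2 + d\<^sup>2 > 0" using p by (auto simp: lattice_pairs_def c_def d_def sum_power2_gt_zero_iff prod_eq_iff)
  moreover have "S \<le> 2 * A \<Longrightarrow> 0 < S \<Longrightarrow> 1 \<le> A" for A S :: int by linarith
  ultimately have "c\<^sup>2 - \<bar>c * d\<bar> + d\<^sup>2 \<ge> 1" by blast
  then have "real_of_int (c\<^sup>2 - \<bar>c * d\<bar> + d\<^sup>2) \<ge> 1" by linarith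
  then have 1: "C\<^sup>2 - \<bar>C * D\<bar> + D\<^sup>2 \<ge> 1" by (simp add: C_def D_def)
  have "\<bar>2 * (C * D * Re z)\<bar> \<le> \<bar>C * D\<bar> * 1"
  proof -
    have "\<bar>C * D\<bar> * \<bar>2 * Re z\<bar> \<le> \<bar>C * D\<bar> * 1" using zz by (intro mult_left_mono) auto
    then show ?thesis by (simp add: abs_mult ac_simps)
  qed
  then have 2: "2 * (C * D * Re z) \<ge> - \<bar>C * D\<bar>" by linarith
  have 3: "C\<^sup>2 * 1 \<le> C\<^sup>2 * ((Re z)\<^sup>2 + (Im z)\<^sup>2)" using zz by (intro mult_left_mono) auto
  have "(cmod (of_int c * z + of_int d))\<^sup>2 = C\<^sup>2 * ((Re z)\<^sup>2 + (Im z)\<^sup>2) + 2 * (C * D * Re z) + D\<^sup>2"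
    by (simp add: cmod_power2 C_def D_def) (simp add: power2_eq_square algebra_simps)
  then have "(cmod (of_int c * z + of_int d))\<^sup>2 \<ge> 1\<^sup>2" using 1 2 3 by simp
  then show ?thesis unfolding c_def d_def by (rule power2_le_imp_le) simp
qed

lemma fundamental_domain_form_lower:
  assumes z: "z \<in> fundamental_domain"
  shows "(cmod (of_int c * z + of_int d))\<^sup>2 \<ge> ((real_of_int c)\<^sup>2 * (Im z)\<^sup>2 + (real_of_int d)\<^sup>2) / 2"
proof -
  define C D where "C = real_of_int c" and "D = real_of_int d"
  define x y where "x = Re z" and "y = Im z"
  have x: "\<bar>x\<bar> \<le> 1/2" using z by (simp add: fundamental_domain_def x_def)
  have y: "y\<^sup>2 \<ge> 3/4" using fundamental_domain_Im[OF z] by (simp add: y_def)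
  have "\<bar>x\<bar>\<^sup>2 \<le> (1/2)\<^sup>2" using x by (intro power_mono) auto
  then have "4 * x\<^sup>2 \<le> 1" by (simp add: power_divide)
  then have "C\<^sup>2 * (4 * x\<^sup>2) \<le> C\<^sup>2 * 1" by (intro mult_left_mono) auto
  then have a: "4 * (C * x)\<^sup>2 \<le> C\<^sup>2" by (simp add: power_mult_distrib)
  have b: "D\<^sup>2 \<le> 2 * (C * x + D)\<^sup>2 + 2 * (C * x)\<^sup>2"
  proof -
    have "0 \<le> ((C * x + D) + C * x)\<^sup>2" by simp
    then show ?thesis by (simp add: power2_eq_square algebra_simps)
  qed
  have "C\<^sup>2 * (3/4) \<le> C\<^sup>2 * y\<^sup>2" using y by (intro mult_left_mono) auto
  then have c: "3 * C\<^sup>2 \<le> 4 * (C\<^sup>2 * y\<^sup>2)" by simp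
  have "C\<^sup>2 * y\<^sup>2 + D\<^sup>2 \<le> 2 * ((C * x + D)\<^sup>2 + C\<^sup>2 * y\<^sup>2)" using a b c mult_nonneg_nonneg[OF zero_le_power2[of C] zero_le_power2[of y]] by argo
  moreover have "(cmod (of_int c * z + of_int d))\<^sup>2 = (C * x + D)\<^sup>2 + C\<^sup>2 * y\<^sup>2"
    by (simp add: cmod_power2 C_def D_def x_def y_def power_mult_distrib)
  ultimately show ?thesis by (simp add: C_def D_def y_def)
qed

text \<open>Since |cz + d| >= 1, its k-th power may be replaced by the fourth, so the constants do
  not depend on \<open>k\<close>. For c nonzero one factor c^2 y^2 can be extracted; the resulting
  decay in y isolates the constant term.\<close>

lemma eisenstein_term_fundamental_domain:
  assumes z: "z \<in> fundamental_domain" and p: "p \<in> lattice_pairs" and k: "k \<ge> 4"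
  shows "cmod (1 / (of_int (fst p) * z + of_int (snd p)) ^ k) \<le> 64 * lattice_bound p"
    and "fst p \<noteq> 0 \<Longrightarrow> cmod (1 / (of_int (fst p) * z + of_int (snd p)) ^ k) \<le> 16 / (Im z)\<^sup>2 * lattice_bound p"
proof -
  define C2 D2 where "C2 = (real_of_int (fst p))\<^sup>2" and "D2 = (real_of_int (snd p))\<^sup>2"
  define w where "w = cmod (of_int (fst p) * z + of_int (snd p))"
  define Y where "Y = (Im z)\<^sup>2"
  have Y: "Y \<ge> 3/4" "Y > 0" using fundamental_domain_Im[OF z] by (auto simp: Y_def)
  have w1: "w \<ge> 1" using fundamental_domain_form_ge_1[OF z p] by (simp add: w_def)
  have w2: "w\<^sup>2 \<ge> (C2 * Y + D2) / 2" using fundamental_domain_form_lower[OF z] by (simp add: w_def C2_def D2_def Y_def)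
  have CD: "C2 \<ge> 0" "D2 \<ge> 0" "C2 + D2 \<ge> 1" using lattice_pair_square_ge[OF p] by (auto simp: C2_def D2_def)
  have "w ^ 4 \<le> w ^ k" using w1 k by (intro power_increasing) auto
  then have wk: "1 / w ^ k \<le> 1 / (w\<^sup>2)\<^sup>2" using w1 by (intro divide_left_mono) (auto simp flip: power_mult)
  have E: "cmod (1 / (of_int (fst p) * z + of_int (snd p)) ^ k) = 1 / w ^ k"
    by (simp add: w_def norm_divide norm_power)
  have lb: "lattice_bound p = 1 / ((1 + C2) * (1 + D2))" by (simp add: lattice_bound_def C2_def D2_def)
  have yy: "C2 * (3/4) \<le> C2 * Y" using Y CD by (intro mult_left_mono) auto
  have g: "8 * w\<^sup>2 \<ge> 3 * (C2 + D2)" using w2 yy CD by simp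
  have g1: "8 * w\<^sup>2 \<ge> 1 + C2" "8 * w\<^sup>2 \<ge> 1 + D2" using g CD by simp_all
  have m1: "(1 + C2) * (1 + D2) \<le> (8 * w\<^sup>2) * (8 * w\<^sup>2)" using g1 CD by (intro mult_mono) auto
  have "1 / (w\<^sup>2)\<^sup>2 = 64 / ((8 * w\<^sup>2) * (8 * w\<^sup>2))" using w1 by (simp add: power2_eq_square)
  also have "\<dots> \<le> 64 / ((1 + C2) * (1 + D2))"
  proof (rule divide_left_mono[OF m1])
    show "0 < 8 * w\<^sup>2 * (8 * w\<^sup>2) * ((1 + C2) * (1 + D2))" using w1 CD by (intro mult_pos_pos) auto
  qed simp
  finally show "cmod (1 / (of_int (fst p) * z + of_int (snd p)) ^ k) \<le> 64 * lattice_bound p"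
    unfolding E lb using wk by simp
  assume "fst p \<noteq> 0"
  then have "(fst p)\<^sup>2 > 0" by simp
  then have "(fst p)\<^sup>2 \<ge> 1" by linarith
  then have "real_of_int ((fst p)\<^sup>2) \<ge> 1" by linarith
  then have C1: "C2 \<ge> 1" by (simp add: C2_def)
  have "1 * Y \<le> C2 * Y" using C1 Y by (intro mult_right_mono) auto
  then have h1: "4 * w\<^sup>2 \<ge> 1 + D2" using w2 CD(2) Y(1) by argo
  have "(1 + C2) * Y \<le> (2 * C2) * Y" using C1 Y by (intro mult_right_mono) auto
  then have h2: "4 * w\<^sup>2 \<ge> (1 + C2) * Y" using w2 CD by simp
  have m2: "((1 + C2) * Y) * (1 + D2) \<le> (4 * w\<^sup>2) * (4 * w\<^sup>2)" using CD Y by (intro mult_mono[OF h2 h1]) auto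
  have "1 / (w\<^sup>2)\<^sup>2 = 16 / ((4 * w\<^sup>2) * (4 * w\<^sup>2))" using w1 by (simp add: power2_eq_square)
  also have "\<dots> \<le> 16 / (((1 + C2) * Y) * (1 + D2))"
  proof (rule divide_left_mono[OF m2])
    show "0 < 4 * w\<^sup>2 * (4 * w\<^sup>2) * ((1 + C2) * Y * (1 + D2))" using w1 CD Y by (intro mult_pos_pos) auto
  qed simp
  also have "\<dots> = 16 / Y * lattice_bound p" unfolding lb using CD Y by simp
  finally show "cmod (1 / (of_int (fst p) * z + of_int (snd p)) ^ k) \<le> 16 / (Im z)\<^sup>2 * lattice_bound p"
    unfolding E using wk by (simp add: Y_def)
qed

lemma eisenstein_bounded:
  assumes "z \<in> fundamental_domain" "k \<ge> 4"
  shows "cmod (eisenstein k z) \<le> 64 * lattice_total"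
  unfolding eisenstein_eq
  by (rule lattice_sum_bound(2)) (use eisenstein_term_fundamental_domain(1)[OF assms(1) _ assms(2)] in auto)

text \<open>The value at the cusp, which is 2 zeta(k) for even k.\<close>

definition eisenstein_const :: "nat \<Rightarrow> complex" where
  "eisenstein_const k = (\<Sum>\<^sub>\<infinity>p\<in>{p\<in>lattice_pairs. fst p = 0}. 1 / of_int (snd p) ^ k)"

lemma eisenstein_near_const_fundamental_domain:
  assumes z: "z \<in> fundamental_domain" and k: "k \<ge> 4"
  shows "cmod (eisenstein k z - eisenstein_const k) \<le> 16 / (Im z)\<^sup>2 * lattice_total"
proof -
  let ?t = "\<lambda>p. 1 / (of_int (fst p) * z + of_int (snd p)) ^ k :: complex"
  let ?A = "{p\<in>lattice_pairs. fst p = 0}" and ?B = "{p\<in>lattice_pairs. fst p \<noteq> 0}"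
  have A: "cmod (?t p) \<le> 64 * lattice_bound p" if "p \<in> ?A" for p
    using eisenstein_term_fundamental_domain(1)[OF z _ k, of p] that by simp
  have sA: "?t summable_on ?A" by (rule lattice_sum_bound(1)) (erule A, simp)
  have B: "cmod (?t p) \<le> 16 / (Im z)\<^sup>2 * lattice_bound p" if "p \<in> ?B" for p
    using eisenstein_term_fundamental_domain(2)[OF z _ k, of p] that by simp
  have sB: "?t summable_on ?B" "cmod (infsum ?t ?B) \<le> 16 / (Im z)\<^sup>2 * lattice_total"
    by (rule lattice_sum_bound, erule B, simp)+
  have "eisenstein k z = infsum ?t (?A \<union> ?B)"
    unfolding eisenstein_eq by (rule infsum_cong_neutral) auto
  also have "\<dots> = infsum ?t ?A + infsum ?t ?B"
    by (rule infsum_Un_disjoint[OF sA sB(1)]) auto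
  also have "infsum ?t ?A = eisenstein_const k"
    unfolding eisenstein_const_def by (rule infsum_cong) auto
  finally show ?thesis using sB(2) by simp
qed

lemma uhp_modular:
  fixes a b c d :: int
  assumes det: "a * d - b * c = 1" and z: "z \<in> upper_half_plane"
  shows "(of_int a * z + of_int b) / (of_int c * z + of_int d) \<in> upper_half_plane"
proof -
  have "(c, d) \<in> lattice_pairs" using det by (auto simp: lattice_pairs_def)
  from lattice_form_nonzero[OF z this] have j: "of_int c * z + of_int d \<noteq> 0" by simp
  have D1: "real_of_int a * real_of_int d - real_of_int b * real_of_int c = 1"
    using arg_cong[OF det, of real_of_int] by simp
  have "(real_of_int a * Im z) * (real_of_int c * Re z + real_of_int d)
      - (real_of_int a * Re z + real_of_int b) * (real_of_int c * Im z)
      = (real_of_int a * real_of_int d - real_of_int b * real_of_int c) * Im z" by (simp add: algebra_simps)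
  then have num: "(real_of_int a * Im z) * (real_of_int c * Re z + real_of_int d)
      - (real_of_int a * Re z + real_of_int b) * (real_of_int c * Im z) = Im z" unfolding D1 by simp
  have "Im ((of_int a * z + of_int b) / (of_int c * z + of_int d))
      = Im z / ((Re (of_int c * z + of_int d))\<^sup>2 + (Im (of_int c * z + of_int d))\<^sup>2)"
    unfolding Im_divide using num by simp
  also have "\<dots> = Im z / (cmod (of_int c * z + of_int d))\<^sup>2" by (simp only: cmod_power2)
  finally show ?thesis using j z by (simp add: upper_half_plane_def)
qed

lemma eisenstein_translation: "z \<in> upper_half_plane \<Longrightarrow> eisenstein k (z + of_int n) = eisenstein k z"
  using eisenstein_modular[of 1 1 n 0 z k] by simp

lemma eisenstein_near_const:
  assumes z: "Im z \<ge> 1" and k: "k \<ge> 4"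
  shows "cmod (eisenstein k z - eisenstein_const k) \<le> 16 / (Im z)\<^sup>2 * lattice_total"
proof -
  \<comment> \<open>Rounding the real part moves z into the fundamental domain without changing Im
    z.\<close>
  define w where "w = z + of_int (- round (Re z))"
  have "\<bar>of_int (round (Re z)) - Re z\<bar> \<le> 1/2" by (rule of_int_round_abs_le)
  then have Re: "\<bar>Re w\<bar> \<le> 1/2" by (simp add: w_def abs_minus_commute)
  have Im: "Im w = Im z" by (simp add: w_def)
  have "cmod w \<ge> 1" using abs_Im_le_cmod[of w] Im z by simp
  then have "w \<in> fundamental_domain" using Re Im z by (simp add: fundamental_domain_def upper_half_plane_def)
  from eisenstein_near_const_fundamental_domain[OF this k] show ?thesis
    using eisenstein_translation[of z k "- round (Re z)"] z Im by (simp add: w_def upper_half_plane_def)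
qed

lemma eisenstein_tendsto:
  assumes k: "k \<ge> 4" shows "(eisenstein k \<longlongrightarrow> eisenstein_const k) (filtercomap Im at_top)"
proof -
  have "((\<lambda>y::real. 16 / y\<^sup>2 * lattice_total) \<longlongrightarrow> 0 * lattice_total) at_top"
  proof (intro tendsto_mult tendsto_const)
    show "((\<lambda>y::real. 16 / y\<^sup>2) \<longlongrightarrow> 0) at_top"
      by (rule tendsto_divide_0[OF tendsto_const])
         (rule filterlim_at_top_imp_at_infinity, rule filterlim_pow_at_top, auto simp: filterlim_ident)
  qed
  then have "((\<lambda>z. 16 / (Im z)\<^sup>2 * lattice_total) \<longlongrightarrow> 0) (filtercomap Im at_top)"
    using filterlim_compose[OF _ filterlim_filtercomap] by fastforce
  moreover have "eventually (\<lambda>z. norm (eisenstein k z - eisenstein_const k) \<le> 16 / (Im z)\<^sup>2 * lattice_total) (filtercomap Im at_top)"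
    unfolding eventually_filtercomap_at_top_linorder using eisenstein_near_const[OF _ k] by blast
  ultimately have "((\<lambda>z. eisenstein k z - eisenstein_const k) \<longlongrightarrow> 0) (filtercomap Im at_top)"
    by (rule Lim_null_comparison[rotated])
  then show ?thesis by (rule LIM_zero_cancel)
qed

lemma i_fundamental_domain: "\<i> \<in> fundamental_domain"
  by (simp add: fundamental_domain_def upper_half_plane_def)

lemma eisenstein_const_ge:
  assumes k: "k \<ge> 4" "even k" shows "cmod (eisenstein_const k) \<ge> 2"
proof -
  let ?A = "{p\<in>lattice_pairs. fst p = 0}"
  let ?r = "\<lambda>p::int \<times> int. 1 / real_of_int (snd p) ^ k"
  have nn: "?r p \<ge> 0" for p using zero_le_even_power[OF k(2), of "real_of_int (snd p)"] by simp
  have "complex_of_real (?r p) = 1 / (of_int (fst p) * \<i> + of_int (snd p)) ^ k" if "p \<in> ?A" for p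
    using that by simp
  moreover have "cmod (1 / (of_int (fst p) * \<i> + of_int (snd p)) ^ k) \<le> 64 * lattice_bound p" if "p \<in> ?A" for p
    using eisenstein_term_fundamental_domain(1)[OF i_fundamental_domain _ k(1), of p] that by simp
  ultimately have "cmod (complex_of_real (?r p)) \<le> 64 * lattice_bound p" if "p \<in> ?A" for p using that by metis
  then have bd: "norm (?r p) \<le> 64 * lattice_bound p" if "p \<in> ?A" for p using that by (simp only: norm_of_real real_norm_def)
  have s: "?r summable_on ?A"
    by (rule abs_summable_summable, rule Infinite_Sum.abs_summable_on_comparison_test'[OF _ bd])
       (auto intro!: summable_on_cmult_right lattice_bound_summable)
  have "2 = sum ?r {(0, 1), (0, -1)}" using k by simp
  also have "\<dots> \<le> infsum ?r ?A"
    by (rule finite_sum_le_infsum[OF s]) (use nn in \<open>auto simp: lattice_pairs_def\<close>)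
  finally have 2: "2 \<le> infsum ?r ?A" .
  have "((\<lambda>p. complex_of_real (?r p)) has_sum complex_of_real (infsum ?r ?A)) ?A"
    by (intro has_sum_of_real has_sum_infsum s)
  then have "infsum (\<lambda>p. complex_of_real (?r p)) ?A = complex_of_real (infsum ?r ?A)" by (rule infsumI)
  then have "eisenstein_const k = complex_of_real (infsum ?r ?A)" by (simp add: eisenstein_const_def)
  then show ?thesis using 2 by simp
qed

text \<open>The threshold \<open>Y\<close> serves all weights at once: the constant term is at least
  2, and the remainder at most 16 \<open>lattice_total\<close> / y^2.\<close>

lemma eisenstein_lower:
  obtains Y where "Y \<ge> 1" "\<And>k z. k \<ge> 4 \<Longrightarrow> even k \<Longrightarrow> Im z \<ge> Y \<Longrightarrow> cmod (eisenstein k z) \<ge> 1"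
proof -
  define Y where "Y = 1 + 16 * lattice_total"
  have Y: "Y \<ge> 1" using lattice_total_nonneg by (simp add: Y_def)
  have "cmod (eisenstein k z) \<ge> 1" if k: "k \<ge> 4" "even k" and z: "Im z \<ge> Y" for k z
  proof -
    have "16 / (Im z)\<^sup>2 * lattice_total \<le> 1"
    proof -
      have "Y * 1 \<le> Im z * Im z" using z Y by (intro mult_mono) auto
      then have "16 * lattice_total \<le> (Im z)\<^sup>2" using lattice_total_nonneg by (simp add: Y_def power2_eq_square)
      moreover have "(Im z)\<^sup>2 > 0" using z Y by simp
      ultimately show ?thesis by simp
    qed
    then have "cmod (eisenstein k z - eisenstein_const k) \<le> 1"
      using eisenstein_near_const[of z k] k z Y by linarith
    moreover have "cmod (eisenstein_const k) \<le> cmod (eisenstein k z) + cmod (eisenstein k z - eisenstein_const k)"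
      by (subst norm_minus_commute) (rule norm_triangle_sub)
    ultimately show ?thesis using eisenstein_const_ge[OF k] by linarith
  qed
  then show ?thesis using that Y by blast
qed

section \<open>A cusp form that does not vanish at i\<close>

text \<open>The point i is fixed by z to -1/z, so modularity reads E(i) = i^k E(i) = - E(i).\<close>

lemma eisenstein_i_eq_0:
  assumes "k mod 4 = 2" shows "eisenstein k \<i> = 0"
proof -
  have "\<i> ^ k = - 1"
  proof -
    have "k = 4 * (k div 4) + 2" using assms by (metis mult_div_mod_eq)
    then have "\<i> ^ k = (\<i> ^ 4) ^ (k div 4) * \<i> ^ 2" by (metis power_add power_mult)
    moreover have "\<i> ^ 4 = 1" by (simp add: numeral_eq_Suc)
    ultimately show ?thesis by simp
  qed
  moreover have "eisenstein k \<i> = \<i> ^ k * eisenstein k \<i>"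
    using eisenstein_modular[of 0 0 "-1" 1 \<i> k] by (simp add: upper_half_plane_def)
  ultimately show ?thesis by (simp add: complex_eq_iff)
qed

text \<open>The weight is divisible by 4, so each of the four lattice points of modulus 1
  contributes exactly 1. All the others have squared modulus at least 2 and together contribute less
  than 4 once the weight is large.\<close>

lemma eisenstein_i_nonzero:
  assumes t: "lattice_total < 2 ^ (4 * t)"
  shows "eisenstein (8 * t + 4) \<i> \<noteq> 0"
proof -
  define k where "k = 8 * t + 4"
  let ?t = "\<lambda>p. 1 / (of_int (fst p) * \<i> + of_int (snd p)) ^ k :: complex"
  let ?U = "{(1, 0), (-1, 0), (0, 1), (0, -1)} :: (int \<times> int) set"
  have i4: "\<i> ^ 4 = 1" by (simp add: numeral_eq_Suc)
  have ik: "\<i> ^ k = 1" "(- \<i>) ^ k = 1"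
  proof -
    have k4: "k = 4 * (2 * t + 1)" by (simp add: k_def)
    show "\<i> ^ k = 1" unfolding k4 power_mult i4 by simp
    have "(- \<i>) ^ 4 = 1" using i4 by simp
    then show "(- \<i>) ^ k = 1" unfolding k4 power_mult by simp
  qed
  have U: "(\<Sum>p\<in>?U. ?t p) = 4" using ik by (simp add: k_def)
  have B: "cmod (?t p) \<le> (4 / 2 ^ (4 * t)) * lattice_bound p" if p: "p \<in> lattice_pairs - ?U" for p
  proof -
    obtain c d where cd: "p = (c, d)" by (cases p)
    define s where "s = (real_of_int c)\<^sup>2 + (real_of_int d)\<^sup>2"
    have "c\<^sup>2 + d\<^sup>2 \<ge> 2"
    proof (rule ccontr)
      assume n: "\<not> c\<^sup>2 + d\<^sup>2 \<ge> 2"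
      have "c\<^sup>2 \<le> 1" "d\<^sup>2 \<le> 1" using n zero_le_power2[of c] zero_le_power2[of d] by linarith+
      then have "\<bar>c\<bar> \<le> 1" "\<bar>d\<bar> \<le> 1" by (simp_all add: abs_square_le_1)
      then have "c \<in> {-1, 0, 1}" "d \<in> {-1, 0, 1}" by auto
      then show False using n p by (auto simp: cd lattice_pairs_def)
    qed
    then have "real_of_int (c\<^sup>2 + d\<^sup>2) \<ge> 2" by linarith
    then have s2: "s \<ge> 2" by (simp add: s_def)
    have "(cmod (of_int c * \<i> + of_int d))\<^sup>2 = s" by (simp add: cmod_power2 s_def)
    moreover have "k = 2 * (4 * t + 2)" by (simp add: k_def)
    ultimately have "cmod (of_int c * \<i> + of_int d) ^ k = s ^ (4 * t + 2)" by (metis power_mult)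
    then have "cmod (?t p) = 1 / s ^ (4 * t) * (1 / s\<^sup>2)"
      by (simp add: cd norm_divide norm_power power_add power2_eq_square)
    also have "\<dots> \<le> 1 / 2 ^ (4 * t) * (1 / s\<^sup>2)"
      using s2 by (intro mult_right_mono divide_left_mono power_mono) auto
    also have "\<dots> \<le> 1 / 2 ^ (4 * t) * (4 * lattice_bound p)"
      using lattice_bound_ge[of p] p by (intro mult_left_mono) (auto simp: cd s_def)
    finally show ?thesis by simp
  qed
  have sB: "?t summable_on lattice_pairs - ?U" "cmod (infsum ?t (lattice_pairs - ?U)) \<le> (4 / 2 ^ (4 * t)) * lattice_total"
    by (rule lattice_sum_bound, erule B, simp)+
  have "eisenstein k \<i> = infsum ?t (?U \<union> (lattice_pairs - ?U))"
    unfolding eisenstein_eq by (rule infsum_cong_neutral) (auto simp: lattice_pairs_def)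
  also have "\<dots> = infsum ?t ?U + infsum ?t (lattice_pairs - ?U)"
    by (rule infsum_Un_disjoint) (use sB(1) in auto)
  also have "infsum ?t ?U = 4" using U by (subst infsum_finite) auto
  finally have e: "eisenstein k \<i> = 4 + infsum ?t (lattice_pairs - ?U)" .
  have "cmod (infsum ?t (lattice_pairs - ?U)) \<le> (4 / 2 ^ (4 * t)) * lattice_total" by (rule sB(2))
  also have "\<dots> < (4 / 2 ^ (4 * t)) * 2 ^ (4 * t)" using t by (intro mult_strict_left_mono) auto
  also have "\<dots> = 4" by simp
  finally have lt: "cmod (infsum ?t (lattice_pairs - ?U)) < 4" .
  show ?thesis unfolding k_def[symmetric]
  proof
    assume "eisenstein k \<i> = 0"
    then have "infsum ?t (lattice_pairs - ?U) = - 4" using e by (simp add: eq_neg_iff_add_eq_0 add.commute)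
    then show False using lt by simp
  qed
qed

text \<open>E_a^2 and E_(2a), weighted by each other's values at the cusp, cancel there. With a
  congruent to 2 modulo 4 the first vanishes at i and the second does not, so the combination is
  nonzero; no Fourier coefficient has to be computed.\<close>

lemma exists_cusp_form:
  obtains w \<Phi> where "w \<ge> 1" "even w" "\<Phi> \<in> cusp_forms w" "\<Phi> \<i> \<noteq> 0"
proof -
  obtain t0 where t0: "lattice_total < 2 ^ t0" using real_arch_pow[of 2 lattice_total] by auto
  define t where "t = Suc t0"
  have "(2::real) ^ t0 \<le> 2 ^ (4 * t)" by (intro power_increasing) (auto simp: t_def)
  then have t: "lattice_total < 2 ^ (4 * t)" using t0 by linarith
  define a where "a = 4 * t + 2"
  have a: "a \<ge> 4" "even a" "a mod 4 = 2" "2 * a = 8 * t + 4" by (auto simp: a_def t_def)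
  define \<Phi> where "\<Phi> z = (if z \<in> upper_half_plane then eisenstein_const (2 * a) * eisenstein a z ^ 2
      - eisenstein_const a ^ 2 * eisenstein (2 * a) z else 0)" for z
  have "\<Phi> \<in> cusp_forms (2 * a)"
  proof (rule cusp_formsI)
    have "(\<lambda>z. eisenstein_const (2 * a) * eisenstein a z ^ 2 - eisenstein_const a ^ 2 * eisenstein (2 * a) z) holomorphic_on upper_half_plane"
      using a by (intro holomorphic_intros eisenstein_holomorphic) auto
    then show "\<Phi> holomorphic_on upper_half_plane"
      by (rule holomorphic_transform) (simp add: \<Phi>_def)
    show "\<Phi> z = 0" if "z \<notin> upper_half_plane" for z using that by (simp add: \<Phi>_def)
    show "\<Phi> ((of_int a' * z + of_int b) / (of_int c * z + of_int d)) = (of_int c * z + of_int d) ^ (2 * a) * \<Phi> z"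
      if "a' * d - b * c = 1" "z \<in> upper_half_plane" for a' b c d :: int and z
      using uhp_modular[OF that] that
      by (simp add: \<Phi>_def eisenstein_modular[OF that] power_mult_distrib right_diff_distrib flip: power_mult)
         (simp add: mult.commute mult.left_commute)
    have "((\<lambda>z. eisenstein_const (2 * a) * eisenstein a z ^ 2 - eisenstein_const a ^ 2 * eisenstein (2 * a) z)
      \<longlongrightarrow> eisenstein_const (2 * a) * eisenstein_const a ^ 2 - eisenstein_const a ^ 2 * eisenstein_const (2 * a)) (filtercomap Im at_top)"
      using a by (intro tendsto_intros eisenstein_tendsto) auto
    moreover have "eventually (\<lambda>z. eisenstein_const (2 * a) * eisenstein a z ^ 2 - eisenstein_const a ^ 2 * eisenstein (2 * a) z = \<Phi> z) (filtercomap Im at_top)"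
      unfolding eventually_filtercomap_at_top_linorder
      by (rule exI[of _ 1]) (auto simp: \<Phi>_def upper_half_plane_def)
    ultimately have "(\<Phi> \<longlongrightarrow> eisenstein_const (2 * a) * eisenstein_const a ^ 2 - eisenstein_const a ^ 2 * eisenstein_const (2 * a)) (filtercomap Im at_top)"
      by (rule Lim_transform_eventually)
    then show "(\<Phi> \<longlongrightarrow> 0) (filtercomap Im at_top)" by (simp add: mult.commute)
  qed
  moreover have "\<Phi> \<i> \<noteq> 0"
  proof -
    have "eisenstein_const a \<noteq> 0" using eisenstein_const_ge[OF a(1,2)] by auto
    then show ?thesis using eisenstein_i_eq_0[OF a(3)] eisenstein_i_nonzero[OF t] a(4)
      by (simp add: \<Phi>_def upper_half_plane_def)
  qed
  ultimately show ?thesis using that[of "2 * a" \<Phi>] a by simp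
qed

lemma cusp_form_mult_eisenstein:
  assumes f: "f \<in> cusp_forms m" and l: "l \<ge> 4"
  shows "(\<lambda>z. f z * eisenstein l z) \<in> cusp_forms (m + l)"
proof (rule cusp_formsI)
  show "(\<lambda>z. f z * eisenstein l z) holomorphic_on upper_half_plane"
    by (intro holomorphic_intros eisenstein_holomorphic cusp_form_holomorphic[OF f] l)
  show "f z * eisenstein l z = 0" if "z \<notin> upper_half_plane" for z using cusp_form_outside[OF f that] by simp
  show "f ((of_int a * z + of_int b) / (of_int c * z + of_int d)) * eisenstein l ((of_int a * z + of_int b) / (of_int c * z + of_int d))
    = (of_int c * z + of_int d) ^ (m + l) * (f z * eisenstein l z)"
    if "a * d - b * c = 1" "z \<in> upper_half_plane" for a b c d :: int and z
    unfolding cusp_form_modular[OF f that] eisenstein_modular[OF that] by (simp add: power_add)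
  show "((\<lambda>z. f z * eisenstein l z) \<longlongrightarrow> 0) (filtercomap Im at_top)"
    using tendsto_mult[OF cusp_form_tendsto[OF f] eisenstein_tendsto[OF l]] by simp
qed

text \<open>\<open>m\<close> is the order of vanishing at the cusp. After removal of the leading
  harmonic, the rest decays one harmonic faster, by comparison with height 1/2.\<close>

lemma cusp_form_order:
  assumes f: "f \<in> cusp_forms k" and z0: "z0 \<in> upper_half_plane" "f z0 \<noteq> 0"
  obtains m C c Y where "m \<ge> 1" "C > 0" "c > 0" "Y \<ge> 1"
    "\<And>z. Im z \<ge> 1/2 \<Longrightarrow> cmod (f z) \<le> C * exp (- 2 * pi * real m * Im z)"
    "\<And>z. Im z \<ge> Y \<Longrightarrow> cmod (f z) \<ge> c * exp (- 2 * pi * real m * Im z)"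
proof -
  obtain q where q: "q 0 = 0"
    "\<And>z. z \<in> upper_half_plane \<Longrightarrow> (\<lambda>n. q n * exp (2 * of_real pi * \<i> * of_nat n * z)) sums f z"
    "\<And>t. t > 0 \<Longrightarrow> summable (\<lambda>n. cmod (q n) * exp (- 2 * pi * real n * t))"
    by (rule cusp_form_expansion[OF f], rule that)
  have "\<exists>n. q n \<noteq> 0"
  proof (rule ccontr)
    assume "\<nexists>n. q n \<noteq> 0"
    then have "(\<lambda>n. 0) sums f z0" using q(2)[OF z0(1)] by simp
    then show False using z0(2) sums_unique2[OF _ sums_zero] by blast
  qed
  define m where "m = (LEAST n. q n \<noteq> 0)"
  have qm: "q m \<noteq> 0" unfolding m_def using \<open>\<exists>n. q n \<noteq> 0\<close> by (rule LeastI_ex)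
  have qlt: "q n = 0" if "n < m" for n using not_less_Least[of n "\<lambda>n. q n \<noteq> 0"] that by (auto simp: m_def)
  have m1: "m \<ge> 1" using qm q(1) by (cases m) auto
  define S where "S = (\<Sum>n. cmod (q n) * exp (- 2 * pi * real n * (1/2)))"
  have S0: "S \<ge> 0" unfolding S_def using q(3)[of "1/2"] by (intro suminf_nonneg) auto
  define C1 where "C1 = S * exp (pi * (real m + 1))"
  have C1: "C1 \<ge> 0" using S0 by (simp add: C1_def)
  have main: "cmod (f z - q m * exp (2 * of_real pi * \<i> * of_nat m * z)) \<le> C1 * exp (- 2 * pi * (real m + 1) * Im z)"
    if z: "Im z \<ge> 1/2" for z
  proof -
    have zH: "z \<in> upper_half_plane" using z by (simp add: upper_half_plane_def)
    let ?r = "\<lambda>n. if n \<le> m then 0 else q n * exp (2 * of_real pi * \<i> * of_nat n * z)"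
    let ?E = "exp (pi * (real m + 1)) * exp (- 2 * pi * (real m + 1) * Im z)"
    have "(\<lambda>n. q n * exp (2 * of_real pi * \<i> * of_nat n * z) - (if n = m then q n * exp (2 * of_real pi * \<i> * of_nat n * z) else 0))
       sums (f z - q m * exp (2 * of_real pi * \<i> * of_nat m * z))"
      by (rule sums_diff[OF q(2)[OF zH] sums_single])
    also have "(\<lambda>n. q n * exp (2 * of_real pi * \<i> * of_nat n * z) - (if n = m then q n * exp (2 * of_real pi * \<i> * of_nat n * z) else 0)) = ?r"
      using qlt by (auto simp: fun_eq_iff)
    finally have r: "?r sums (f z - q m * exp (2 * of_real pi * \<i> * of_nat m * z))" .
    have le: "cmod (?r n) \<le> (cmod (q n) * exp (- 2 * pi * real n * (1/2))) * ?E" for n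
    proof (cases "n \<le> m")
      case False
      define d where "d = real n - (real m + 1)"
      have d: "d \<ge> 0" using False by (simp add: d_def)
      have "d * Im z \<ge> d * (1/2)" using d z by (intro mult_left_mono) auto
      then have "2 * pi * (d * Im z) \<ge> 2 * pi * (d * (1/2))" by (rule mult_left_mono) simp
      then have "- 2 * pi * real n * Im z \<le> - 2 * pi * real n * (1/2) + (pi * (real m + 1) + - 2 * pi * (real m + 1) * Im z)"
        by (simp add: d_def algebra_simps add_divide_distrib diff_divide_distrib)
      then have "exp (- 2 * pi * real n * Im z) \<le> exp (- 2 * pi * real n * (1/2) + (pi * (real m + 1) + - 2 * pi * (real m + 1) * Im z))" by simp
      also have "\<dots> = exp (- 2 * pi * real n * (1/2)) * ?E" by (simp only: exp_add)
      finally have "cmod (q n) * exp (- 2 * pi * real n * Im z) \<le> cmod (q n) * (exp (- 2 * pi * real n * (1/2)) * ?E)"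
        by (intro mult_left_mono) auto
      then show ?thesis using False by (simp add: norm_mult norm_exp_2pi_i mult.assoc)
    qed simp
    have "cmod (f z - q m * exp (2 * of_real pi * \<i> * of_nat m * z)) \<le> (\<Sum>n. (cmod (q n) * exp (- 2 * pi * real n * (1/2))) * ?E)"
      unfolding sums_unique[OF r]
      by (rule norm_suminf_le[OF le]) (intro summable_mult2 q(3), simp)
    also have "\<dots> = S * ?E"
      unfolding S_def by (rule suminf_mult2[symmetric]) (intro q(3), simp)
    finally show ?thesis by (simp add: C1_def mult.assoc)
  qed
  have shift: "exp (- 2 * pi * (real m + 1) * Im z) = exp (- 2 * pi * Im z) * exp (- 2 * pi * real m * Im z)" for z
    by (simp add: exp_add[symmetric] algebra_simps)
  have nm: "cmod (q m * exp (2 * of_real pi * \<i> * of_nat m * z)) = cmod (q m) * exp (- 2 * pi * real m * Im z)" for z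
    by (simp add: norm_mult norm_exp_2pi_i)
  have up: "cmod (f z) \<le> (cmod (q m) + C1) * exp (- 2 * pi * real m * Im z)" if z: "Im z \<ge> 1/2" for z
  proof -
    have "exp (- 2 * pi * Im z) \<le> 1" using z by simp
    then have "C1 * exp (- 2 * pi * (real m + 1) * Im z) \<le> C1 * (1 * exp (- 2 * pi * real m * Im z))"
      unfolding shift using C1 by (intro mult_left_mono mult_right_mono) auto
    moreover have "cmod (f z) \<le> cmod (q m * exp (2 * of_real pi * \<i> * of_nat m * z)) + cmod (f z - q m * exp (2 * of_real pi * \<i> * of_nat m * z))"
      by (rule norm_triangle_sub)
    ultimately show ?thesis using main[OF z] unfolding nm by (simp add: distrib_right)
  qed
  \<comment> \<open>Above this height the remainder is at most half of the leading term, by exp (-2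
    pi y) <= 1/y.\<close>
  define Y where "Y = 1 + 2 * C1 / cmod (q m)"
  have Y: "Y \<ge> 1" using C1 by (simp add: Y_def)
  have lo: "cmod (f z) \<ge> cmod (q m) / 2 * exp (- 2 * pi * real m * Im z)" if z: "Im z \<ge> Y" for z
  proof -
    have z1: "Im z \<ge> 1/2" "Im z > 0" using z Y by linarith+
    have "exp (- 2 * pi * Im z) \<le> 1 / Im z"
    proof -
      have "Im z \<le> 2 * pi * Im z" using z1 pi_gt3 by (simp add: mult_le_cancel_right1)
      also have "\<dots> \<le> exp (2 * pi * Im z)" using exp_ge_add_one_self[of "2 * pi * Im z"] by linarith
      finally show ?thesis using z1 by (simp add: exp_minus field_simps)
    qed
    then have "C1 * exp (- 2 * pi * Im z) \<le> C1 * (1 / Im z)" using C1 by (intro mult_left_mono)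
    also have "\<dots> \<le> cmod (q m) / 2"
    proof -
      have "2 * C1 / cmod (q m) \<le> Im z" using z by (simp add: Y_def)
      then show ?thesis using qm z1 by (simp add: field_simps)
    qed
    finally have le: "C1 * exp (- 2 * pi * Im z) * exp (- 2 * pi * real m * Im z) \<le> cmod (q m) / 2 * exp (- 2 * pi * real m * Im z)"
      by (intro mult_right_mono) auto
    have "cmod (f z - q m * exp (2 * of_real pi * \<i> * of_nat m * z)) \<le> C1 * exp (- 2 * pi * Im z) * exp (- 2 * pi * real m * Im z)"
      using main[OF z1(1)] unfolding shift by (simp only: mult.assoc)
    then have "cmod (f z - q m * exp (2 * of_real pi * \<i> * of_nat m * z)) \<le> cmod (q m) / 2 * exp (- 2 * pi * real m * Im z)"
      using le by (rule order_trans)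
    moreover have "cmod (q m * exp (2 * of_real pi * \<i> * of_nat m * z)) \<le> cmod (f z) + cmod (f z - q m * exp (2 * of_real pi * \<i> * of_nat m * z))"
      by (subst norm_minus_commute) (rule norm_triangle_sub)
    ultimately show ?thesis unfolding nm by (simp add: field_simps)
  qed
  show ?thesis
    by (rule that[OF m1 _ _ Y up lo]) (use qm C1 in \<open>auto intro: add_pos_nonneg\<close>)
qed


section \<open>Integrals over the fundamental domain\<close>

lemma sum_fun_apply: "(\<Sum>i\<in>A. g i) x = (\<Sum>i\<in>A. g i x)"
  for g :: "'i \<Rightarrow> 'a \<Rightarrow> 'b::comm_monoid_add"
  by (induction A rule: infinite_finite_induct) auto

lemma hyp_weight_fundamental_domain:
  "z \<in> fundamental_domain \<Longrightarrow> hyp_weight z = ennreal (1 / (Im z)\<^sup>2)"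
  by (simp add: hyp_weight_def fundamental_domain_def)

text \<open>The domain is enlarged to the half-infinite rectangle |x| <= 1/2, y >= 4/5 of width
  1.\<close>

lemma nn_integral_fundamental_domain_le:
  fixes g :: "real \<Rightarrow> real"
  assumes g: "\<And>y. y \<ge> 4/5 \<Longrightarrow> g y \<ge> 0" and [measurable]: "g \<in> borel_measurable borel"
  shows "(\<integral>\<^sup>+z. ennreal (g (Im z)) * indicator fundamental_domain z * hyp_weight z \<partial>lborel)
    \<le> (\<integral>\<^sup>+y. ennreal (g y / y\<^sup>2) * indicator {4/5..} y \<partial>lborel)"
proof -
  let ?h = "\<lambda>x y. indicator {-1/2..1/2::real} x * (ennreal (g y / y\<^sup>2) * indicator {4/5..} y)"
  have "(\<integral>\<^sup>+z. ennreal (g (Im z)) * indicator fundamental_domain z * hyp_weight z \<partial>lborel)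
      = (\<integral>\<^sup>+x. (\<integral>\<^sup>+y. ennreal (g y) * indicator fundamental_domain (Complex x y) * hyp_weight (Complex x y) \<partial>lborel) \<partial>lborel)"
    by (subst nn_integral_lborel_complex) auto
  also have "\<dots> \<le> (\<integral>\<^sup>+x. (\<integral>\<^sup>+y. ?h x y \<partial>lborel) \<partial>lborel)"
  proof (intro nn_integral_mono)
    fix x y :: real
    show "ennreal (g y) * indicator fundamental_domain (Complex x y) * hyp_weight (Complex x y) \<le> ?h x y"
    proof (cases "Complex x y \<in> fundamental_domain")
      case True
      have "y \<ge> 4/5" using fundamental_domain_Im(3)[OF True] by simp
      moreover have "x \<in> {-1/2..1/2}" using True by (auto simp: fundamental_domain_def)
      ultimately show ?thesis
        using True hyp_weight_fundamental_domain[OF True] g[of y] by (simp add: ennreal_mult[symmetric])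
    qed simp
  qed
  also have "\<dots> = (\<integral>\<^sup>+x. indicator {-1/2..1/2::real} x * (\<integral>\<^sup>+y. ennreal (g y / y\<^sup>2) * indicator {4/5..} y \<partial>lborel) \<partial>lborel)"
    by (intro nn_integral_cong nn_integral_cmult) auto
  also have "\<dots> = (\<integral>\<^sup>+y. ennreal (g y / y\<^sup>2) * indicator {4/5..} y \<partial>lborel)"
    by (subst nn_integral_multc) auto
  finally show ?thesis .
qed

text \<open>The exact value is pi/3; that 5/4 is below 2 is enough for the averaging argument in
  \<open>bergman_avg\<close>.\<close>

lemma fundamental_domain_area:
  "(\<integral>\<^sup>+z. indicator fundamental_domain z * hyp_weight z \<partial>lborel) \<le> ennreal (5/4)"
proof -
  have "(\<integral>\<^sup>+z. indicator fundamental_domain z * hyp_weight z \<partial>lborel)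
      = (\<integral>\<^sup>+z. ennreal ((\<lambda>_. 1) (Im z)) * indicator fundamental_domain z * hyp_weight z \<partial>lborel)" by simp
  also have "\<dots> \<le> (\<integral>\<^sup>+y. ennreal (1 / y\<^sup>2) * indicator {4/5..} y \<partial>lborel)"
    by (rule nn_integral_fundamental_domain_le) auto
  also have "\<dots> = ennreal (0 - (- 1 / (4/5)))"
  proof (rule nn_integral_FTC_atLeast)
    show "((\<lambda>t. - 1 / t) has_real_derivative 1 / t\<^sup>2) (at t)" if "4/5 \<le> t" for t :: real
      using that by (auto intro!: derivative_eq_intros simp: power2_eq_square)
    show "((\<lambda>t::real. - 1 / t) \<longlongrightarrow> 0) at_top"
      by (rule tendsto_divide_0[OF tendsto_const]) (simp add: filterlim_at_top_imp_at_infinity filterlim_ident)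
  qed auto
  finally show ?thesis by simp
qed

text \<open>Finite because sqrt y / y^2 is integrable at infinity. It makes the bound of order k
  sqrt y for the kernel yield a dimension of order at most k.\<close>

lemma fundamental_domain_sqrt_integral:
  "(\<integral>\<^sup>+z. ennreal (sqrt (Im z)) * indicator fundamental_domain z * hyp_weight z \<partial>lborel) \<le> ennreal 3"
proof -
  have "(\<integral>\<^sup>+z. ennreal (sqrt (Im z)) * indicator fundamental_domain z * hyp_weight z \<partial>lborel)
      \<le> (\<integral>\<^sup>+y. ennreal (sqrt y / y\<^sup>2) * indicator {4/5..} y \<partial>lborel)"
    by (rule nn_integral_fundamental_domain_le) auto
  also have "\<dots> = ennreal (0 - (- 2 / sqrt (4/5)))"
  proof (rule nn_integral_FTC_atLeast)
    show "((\<lambda>t. - 2 / sqrt t) has_real_derivative sqrt t / t\<^sup>2) (at t)" if t: "4/5 \<le> t" for t :: real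
    proof -
      define s where "s = sqrt t"
      have s: "s > 0" "t = s * s" using t by (auto simp: s_def)
      have "((\<lambda>t. - 2 / sqrt t) has_real_derivative - ((- 2) * (inverse (sqrt t) / 2)) / (sqrt t * sqrt t)) (at t)"
        using t by (auto intro!: derivative_eq_intros)
      moreover have "- ((- 2) * (inverse (sqrt t) / 2)) / (sqrt t * sqrt t) = sqrt t / t\<^sup>2"
        unfolding s_def[symmetric] s(2) using s(1) by (simp add: power2_eq_square field_simps)
      ultimately show ?thesis by simp
    qed
    show "((\<lambda>t::real. - 2 / sqrt t) \<longlongrightarrow> 0) at_top"
      by (rule tendsto_divide_0[OF tendsto_const]) (rule filterlim_at_top_imp_at_infinity[OF sqrt_at_top])
  qed auto
  also have "0 - (- 2 / sqrt (4/5)) \<le> (3::real)"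
  proof -
    have "2/3 \<le> sqrt (4/5 :: real)" by (rule real_le_rsqrt) (simp add: power2_eq_square)
    then have "2 / sqrt (4/5) \<le> 2 / (2/3 :: real)" by (intro divide_left_mono) auto
    then show ?thesis by simp
  qed
  finally show ?thesis by (simp add: ennreal_leI order_trans)
qed

section \<open>The Bergman kernel\<close>

locale cusp_basis =
  fixes k :: nat and f :: "nat \<Rightarrow> complex \<Rightarrow> complex"
  assumes k_ge: "k \<ge> 1" and dim_ge: "cusp_dim k \<ge> 1" and onb: "orthonormal_cusp_basis k f"
begin

abbreviation N :: nat where "N \<equiv> cusp_dim k"

abbreviation form :: "(nat \<Rightarrow> complex) \<Rightarrow> complex \<Rightarrow> complex" where
  "form a \<equiv> random_cusp_form k f a"

lemma span_f: "cfun.span (f ` {..<N}) = cusp_forms k"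
  using onb by (simp add: orthonormal_cusp_basis_def)

lemma orthonormal: "i < N \<Longrightarrow> j < N \<Longrightarrow> petersson k (f i) (f j) = (if i = j then 1 else 0)"
  using onb by (simp add: orthonormal_cusp_basis_def)

lemma f_cusp: "j < N \<Longrightarrow> f j \<in> cusp_forms k"
  unfolding span_f[symmetric] by (rule cfun.span_base) auto

lemma f_measurable: "j < N \<Longrightarrow> f j \<in> borel_measurable borel"
  by (rule cusp_form_measurable[OF f_cusp])

lemma inj_f: "inj_on f {..<N}"
proof (rule inj_onI)
  fix i j assume "i \<in> {..<N}" "j \<in> {..<N}" "f i = f j"
  then show "i = j" using orthonormal[of i j] orthonormal[of i i] by (auto split: if_splits)
qed

lemma form_pair: "form a z = cvec_pair N a (\<lambda>j. f j z)"
  by (simp add: random_cusp_form_def cvec_pair_def)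

lemma form_eq_sum: "form a = (\<Sum>j<N. fun_scale (a j) (f j))"
  by (rule ext) (simp add: random_cusp_form_def sum_fun_apply fun_scale_def)

lemma form_cusp: "form a \<in> cusp_forms k"
  unfolding span_f[symmetric] form_eq_sum
  by (intro cfun.span_sum cfun.span_scale cfun.span_base) auto

lemma cusp_form_obtain:
  assumes "g \<in> cusp_forms k" obtains a where "g = form a"
proof -
  have "g \<in> cfun.span (f ` {..<N})" using assms by (simp add: span_f)
  then obtain u where "g = (\<Sum>v\<in>f ` {..<N}. fun_scale (u v) v)"
    by (auto simp: cfun.span_finite)
  then have "g = form (\<lambda>j. u (f j))" unfolding form_eq_sum by (simp add: sum.reindex[OF inj_f])
  then show ?thesis by (rule that)
qed

definition pet_weight :: "complex \<Rightarrow> real" where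
  "pet_weight z = indicator fundamental_domain z * (Im z ^ k / Im z ^ 2)"

lemma pet_weight_nonneg [simp]: "pet_weight z \<ge> 0"
  by (auto simp: pet_weight_def indicator_def fundamental_domain_def upper_half_plane_def)

lemma pet_weight_measurable [measurable]: "pet_weight \<in> borel_measurable borel"
  unfolding pet_weight_def[abs_def] by measurable

lemma petersson_eq: "petersson k g h = (LINT z|lborel. pet_weight z *\<^sub>R (g z * cnj (h z)))"
  unfolding petersson_def set_lebesgue_integral_def pet_weight_def
  by (rule Bochner_Integration.integral_cong) (auto simp: indicator_def scaleR_conv_of_real)

lemma petersson_nn_eq: "petersson_nn k g = (\<integral>\<^sup>+z. ennreal (pet_weight z * (cmod (g z))\<^sup>2) \<partial>lborel)"
  unfolding petersson_nn_def
proof (rule nn_integral_cong)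
  fix z
  show "ennreal ((cmod (g z))\<^sup>2 * Im z ^ k) * indicator fundamental_domain z * hyp_weight z = ennreal (pet_weight z * (cmod (g z))\<^sup>2)"
  proof (cases "z \<in> fundamental_domain")
    case True
    then have "Im z > 0" using fundamental_domain_Im by blast
    then show ?thesis using True
      by (simp add: pet_weight_def hyp_weight_fundamental_domain ennreal_mult[symmetric] ac_simps)
  qed (simp add: pet_weight_def)
qed

lemma cnj_measurable [measurable (raw)]:
  "g \<in> borel_measurable M \<Longrightarrow> (\<lambda>x. cnj (g x)) \<in> borel_measurable M"
  by (rule measurable_compose[of g M borel cnj])
     (auto intro!: borel_measurable_continuous_onI continuous_on_cnj continuous_on_id)

text \<open>Orthonormality contains integrability: the Bochner integral of a non-integrable function
  is 0, whereas the diagonal products equal 1. The mixed products are dominated by the diagonal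
  ones.\<close>

lemma pet_integrable:
  assumes i: "i < N" and j: "j < N"
  shows "integrable lborel (\<lambda>z. pet_weight z *\<^sub>R (f i z * cnj (f j z)))"
proof -
  note [measurable] = f_measurable[OF i] f_measurable[OF j]
  have diag: "integrable lborel (\<lambda>z. pet_weight z * (cmod (f l z))\<^sup>2)" if l: "l < N" for l
  proof -
    have "integrable lborel (\<lambda>z. pet_weight z *\<^sub>R (f l z * cnj (f l z)))"
      using orthonormal[OF l l] not_integrable_integral_eq[of lborel "\<lambda>z. pet_weight z *\<^sub>R (f l z * cnj (f l z))"]
      unfolding petersson_eq by auto
    then have "integrable lborel (\<lambda>z. norm (pet_weight z *\<^sub>R (f l z * cnj (f l z))))" by (rule integrable_norm)
    then show ?thesis by (simp add: norm_mult power2_eq_square)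
  qed
  show ?thesis
  proof (rule Bochner_Integration.integrable_bound[OF Bochner_Integration.integrable_add[OF diag[OF i] diag[OF j]]])
    show "AE z in lborel. norm (pet_weight z *\<^sub>R (f i z * cnj (f j z))) \<le> norm (pet_weight z * (cmod (f i z))\<^sup>2 + pet_weight z * (cmod (f j z))\<^sup>2)"
    proof (rule AE_I2)
      fix z
      have "cmod (f i z) * cmod (f j z) \<le> (cmod (f i z))\<^sup>2 + (cmod (f j z))\<^sup>2"
      proof -
        have "0 \<le> (cmod (f i z) - cmod (f j z))\<^sup>2" by simp
        then have "2 * (cmod (f i z) * cmod (f j z)) \<le> (cmod (f i z))\<^sup>2 + (cmod (f j z))\<^sup>2"
          by (simp add: power2_eq_square algebra_simps)
        moreover have "0 \<le> cmod (f i z) * cmod (f j z)" by simp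
        ultimately show ?thesis by linarith
      qed
      then have "pet_weight z * (cmod (f i z) * cmod (f j z)) \<le> pet_weight z * ((cmod (f i z))\<^sup>2 + (cmod (f j z))\<^sup>2)"
        by (rule mult_left_mono) simp
      then show "norm (pet_weight z *\<^sub>R (f i z * cnj (f j z))) \<le> norm (pet_weight z * (cmod (f i z))\<^sup>2 + pet_weight z * (cmod (f j z))\<^sup>2)"
        by (simp add: norm_mult distrib_left)
    qed
  qed measurable
qed

text \<open>Identifies the norm of coefficients with the Petersson norm, and so shows that every
  cusp form of this weight has finite norm.\<close>

lemma petersson_nn_form: "petersson_nn k (form a) = ennreal ((cvec_norm N a)\<^sup>2)"
proof -
  let ?I = "\<lambda>i j z. pet_weight z *\<^sub>R (f i z * cnj (f j z))"
  let ?R = "\<lambda>z. pet_weight z * (cmod (form a z))\<^sup>2"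
  have expand: "complex_of_real (?R z) = (\<Sum>i<N. \<Sum>j<N. (a i * cnj (a j)) * ?I i j z)" for z
  proof -
    have "complex_of_real ((cmod (form a z))\<^sup>2) = (\<Sum>i<N. \<Sum>j<N. (a i * f i z) * cnj (a j * f j z))"
      unfolding complex_norm_square random_cusp_form_def cnj_sum sum_product ..
    then have "complex_of_real (?R z) = of_real (pet_weight z) * (\<Sum>i<N. \<Sum>j<N. (a i * f i z) * cnj (a j * f j z))"
      by (simp only: of_real_mult)
    also have "\<dots> = (\<Sum>i<N. \<Sum>j<N. (a i * cnj (a j)) * ?I i j z)"
      unfolding sum_distrib_left by (intro sum.cong refl) (simp add: scaleR_conv_of_real ac_simps)
    finally show ?thesis .
  qed
  have int2: "integrable lborel (\<lambda>z. (a i * cnj (a j)) * ?I i j z)" if "i < N" "j < N" for i j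
    by (rule integrable_mult_right[OF pet_integrable[OF that]])
  have intc: "integrable lborel (\<lambda>z. complex_of_real (?R z))"
    unfolding expand by (intro Bochner_Integration.integrable_sum int2) auto
  then have "integrable lborel (\<lambda>z. norm (complex_of_real (?R z)))" by (rule integrable_norm)
  then have intR: "integrable lborel ?R" by (simp only: norm_of_real) (simp add: abs_mult)
  have "complex_of_real (LINT z|lborel. ?R z) = (LINT z|lborel. (\<Sum>i<N. \<Sum>j<N. (a i * cnj (a j)) * ?I i j z))"
    unfolding integral_complex_of_real[symmetric] expand ..
  also have "\<dots> = (\<Sum>i<N. (LINT z|lborel. (\<Sum>j<N. (a i * cnj (a j)) * ?I i j z)))"
    by (rule Bochner_Integration.integral_sum) (intro Bochner_Integration.integrable_sum int2, auto)
  also have "\<dots> = (\<Sum>i<N. \<Sum>j<N. (LINT z|lborel. (a i * cnj (a j)) * ?I i j z))"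
    by (intro sum.cong refl Bochner_Integration.integral_sum int2) auto
  also have "\<dots> = (\<Sum>i<N. \<Sum>j<N. (a i * cnj (a j)) * (if i = j then 1 else 0))"
    unfolding integral_mult_right_zero petersson_eq[symmetric] by (intro sum.cong refl) (simp add: orthonormal)
  also have "\<dots> = (\<Sum>i<N. a i * cnj (a i))"
    by (intro sum.cong refl) (simp add: if_distrib[where f = "\<lambda>x. _ * x"] cong: if_cong)
  also have "\<dots> = complex_of_real ((cvec_norm N a)\<^sup>2)"
    unfolding cvec_norm_square by (simp only: of_real_sum complex_norm_square)
  finally have "(LINT z|lborel. ?R z) = (cvec_norm N a)\<^sup>2" using of_real_eq_iff by blast
  moreover have "(\<integral>\<^sup>+z. ennreal (?R z) \<partial>lborel) = ennreal (LINT z|lborel. ?R z)"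
    by (rule nn_integral_eq_integral[OF intR]) simp
  ultimately show ?thesis by (simp add: petersson_nn_eq)
qed

definition bergman :: "complex \<Rightarrow> real" where
  "bergman z = Im z ^ k * (cvec_norm N (\<lambda>j. f j z))\<^sup>2"

lemma bergman_nonneg: "z \<in> fundamental_domain \<Longrightarrow> bergman z \<ge> 0"
  using fundamental_domain_Im(2)[of z] by (simp add: bergman_def)

lemma form_le_bergman:
  assumes "z \<in> fundamental_domain"
  shows "Im z ^ k * (cmod (form a z))\<^sup>2 \<le> (cvec_norm N a)\<^sup>2 * bergman z"
proof -
  have "(cmod (form a z))\<^sup>2 \<le> (cvec_norm N a * cvec_norm N (\<lambda>j. f j z))\<^sup>2"
    unfolding form_pair by (intro power_mono cvec_pair_le) auto
  then have "Im z ^ k * (cmod (form a z))\<^sup>2 \<le> Im z ^ k * (cvec_norm N a * cvec_norm N (\<lambda>j. f j z))\<^sup>2"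
    using fundamental_domain_Im(2)[OF assms] by (intro mult_left_mono) auto
  then show ?thesis by (simp add: bergman_def power_mult_distrib ac_simps)
qed

text \<open>The pointwise bound is applied to the extremal form at z, the reproducing kernel with
  coefficients cnj (f_j z). Its value at z and its squared norm are the same number n, so (Im z)^k
  n^2 <= T n, and one factor n cancels.\<close>

lemma bergman_upper:
  assumes z: "z \<in> fundamental_domain"
  shows "bergman z \<le> 240 * real k * min (sqrt (real k)) (sqrt (Im z))"
proof -
  define T where "T = 240 * real k * min (sqrt (real k)) (sqrt (Im z))"
  define n where "n = (cvec_norm N (\<lambda>j. f j z))\<^sup>2"
  have y: "Im z > 0" "Im z \<ge> 4/5" using fundamental_domain_Im[OF z] by auto
  have T: "T \<ge> 0" using y by (simp add: T_def)
  have n: "n \<ge> 0" by (simp add: n_def)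
  define a where "a j = cnj (f j z)" for j
  have na: "(cvec_norm N a)\<^sup>2 = n" by (simp add: n_def a_def cvec_norm_def)
  have "form a z = (\<Sum>j<N. f j z * cnj (f j z))" by (simp add: random_cusp_form_def a_def mult.commute)
  also have "\<dots> = complex_of_real n" unfolding n_def cvec_norm_square by (simp only: of_real_sum complex_norm_square)
  finally have fa: "form a z = complex_of_real n" .
  have "ennreal (Im z ^ k * (cmod (form a z))\<^sup>2) \<le> ennreal T * ennreal n"
    using cusp_form_pointwise_bound[OF form_cusp k_ge y(2), of a] unfolding petersson_nn_form na T_def .
  then have "ennreal (Im z ^ k * n\<^sup>2) \<le> ennreal (T * n)" using T n by (simp add: fa ennreal_mult)
  then have le: "Im z ^ k * n\<^sup>2 \<le> T * n" using T n by (subst (asm) ennreal_le_iff) auto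
  have "Im z ^ k * n \<le> T"
  proof (cases "n = 0")
    case False
    then have "n > 0" using n by simp
    have "(Im z ^ k * n) * n \<le> T * n" using le by (simp add: power2_eq_square mult.assoc)
    then show ?thesis using \<open>n > 0\<close> by (rule mult_right_le_imp_le)
  qed (use T in simp)
  then show ?thesis by (simp add: bergman_def T_def n_def)
qed

lemma bergman_measurable [measurable]: "bergman \<in> borel_measurable borel"
proof -
  have "(\<lambda>z. \<Sum>j<N. (cmod (f j z))\<^sup>2) \<in> borel_measurable borel"
    using f_measurable by (intro borel_measurable_sum borel_measurable_power borel_measurable_norm) auto
  then show ?thesis unfolding bergman_def[abs_def] cvec_norm_square by measurable
qed

lemma bergman_trace:
  "(\<integral>\<^sup>+z. ennreal (bergman z) * indicator fundamental_domain z * hyp_weight z \<partial>lborel) = ennreal (real N)"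
proof -
  have meas: "(\<lambda>z. ennreal ((cmod (f j z))\<^sup>2 * Im z ^ k) * indicator fundamental_domain z * hyp_weight z) \<in> borel_measurable lborel" if "j \<in> {..<N}" for j
    using f_measurable[of j] that by simp
  have "(\<integral>\<^sup>+z. ennreal (bergman z) * indicator fundamental_domain z * hyp_weight z \<partial>lborel)
      = (\<integral>\<^sup>+z. (\<Sum>j<N. ennreal ((cmod (f j z))\<^sup>2 * Im z ^ k) * indicator fundamental_domain z * hyp_weight z) \<partial>lborel)"
  proof (rule nn_integral_cong)
    fix z
    show "ennreal (bergman z) * indicator fundamental_domain z * hyp_weight z
       = (\<Sum>j<N. ennreal ((cmod (f j z))\<^sup>2 * Im z ^ k) * indicator fundamental_domain z * hyp_weight z)"
    proof (cases "z \<in> fundamental_domain")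
      case True
      then have "Im z > 0" using fundamental_domain_Im by blast
      then have "ennreal (bergman z) = (\<Sum>j<N. ennreal ((cmod (f j z))\<^sup>2 * Im z ^ k))"
        unfolding bergman_def cvec_norm_square
        by (subst sum_ennreal) (auto simp: sum_distrib_left mult.commute)
      then show ?thesis using True by (simp add: sum_distrib_right)
    qed simp
  qed
  also have "\<dots> = (\<Sum>j<N. petersson_nn k (f j))"
    unfolding petersson_nn_def by (rule nn_integral_sum[OF meas])
  also have "\<dots> = (\<Sum>j<N. 1)"
  proof (rule sum.cong[OF refl])
    fix j assume j: "j \<in> {..<N}"
    define e :: "nat \<Rightarrow> complex" where "e i = (if i = j then 1 else 0)" for i
    have "form e = f j" using j by (auto simp: fun_eq_iff random_cusp_form_def e_def if_distrib[where f = "\<lambda>x. x * _"] cong: if_cong)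
    moreover have "(cvec_norm N e)\<^sup>2 = 1"
    proof -
      have "(cvec_norm N e)\<^sup>2 = (\<Sum>i<N. if i = j then 1 else 0)"
        unfolding cvec_norm_square by (rule sum.cong) (auto simp: e_def)
      then show ?thesis using j by simp
    qed
    ultimately show "petersson_nn k (f j) = 1" using petersson_nn_form[of e] by simp
  qed
  finally show ?thesis by (simp add: ennreal_of_nat_eq_real_of_nat)
qed

text \<open>The integral of the kernel is the dimension, and its bound of order k sqrt y integrates
  to order k.\<close>

lemma dim_upper: "real N \<le> 720 * real k"
proof -
  have "ennreal (real N) = (\<integral>\<^sup>+z. ennreal (bergman z) * indicator fundamental_domain z * hyp_weight z \<partial>lborel)"
    by (rule bergman_trace[symmetric])
  also have "\<dots> \<le> (\<integral>\<^sup>+z. ennreal (240 * real k) * (ennreal (sqrt (Im z)) * indicator fundamental_domain z * hyp_weight z) \<partial>lborel)"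
  proof (rule nn_integral_mono)
    fix z
    show "ennreal (bergman z) * indicator fundamental_domain z * hyp_weight z
      \<le> ennreal (240 * real k) * (ennreal (sqrt (Im z)) * indicator fundamental_domain z * hyp_weight z)"
    proof (cases "z \<in> fundamental_domain")
      case True
      have "bergman z \<le> 240 * real k * sqrt (Im z)"
        by (rule order_trans[OF bergman_upper[OF True]]) (intro mult_left_mono, auto)
      then have "ennreal (bergman z) \<le> ennreal (240 * real k) * ennreal (sqrt (Im z))"
        using fundamental_domain_Im(2)[OF True] by (subst ennreal_mult[symmetric]) (auto intro: ennreal_leI)
      then show ?thesis using True by (simp add: mult.assoc[symmetric] mult_right_mono)
    qed simp
  qed
  also have "\<dots> = ennreal (240 * real k) * (\<integral>\<^sup>+z. ennreal (sqrt (Im z)) * indicator fundamental_domain z * hyp_weight z \<partial>lborel)"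
    by (rule nn_integral_cmult) measurable
  also have "\<dots> \<le> ennreal (240 * real k) * ennreal 3"
    by (intro mult_left_mono fundamental_domain_sqrt_integral) auto
  also have "\<dots> = ennreal (720 * real k)" by (subst ennreal_mult[symmetric]) auto
  finally show ?thesis by simp
qed

text \<open>The mean of the kernel is N divided by the area. This covers the finitely many weights
  below the range of the asymptotic lower bound.\<close>

lemma bergman_avg: "\<exists>z\<in>fundamental_domain. bergman z \<ge> real N / 2"
proof (rule ccontr)
  assume "\<not> (\<exists>z\<in>fundamental_domain. bergman z \<ge> real N / 2)"
  then have lt: "bergman z < real N / 2" if "z \<in> fundamental_domain" for z using that by force
  have "ennreal (real N) \<le> (\<integral>\<^sup>+z. ennreal (real N / 2) * (indicator fundamental_domain z * hyp_weight z) \<partial>lborel)"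
    unfolding bergman_trace[symmetric]
  proof (rule nn_integral_mono)
    fix z
    show "ennreal (bergman z) * indicator fundamental_domain z * hyp_weight z
      \<le> ennreal (real N / 2) * (indicator fundamental_domain z * hyp_weight z)"
    proof (cases "z \<in> fundamental_domain")
      case True
      have "ennreal (bergman z) \<le> ennreal (real N / 2)" using lt[OF True] by (intro ennreal_leI) simp
      then show ?thesis using True by (simp add: mult_right_mono)
    qed simp
  qed
  also have "\<dots> = ennreal (real N / 2) * (\<integral>\<^sup>+z. indicator fundamental_domain z * hyp_weight z \<partial>lborel)"
    by (rule nn_integral_cmult) measurable
  also have "\<dots> \<le> ennreal (real N / 2) * ennreal (5/4)"
    by (intro mult_left_mono fundamental_domain_area) auto
  also have "\<dots> = ennreal (real N / 2 * (5/4))" by (subst ennreal_mult[symmetric]) auto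
  finally have "real N \<le> real N / 2 * (5/4)" by simp
  then show False using dim_ge by simp
qed

end

section \<open>Lower bounds for the Bergman kernel and the dimension\<close>

text \<open>The factor sqrt n has the correct order, and it decides the exponent 3/2 of the kernel.
  The induction step is (n + 1/2) ln (1 + 1/n) >= 1.\<close>

lemma fact_upper_stirling:
  assumes "n \<ge> 1" shows "(fact n :: real) \<le> exp 1 * sqrt (real n) * (real n ^ n * exp (- real n))"
  using assms
proof (induction n rule: nat_induct_at_least)
  case base
  show ?case by (simp add: exp_minus)
next
  case (Suc n)
  have n: "real n > 0" using Suc.hyps by simp
  have A: "sqrt x * x ^ n = exp ((real n + 1/2) * ln x)" if "x > 0" for x :: real
  proof -
    have "exp ((real n + 1/2) * ln x) = exp (real n * ln x) * exp (ln x / 2)"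
      by (simp add: exp_add[symmetric] algebra_simps)
    also have "exp (real n * ln x) = x ^ n" using that by (simp add: exp_of_nat_mult)
    also have "exp (ln x / 2) = sqrt x" using that by (simp add: ln_sqrt[symmetric])
    finally show ?thesis by simp
  qed
  have "2 * (real (Suc n) - real n) / (real n + real (Suc n)) \<le> ln (real (Suc n)) - ln (real n)"
    by (rule ln_inverse_approx_ge) (use n in auto)
  then have "(real n + 1/2) * (2 / (2 * real n + 1)) \<le> (real n + 1/2) * (ln (real (Suc n)) - ln (real n))"
    using n by (intro mult_left_mono) (auto simp: algebra_simps)
  moreover have "(real n + 1/2) * (2 / (2 * real n + 1)) = 1" using n by (simp add: field_simps)
  ultimately have "1 + (real n + 1/2) * ln (real n) \<le> (real n + 1/2) * ln (real (Suc n))" by (simp only: right_diff_distrib)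
  then have "exp (1 + (real n + 1/2) * ln (real n)) \<le> exp ((real n + 1/2) * ln (real (Suc n)))" by simp
  then have key: "exp 1 * (sqrt (real n) * real n ^ n) \<le> sqrt (real (Suc n)) * real (Suc n) ^ n"
    using n by (simp only: exp_add A[of "real n"] A[of "real (Suc n)"] of_nat_0_less_iff zero_less_Suc)
  have "fact (Suc n) = real (Suc n) * fact n" by simp
  also have "\<dots> \<le> real (Suc n) * (exp 1 * sqrt (real n) * (real n ^ n * exp (- real n)))"
    by (rule mult_left_mono[OF Suc.IH]) simp
  also have "\<dots> = real (Suc n) * exp (- real n) * (exp 1 * (sqrt (real n) * real n ^ n))" by (simp only: ac_simps)
  also have "\<dots> \<le> real (Suc n) * exp (- real n) * (sqrt (real (Suc n)) * real (Suc n) ^ n)"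
    by (rule mult_left_mono[OF key]) simp
  also have "exp (- real n) = exp 1 * exp (- real (Suc n))" by (simp add: exp_add[symmetric])
  finally show ?case by (simp only: power_Suc ac_simps)
qed

lemma nn_integral_power_exp:
  assumes l: "l > 0"
  shows "(\<integral>\<^sup>+y. ennreal (y ^ n * exp (- (l * y))) * indicator {0..} y \<partial>lborel) = ennreal (fact n / l ^ Suc n)"
proof -
  let ?f = "\<lambda>y. ennreal (y ^ n * exp (- (l * y))) * indicator {0..} y :: ennreal"
  have "(\<integral>\<^sup>+y. ?f y \<partial>lborel) = ennreal \<bar>1 / l\<bar> * (\<integral>\<^sup>+x. ?f (0 + (1 / l) * x) \<partial>lborel)"
    using l by (intro nn_integral_real_affine) auto
  also have "(\<integral>\<^sup>+x. ?f (0 + (1 / l) * x) \<partial>lborel) = (\<integral>\<^sup>+x. ennreal (1 / l ^ n) * (ennreal (x ^ n * exp (- x)) * indicator {0..} x) \<partial>lborel)"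
  proof (rule nn_integral_cong)
    fix x :: real
    show "?f (0 + (1 / l) * x) = ennreal (1 / l ^ n) * (ennreal (x ^ n * exp (- x)) * indicator {0..} x)"
      using l by (cases "x \<ge> 0") (auto simp: ennreal_mult[symmetric] power_divide zero_le_divide_iff)
  qed
  also have "\<dots> = ennreal (1 / l ^ n) * ennreal (fact n)"
    by (subst nn_integral_cmult) (auto simp: nn_intergal_power_times_exp_Ici)
  also have "ennreal \<bar>1 / l\<bar> * (ennreal (1 / l ^ n) * ennreal (fact n)) = ennreal (fact n / l ^ Suc n)"
    using l by (simp add: ennreal_mult[symmetric])
  finally show ?thesis .
qed

text \<open>The height integral is extended down to 0, where it becomes a complete gamma
  integral.\<close>

lemma petersson_nn_exp_bound:
  assumes k: "k \<ge> 2" and m: "m \<ge> 1" and B: "B \<ge> 0"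
    and g: "\<And>z. z \<in> fundamental_domain \<Longrightarrow> cmod (g z) \<le> B * exp (- 2 * pi * real m * Im z)"
  shows "petersson_nn k g \<le> ennreal (B\<^sup>2 * (fact (k - 2) / (4 * pi * real m) ^ (k - 1)))"
proof -
  define l where "l = 4 * pi * real m"
  have l: "l > 0" using m by (simp add: l_def)
  let ?h = "\<lambda>y. B\<^sup>2 * (exp (- (l * y)) * y ^ k)"
  have "petersson_nn k g \<le> (\<integral>\<^sup>+z. ennreal (?h (Im z)) * indicator fundamental_domain z * hyp_weight z \<partial>lborel)"
    unfolding petersson_nn_def
  proof (rule nn_integral_mono)
    fix z
    show "ennreal ((cmod (g z))\<^sup>2 * Im z ^ k) * indicator fundamental_domain z * hyp_weight z
      \<le> ennreal (?h (Im z)) * indicator fundamental_domain z * hyp_weight z"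
    proof (cases "z \<in> fundamental_domain")
      case True
      have y: "Im z > 0" using fundamental_domain_Im[OF True] by blast
      have "(cmod (g z))\<^sup>2 \<le> (B * exp (- 2 * pi * real m * Im z))\<^sup>2" using g[OF True] by (intro power_mono) auto
      also have "\<dots> = B\<^sup>2 * exp (- (l * Im z))"
        by (simp add: power_mult_distrib l_def mult.assoc flip: exp_double)
      finally have "(cmod (g z))\<^sup>2 * Im z ^ k \<le> B\<^sup>2 * exp (- (l * Im z)) * Im z ^ k"
        using y by (intro mult_right_mono) auto
      then have "ennreal ((cmod (g z))\<^sup>2 * Im z ^ k) \<le> ennreal (?h (Im z))" by (intro ennreal_leI) (simp add: mult.assoc)
      then show ?thesis by (intro mult_right_mono) auto
    qed simp
  qed
  also have "\<dots> \<le> (\<integral>\<^sup>+y. ennreal (?h y / y\<^sup>2) * indicator {4/5..} y \<partial>lborel)"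
    by (rule nn_integral_fundamental_domain_le) auto
  also have "\<dots> \<le> (\<integral>\<^sup>+y. ennreal (B\<^sup>2) * (ennreal (y ^ (k - 2) * exp (- (l * y))) * indicator {0..} y) \<partial>lborel)"
  proof (rule nn_integral_mono)
    fix y :: real
    show "ennreal (?h y / y\<^sup>2) * indicator {4/5..} y \<le> ennreal (B\<^sup>2) * (ennreal (y ^ (k - 2) * exp (- (l * y))) * indicator {0..} y)"
    proof (cases "y \<ge> 4/5")
      case True
      have "y ^ k = y ^ (k - 2) * y\<^sup>2" using k by (metis le_add_diff_inverse2 power_add)
      then have "?h y / y\<^sup>2 = B\<^sup>2 * (y ^ (k - 2) * exp (- (l * y)))" using True by simp
      then show ?thesis using True by (simp add: ennreal_mult)
    qed simp
  qed
  also have "\<dots> = ennreal (B\<^sup>2) * ennreal (fact (k - 2) / l ^ Suc (k - 2))"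
    by (subst nn_integral_cmult) (auto simp: nn_integral_power_exp[OF l])
  also have "Suc (k - 2) = k - 1" using k by simp
  also have "ennreal (B\<^sup>2) * ennreal (fact (k - 2) / l ^ (k - 1)) = ennreal (B\<^sup>2 * (fact (k - 2) / l ^ (k - 1)))"
    using l by (subst ennreal_mult) auto
  finally show ?thesis by (simp only: l_def)
qed

text \<open>The kernel at z is at least y^k |g z|^2 divided by the squared norm of g, for any cusp
  form g. For the product of \<open>\<Phi>\<close> with an Eisenstein series, the numerator at the
  peak is comparable to y^k exp (-k) and the norm is at most of order (k-2)! / l^(k-1); by Stirling
  the quotient is of order k^2 / sqrt k.\<close>

lemma bergman_lower:
  obtains c k0 where "c > 0"
    "\<And>k f. cusp_basis k f \<Longrightarrow> even k \<Longrightarrow> k \<ge> k0 \<Longrightarrow>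
       \<exists>z\<in>fundamental_domain. cusp_basis.bergman k f z \<ge> c * (real k * sqrt (real k))"
proof -
  obtain w \<Phi> where w: "w \<ge> 1" "even w" "\<Phi> \<in> cusp_forms w" "\<Phi> \<i> \<noteq> 0" by (rule exists_cusp_form)
  have iH: "\<i> \<in> upper_half_plane" by (simp add: upper_half_plane_def)
  obtain m C c Y where m: "m \<ge> 1" "C > 0" "c > 0" "Y \<ge> 1"
    "\<And>z. Im z \<ge> 1/2 \<Longrightarrow> cmod (\<Phi> z) \<le> C * exp (- 2 * pi * real m * Im z)"
    "\<And>z. Im z \<ge> Y \<Longrightarrow> cmod (\<Phi> z) \<ge> c * exp (- 2 * pi * real m * Im z)"
    by (rule cusp_form_order[OF w(3) iH w(4)], rule that)
  obtain Y' where Y': "Y' \<ge> 1" "\<And>k z. k \<ge> 4 \<Longrightarrow> even k \<Longrightarrow> Im z \<ge> Y' \<Longrightarrow> cmod (eisenstein k z) \<ge> 1"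
    by (rule eisenstein_lower, rule that)
  define B where "B = C * (64 * lattice_total + 1)"
  have B: "B > 0" using m lattice_total_nonneg by (simp add: B_def add_nonneg_pos)
  define l where "l = 4 * pi * real m"
  have l: "l > 0" using m by (simp add: l_def)
  \<comment> \<open>Large enough for the Eisenstein weight k - w to be at least 4 and for the peak k
    / l to lie above both thresholds.\<close>
  define k0 where "k0 = w + 4 + nat \<lceil>l * (Y + Y')\<rceil>"
  define d where "d = c\<^sup>2 / (2 * exp 1 * l * B\<^sup>2)"
  have d: "d > 0" using m l B by (simp add: d_def)
  have "\<exists>z\<in>fundamental_domain. cusp_basis.bergman k f z \<ge> d * (real k * sqrt (real k))"
    if cb: "cusp_basis k f" and ev: "even k" and kk: "k \<ge> k0" for k f
  proof -
    interpret cusp_basis k f by (rule cb)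
    have kw: "k \<ge> w + 4" "k - w \<ge> 4" using kk by (auto simp: k0_def)
    have evw: "even (k - w)" using ev w(2) kw by auto
    define g where "g z = \<Phi> z * eisenstein (k - w) z" for z
    have "g \<in> cusp_forms (w + (k - w))" unfolding g_def[abs_def] by (rule cusp_form_mult_eisenstein[OF w(3) kw(2)])
    then have g: "g \<in> cusp_forms k" using kw by simp
    have gB: "cmod (g z) \<le> B * exp (- 2 * pi * real m * Im z)" if z: "z \<in> fundamental_domain" for z
    proof -
      have "cmod (\<Phi> z) \<le> C * exp (- 2 * pi * real m * Im z)" using fundamental_domain_Im(3)[OF z] by (intro m(5)) simp
      moreover have "cmod (eisenstein (k - w) z) \<le> 64 * lattice_total + 1" using eisenstein_bounded[OF z kw(2)] by simp
      ultimately have "cmod (\<Phi> z) * cmod (eisenstein (k - w) z) \<le> (C * exp (- 2 * pi * real m * Im z)) * (64 * lattice_total + 1)"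
        using m by (intro mult_mono) auto
      then show ?thesis by (simp add: g_def norm_mult B_def ac_simps)
    qed
    obtain a where a: "g = form a" by (rule cusp_form_obtain[OF g])
    have k2: "k \<ge> 2" using kw by simp
    have "ennreal ((cvec_norm N a)\<^sup>2) \<le> ennreal (B\<^sup>2 * (fact (k - 2) / l ^ (k - 1)))"
      unfolding petersson_nn_form[symmetric] a[symmetric] l_def
      by (rule petersson_nn_exp_bound[OF k2 m(1) _ gB]) (use B in simp)
    then have na: "(cvec_norm N a)\<^sup>2 \<le> B\<^sup>2 * (fact (k - 2) / l ^ (k - 1))"
      using l by (subst (asm) ennreal_le_iff) auto
    \<comment> \<open>The maximum of y^k exp (-l y).\<close>
    define y where "y = real k / l"
    define z where "z = Complex 0 y"
    have ky: "l * y = real k" using l by (simp add: y_def)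
    have "l * (Y + Y') \<le> real k" using kk unfolding k0_def by linarith
    then have "Y + Y' \<le> y" using l by (simp add: y_def pos_le_divide_eq mult.commute)
    then have y: "y \<ge> Y" "y \<ge> Y'" "y > 0" "y \<ge> 1" using m(4) Y'(1) by auto
    have z: "z \<in> fundamental_domain" "Im z = y"
      using y by (auto simp: z_def fundamental_domain_def upper_half_plane_def cmod_def)
    have "c * exp (- 2 * pi * real m * y) * 1 \<le> cmod (\<Phi> z) * cmod (eisenstein (k - w) z)"
      using m(6)[of z] Y'(2)[OF kw(2) evw, of z] z(2) y m(3) by (intro mult_mono) auto
    then have "(c * exp (- 2 * pi * real m * y))\<^sup>2 \<le> (cmod (g z))\<^sup>2"
      using m(3) by (intro power_mono) (auto simp: g_def norm_mult)
    moreover have "(c * exp (- 2 * pi * real m * y))\<^sup>2 = c\<^sup>2 * exp (- real k)"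
      unfolding ky[symmetric] by (simp add: power_mult_distrib l_def mult.assoc flip: exp_double)
    ultimately have "y ^ k * (c\<^sup>2 * exp (- real k)) \<le> y ^ k * (cmod (g z))\<^sup>2" using y by (intro mult_left_mono) auto
    also have "\<dots> \<le> (cvec_norm N a)\<^sup>2 * bergman z" using form_le_bergman[OF z(1), of a] by (simp add: z(2) a)
    also have "\<dots> \<le> (B\<^sup>2 * (fact (k - 2) / l ^ (k - 1))) * bergman z"
      by (rule mult_right_mono[OF na bergman_nonneg[OF z(1)]])
    finally have 1: "y ^ k * (c\<^sup>2 * exp (- real k)) \<le> (B\<^sup>2 * (fact (k - 2) / l ^ (k - 1))) * bergman z" .
    have "l ^ k * (y ^ k * (c\<^sup>2 * exp (- real k))) \<le> l ^ k * ((B\<^sup>2 * (fact (k - 2) / l ^ (k - 1))) * bergman z)"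
      using l by (intro mult_left_mono[OF 1]) auto
    moreover have "l ^ k * (y ^ k * (c\<^sup>2 * exp (- real k))) = real k ^ k * (c\<^sup>2 * exp (- real k))"
      unfolding ky[symmetric] by (simp add: power_mult_distrib)
    moreover have "l ^ k = l * l ^ (k - 1)" using k2 by (cases k) auto
    then have "l ^ k * ((B\<^sup>2 * (fact (k - 2) / l ^ (k - 1))) * bergman z) = B\<^sup>2 * l * bergman z * fact (k - 2)"
      using l by simp
    ultimately have 2: "real k ^ k * (c\<^sup>2 * exp (- real k)) \<le> B\<^sup>2 * l * bergman z * fact (k - 2)" by simp
    have F: "(real k)\<^sup>2 * fact (k - 2) \<le> 2 * (exp 1 * sqrt (real k) * (real k ^ k * exp (- real k)))"
    proof -
      have "fact k = real k * (real k - 1) * fact (k - 2)"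
      proof -
        obtain j where "k = Suc (Suc j)" using k2 by (metis add_2_eq_Suc le_Suc_ex)
        then show ?thesis by simp
      qed
      moreover have "(real k)\<^sup>2 \<le> 2 * (real k * (real k - 1))"
      proof -
        have "real k * 2 \<le> real k * real k" using k2 by (intro mult_left_mono) auto
        then show ?thesis by (simp add: power2_eq_square algebra_simps)
      qed
      then have "(real k)\<^sup>2 * fact (k - 2) \<le> 2 * (real k * (real k - 1)) * fact (k - 2)" by (intro mult_right_mono) auto
      ultimately have "(real k)\<^sup>2 * fact (k - 2) \<le> 2 * fact k" by simp
      moreover have "(fact k :: real) \<le> exp 1 * sqrt (real k) * (real k ^ k * exp (- real k))"
        by (rule fact_upper_stirling) (use k2 in simp)
      ultimately show ?thesis by simp
    qed
    define K where "K = bergman z"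
    have K: "K \<ge> 0" using bergman_nonneg[OF z(1)] by (simp add: K_def)
    define E where "E = real k ^ k * exp (- real k)"
    have E: "E > 0" using k2 by (simp add: E_def)
    have "(real k)\<^sup>2 * (E * c\<^sup>2) \<le> (real k)\<^sup>2 * (B\<^sup>2 * l * K * fact (k - 2))"
      using 2 by (intro mult_left_mono) (auto simp: E_def K_def ac_simps)
    also have "\<dots> = (B\<^sup>2 * l * K) * ((real k)\<^sup>2 * fact (k - 2))" by (simp only: ac_simps)
    also have "\<dots> \<le> (B\<^sup>2 * l * K) * (2 * (exp 1 * sqrt (real k) * E))"
      unfolding E_def by (rule mult_left_mono[OF F]) (use l K in simp)
    finally have "E * ((real k)\<^sup>2 * c\<^sup>2) \<le> E * ((2 * exp 1 * l * B\<^sup>2) * K * sqrt (real k))" by (simp only: ac_simps)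
    then have 3: "(real k)\<^sup>2 * c\<^sup>2 \<le> (2 * exp 1 * l * B\<^sup>2) * K * sqrt (real k)" using E by (simp only: mult_le_cancel_left_pos)
    define s where "s = sqrt (real k)"
    have s: "s > 0" "real k = s * s" using k2 by (auto simp: s_def)
    define G where "G = 2 * exp 1 * l * B\<^sup>2"
    have G: "G > 0" using l B by (simp add: G_def)
    have "(s * s * s * c\<^sup>2) * s \<le> (G * K) * s" using 3 unfolding s_def[symmetric] G_def[symmetric] unfolding s(2) by (simp add: power2_eq_square ac_simps)
    then have "s * s * s * c\<^sup>2 \<le> G * K" using s by (simp only: mult_le_cancel_right_pos)
    then have "c\<^sup>2 / G * (s * s * s) \<le> K" using G by (simp add: field_simps)
    then have "d * (real k * sqrt (real k)) \<le> bergman z"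
      unfolding d_def G_def[symmetric] s_def[symmetric] K_def[symmetric] unfolding s(2) .
    then show ?thesis using z(1) by blast
  qed
  then show ?thesis using that d by blast
qed

section \<open>The lower bound for the dimension\<close>

text \<open>The products vanish at the cusp to different orders. Dividing a relation by the lowest
  power of \<open>\<Phi>\<close> that occurs, which is possible high up where \<open>\<Phi>\<close>
  has no zero, and letting Im z grow leaves its coefficient times a nonzero constant term.\<close>

lemma cusp_eisenstein_independent:
  assumes w: "w \<ge> 1" "even w" and Y: "\<And>z. Im z \<ge> Y \<Longrightarrow> \<Phi> z \<noteq> 0" and Phi: "\<Phi> \<in> cusp_forms w"
    and k: "even k" "w * J + 4 \<le> k"
    and rel: "\<And>z. (\<Sum>j=1..J. c j * (\<Phi> z ^ j * eisenstein (k - w * j) z)) = 0"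
    and j: "j \<in> {1..J}"
  shows "c j = 0"
proof (rule ccontr)
  assume "c j \<noteq> 0"
  define j0 where "j0 = (LEAST j. j \<ge> 1 \<and> c j \<noteq> 0)"
  have j0: "j0 \<ge> 1" "c j0 \<noteq> 0" "j0 \<le> j"
    using LeastI[of "\<lambda>j. j \<ge> 1 \<and> c j \<noteq> 0" j] Least_le[of "\<lambda>j. j \<ge> 1 \<and> c j \<noteq> 0" j] \<open>c j \<noteq> 0\<close> j
    by (auto simp: j0_def)
  have below: "c i = 0" if "1 \<le> i" "i < j0" for i
    using not_less_Least[of i "\<lambda>j. j \<ge> 1 \<and> c j \<noteq> 0"] that by (auto simp: j0_def)
  have j0J: "j0 \<le> J" using j0 j by simp
  have wt: "k - w * i \<ge> 4" "even (k - w * i)" if "i \<le> J" for i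
  proof -
    have "w * i \<le> w * J" using that by simp
    then show "k - w * i \<ge> 4" using k by linarith
    show "even (k - w * i)" using k w by auto
  qed
  let ?h = "\<lambda>z. \<Sum>i=j0..J. c i * (\<Phi> z ^ (i - j0) * eisenstein (k - w * i) z)"
  have h0: "?h z = 0" if "\<Phi> z \<noteq> 0" for z
  proof -
    have "\<Phi> z ^ j0 * ?h z = (\<Sum>i=j0..J. c i * (\<Phi> z ^ i * eisenstein (k - w * i) z))"
      unfolding sum_distrib_left
    proof (rule sum.cong[OF refl])
      fix i assume "i \<in> {j0..J}"
      then have "\<Phi> z ^ i = \<Phi> z ^ j0 * \<Phi> z ^ (i - j0)" by (simp flip: power_add)
      then show "\<Phi> z ^ j0 * (c i * (\<Phi> z ^ (i - j0) * eisenstein (k - w * i) z)) = c i * (\<Phi> z ^ i * eisenstein (k - w * i) z)"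
        by simp
    qed
    also have "\<dots> = (\<Sum>i=1..J. c i * (\<Phi> z ^ i * eisenstein (k - w * i) z))"
      by (rule sum.mono_neutral_left) (use j0 below in auto)
    finally show ?thesis using rel[of z] that by simp
  qed
  have "(?h \<longlongrightarrow> (\<Sum>i=j0..J. c i * (0 ^ (i - j0) * eisenstein_const (k - w * i)))) (filtercomap Im at_top)"
    by (intro tendsto_intros cusp_form_tendsto[OF Phi] eisenstein_tendsto wt) auto
  moreover have "eventually (\<lambda>z. ?h z = 0) (filtercomap Im at_top)"
    unfolding eventually_filtercomap_at_top_linorder using h0 Y by blast
  then have "(?h \<longlongrightarrow> 0) (filtercomap Im at_top)" by (rule tendsto_eventually)
  moreover have "filtercomap Im at_top \<noteq> bot"
  proof
    assume "filtercomap Im at_top = bot"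
    then have "eventually (\<lambda>z. False) (filtercomap Im at_top)" by simp
    then obtain b where "\<And>z. Im z \<ge> b \<Longrightarrow> False" unfolding eventually_filtercomap_at_top_linorder by blast
    from this[of "Complex 0 b"] show False by simp
  qed
  ultimately have "(\<Sum>i=j0..J. c i * (0 ^ (i - j0) * eisenstein_const (k - w * i))) = 0"
    using tendsto_unique by blast
  moreover have "(\<Sum>i=j0..J. c i * (0 ^ (i - j0) * eisenstein_const (k - w * i))) = (\<Sum>i\<in>{j0}. c i * (0 ^ (i - j0) * eisenstein_const (k - w * i)))"
    by (rule sum.mono_neutral_right) (use j0J in auto)
  ultimately have "eisenstein_const (k - w * j0) = 0" using j0 by simp
  then show False using eisenstein_const_ge[OF wt[OF j0J]] by simp
qed

lemma cusp_dim_lower: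
  obtains W where "W > 0" "\<And>k f. cusp_basis k f \<Longrightarrow> even k \<Longrightarrow> real k \<le> W * real (cusp_dim k)"
proof -
  obtain w \<Phi> where w: "w \<ge> 1" "even w" "\<Phi> \<in> cusp_forms w" "\<Phi> \<i> \<noteq> 0" by (rule exists_cusp_form)
  have iH: "\<i> \<in> upper_half_plane" by (simp add: upper_half_plane_def)
  obtain m c Y where m: "c > 0" "\<And>z. Im z \<ge> Y \<Longrightarrow> cmod (\<Phi> z) \<ge> c * exp (- 2 * pi * real (m::nat) * Im z)"
    by (rule cusp_form_order[OF w(3) iH w(4)], rule that)
  have nz: "\<Phi> z \<noteq> 0" if "Im z \<ge> Y" for z
  proof
    assume "\<Phi> z = 0"
    then have "c * exp (- 2 * pi * real m * Im z) \<le> 0" using m(2)[OF that] by simp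
    moreover have "c * exp (- 2 * pi * real m * Im z) > 0" using m(1) by simp
    ultimately show False by linarith
  qed
  have "real k \<le> (2 * real w + 4) * real (cusp_dim k)" if cb: "cusp_basis k f" and ev: "even k" for k f
  proof -
    interpret cusp_basis k f by (rule cb)
    \<comment> \<open>The number of admissible products: the Eisenstein factor of weight k - w j
      needs k - w j >= 4.\<close>
    define J where "J = (k - 4) div w"
    have "J \<le> N"
    proof (cases "J = 0")
      case False
      have "w * J \<le> k - 4" unfolding J_def by simp
      moreover have "w * J \<ge> 1" using False w by simp
      ultimately have kJ: "w * J + 4 \<le> k" by linarith
      define F where "F j z = \<Phi> z ^ j * eisenstein (k - w * j) z" for j z
      have F: "F j \<in> cusp_forms k" if j: "j \<in> {1..J}" for j
      proof -
        have wj: "w * j \<le> w * J" using j by simp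
        have kj: "k - w * j \<ge> 4" using wj kJ by linarith
        have "F j \<in> cusp_forms (w * j + (k - w * j))"
          unfolding F_def[abs_def] using j by (intro cusp_form_mult_eisenstein[OF _ kj] cusp_form_power w) auto
        then show ?thesis using wj kJ by simp
      qed
      have rel: "u j = 0" if "\<And>z. (\<Sum>j=1..J. u j * F j z) = 0" "j \<in> {1..J}" for u j
        by (rule cusp_eisenstein_independent[OF w(1,2) nz w(3) ev kJ _ that(2)]) (use that(1) in \<open>auto simp: F_def\<close>)
      have inj: "inj_on F {1..J}"
      proof (rule inj_onI, rule ccontr)
        fix i j assume ij: "i \<in> {1..J}" "j \<in> {1..J}" "F i = F j" "i \<noteq> j"
        \<comment> \<open>Two equal products would give the relation F i - F j = 0 with coefficients
          1 and -1.\<close>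
        define u :: "nat \<Rightarrow> complex" where "u l = (if l = i then 1 else 0) - (if l = j then 1 else 0)" for l
        have *: "(\<Sum>l=1..J. u l * F l z) = F i z - F j z" for z
          unfolding u_def left_diff_distrib sum_subtractf using ij(1,2)
          by (simp add: if_distrib[where f = "\<lambda>x. x * _"] cong: if_cong)
        have "u i = 0" by (rule rel[OF _ ij(1)]) (simp only: * ij(3) diff_self)
        then show False using ij(4) by (simp add: u_def)
      qed
      have "cfun.independent (F ` {1..J})"
      proof (rule cfun.independent_if_scalars_zero)
        fix u v assume s: "(\<Sum>v\<in>F ` {1..J}. fun_scale (u v) v) = 0" and v: "v \<in> F ` {1..J}"
        then obtain j where j: "j \<in> {1..J}" "v = F j" by blast
        have "(\<Sum>j=1..J. u (F j) * F j z) = 0" for z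
        proof -
          have "(\<Sum>j=1..J. fun_scale (u (F j)) (F j)) = 0" using s by (simp only: sum.reindex[OF inj] o_def)
          then have "(\<Sum>j=1..J. fun_scale (u (F j)) (F j)) z = 0" by simp
          then show ?thesis by (simp only: sum_fun_apply fun_scale_def)
        qed
        from rel[of "\<lambda>j. u (F j)", OF this j(1)] show "u v = 0" by (simp add: j)
      qed simp
      moreover have "F ` {1..J} \<subseteq> cfun.span (f ` {..<N})" using F by (auto simp: span_f)
      ultimately have "card (F ` {1..J}) \<le> card (f ` {..<N})"
        using cfun.independent_span_bound[of "f ` {..<N}" "F ` {1..J}"] by simp
      then have "card {1..J} \<le> card {..<N}" by (simp only: card_image[OF inj] card_image[OF inj_f])
      then show ?thesis by simp
    qed simp
    have "k - 4 < w * (J + 1)"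
    proof -
      have "(k - 4) mod w < w" using w by simp
      then show ?thesis unfolding J_def distrib_left using mult_div_mod_eq[of w "k - 4"] by linarith
    qed
    then have "k \<le> w * (J + 1) + 4" by linarith
    \<comment> \<open>\<open>dim_ge\<close>, that is N >= 1, absorbs the additive constants.\<close>
    also have "\<dots> \<le> w * (N + N) + 4 * N" using \<open>J \<le> N\<close> dim_ge by (intro add_mono mult_le_mono) auto
    finally have "real k \<le> real (w * (N + N) + 4 * N)" by (rule of_nat_mono)
    then show ?thesis by (simp add: algebra_simps)
  qed
  then show ?thesis using that[of "2 * real w + 4"] by (simp add: add_nonneg_pos)
qed

section \<open>The random sup-norm\<close>

lemma powr_quarter: "x \<ge> 0 \<Longrightarrow> x powr (1/4) = sqrt (sqrt x)"
proof -
  assume x: "x \<ge> 0"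
  have "x powr (1/4) = (x powr (1/2)) powr (1/2)" by (simp add: powr_powr)
  also have "\<dots> = sqrt (sqrt x)" using x by (simp add: powr_half_sqrt)
  finally show ?thesis .
qed

context cusp_basis
begin

text \<open>The normalised evaluation functional at z: its pairing with a has modulus y^(k/2) |form
  a z|, and its squared norm is the Bergman kernel. The random supremum is thus a supremum of moduli
  of linear functionals.\<close>

definition nvec :: "complex \<Rightarrow> nat \<Rightarrow> complex" where
  "nvec z j = sqrt (Im z ^ k) *\<^sub>R f j z"

definition lip :: real where
  "lip = sqrt (240 * (real k * sqrt (real k)))"

lemma lip_pos: "lip > 0"
  using k_ge by (simp add: lip_def)

lemma lip_square: "lip\<^sup>2 = 240 * (real k * sqrt (real k))"
  by (simp add: lip_def)

lemma nvec_norm: "z \<in> fundamental_domain \<Longrightarrow> cvec_norm N (nvec z) = sqrt (bergman z)"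
  using fundamental_domain_Im(2)[of z]
  by (simp add: nvec_def[abs_def] cvec_norm_scaleR bergman_def real_sqrt_mult)

lemma nvec_norm_le: "z \<in> fundamental_domain \<Longrightarrow> cvec_norm N (nvec z) \<le> lip"
proof -
  assume z: "z \<in> fundamental_domain"
  have "bergman z \<le> 240 * real k * sqrt (real k)"
    by (rule order_trans[OF bergman_upper[OF z]]) (intro mult_left_mono, auto)
  then show ?thesis using z by (simp add: nvec_norm lip_def mult.assoc)
qed

lemma pair_nvec: "cvec_pair N a (nvec z) = sqrt (Im z ^ k) *\<^sub>R form a z"
  unfolding nvec_def[abs_def] cvec_pair_scaleR form_pair ..

lemma pair_nvec_le: "z \<in> fundamental_domain \<Longrightarrow> cmod (cvec_pair N a (nvec z)) \<le> lip * cvec_norm N a"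
proof -
  assume z: "z \<in> fundamental_domain"
  have "cmod (cvec_pair N a (nvec z)) \<le> cvec_norm N a * cvec_norm N (nvec z)" by (rule cvec_pair_le)
  also have "\<dots> \<le> cvec_norm N a * lip" by (intro mult_left_mono nvec_norm_le[OF z]) simp
  finally show ?thesis by (simp add: mult.commute)
qed

lemma sup_rv_eq: "sup_rv k f a = (SUP z\<in>fundamental_domain. cmod (cvec_pair N a (nvec z)))"
  unfolding sup_rv_def form_sup_def
proof (rule SUP_cong[OF refl])
  fix z assume z: "z \<in> fundamental_domain"
  then have y: "Im z > 0" using fundamental_domain_Im by blast
  have "Im z powr (real k / 2) = (Im z powr real k) powr (1/2)" by (simp add: powr_powr)
  also have "\<dots> = sqrt (Im z ^ k)" using y by (simp add: powr_half_sqrt powr_realpow)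
  finally show "Im z powr (real k / 2) * cmod (form a z) = cmod (cvec_pair N a (nvec z))"
    using y by (simp add: pair_nvec)
qed

lemma pair_bdd: "bdd_above ((\<lambda>z. cmod (cvec_pair N a (nvec z))) ` fundamental_domain)"
  using pair_nvec_le by (auto intro!: bdd_aboveI[where M = "lip * cvec_norm N a"])

lemma sup_rv_upper: "z \<in> fundamental_domain \<Longrightarrow> cmod (cvec_pair N a (nvec z)) \<le> sup_rv k f a"
  unfolding sup_rv_eq by (rule cSUP_upper[OF _ pair_bdd])

lemma sup_rv_least: "(\<And>z. z \<in> fundamental_domain \<Longrightarrow> cmod (cvec_pair N a (nvec z)) \<le> B) \<Longrightarrow> sup_rv k f a \<le> B"
  unfolding sup_rv_eq using i_fundamental_domain by (intro cSUP_least) auto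

lemma sup_rv_nonneg: "sup_rv k f a \<ge> 0"
  using sup_rv_upper[OF i_fundamental_domain, of a] norm_ge_zero order_trans by blast

lemma sup_rv_le: "sup_rv k f a \<le> lip * cvec_norm N a"
  by (rule sup_rv_least) (rule pair_nvec_le)

lemma sup_rv_lipschitz: "sup_rv k f b - sup_rv k f a \<le> lip * cvec_norm N (\<lambda>j. a j - b j)"
proof -
  have "sup_rv k f b \<le> sup_rv k f a + lip * cvec_norm N (\<lambda>j. b j - a j)"
  proof (rule sup_rv_least)
    fix z assume z: "z \<in> fundamental_domain"
    have "cmod (cvec_pair N b (nvec z)) \<le> cmod (cvec_pair N a (nvec z)) + cmod (cvec_pair N b (nvec z) - cvec_pair N a (nvec z))"
      by (rule norm_triangle_sub)
    also have "cvec_pair N b (nvec z) - cvec_pair N a (nvec z) = cvec_pair N (\<lambda>j. b j - a j) (nvec z)"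
      by (rule cvec_pair_diff[symmetric])
    finally show "cmod (cvec_pair N b (nvec z)) \<le> sup_rv k f a + lip * cvec_norm N (\<lambda>j. b j - a j)"
      using sup_rv_upper[OF z, of a] pair_nvec_le[OF z, of "\<lambda>j. b j - a j"] by linarith
  qed
  then show ?thesis using cvec_norm_minus_commute[of N a b] by simp
qed

lemma pair_continuous: "continuous_on fundamental_domain (\<lambda>z. cmod (cvec_pair N a (nvec z)))"
proof -
  have "continuous_on fundamental_domain (f j)" if "j \<in> {..<N}" for j
  proof (rule continuous_on_subset)
    show "continuous_on upper_half_plane (f j)"
      using f_cusp that by (intro holomorphic_on_imp_continuous_on cusp_form_holomorphic) auto
  qed (auto simp: fundamental_domain_def)
  then show ?thesis unfolding cvec_pair_def nvec_def by (intro continuous_intros) auto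
qed

text \<open>By continuity in z the supremum may be taken over a countable dense subset of the
  domain.\<close>

lemma sup_rv_measurable: "sup_rv k f \<in> borel_measurable (cvec_borel N)"
proof -
  obtain Q where Q: "countable Q" "Q \<subseteq> fundamental_domain" "fundamental_domain \<subseteq> closure Q"
    using separable[of fundamental_domain] by metis
  have Qne: "Q \<noteq> {}" using Q(3) i_fundamental_domain by auto
  have bddQ: "bdd_above ((\<lambda>z. cmod (cvec_pair N a (nvec z))) ` Q)" for a
    by (rule bdd_above_mono[OF pair_bdd[of a]]) (use Q(2) in auto)
  have "sup_rv k f a = (SUP z\<in>Q. cmod (cvec_pair N a (nvec z)))" for a
  proof (rule antisym)
    show "sup_rv k f a \<le> (SUP z\<in>Q. cmod (cvec_pair N a (nvec z)))"
    proof (rule sup_rv_least)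
      fix z assume z: "z \<in> fundamental_domain"
      then obtain x where x: "\<And>n. x n \<in> Q" "x \<longlonglongrightarrow> z"
        using Q(3) closure_sequential[of z Q] by blast
      have "(\<lambda>n. cmod (cvec_pair N a (nvec (x n)))) \<longlonglongrightarrow> cmod (cvec_pair N a (nvec z))"
        by (rule continuous_on_tendsto_compose[OF pair_continuous x(2) z])
           (use x(1) Q(2) in \<open>auto intro!: always_eventually\<close>)
      then show "cmod (cvec_pair N a (nvec z)) \<le> (SUP z\<in>Q. cmod (cvec_pair N a (nvec z)))"
        by (rule LIMSEQ_le_const2) (auto intro!: cSUP_upper x(1) bddQ)
    qed
    show "(SUP z\<in>Q. cmod (cvec_pair N a (nvec z))) \<le> sup_rv k f a"
      using Qne Q(2) by (intro cSUP_least sup_rv_upper) auto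
  qed
  then have "sup_rv k f = (\<lambda>a. SUP z\<in>Q. cmod (cvec_pair N a (nvec z)))" by (rule ext)
  also have "\<dots> \<in> borel_measurable (cvec_borel N)"
    by (rule borel_measurable_cSUP[OF Q(1) _ bddQ]) measurable
  finally show ?thesis .
qed

lemma sup_rv_integrable: "integrable (uniform_unit_sphere N) (sup_rv k f)"
  by (rule sphere_integrable_bounded[OF dim_ge sup_rv_measurable, of lip])
     (use sup_rv_le sup_rv_nonneg in \<open>auto simp: abs_of_nonneg\<close>, metis mult.right_neutral)

lemma expected_lower:
  assumes z: "z \<in> fundamental_domain"
  shows "sqrt (bergman z) / (3000 * sqrt (real N)) \<le> expected_sup k f"
proof -
  have "sqrt (bergman z) / (3000 * sqrt (real N)) \<le> (LINT a|uniform_unit_sphere N. cmod (cvec_pair N a (nvec z)))"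
    using sphere_pair_abs_lower[OF dim_ge, of "nvec z"] by (simp add: nvec_norm[OF z])
  also have "\<dots> \<le> expected_sup k f"
    unfolding expected_sup_def
  proof (rule integral_mono)
    show "integrable (uniform_unit_sphere N) (\<lambda>a. cmod (cvec_pair N a (nvec z)))"
    proof (rule sphere_integrable_bounded[OF dim_ge, of _ lip])
      fix a assume "cvec_norm N a = 1"
      then show "norm (cmod (cvec_pair N a (nvec z))) \<le> lip" using pair_nvec_le[OF z, of a] by simp
    qed measurable
  qed (auto intro: sup_rv_integrable sup_rv_upper[OF z])
  finally show ?thesis .
qed

text \<open>The exponent is N r^2 / (96 lip^2) with lip^2 = 240 k^(3/2); N >= k / W leaves sqrt k in
  the denominator, and 23040 = 96 * 240.\<close>

lemma sup_rv_tail: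
  assumes W: "W > 0" "real k \<le> W * real N" and med: "is_median (uniform_unit_sphere N) (sup_rv k f) \<mu>" and r: "r > 0"
  shows "measure (uniform_unit_sphere N) {a \<in> space (cvec_borel N). \<bar>sup_rv k f a - \<mu>\<bar> > r}
    \<le> 2 * exp (- (1 / (23040 * W) / sqrt (real k) * r\<^sup>2))"
proof -
  have "measure (uniform_unit_sphere N) {a \<in> space (cvec_borel N). \<bar>sup_rv k f a - \<mu>\<bar> > r}
      \<le> 2 * exp (- (real N * (r / lip)\<^sup>2 / 96))"
    by (rule sphere_concentration[OF dim_ge sup_rv_measurable lip_pos r sup_rv_lipschitz med])
  also have "\<dots> \<le> 2 * exp (- (1 / (23040 * W) / sqrt (real k) * r\<^sup>2))"
  proof -
    define s where "s = sqrt (real k)"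
    have s: "s > 0" "real k = s * s" using k_ge by (auto simp: s_def)
    have "1 / (23040 * W) / s \<le> real N / (23040 * (s * s * s))"
    proof -
      have "s * s \<le> W * real N" using W s by simp
      then have "1 / W \<le> real N / (s * s)" using W s by (simp add: field_simps)
      then have "(1 / W) * (1 / (23040 * s)) \<le> (real N / (s * s)) * (1 / (23040 * s))" using s by (intro mult_right_mono) auto
      then show ?thesis by (simp add: ac_simps)
    qed
    then have "1 / (23040 * W) / s * r\<^sup>2 \<le> real N / (23040 * (s * s * s)) * r\<^sup>2" by (intro mult_right_mono) auto
    also have "\<dots> = real N * (r / lip)\<^sup>2 / 96"
      unfolding power_divide lip_square s_def[symmetric] s(2) using s(1) by (simp add: abs_of_pos)
    finally show ?thesis by (simp add: s_def)
  qed
  finally show ?thesis .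
qed

text \<open>The tail about the median bounds the mean of |sup - \<mu>|, and hence the distance
  between mean and median.\<close>

lemma median_close:
  assumes W: "W > 0" "real k \<le> W * real N" and med: "is_median (uniform_unit_sphere N) (sup_rv k f) \<mu>"
  shows "\<bar>\<mu> - expected_sup k f\<bar> \<le> 3 * sqrt (46080 * W) * real k powr (1/4)"
proof -
  interpret prob_space "uniform_unit_sphere N" by (rule prob_space_uniform_unit_sphere[OF dim_ge])
  define b where "b = 1 / (23040 * W) / sqrt (real k)"
  have b: "b > 0" using W k_ge by (simp add: b_def)
  have [measurable]: "sup_rv k f \<in> borel_measurable (uniform_unit_sphere N)"
    using sup_rv_measurable by (simp add: measurable_cong_sets[OF sets_uniform_unit_sphere refl])
  let ?Z = "\<lambda>a. sup_rv k f a - \<mu>"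
  have nn: "(\<integral>\<^sup>+a. ennreal \<bar>?Z a\<bar> \<partial>uniform_unit_sphere N) \<le> ennreal (sqrt (2 / b) * (1 + 2))"
    by (rule subgaussian_abs_moment) (use b sup_rv_tail[OF W med] in \<open>auto simp: b_def\<close>)
  have int: "integrable (uniform_unit_sphere N) ?Z" using sup_rv_integrable by simp
  have "expected_sup k f - \<mu> = (LINT a|uniform_unit_sphere N. ?Z a)"
    unfolding expected_sup_def using sup_rv_integrable prob_space by (simp del: space_uniform_unit_sphere)
  then have "\<bar>expected_sup k f - \<mu>\<bar> \<le> (LINT a|uniform_unit_sphere N. \<bar>?Z a\<bar>)"
    using integral_abs_bound[of "uniform_unit_sphere N" ?Z] by simp
  also have "\<dots> \<le> sqrt (2 / b) * (1 + 2)"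
  proof -
    have "ennreal (LINT a|uniform_unit_sphere N. \<bar>?Z a\<bar>) \<le> ennreal (sqrt (2 / b) * (1 + 2))"
      using nn nn_integral_eq_integral[of "uniform_unit_sphere N" "\<lambda>a. \<bar>?Z a\<bar>"] int by simp
    then show ?thesis using b by (subst (asm) ennreal_le_iff) auto
  qed
  also have "2 / b = (46080 * W) * sqrt (real k)" using W by (simp add: b_def)
  also have "sqrt ((46080 * W) * sqrt (real k)) * (1 + 2) = 3 * sqrt (46080 * W) * real k powr (1/4)"
    by (simp add: real_sqrt_mult powr_quarter)
  finally show ?thesis by (simp add: abs_minus_commute)
qed

section \<open>Moments of the supremum through powers of the form\<close>

lemma pair_nvec_power:
  assumes z: "z \<in> fundamental_domain"
  shows "cmod (cvec_pair N a (nvec z)) ^ (2 * m) = (cmod (form a z ^ m))\<^sup>2 * Im z ^ (k * m)"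
proof -
  have y: "Im z > 0" using fundamental_domain_Im[OF z] by blast
  have "(cmod (cvec_pair N a (nvec z)))\<^sup>2 = Im z ^ k * (cmod (form a z))\<^sup>2"
    using y by (simp add: pair_nvec power_mult_distrib)
  then have "cmod (cvec_pair N a (nvec z)) ^ (2 * m) = (Im z ^ k * (cmod (form a z))\<^sup>2) ^ m" by (simp only: power_mult)
  also have "\<dots> = (cmod (form a z ^ m))\<^sup>2 * Im z ^ (k * m)"
    by (simp add: power_mult_distrib norm_power mult.commute flip: power_mult)
  finally show ?thesis .
qed

text \<open>The sup-norm estimate is applied to the m-th power as a cusp form of weight k * m. It
  bounds the 2m-th powers of the values; the root brings the bound back to the values themselves,
  over which the supremum is taken.\<close>

lemma sup_rv_power_le:
  assumes m: "m \<ge> 1"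
  shows "ennreal (sup_rv k f a ^ (2 * m))
    \<le> ennreal (240 * real (k * m) * sqrt (real (k * m))) * petersson_nn (k * m) (\<lambda>z. form a z ^ m)"
proof -
  define T where "T = 240 * real (k * m) * sqrt (real (k * m))"
  have T: "T > 0" using m k_ge by (simp add: T_def)
  have km: "k * m \<ge> 1" using m k_ge by simp
  let ?P = "petersson_nn (k * m) (\<lambda>z. form a z ^ m)"
  have pt: "ennreal (cmod (cvec_pair N a (nvec z)) ^ (2 * m)) \<le> ennreal T * ?P" if z: "z \<in> fundamental_domain" for z
  proof -
    have "ennreal (Im z ^ (k * m) * (cmod (form a z ^ m))\<^sup>2)
       \<le> ennreal (240 * real (k * m) * min (sqrt (real (k * m))) (sqrt (Im z))) * ?P"
      by (rule cusp_form_pointwise_bound[OF cusp_form_power[OF form_cusp m] km fundamental_domain_Im(3)[OF z]])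
    also have "\<dots> \<le> ennreal T * ?P"
      unfolding T_def by (intro mult_right_mono ennreal_leI mult_left_mono) auto
    moreover have "cmod (cvec_pair N a (nvec z)) ^ (2 * m) = Im z ^ (k * m) * (cmod (form a z ^ m))\<^sup>2"
      by (subst pair_nvec_power[OF z]) (rule mult.commute)
    ultimately show ?thesis by (simp only:)
  qed
  show ?thesis
  proof (cases ?P)
    case (real p)
    have le: "cmod (cvec_pair N a (nvec z)) \<le> root (2 * m) (T * p)" if z: "z \<in> fundamental_domain" for z
    proof -
      have "cmod (cvec_pair N a (nvec z)) ^ (2 * m) \<le> T * p"
        using pt[OF z] real T by (simp add: ennreal_mult[symmetric])
      then have "root (2 * m) (cmod (cvec_pair N a (nvec z)) ^ (2 * m)) \<le> root (2 * m) (T * p)"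
        using m by (intro real_root_le_mono) auto
      then show ?thesis using m by (simp add: real_root_power_cancel)
    qed
    have "sup_rv k f a ^ (2 * m) \<le> root (2 * m) (T * p) ^ (2 * m)"
      by (intro power_mono sup_rv_least le sup_rv_nonneg)
    also have "\<dots> = T * p" using m T real by (intro real_root_pow_pos2) auto
    finally show ?thesis using real T unfolding T_def[symmetric] by (simp add: ennreal_mult[symmetric] ennreal_leI)
  next
    case top
    then show ?thesis using T unfolding T_def[symmetric] by (simp add: ennreal_mult_top)
  qed
qed

text \<open>Tonelli reduces the mean to the 2m-th moment of the pairing at each fixed z, bounded
  uniformly by the maximal norm \<open>lip\<close>; the area of the domain is finite.\<close>

lemma petersson_nn_power_mean:
  "(\<integral>\<^sup>+a. petersson_nn (k * m) (\<lambda>z. form a z ^ m) \<partial>uniform_unit_sphere N)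
    \<le> ennreal (5 * fact m * (256 * lip\<^sup>2 / real N) ^ m * (5/4))"
proof -
  let ?\<sigma> = "uniform_unit_sphere N"
  interpret prob_space ?\<sigma> by (rule prob_space_uniform_unit_sphere[OF dim_ge])
  interpret P: pair_sigma_finite ?\<sigma> "lborel :: complex measure" ..
  define M where "M = 5 * fact m * (256 * lip\<^sup>2 / real N) ^ m"
  have M: "M \<ge> 0" by (simp add: M_def)
  let ?h = "\<lambda>a z. ennreal ((cmod (form a z ^ m))\<^sup>2 * Im z ^ (k * m)) * indicator fundamental_domain z * hyp_weight z"
  have fm: "(\<lambda>p. form (fst p) (snd p)) \<in> borel_measurable (?\<sigma> \<Otimes>\<^sub>M lborel)"
    unfolding random_cusp_form_def
  proof (intro borel_measurable_sum borel_measurable_times)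
    fix j assume j: "j \<in> {..<N}"
    have "(\<lambda>a. a j) \<in> ?\<sigma> \<rightarrow>\<^sub>M borel"
      unfolding measurable_cong_sets[OF sets_uniform_unit_sphere refl] using j by (rule measurable_component_singleton)
    then show "(\<lambda>p. fst p j) \<in> borel_measurable (?\<sigma> \<Otimes>\<^sub>M (lborel :: complex measure))"
      by (rule measurable_compose[OF measurable_fst])
    have "f j \<in> borel_measurable lborel" using f_measurable[of j] j by simp
    then show "(\<lambda>p. f j (snd p)) \<in> borel_measurable (?\<sigma> \<Otimes>\<^sub>M lborel)"
      by (rule measurable_compose[OF measurable_snd])
  qed
  have hm: "(\<lambda>(a, z). ?h a z) \<in> borel_measurable (?\<sigma> \<Otimes>\<^sub>M lborel)"
    unfolding case_prod_beta' using fm by measurable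
  have "(\<integral>\<^sup>+a. petersson_nn (k * m) (\<lambda>z. form a z ^ m) \<partial>?\<sigma>) = (\<integral>\<^sup>+z. (\<integral>\<^sup>+a. ?h a z \<partial>?\<sigma>) \<partial>lborel)"
    unfolding petersson_nn_def by (rule P.Fubini'[symmetric, OF hm])
  also have "\<dots> \<le> (\<integral>\<^sup>+z. ennreal M * (indicator fundamental_domain z * hyp_weight z) \<partial>lborel)"
  proof (rule nn_integral_mono)
    fix z
    show "(\<integral>\<^sup>+a. ?h a z \<partial>?\<sigma>) \<le> ennreal M * (indicator fundamental_domain z * hyp_weight z)"
    proof (cases "z \<in> fundamental_domain")
      case True
      have pm: "(\<lambda>a. cvec_pair N a (nvec z)) \<in> borel_measurable ?\<sigma>"
        unfolding measurable_cong_sets[OF sets_uniform_unit_sphere refl] by measurable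
      have "(\<integral>\<^sup>+a. ?h a z \<partial>?\<sigma>) = (\<integral>\<^sup>+a. ennreal (cmod (cvec_pair N a (nvec z)) ^ (2 * m)) * hyp_weight z \<partial>?\<sigma>)"
        using True by (simp add: pair_nvec_power)
      also have "\<dots> = (\<integral>\<^sup>+a. ennreal (cmod (cvec_pair N a (nvec z)) ^ (2 * m)) \<partial>?\<sigma>) * hyp_weight z"
        by (rule nn_integral_multc) (use pm in measurable)
      also have "\<dots> \<le> ennreal M * hyp_weight z"
      proof (rule mult_right_mono)
        have "(\<integral>\<^sup>+a. ennreal (cmod (cvec_pair N a (nvec z)) ^ (2 * m)) \<partial>?\<sigma>)
            \<le> ennreal (5 * fact m * (256 * (cvec_norm N (nvec z))\<^sup>2 / real N) ^ m)"
          by (rule sphere_pair_even_moment[OF dim_ge])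
        also have "\<dots> \<le> ennreal M" unfolding M_def
          by (intro ennreal_leI mult_left_mono power_mono divide_right_mono nvec_norm_le[OF True]) auto
        finally show "(\<integral>\<^sup>+a. ennreal (cmod (cvec_pair N a (nvec z)) ^ (2 * m)) \<partial>?\<sigma>) \<le> ennreal M" .
      qed simp
      finally show ?thesis using True by simp
    qed simp
  qed
  also have "\<dots> = ennreal M * (\<integral>\<^sup>+z. indicator fundamental_domain z * hyp_weight z \<partial>lborel)"
    by (rule nn_integral_cmult) measurable
  also have "\<dots> \<le> ennreal M * ennreal (5/4)" by (intro mult_left_mono fundamental_domain_area) auto
  also have "\<dots> = ennreal (M * (5/4))" using M by (subst ennreal_mult) auto
  finally show ?thesis by (simp only: M_def)
qed

lemma sup_rv_moment:
  assumes m: "m \<ge> 1"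
  shows "(\<integral>\<^sup>+a. ennreal (sup_rv k f a ^ (2 * m)) \<partial>uniform_unit_sphere N)
    \<le> ennreal ((240 * real (k * m) * sqrt (real (k * m))) * (5 * fact m * (256 * lip\<^sup>2 / real N) ^ m * (5/4)))"
proof -
  define T where "T = 240 * real (k * m) * sqrt (real (k * m))"
  define M where "M = 5 * fact m * (256 * lip\<^sup>2 / real N) ^ m * (5/4)"
  have TM: "T \<ge> 0" "M \<ge> 0" by (auto simp: T_def M_def)
  let ?E = "\<integral>\<^sup>+a. ennreal (sup_rv k f a ^ (2 * m)) \<partial>uniform_unit_sphere N"
  have "?E \<le> ennreal T * ennreal M"
  proof (cases "T = 0")
    case True
    then show ?thesis using m k_ge by (simp add: T_def)
  next
    case False
    then have T: "T > 0" using TM by simp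
    \<comment> \<open>Dividing by T on this side requires measurability of the supremum only, not of
      the Petersson norm as a function of the coefficients.\<close>
    have "ennreal (1 / T) * ?E = (\<integral>\<^sup>+a. ennreal (1 / T) * ennreal (sup_rv k f a ^ (2 * m)) \<partial>uniform_unit_sphere N)"
      by (rule nn_integral_cmult[symmetric])
         (use sup_rv_measurable in \<open>simp add: measurable_cong_sets[OF sets_uniform_unit_sphere refl]\<close>)
    also have "\<dots> \<le> (\<integral>\<^sup>+a. petersson_nn (k * m) (\<lambda>z. form a z ^ m) \<partial>uniform_unit_sphere N)"
    proof (rule nn_integral_mono)
      fix a
      have "ennreal (1 / T) * ennreal (sup_rv k f a ^ (2 * m)) \<le> ennreal (1 / T) * (ennreal T * petersson_nn (k * m) (\<lambda>z. form a z ^ m))"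
        unfolding T_def by (intro mult_left_mono sup_rv_power_le[OF m]) simp
      also have "\<dots> = (ennreal (1 / T) * ennreal T) * petersson_nn (k * m) (\<lambda>z. form a z ^ m)" by (simp only: mult.assoc)
      also have "ennreal (1 / T) * ennreal T = 1" using T by (simp add: ennreal_mult[symmetric])
      finally show "ennreal (1 / T) * ennreal (sup_rv k f a ^ (2 * m)) \<le> petersson_nn (k * m) (\<lambda>z. form a z ^ m)" by simp
    qed
    also have "\<dots> \<le> ennreal M" unfolding M_def by (rule petersson_nn_power_mean)
    finally have "ennreal T * (ennreal (1 / T) * ?E) \<le> ennreal T * ennreal M" by (intro mult_left_mono) auto
    moreover have "ennreal T * (ennreal (1 / T) * ?E) = ?E"
    proof -
      have "ennreal T * ennreal (1 / T) = 1" using T by (simp add: ennreal_mult[symmetric])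
      then show ?thesis by (simp only: mult.assoc[symmetric]) simp
    qed
    ultimately show ?thesis by simp
  qed
  also have "\<dots> = ennreal (T * M)" using TM by (simp add: ennreal_mult)
  finally show ?thesis by (simp only: T_def M_def)
qed

text \<open>At the scale s with s^2 of order m sqrt k, the 2m-th moment is at most s^(2m), and X <=
  s + s^(1-2m) X^(2m) gives a mean of at most 2 s.\<close>

lemma expected_upper:
  assumes W: "W > 0" "real k \<le> W * real N" and k2: "k \<ge> 2"
  shows "expected_sup k f \<le> 2 * sqrt (3 * (1500 * exp 4 * (61440 * W))) * (real k powr (1/4) * sqrt (ln (real k)))"
proof -
  let ?\<sigma> = "uniform_unit_sphere N"
  interpret prob_space ?\<sigma> by (rule prob_space_uniform_unit_sphere[OF dim_ge])
  have lnk: "ln (real k) \<ge> 1/2"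
  proof -
    have "1/2 \<le> ln (2::real)" using ln2_ge_two_thirds by simp
    also have "\<dots> \<le> ln (real k)" using k2 by (subst ln_le_cancel_iff) auto
    finally show ?thesis .
  qed
  \<comment> \<open>Then k <= exp m, so the polynomial loss (k m)^(3/2) is at most exp (4 m), which
    only changes the constant in s. As ln k >= 1/2, also m <= 3 ln k.\<close>
  define m where "m = nat \<lceil>ln (real k)\<rceil>"
  have m: "real m \<ge> ln (real k)" "real m \<le> ln (real k) + 1" using lnk unfolding m_def by linarith+
  have m1: "m \<ge> 1" using m(1) lnk by (cases m) auto
  \<comment> \<open>1500 = 240 * 5 * 5/4 collects the prefactors of the moment bound, and 61440 =
    256 * 240 comes from the even moments and \<open>lip\<close>.\<close>
  define \<Lambda> where "\<Lambda> = 1500 * exp 4 * (61440 * W)"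
  have \<Lambda>: "\<Lambda> > 0" using W by (simp add: \<Lambda>_def)
  define s where "s = sqrt (\<Lambda> * real m * sqrt (real k))"
  have s2: "s\<^sup>2 = \<Lambda> * real m * sqrt (real k)" using \<Lambda> by (simp add: s_def)
  have s: "s > 0" using \<Lambda> m1 k2 by (simp add: s_def)
  have mom: "(240 * real (k * m) * sqrt (real (k * m))) * (5 * fact m * (256 * lip\<^sup>2 / real N) ^ m * (5/4)) \<le> s ^ (2 * m)"
  proof -
    have a1: "256 * lip\<^sup>2 / real N \<le> 61440 * W * sqrt (real k)"
    proof -
      have "real k / real N \<le> W" using W dim_ge by (simp add: field_simps)
      then have "61440 * sqrt (real k) * (real k / real N) \<le> 61440 * sqrt (real k) * W" by (intro mult_left_mono) auto
      then show ?thesis by (simp add: lip_square ac_simps)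
    qed
    have a2: "(256 * lip\<^sup>2 / real N) ^ m \<le> (61440 * W * sqrt (real k)) ^ m" by (intro power_mono a1) auto
    have a3: "(fact m :: real) \<le> real m ^ m" using fact_le_power[of m, where ?'a = real] by simp
    have kme: "real (k * m) \<le> exp 2 ^ m"
    proof -
      have "real k = exp (ln (real k))" using k2 by simp
      also have "\<dots> \<le> exp (real m)" using m by simp
      finally have "real k \<le> exp (real m)" .
      moreover have "real m \<le> exp (real m)" using exp_ge_add_one_self[of "real m"] by linarith
      ultimately have "real k * real m \<le> exp (real m) * exp (real m)" by (intro mult_mono) auto
      also have "\<dots> = exp 2 ^ m" by (simp add: exp_of_nat_mult[symmetric] exp_add[symmetric])
      finally show ?thesis by simp
    qed
    have a4: "real (k * m) * sqrt (real (k * m)) \<le> exp 4 ^ m"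
    proof -
      define x where "x = real (k * m)"
      have "k * m \<ge> 1" using k2 m1 by simp
      then have km1: "x \<ge> 1" unfolding x_def by linarith
      have "sqrt x \<le> x" using km1 mult_left_mono[OF km1, of x] by (intro real_le_lsqrt) (auto simp: power2_eq_square)
      then have "x * sqrt x \<le> exp 2 ^ m * exp 2 ^ m" using kme[folded x_def] km1 by (intro mult_mono) auto
      also have "\<dots> = exp 4 ^ m" by (simp add: power_mult_distrib[symmetric] exp_add[symmetric])
      finally show ?thesis by (simp only: x_def)
    qed
    have a5: "(1500::real) \<le> 1500 ^ m" using m1 self_le_power[of "1500::real" m] by simp
    have "(240 * real (k * m) * sqrt (real (k * m))) * (5 * fact m * (256 * lip\<^sup>2 / real N) ^ m * (5/4))
        = 1500 * (real (k * m) * sqrt (real (k * m))) * (fact m * (256 * lip\<^sup>2 / real N) ^ m)" by simp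
    also have "\<dots> \<le> 1500 ^ m * exp 4 ^ m * (real m ^ m * (61440 * W * sqrt (real k)) ^ m)"
      using W by (intro mult_mono a2 a3 a4 a5) auto
    also have "\<dots> = (s\<^sup>2) ^ m"
      unfolding s2 \<Lambda>_def by (simp only: power_mult_distrib ac_simps)
    finally show ?thesis by (simp only: power_mult)
  qed
  have "ennreal (expected_sup k f) = (\<integral>\<^sup>+a. ennreal (sup_rv k f a) \<partial>?\<sigma>)"
    unfolding expected_sup_def
    by (rule nn_integral_eq_integral[symmetric]) (auto intro: sup_rv_integrable sup_rv_nonneg)
  also have "\<dots> \<le> (\<integral>\<^sup>+a. ennreal s + ennreal (s / s ^ (2 * m)) * ennreal (sup_rv k f a ^ (2 * m)) \<partial>?\<sigma>)"
  proof (rule nn_integral_mono)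
    fix a
    define u where "u = sup_rv k f a / s"
    have u: "u \<ge> 0" "sup_rv k f a = s * u" using s sup_rv_nonneg by (auto simp: u_def)
    have "u \<le> 1 + u ^ (2 * m)"
    proof (cases "u \<le> 1")
      case True then show ?thesis using u by (simp add: add_increasing2)
    next
      case False
      then have "u ^ 1 \<le> u ^ (2 * m)" using m1 by (intro power_increasing) auto
      then show ?thesis by simp
    qed
    then have "s * u \<le> s * (1 + u ^ (2 * m))" using s by (intro mult_left_mono) auto
    also have "\<dots> = s + s / s ^ (2 * m) * sup_rv k f a ^ (2 * m)"
      using s by (simp add: u_def power_divide distrib_left)
    finally have "ennreal (sup_rv k f a) \<le> ennreal (s + s / s ^ (2 * m) * sup_rv k f a ^ (2 * m))" using u by (simp add: ennreal_leI)
    also have "\<dots> = ennreal s + ennreal (s / s ^ (2 * m)) * ennreal (sup_rv k f a ^ (2 * m))"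
    proof -
      have "0 \<le> s / s ^ (2 * m)" "0 \<le> sup_rv k f a ^ (2 * m)" using s sup_rv_nonneg[of a] by simp_all
      then show ?thesis using s by (simp only: ennreal_plus ennreal_mult mult_nonneg_nonneg less_imp_le)
    qed
    finally show "ennreal (sup_rv k f a) \<le> ennreal s + ennreal (s / s ^ (2 * m)) * ennreal (sup_rv k f a ^ (2 * m))" .
  qed
  also have "\<dots> = ennreal s + ennreal (s / s ^ (2 * m)) * (\<integral>\<^sup>+a. ennreal (sup_rv k f a ^ (2 * m)) \<partial>?\<sigma>)"
  proof -
    have [measurable]: "sup_rv k f \<in> borel_measurable ?\<sigma>"
      using sup_rv_measurable by (simp add: measurable_cong_sets[OF sets_uniform_unit_sphere refl])
    show ?thesis
      using emeasure_space_1 by (subst nn_integral_add) (auto simp: nn_integral_cmult simp del: space_uniform_unit_sphere)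
  qed
  also have "\<dots> \<le> ennreal s + ennreal (s / s ^ (2 * m)) * ennreal (s ^ (2 * m))"
    by (intro add_left_mono mult_left_mono order_trans[OF sup_rv_moment[OF m1] ennreal_leI[OF mom]]) auto
  also have "\<dots> = ennreal (2 * s)" using s by (simp add: ennreal_mult[symmetric] ennreal_plus[symmetric] del: ennreal_plus)
  finally have "expected_sup k f \<le> 2 * s" using s by (subst (asm) ennreal_le_iff) auto
  also have "s \<le> sqrt (3 * \<Lambda>) * (real k powr (1/4) * sqrt (ln (real k)))"
  proof -
    have "real m \<le> 3 * ln (real k)" using m lnk by linarith
    then have "\<Lambda> * real m * sqrt (real k) \<le> \<Lambda> * (3 * ln (real k)) * sqrt (real k)"
      using \<Lambda> by (intro mult_right_mono mult_left_mono) auto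
    then have "s \<le> sqrt (\<Lambda> * (3 * ln (real k)) * sqrt (real k))" unfolding s_def by (rule real_sqrt_le_mono)
    also have "\<dots> = sqrt (3 * \<Lambda>) * (real k powr (1/4) * sqrt (ln (real k)))"
      by (simp add: powr_quarter real_sqrt_mult)
    finally show ?thesis .
  qed
  finally show ?thesis by (simp add: \<Lambda>_def)
qed

end

text \<open>A large value of the kernel at one point suffices. From \<open>k0\<close> on it comes
  from the test form and N <= 720 k; below \<open>k0\<close> the average of the kernel is enough, as
  \<open>k\<close> is bounded there.\<close>

lemma sup_expectation_lower:
  obtains c where "c > 0" "\<And>k f. cusp_basis k f \<Longrightarrow> even k \<Longrightarrow> c * real k powr (1/4) \<le> expected_sup k f"
proof -
  obtain c k0 where c: "c > 0"
    and B: "\<And>k f. cusp_basis k f \<Longrightarrow> even k \<Longrightarrow> k \<ge> k0 \<Longrightarrow> \<exists>z\<in>fundamental_domain. cusp_basis.bergman k f z \<ge> c * (real k * sqrt (real k))"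
    by (rule bergman_lower, rule that)
  define d where "d = sqrt (c / 720) / 3000"
  define e where "e = sqrt (1 / 2) / (3000 * sqrt (sqrt (real (Suc k0))))"
  have d: "d > 0" and e: "e > 0" using c by (simp_all add: d_def e_def)
  have "min d e * real k powr (1/4) \<le> expected_sup k f" if cb: "cusp_basis k f" and ev: "even k" for k f
  proof -
    interpret cusp_basis k f by (rule cb)
    have N: "real N > 0" using dim_ge by simp
    show ?thesis
    proof (cases "k \<ge> k0")
      case True
      obtain z where z: "z \<in> fundamental_domain" "bergman z \<ge> c * (real k * sqrt (real k))"
        using B[OF cb ev True] by blast
      have "c / 720 * sqrt (real k) * real N \<le> c / 720 * sqrt (real k) * (720 * real k)"
        using c dim_upper by (intro mult_left_mono) auto
      also have "\<dots> = c * (real k * sqrt (real k))" by simp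
      also have "\<dots> \<le> bergman z" by (rule z(2))
      finally have "c / 720 * sqrt (real k) \<le> bergman z / real N" using N by (simp add: field_simps)
      then have "sqrt (c / 720 * sqrt (real k)) \<le> sqrt (bergman z / real N)" by (rule real_sqrt_le_mono)
      then have "d * real k powr (1/4) \<le> sqrt (bergman z) / (3000 * sqrt (real N))"
        by (simp add: d_def powr_quarter real_sqrt_mult real_sqrt_divide)
      also have "\<dots> \<le> expected_sup k f" by (rule expected_lower[OF z(1)])
      finally have "d * real k powr (1/4) \<le> expected_sup k f" .
      moreover have "min d e * real k powr (1/4) \<le> d * real k powr (1/4)" by (intro mult_right_mono) auto
      ultimately show ?thesis by linarith
    next
      case False
      obtain z where z: "z \<in> fundamental_domain" "bergman z \<ge> real N / 2" using bergman_avg by blast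
      have "e * real k powr (1/4) \<le> e * sqrt (sqrt (real (Suc k0)))"
        using e False by (intro mult_left_mono) (auto simp: powr_quarter)
      also have "\<dots> = sqrt (1 / 2) / 3000" by (simp add: e_def)
      also have "\<dots> \<le> sqrt (bergman z / real N) / 3000"
        using z(2) N by (intro divide_right_mono real_sqrt_le_mono) (auto simp: field_simps)
      also have "\<dots> = sqrt (bergman z) / (3000 * sqrt (real N))" by (simp add: real_sqrt_divide)
      also have "\<dots> \<le> expected_sup k f" by (rule expected_lower[OF z(1)])
      finally have "e * real k powr (1/4) \<le> expected_sup k f" .
      moreover have "min d e * real k powr (1/4) \<le> e * real k powr (1/4)" by (intro mult_right_mono) auto
      ultimately show ?thesis by linarith
    qed
  qed
  then show ?thesis using that[of "min d e"] d e by simp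
qed

lemma admissible_imp_cusp_basis:
  assumes "admissible k f"
  shows "cusp_basis k f" "even k" "k \<ge> 2"
  using assms by (auto simp: admissible_def cusp_basis_def)

theorem theorem1p3:
  shows "(\<exists>c\<^sub>1>0. \<exists>c\<^sub>2>0. \<forall>k f. admissible k f \<longrightarrow>
            c\<^sub>1 * real k powr (1/4) \<le> expected_sup k f \<and>
            expected_sup k f \<le> c\<^sub>2 * (real k powr (1/4) * sqrt (ln (real k))))
       \<and> (\<exists>C>0. \<forall>k f \<mu>. admissible k f \<longrightarrow> is_median (coeff_law k) (sup_rv k f) \<mu> \<longrightarrow>
            \<bar>\<mu> - expected_sup k f\<bar> \<le> C * real k powr (1/4))
       \<and> (\<exists>c>0. \<forall>k f \<mu>. admissible k f \<longrightarrow> is_median (coeff_law k) (sup_rv k f) \<mu> \<longrightarrow>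
            (\<forall>r>0. measure (coeff_law k) {a \<in> space (coeff_law k). \<bar>sup_rv k f a - \<mu>\<bar> > r}
                     \<le> 2 * exp (- c * r\<^sup>2 / real k powr (1/2))))"
proof -
  obtain c1 where c1: "c1 > 0" "\<And>k f. cusp_basis k f \<Longrightarrow> even k \<Longrightarrow> c1 * real k powr (1/4) \<le> expected_sup k f"
    by (rule sup_expectation_lower, rule that)
  obtain W where W: "W > 0" "\<And>k f. cusp_basis k f \<Longrightarrow> even k \<Longrightarrow> real k \<le> W * real (cusp_dim k)"
    by (rule cusp_dim_lower, rule that)
  note adm = admissible_imp_cusp_basis
  show ?thesis
  proof (intro conjI)
    have "2 * sqrt (3 * (1500 * exp 4 * (61440 * W))) > 0" using W(1) by simp
    moreover have "c1 * real k powr (1/4) \<le> expected_sup k f \<and>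
        expected_sup k f \<le> 2 * sqrt (3 * (1500 * exp 4 * (61440 * W))) * (real k powr (1/4) * sqrt (ln (real k)))"
      if a: "admissible k f" for k f
      using c1(2)[OF adm(1)[OF a] adm(2)[OF a]] cusp_basis.expected_upper[OF adm(1)[OF a] W(1) W(2)[OF adm(1)[OF a] adm(2)[OF a]] adm(3)[OF a]] by blast
    ultimately show "\<exists>c\<^sub>1>0. \<exists>c\<^sub>2>0. \<forall>k f. admissible k f \<longrightarrow>
            c\<^sub>1 * real k powr (1/4) \<le> expected_sup k f \<and>
            expected_sup k f \<le> c\<^sub>2 * (real k powr (1/4) * sqrt (ln (real k)))"
      using c1(1) by blast
  next
    have "3 * sqrt (46080 * W) > 0" using W(1) by simp
    moreover have "\<bar>\<mu> - expected_sup k f\<bar> \<le> 3 * sqrt (46080 * W) * real k powr (1/4)"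
      if a: "admissible k f" and med: "is_median (coeff_law k) (sup_rv k f) \<mu>" for k f \<mu>
      by (rule cusp_basis.median_close[OF adm(1)[OF a] W(1) W(2)[OF adm(1)[OF a] adm(2)[OF a]] med])
    ultimately show "\<exists>C>0. \<forall>k f \<mu>. admissible k f \<longrightarrow> is_median (coeff_law k) (sup_rv k f) \<mu> \<longrightarrow>
            \<bar>\<mu> - expected_sup k f\<bar> \<le> C * real k powr (1/4)"
      by blast
  next
    have "1 / (23040 * W) > 0" using W(1) by simp
    moreover have "measure (coeff_law k) {a \<in> space (coeff_law k). \<bar>sup_rv k f a - \<mu>\<bar> > r}
        \<le> 2 * exp (- (1 / (23040 * W)) * r\<^sup>2 / real k powr (1/2))"
      if a: "admissible k f" and med: "is_median (coeff_law k) (sup_rv k f) \<mu>" and r: "r > 0" for k f \<mu> r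
    proof -
      have "- (1 / (23040 * W) / sqrt (real k) * r\<^sup>2) = - (1 / (23040 * W)) * r\<^sup>2 / real k powr (1/2)"
        by (simp add: powr_half_sqrt)
      then show ?thesis
        using cusp_basis.sup_rv_tail[OF adm(1)[OF a] W(1) W(2)[OF adm(1)[OF a] adm(2)[OF a]] med r]
        by (simp only: space_uniform_unit_sphere)
    qed
    ultimately show "\<exists>c>0. \<forall>k f \<mu>. admissible k f \<longrightarrow> is_median (coeff_law k) (sup_rv k f) \<mu> \<longrightarrow>
            (\<forall>r>0. measure (coeff_law k) {a \<in> space (coeff_law k). \<bar>sup_rv k f a - \<mu>\<bar> > r}
                     \<le> 2 * exp (- c * r\<^sup>2 / real k powr (1/2)))"
      by blast
  qed
qed

end
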